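(* There is a universal constant $C>0$ such that the following holds. Let $X=Z_0+\sum_{i=1}^n Z_i$ be a $d\times d$ self-adjoint random matrix as in the context, and let $G$ be its associated Gaussian model, where $X$ and $G$ are defined on a common probability space with an arbitrary joint distribution. For $t\ge 0$ let $$\varepsilon(t)=\sigma_*(X)\,t^{\frac12}+R(X)^{\frac13}\sigma(X)^{\frac23}t^{\frac23}+R(X)\,t.$$ Then for every $t\ge 0$, $$\mathbf{P}\big[|\lambda_{\max}(X)-\lambda_{\max}(G)|>C\varepsilon(t)\big]\le d\,e^{-t},$$ $$\mathbf{P}\big[|\lambda_{\max}(X)-\mathbf{E}\lambda_{\max}(G)|>C\varepsilon(t)\big]\le d\,e^{-t},$$ and moreover $$|\mathbf{E}\lambda_{\max}(X)-\mathbf{E}\lambda_{\max}(G)|\le C\big\{\sigma_*(X)(\log d)^{\frac12}+R(X)^{\frac13}\sigma(X)^{\frac23}(\log d)^{\frac23}+R(X)\log d\big\}.$$ The same three bounds hold if $\lambda_{\max}(X),\lambda_{\max}(G)$ are replaced by $\|X\|,\|G\|$, respectively.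
   Context: Model: $d\ge 2$, $n\in\mathbb{N}$; $Z_0$ is a deterministic self-adjoint $d\times d$ complex matrix; $Z_1,\dots,Z_n$ are independent self-adjoint $d\times d$ random matrices with complex entries (with finite second moments) and $\mathbf{E}[Z_i]=0$; $X:=Z_0+\sum_{i=1}^n Z_i$. $\mathrm{Cov}(X)$ is the $d^2\times d^2$ matrix $\mathrm{Cov}(X)_{ij,kl}=\mathbf{E}[(X-\mathbf{E}X)_{ij}\overline{(X-\mathbf{E}X)_{kl}}]$. The Gaussian model $G$ is the $d\times d$ self-adjoint random matrix such that $\{\mathrm{Re}\,G_{ij},\mathrm{Im}\,G_{ij}\}_{i,j}$ are jointly Gaussian, $\mathbf{E}[G]=\mathbf{E}[X]$ and $\mathrm{Cov}(G)=\mathrm{Cov}(X)$. Parameters ($\|\cdot\|$ is the operator norm of a matrix, resp. Euclidean norm of a vector; $\|\cdot\|_\infty$ of a scalar random variable is the essential supremum of its absolute value): $\sigma(X):=\|\mathbf{E}[(X-\mathbf{E}X)^2]\|^{1/2}$; $\sigma_*(X):=\sup_{\|v\|=\|w\|=1}\mathbf{E}[|\langle v,(X-\mathbf{E}X)w\rangle|^2]^{1/2}$; $R(X):=\big\|\max_{1\le i\le n}\|Z_i\|\big\|_\infty$. $\lambda_{\max}(\cdot)$ denotes the largest eigenvalue of a self-adjoint matrix. *)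

theory Defs
  imports
    "HOL-Probability.Probability"
    "Jordan_Normal_Form.Schur_Decomposition"
begin

section \<open>Norm and largest eigenvalue\<close>

definition vnorm :: "complex Matrix.vec \<Rightarrow> real" where
  "vnorm v = sqrt (\<Sum>i<dim_vec v. (cmod (vec_index v i))\<^sup>2)"

definition unit_vecs :: "nat \<Rightarrow> complex Matrix.vec set" where
  "unit_vecs d = {v \<in> carrier_vec d. vnorm v = 1}"

definition opnorm :: "complex mat \<Rightarrow> real" where
  "opnorm A = (SUP v\<in>unit_vecs (dim_col A). vnorm (A *\<^sub>v v))"

definition self_adjoint :: "nat \<Rightarrow> complex mat \<Rightarrow> bool" where
  "self_adjoint d A \<longleftrightarrow> A \<in> carrier_mat d d \<and> mat_adjoint A = A"

text \<open>Only used for self-adjoint matrices of positive size, whose eigenvalues are all real.\<close>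

definition lambda_max :: "complex mat \<Rightarrow> real" where
  "lambda_max A = Max {x :: real. eigenvalue A (complex_of_real x)}"


section \<open>Random matrices\<close>

text \<open>The Borel \<open>\<sigma>\<close>-algebra on the complex \<open>d \<times> d\<close> matrices, i.e. the one generated by
  the matrix entries.\<close>

definition mat_borel :: "nat \<Rightarrow> complex mat measure" where
  "mat_borel d = vimage_algebra (carrier_mat d d)
     (\<lambda>A. \<lambda>p\<in>{..<d} \<times> {..<d}. A $$ p) (\<Pi>\<^sub>M p\<in>{..<d} \<times> {..<d}. borel)"

definition expect_mat :: "'a measure \<Rightarrow> nat \<Rightarrow> ('a \<Rightarrow> complex mat) \<Rightarrow> complex mat" where
  "expect_mat M d Y = mat d d (\<lambda>(i, j). LINT \<omega>|M. Y \<omega> $$ (i, j))"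

definition centered :: "'a measure \<Rightarrow> nat \<Rightarrow> ('a \<Rightarrow> complex mat) \<Rightarrow> 'a \<Rightarrow> complex mat" where
  "centered M d Y \<omega> = Y \<omega> - expect_mat M d Y"

text \<open>Rows and columns of the \<open>d\<^sup>2 \<times> d\<^sup>2\<close> covariance matrix are indexed by pairs in
  \<open>{..<d} \<times> {..<d}\<close>.\<close>

definition cov_mat ::
  "'a measure \<Rightarrow> nat \<Rightarrow> ('a \<Rightarrow> complex mat) \<Rightarrow> nat \<times> nat \<Rightarrow> nat \<times> nat \<Rightarrow> complex" where
  "cov_mat M d Y = (\<lambda>p\<in>{..<d} \<times> {..<d}. \<lambda>q\<in>{..<d} \<times> {..<d}.
     (LINT \<omega>|M. (centered M d Y \<omega> $$ p) * cnj (centered M d Y \<omega> $$ q)))"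

definition rsum :: "nat \<Rightarrow> nat \<Rightarrow> complex mat \<Rightarrow> (nat \<Rightarrow> 'a \<Rightarrow> complex mat) \<Rightarrow> 'a \<Rightarrow> complex mat" where
  "rsum d n Z0 Z \<omega> = mat d d (\<lambda>(i, j). Z0 $$ (i, j) + (\<Sum>k=1..n. Z k \<omega> $$ (i, j)))"

definition independent_sum_model ::
  "'a measure \<Rightarrow> nat \<Rightarrow> nat \<Rightarrow> complex mat \<Rightarrow> (nat \<Rightarrow> 'a \<Rightarrow> complex mat) \<Rightarrow> bool" where
  "independent_sum_model M d n Z0 Z \<longleftrightarrow>
     prob_space M \<and> 2 \<le> d \<and> self_adjoint d Z0 \<and>
     prob_space.indep_vars M (\<lambda>_. mat_borel d) Z {1..n} \<and>
     (\<forall>k\<in>{1..n}.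
        (\<forall>\<omega>\<in>space M. self_adjoint d (Z k \<omega>)) \<and>
        (\<forall>i<d. \<forall>j<d. integrable M (\<lambda>\<omega>. (cmod (Z k \<omega> $$ (i, j)))\<^sup>2)) \<and>
        expect_mat M d (Z k) = 0\<^sub>m d d)"

text \<open>A real Gaussian variable; constants are the degenerate case.\<close>

definition gaussian_var :: "'a measure \<Rightarrow> ('a \<Rightarrow> real) \<Rightarrow> bool" where
  "gaussian_var M Y \<longleftrightarrow> Y \<in> borel_measurable M \<and>
     ((\<exists>\<mu>. AE \<omega> in M. Y \<omega> = \<mu>) \<or>
      (\<exists>\<mu> \<tau>. \<tau> > 0 \<and> distributed M lborel Y (normal_density \<mu> \<tau>)))"

text \<open>Joint Gaussianity of the real and imaginary parts of all entries: every real linear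
  combination of them is Gaussian.\<close>

definition gaussian_mat :: "'a measure \<Rightarrow> nat \<Rightarrow> ('a \<Rightarrow> complex mat) \<Rightarrow> bool" where
  "gaussian_mat M d G \<longleftrightarrow> (\<forall>(a :: nat \<Rightarrow> nat \<Rightarrow> real) (b :: nat \<Rightarrow> nat \<Rightarrow> real).
     gaussian_var M (\<lambda>\<omega>. \<Sum>i<d. \<Sum>j<d. a i j * Re (G \<omega> $$ (i, j)) + b i j * Im (G \<omega> $$ (i, j))))"

definition gaussian_model ::
  "'a measure \<Rightarrow> nat \<Rightarrow> ('a \<Rightarrow> complex mat) \<Rightarrow> ('a \<Rightarrow> complex mat) \<Rightarrow> bool" where
  "gaussian_model M d X G \<longleftrightarrow>
     G \<in> M \<rightarrow>\<^sub>M mat_borel d \<and> (\<forall>\<omega>\<in>space M. self_adjoint d (G \<omega>)) \<and>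
     gaussian_mat M d G \<and> expect_mat M d G = expect_mat M d X \<and> cov_mat M d G = cov_mat M d X"


section \<open>Parameters\<close>

definition sigma_par :: "'a measure \<Rightarrow> nat \<Rightarrow> ('a \<Rightarrow> complex mat) \<Rightarrow> real" where
  "sigma_par M d X =
     opnorm (expect_mat M d (\<lambda>\<omega>. centered M d X \<omega> * centered M d X \<omega>)) powr (1/2)"

definition sigma_star :: "'a measure \<Rightarrow> nat \<Rightarrow> ('a \<Rightarrow> complex mat) \<Rightarrow> real" where
  "sigma_star M d X = (SUP (v, w)\<in>unit_vecs d \<times> unit_vecs d.
     (LINT \<omega>|M. (cmod ((centered M d X \<omega> *\<^sub>v w) \<bullet>c v))\<^sup>2) powr (1/2))"

text \<open>This parameter may be infinite. The supremum over the empty index set is \<open>0\<close>.\<close>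

definition R_par :: "'a measure \<Rightarrow> nat \<Rightarrow> (nat \<Rightarrow> 'a \<Rightarrow> complex mat) \<Rightarrow> ennreal" where
  "R_par M n Z = esssup M (\<lambda>\<omega>. SUP k\<in>{1..n}. ennreal (opnorm (Z k \<omega>)))"

text \<open>Only used for exponents \<open>p > 0\<close>.\<close>

definition ennpowr :: "ennreal \<Rightarrow> real \<Rightarrow> ennreal" where
  "ennpowr x p = (if x = \<top> then \<top> else ennreal (enn2real x powr p))"

definition epsilon ::
  "'a measure \<Rightarrow> nat \<Rightarrow> nat \<Rightarrow> complex mat \<Rightarrow> (nat \<Rightarrow> 'a \<Rightarrow> complex mat) \<Rightarrow> real \<Rightarrow> ennreal" where
  "epsilon M d n Z0 Z t =
     (let X = rsum d n Z0 Z in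
      ennreal (sigma_star M d X * t powr (1/2)) +
      ennpowr (R_par M n Z) (1/3) * ennreal (sigma_par M d X powr (2/3) * t powr (2/3)) +
      R_par M n Z * ennreal t)"


section \<open>The bounds\<close>

text \<open>The three bounds for a matrix functional \<open>f\<close>. The right-hand side of the third one
  is \<open>C\<close> times \<open>\<epsilon>(log d)\<close>.\<close>

definition three_bounds ::
  "real \<Rightarrow> 'a measure \<Rightarrow> nat \<Rightarrow> nat \<Rightarrow> complex mat \<Rightarrow> (nat \<Rightarrow> 'a \<Rightarrow> complex mat) \<Rightarrow>
   ('a \<Rightarrow> complex mat) \<Rightarrow> (complex mat \<Rightarrow> real) \<Rightarrow> bool" where
  "three_bounds C M d n Z0 Z G f \<longleftrightarrow>
     (let X = rsum d n Z0 Z; \<epsilon> = epsilon M d n Z0 Z in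
      (\<forall>t\<ge>0. \<P>(\<omega> in M. ennreal \<bar>f (X \<omega>) - f (G \<omega>)\<bar> > ennreal C * \<epsilon> t) \<le> real d * exp (- t)) \<and>
      (\<forall>t\<ge>0. \<P>(\<omega> in M. ennreal \<bar>f (X \<omega>) - (LINT \<omega>'|M. f (G \<omega>'))\<bar> > ennreal C * \<epsilon> t)
                \<le> real d * exp (- t)) \<and>
      ennreal \<bar>(LINT \<omega>|M. f (X \<omega>)) - (LINT \<omega>|M. f (G \<omega>))\<bar> \<le> ennreal C * \<epsilon> (ln (real d)))"

definition admissible_constant :: "real \<Rightarrow> 'a measure \<Rightarrow> bool" where
  "admissible_constant C M \<longleftrightarrow>
     (\<forall>d n Z0 Z G. independent_sum_model M d n Z0 Z \<longrightarrow> gaussian_model M d (rsum d n Z0 Z) G \<longrightarrow>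
        three_bounds C M d n Z0 Z G lambda_max \<and> three_bounds C M d n Z0 Z G opnorm)"

text \<open>A universal constant must not depend on the type of the sample space, but HOL cannot
  quantify over types below an existential quantifier. In the theorem the constant is
  therefore chosen for one fixed type of sample spaces, the type \<open>nat \<Rightarrow> complex mat\<close> of
  sequences of matrices (the values of \<open>G, Z 1, Z 2, \<dots>\<close>), and every constant that
  serves this type is asserted to serve all sample spaces of an arbitrary type \<open>'a\<close>.\<close>

end

theory Submission
  imports Defs "Jordan_Normal_Form.Spectral_Radius"
begin

text \<open>The largest eigenvalue is reached through even powers: with \<open>Y = 2 + \<beta> A / m\<close> the quantity
  \<open>d + tr (Y\<^sup>2\<^sup>m)\<close>, divided by \<open>4\<^sup>m\<close>, tends to \<open>tr (exp (\<beta> A))\<close>, which lies between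
  \<open>exp (\<beta> \<lambda>\<^sub>m\<^sub>a\<^sub>x A)\<close> and \<open>d\<close> times this number. The expectation of \<open>\<psi> (d + tr (Y\<^sup>2\<^sup>m))\<close>, where \<open>\<psi>\<close> is the
  identity or the reciprocal, is compared for \<open>X\<close> and \<open>G\<close> along the interpolation
  \<open>sin t (X - E X) + cos t (G - E G)\<close> with independent summands. By Gaussian integration by
  parts the covariances cancel in its derivative and a third-order remainder is left, of size at
  most a constant times \<open>\<beta>\<^sup>3 R \<sigma>\<^sup>2\<close> times the expectation itself when \<open>\<beta> R\<close> is small. Gronwall's inequality
  gives \<open>E exp (\<plusminus> \<beta> \<lambda>\<^sub>m\<^sub>a\<^sub>x X) \<le> d exp (c \<beta>\<^sup>3 R \<sigma>\<^sup>2) E exp (\<plusminus> \<beta> \<lambda>\<^sub>m\<^sub>a\<^sub>x G)\<close> for both signs, so that the deviations of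
  \<open>\<lambda>\<^sub>m\<^sub>a\<^sub>x X\<close> from \<open>E \<lambda>\<^sub>m\<^sub>a\<^sub>x G\<close> inherit the exponential moments that Gaussian concentration, with
  variance parameter \<open>\<sigma>\<^sub>*\<close>, provides for \<open>G\<close>; all bounds follow with \<open>\<beta>\<close> of order \<open>t / \<epsilon>(t)\<close>. The norm is
  the larger of \<open>\<lambda>\<^sub>m\<^sub>a\<^sub>x X\<close> and \<open>\<lambda>\<^sub>m\<^sub>a\<^sub>x (- X)\<close>.\<close>


section \<open>Finitely supported matrices\<close>

text \<open>A negative exponential of the largest eigenvalue is not comparable to the trace of a
  function of the matrix: tr exp (- \<beta> X) sees the smallest eigenvalue instead. Hence the
  reciprocal of tr exp (\<beta> X), whose derivatives are sums of products of traces. They must be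
  bounded relative to the functional itself, or the differential inequality would not close; each
  factor 1 / F produced by the reciprocal is paid for by a first derivative of F. Powers replace the
  exponential because the derivative of a power is a finite sum of words, and words are controlled
  by Cauchy-Schwarz and convexity in the exponents alone. An even power sees both ends of the
  spectrum; the shift by 2 suppresses the lower end, and the summand d keeps the reciprocal bounded.
  The main obstacle is that the remainder of a Taylor expansion in one summand still depends on that
  summand, whereas \<sigma> enters through a sum of variances at a fixed base point. The remainder
  is therefore measured by a local energy that changes by a bounded factor when one summand, of norm
  at most R, is added; an independent copy can then stand for the summand.\<close>

typedef fm = "{f :: nat \<Rightarrow> nat \<Rightarrow> complex. \<exists>n. \<forall>i j. n \<le> i \<or> n \<le> j \<longrightarrow> f i j = 0}"
  morphisms ent Abs_fm
  by (rule exI[of _ "\<lambda>_ _. 0"]) auto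

definition bd :: "fm \<Rightarrow> nat \<Rightarrow> bool" where
  "bd A n \<longleftrightarrow> (\<forall>i j. n \<le> i \<or> n \<le> j \<longrightarrow> ent A i j = 0)"

definition dm :: "fm \<Rightarrow> nat" where "dm A = (LEAST n. bd A n)"

definition mkfm :: "nat \<Rightarrow> (nat \<Rightarrow> nat \<Rightarrow> complex) \<Rightarrow> fm" where
  "mkfm n f = Abs_fm (\<lambda>i j. if i < n \<and> j < n then f i j else 0)"

lemma ent_mkfm: "ent (mkfm n f) i j = (if i < n \<and> j < n then f i j else 0)"
  unfolding mkfm_def by (subst Abs_fm_inverse) (auto intro!: exI[of _ n])

lemma bd_mkfm: "bd (mkfm n f) n"
  by (auto simp: bd_def ent_mkfm)

lemma fm_eqI: "(\<And>i j. ent A i j = ent B i j) \<Longrightarrow> A = B"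
  by (metis ent_inject ext)

lemma ex_bd: "\<exists>n. bd A n"
  using ent[of A] by (auto simp: bd_def)

lemma bd_dm: "bd A (dm A)"
  unfolding dm_def using ex_bd by (rule LeastI_ex)

lemma bd_mono: "bd A n \<Longrightarrow> n \<le> m \<Longrightarrow> bd A m"
  by (auto simp: bd_def)

lemma dm_le: "bd A n \<Longrightarrow> dm A \<le> n"
  unfolding dm_def by (rule Least_le)

lemma bd_ent: "bd A n \<Longrightarrow> n \<le> i \<or> n \<le> j \<Longrightarrow> ent A i j = 0"
  by (auto simp: bd_def)

text \<open>The size d is a variable, so the d-by-d matrices form no type that could be an instance
  of a type class. The matrices of finite support, of whatever size, form a single type, and the
  predicate \<open>bd\<close> recovers the size.\<close>

instantiation fm :: "{zero, plus, minus, uminus, times, scaleR}"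
begin
definition "0 = mkfm 0 (\<lambda>_ _. 0)"
definition "A + B = mkfm (max (dm A) (dm B)) (\<lambda>i j. ent A i j + ent B i j)"
definition "A - B = mkfm (max (dm A) (dm B)) (\<lambda>i j. ent A i j - ent B i j)"
definition "- A = mkfm (dm A) (\<lambda>i j. - ent A i j)"
definition "A * B = mkfm (max (dm A) (dm B)) (\<lambda>i j. \<Sum>k<dm A. ent A i k * ent B k j)"
definition "c *\<^sub>R A = mkfm (dm A) (\<lambda>i j. c *\<^sub>R ent A i j)"
instance ..
end

lemma ent_zero [simp]: "ent 0 i j = 0"
  by (simp add: zero_fm_def ent_mkfm)

lemma ent_add [simp]: "ent (A + B) i j = ent A i j + ent B i j"
  using bd_ent[OF bd_dm[of A], of i j] bd_ent[OF bd_dm[of B], of i j]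
  by (auto simp: plus_fm_def ent_mkfm not_less)

lemma ent_diff [simp]: "ent (A - B) i j = ent A i j - ent B i j"
  using bd_ent[OF bd_dm[of A], of i j] bd_ent[OF bd_dm[of B], of i j]
  by (auto simp: minus_fm_def ent_mkfm not_less)

lemma ent_uminus [simp]: "ent (- A) i j = - ent A i j"
  using bd_ent[OF bd_dm[of A], of i j]
  by (auto simp: uminus_fm_def ent_mkfm not_less)

lemma ent_scaleR [simp]: "ent (c *\<^sub>R A) i j = c *\<^sub>R ent A i j"
  using bd_ent[OF bd_dm[of A], of i j]
  by (auto simp: scaleR_fm_def ent_mkfm not_less)

lemma sum_mono_zero_lessThan:
  fixes f :: "nat \<Rightarrow> 'a :: comm_monoid_add"
  assumes "n \<le> m" "\<And>k. n \<le> k \<Longrightarrow> f k = 0"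
  shows "(\<Sum>k<m. f k) = (\<Sum>k<n. f k)"
  using assms by (intro sum.mono_neutral_right) auto

lemma ent_times_dm: "ent (A * B) i j = (\<Sum>k<dm A. ent A i k * ent B k j)"
proof -
  have "(\<Sum>k<dm A. ent A i k * ent B k j) = 0" if "dm A \<le> i \<or> dm B \<le> j"
    using that bd_ent[OF bd_dm[of A]] bd_ent[OF bd_dm[of B]] by (auto intro!: sum.neutral)
  then show ?thesis
    unfolding times_fm_def ent_mkfm by (metis (no_types, lifting) less_max_iff_disj not_le)
qed

lemma ent_times: "bd A n \<Longrightarrow> ent (A * B) i j = (\<Sum>k<n. ent A i k * ent B k j)"
  unfolding ent_times_dm
  by (rule sum_mono_zero_lessThan[symmetric]) (auto simp: dm_le bd_ent[OF bd_dm])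

lemma ent_times': "bd B n \<Longrightarrow> ent (A * B) i j = (\<Sum>k<n. ent A i k * ent B k j)"
proof -
  assume B: "bd B n"
  have "ent (A * B) i j = (\<Sum>k<max n (dm A). ent A i k * ent B k j)"
    by (rule ent_times) (rule bd_mono[OF bd_dm], simp)
  also have "\<dots> = (\<Sum>k<n. ent A i k * ent B k j)"
    by (rule sum_mono_zero_lessThan) (auto simp: bd_ent[OF B])
  finally show ?thesis .
qed

text \<open>There is no multiplicative unit, because the infinite identity matrix has infinite
  support; on matrices of size d its part is taken by \<open>idm d\<close>.\<close>

instance fm :: "{ring, real_algebra}"
proof
  fix A B C :: fm and a b :: real
  show "A * B * C = A * (B * C)"
  proof (rule fm_eqI)
    fix i j
    define n where "n = max (dm A) (dm B)"
    have A: "bd A n" and B: "bd B n" by (auto simp: n_def intro: bd_mono[OF bd_dm])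
    have AB: "bd (A * B) n"
      by (auto simp: bd_def ent_times[OF A] bd_ent[OF A] bd_ent[OF B])
    have "ent (A * B * C) i j = (\<Sum>k<n. \<Sum>l<n. ent A i l * ent B l k * ent C k j)"
      by (simp add: ent_times[OF AB] ent_times[OF A] sum_distrib_right)
    also have "\<dots> = (\<Sum>l<n. \<Sum>k<n. ent A i l * ent B l k * ent C k j)"
      by (rule sum.swap)
    also have "\<dots> = ent (A * (B * C)) i j"
      by (simp add: ent_times[OF A] ent_times[OF B] sum_distrib_left mult.assoc)
    finally show "ent (A * B * C) i j = ent (A * (B * C)) i j" .
  qed
  show "(A + B) * C = A * C + B * C"
  proof (rule fm_eqI)
    fix i j
    show "ent ((A + B) * C) i j = ent (A * C + B * C) i j"
      by (simp add: ent_times'[OF bd_dm[of C]] sum.distrib distrib_right)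
  qed
  show "A * (B + C) = A * B + A * C"
    by (rule fm_eqI) (simp add: ent_times[OF bd_dm[of A]] sum.distrib distrib_left)
  show "a *\<^sub>R A * B = a *\<^sub>R (A * B)"
    by (rule fm_eqI) (simp add: ent_times'[OF bd_dm[of B]] scaleR_sum_right)
  show "A * a *\<^sub>R B = a *\<^sub>R (A * B)"
    by (rule fm_eqI) (simp add: ent_times[OF bd_dm[of A]] scaleR_sum_right)
qed (auto intro!: fm_eqI simp: algebra_simps)

text \<open>The norm is the Frobenius norm and the inner product is the real part of the trace
  pairing. The functionals \<open>inner L\<close> are therefore exactly the finite real linear
  combinations of the real and imaginary parts of the entries, which is the form in which
  Gaussianity is given.\<close>

instantiation fm :: real_inner
begin
definition "inner A B = Re (\<Sum>i<dm A. \<Sum>j<dm A. ent A i j * cnj (ent B i j))"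
definition "norm (A :: fm) = sqrt (inner A A)"
definition "sgn (A :: fm) = inverse (norm A) *\<^sub>R A"
definition "dist (A :: fm) B = norm (A - B)"
definition "uniformity = (INF e\<in>{0 <..}. principal {(x :: fm, y). dist x y < e})"
definition "open (U :: fm set) \<longleftrightarrow> (\<forall>x\<in>U. eventually (\<lambda>(x', y). x' = x \<longrightarrow> y \<in> U) uniformity)"

lemma inner_fm_bd: "bd A n \<Longrightarrow> inner A B = (\<Sum>i<n. \<Sum>j<n. Re (ent A i j * cnj (ent B i j)))"
proof -
  assume A: "bd A n"
  have "(\<Sum>i<n. \<Sum>j<n. Re (ent A i j * cnj (ent B i j)))
      = (\<Sum>i<dm A. \<Sum>j<n. Re (ent A i j * cnj (ent B i j)))"
    by (rule sum_mono_zero_lessThan) (auto simp: dm_le[OF A] bd_ent[OF bd_dm] intro!: sum.neutral)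
  also have "\<dots> = (\<Sum>i<dm A. \<Sum>j<dm A. Re (ent A i j * cnj (ent B i j)))"
    by (rule sum.cong[OF refl], rule sum_mono_zero_lessThan) (auto simp: dm_le[OF A] bd_ent[OF bd_dm])
  finally show ?thesis by (simp add: inner_fm_def)
qed

lemma inner_fm_bd': "bd B n \<Longrightarrow> inner A B = (\<Sum>i<n. \<Sum>j<n. Re (ent A i j * cnj (ent B i j)))"
proof -
  assume B: "bd B n"
  define m where "m = max n (dm A)"
  have m: "n \<le> m" by (simp add: m_def)
  have "inner A B = (\<Sum>i<m. \<Sum>j<m. Re (ent A i j * cnj (ent B i j)))"
    by (rule inner_fm_bd) (rule bd_mono[OF bd_dm], simp add: m_def)
  also have "\<dots> = (\<Sum>i<n. \<Sum>j<m. Re (ent A i j * cnj (ent B i j)))"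
    by (rule sum_mono_zero_lessThan) (auto simp: m bd_ent[OF B] intro!: sum.neutral)
  also have "\<dots> = (\<Sum>i<n. \<Sum>j<n. Re (ent A i j * cnj (ent B i j)))"
    by (rule sum.cong[OF refl], rule sum_mono_zero_lessThan) (auto simp: m bd_ent[OF B])
  finally show ?thesis .
qed

lemma inner_fm_self: "bd A n \<Longrightarrow> inner A A = (\<Sum>i<n. \<Sum>j<n. (cmod (ent A i j))\<^sup>2)"
  unfolding inner_fm_bd
  by (intro sum.cong refl) (metis Re_complex_of_real complex_norm_square)

instance
proof
  fix A B C :: fm and r :: real
  show "dist A B = norm (A - B)" by (rule dist_fm_def)
  show "sgn A = A /\<^sub>R norm A" by (rule sgn_fm_def)
  show "uniformity = (INF e\<in>{0 <..}. principal {(x :: fm, y). dist x y < e})"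
    by (rule uniformity_fm_def)
  show "open U = (\<forall>x\<in>U. \<forall>\<^sub>F (x', y) in uniformity. x' = x \<longrightarrow> y \<in> U)" for U :: "fm set"
    by (rule open_fm_def)
  show "norm A = sqrt (inner A A)" by (rule norm_fm_def)
  show "inner A B = inner B A"
    by (simp add: inner_fm_bd[OF bd_dm[of A]] inner_fm_bd'[OF bd_dm[of A]] mult.commute)
  show "inner (A + B) C = inner A C + inner B C"
    by (simp add: inner_fm_bd'[OF bd_dm[of C]] sum.distrib algebra_simps)
  show "inner (r *\<^sub>R A) B = r * inner A B"
    by (simp add: inner_fm_bd'[OF bd_dm[of B]] sum_distrib_left algebra_simps)
  show "0 \<le> inner A A"
    unfolding inner_fm_self[OF bd_dm] by (intro sum_nonneg) auto
  show "inner A A = 0 \<longleftrightarrow> A = 0"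
  proof
    assume 0: "inner A A = 0"
    have "ent A i j = 0" for i j
    proof (cases "i < dm A \<and> j < dm A")
      case True
      have "(\<Sum>j<dm A. (cmod (ent A i j))\<^sup>2) = 0"
        using 0 True unfolding inner_fm_self[OF bd_dm]
        by (subst (asm) sum_nonneg_eq_0_iff) (auto intro: sum_nonneg)
      then show ?thesis
        using True by (subst (asm) sum_nonneg_eq_0_iff) auto
    next
      case False
      then show ?thesis by (intro bd_ent[OF bd_dm]) auto
    qed
    then show "A = 0" by (intro fm_eqI) simp
  next
    assume "A = 0" then show "inner A A = 0" by (simp add: inner_fm_def)
  qed
qed
end

lemma norm_fm_sq: "bd A n \<Longrightarrow> (norm A)\<^sup>2 = (\<Sum>i<n. \<Sum>j<n. (cmod (ent A i j))\<^sup>2)"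
  by (simp add: power2_norm_eq_inner inner_fm_self)

lemma bd_times: "bd (A * B) n" if A: "bd A n" and B: "bd B n"
  unfolding bd_def by (auto simp: ent_times[OF A] bd_ent[OF A] bd_ent[OF B])

lemma norm_sum_mult_sq_le:
  fixes a b :: "nat \<Rightarrow> complex"
  shows "(cmod (\<Sum>k<n. a k * b k))\<^sup>2 \<le> (\<Sum>k<n. (cmod (a k))\<^sup>2) * (\<Sum>k<n. (cmod (b k))\<^sup>2)"
proof -
  have "cmod (\<Sum>k<n. a k * b k) \<le> (\<Sum>k<n. cmod (a k) * cmod (b k))"
    by (rule order_trans[OF norm_sum]) (simp add: norm_mult)
  then have "(cmod (\<Sum>k<n. a k * b k))\<^sup>2 \<le> (\<Sum>k<n. cmod (a k) * cmod (b k))\<^sup>2"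
    by (intro power_mono) auto
  also have "\<dots> \<le> (\<Sum>k<n. (cmod (a k))\<^sup>2) * (\<Sum>k<n. (cmod (b k))\<^sup>2)"
    by (rule Cauchy_Schwarz_ineq_sum)
  finally show ?thesis .
qed

instance fm :: real_normed_algebra
proof
  fix A B :: fm
  define n where "n = max (dm A) (dm B)"
  have A: "bd A n" and B: "bd B n" by (auto simp: n_def intro: bd_mono[OF bd_dm])
  have "(norm (A * B))\<^sup>2 = (\<Sum>i<n. \<Sum>j<n. (cmod (\<Sum>k<n. ent A i k * ent B k j))\<^sup>2)"
    by (simp add: norm_fm_sq[OF bd_times[OF A B]] ent_times[OF A])
  also have "\<dots> \<le> (\<Sum>i<n. \<Sum>j<n. (\<Sum>k<n. (cmod (ent A i k))\<^sup>2) * (\<Sum>k<n. (cmod (ent B k j))\<^sup>2))"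
    by (intro sum_mono norm_sum_mult_sq_le)
  also have "\<dots> = (\<Sum>i<n. \<Sum>k<n. (cmod (ent A i k))\<^sup>2) * (\<Sum>j<n. \<Sum>k<n. (cmod (ent B k j))\<^sup>2)"
    by (simp add: sum_product)
  also have "\<dots> = (norm A)\<^sup>2 * (norm B)\<^sup>2"
    unfolding norm_fm_sq[OF A] norm_fm_sq[OF B] by (subst (3) sum.swap) simp
  finally show "norm (A * B) \<le> norm A * norm B"
    by (metis mult_nonneg_nonneg norm_ge_zero power2_le_imp_le power_mult_distrib)
qed

definition adj :: "fm \<Rightarrow> fm" where "adj A = mkfm (dm A) (\<lambda>i j. cnj (ent A j i))"

lemma ent_adj [simp]: "ent (adj A) i j = cnj (ent A j i)"
  using bd_ent[OF bd_dm[of A], of j i] by (auto simp: adj_def ent_mkfm not_less)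

lemma bd_adj: "bd A n \<Longrightarrow> bd (adj A) n"
  by (auto simp: bd_def)

lemma adj_adj [simp]: "adj (adj A) = A"
  by (rule fm_eqI) simp

lemma adj_add: "adj (A + B) = adj A + adj B"
  by (rule fm_eqI) simp

lemma adj_scaleR: "adj (c *\<^sub>R A) = c *\<^sub>R adj A"
  by (rule fm_eqI) simp

lemma adj_zero [simp]: "adj 0 = 0"
  by (rule fm_eqI) simp

lemma adj_times: "adj (A * B) = adj B * adj A"
  by (rule fm_eqI)
    (simp add: ent_times[OF bd_dm[of A]] ent_times'[OF bd_adj[OF bd_dm[of A]]] mult.commute)

lemma inner_adj: "inner (adj A) (adj B) = inner A B"
proof -
  define n where "n = dm A"
  have A: "bd A n" by (simp add: n_def bd_dm)
  have "inner (adj A) (adj B) = (\<Sum>i<n. \<Sum>j<n. Re (ent A j i * cnj (ent B j i)))"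
    unfolding inner_fm_bd[OF bd_adj[OF A]] by simp
  also have "\<dots> = inner A B"
    unfolding inner_fm_bd[OF A] by (rule sum.swap)
  finally show ?thesis .
qed

lemma norm_adj [simp]: "norm (adj A) = norm A"
  by (simp add: norm_eq_sqrt_inner inner_adj)

lemma inner_times_left: "inner (A * B) C = inner B (adj A * C)"
proof -
  define n where "n = max (dm A) (max (dm B) (dm C))"
  have A: "bd A n" and B: "bd B n" and C: "bd C n" by (auto simp: n_def intro: bd_mono[OF bd_dm])
  have "inner (A * B) C = Re (\<Sum>i<n. \<Sum>j<n. \<Sum>k<n. ent A i k * ent B k j * cnj (ent C i j))"
    by (simp add: inner_fm_bd[OF bd_times[OF A B]] ent_times[OF A] sum_distrib_right)
  also have "(\<Sum>i<n. \<Sum>j<n. \<Sum>k<n. ent A i k * ent B k j * cnj (ent C i j))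
      = (\<Sum>i<n. \<Sum>k<n. \<Sum>j<n. ent A i k * ent B k j * cnj (ent C i j))"
    by (rule sum.cong[OF refl], rule sum.swap)
  also have "\<dots> = (\<Sum>k<n. \<Sum>i<n. \<Sum>j<n. ent A i k * ent B k j * cnj (ent C i j))"
    by (rule sum.swap)
  also have "\<dots> = (\<Sum>k<n. \<Sum>j<n. \<Sum>i<n. ent A i k * ent B k j * cnj (ent C i j))"
    by (rule sum.cong[OF refl], rule sum.swap)
  also have "\<dots> = (\<Sum>k<n. \<Sum>j<n. ent B k j * cnj (ent (adj A * C) k j))"
    by (simp add: ent_times[OF bd_adj[OF A]] sum_distrib_left mult_ac)
  also have "Re \<dots> = inner B (adj A * C)"
    by (simp add: inner_fm_bd[OF B])
  finally show ?thesis .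
qed

lemma inner_times_right: "inner (A * B) C = inner A (C * adj B)"
proof -
  have "inner (A * B) C = inner (adj B * adj A) (adj C)"
    by (metis adj_times inner_adj)
  also have "\<dots> = inner (adj A) (B * adj C)" by (simp add: inner_times_left)
  also have "\<dots> = inner A (C * adj B)" by (metis adj_adj adj_times inner_adj)
  finally show ?thesis .
qed

definition idm :: "nat \<Rightarrow> fm" where "idm d = mkfm d (\<lambda>i j. if i = j then 1 else 0)"

lemma ent_idm: "ent (idm d) i j = (if i = j \<and> i < d then 1 else 0)"
  by (simp add: idm_def ent_mkfm)

lemma bd_idm [simp]: "bd (idm d) d"
  by (simp add: idm_def bd_mkfm)

lemma adj_idm [simp]: "adj (idm d) = idm d"
  by (rule fm_eqI) (auto simp: ent_idm)

lemma idm_times [simp]: "bd A d \<Longrightarrow> idm d * A = A"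
proof (rule fm_eqI)
  fix i j assume A: "bd A d"
  have "ent (idm d * A) i j = (\<Sum>k<d. if k = i then ent A i j else 0)"
    unfolding ent_times[OF bd_idm] by (rule sum.cong) (auto simp: ent_idm)
  then show "ent (idm d * A) i j = ent A i j"
    by (auto simp: bd_ent[OF A] not_less)
qed

lemma times_idm [simp]: "bd A d \<Longrightarrow> A * idm d = A"
  by (metis adj_adj adj_idm adj_times bd_adj idm_times)

lemma norm_idm: "(norm (idm d))\<^sup>2 = real d"
proof -
  have "(norm (idm d))\<^sup>2 = (\<Sum>i<d. \<Sum>j<d. if j = i then 1 else 0)"
    unfolding norm_fm_sq[OF bd_idm] by (intro sum.cong refl) (auto simp: ent_idm)
  then show ?thesis by simp
qed

lemma bd_zero [simp]: "bd 0 n" by (simp add: bd_def)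
lemma bd_add: "bd A n \<Longrightarrow> bd B n \<Longrightarrow> bd (A + B) n" by (auto simp: bd_def)
lemma bd_scaleR: "bd A n \<Longrightarrow> bd (c *\<^sub>R A) n" by (auto simp: bd_def)
definition sad :: "nat \<Rightarrow> fm set" where "sad d = {A. bd A d \<and> adj A = A}"

lemma sad_add: "A \<in> sad d \<Longrightarrow> B \<in> sad d \<Longrightarrow> A + B \<in> sad d"
  by (auto simp: sad_def bd_add adj_add)
lemma sad_scaleR: "A \<in> sad d \<Longrightarrow> c *\<^sub>R A \<in> sad d"
  by (auto simp: sad_def bd_scaleR adj_scaleR)
lemma sad_zero [simp]: "0 \<in> sad d" by (simp add: sad_def)
lemma sad_idm [simp]: "idm d \<in> sad d" by (simp add: sad_def)
lemma sad_sum: "(\<And>i. i \<in> I \<Longrightarrow> f i \<in> sad d) \<Longrightarrow> sum f I \<in> sad d"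
  by (induction I rule: infinite_finite_induct) (auto simp: sad_add)
lemma sad_diff: "A \<in> sad d \<Longrightarrow> B \<in> sad d \<Longrightarrow> A - B \<in> sad d"
  using sad_add[of A d "(-1) *\<^sub>R B"] sad_scaleR[of B d "-1"] by simp

section \<open>Words and derivatives of the trace functional\<close>

text \<open>At the least index where the maximum is attained, an interior point would have a
  strictly smaller left neighbour and a right neighbour that is no larger, against midpoint
  convexity.\<close>

lemma convex_seq_le_max:
  fixes h :: "nat \<Rightarrow> real"
  assumes conv: "\<And>j. 0 < j \<Longrightarrow> j < n \<Longrightarrow> 2 * h j \<le> h (j - 1) + h (j + 1)" and "j \<le> n"
  shows "h j \<le> max (h 0) (h n)"
proof -
  define M where "M = Max (h ` {..n})"
  have M: "h i \<le> M" if "i \<le> n" for i unfolding M_def using that by (intro Max_ge) auto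
  have "M \<in> h ` {..n}" unfolding M_def by (intro Max_in) auto
  then have ex: "\<exists>i. i \<le> n \<and> h i = M" by auto
  define i where "i = (LEAST i. i \<le> n \<and> h i = M)"
  have i: "i \<le> n" "h i = M" using LeastI_ex[OF ex] by (auto simp: i_def)
  have "i = 0 \<or> i = n"
  proof (rule ccontr)
    assume "\<not> ?thesis"
    then have i': "0 < i" "i < n" using i by auto
    have "h (i - 1) \<noteq> M"
      using not_less_Least[of "i - 1" "\<lambda>i. i \<le> n \<and> h i = M"] i' unfolding i_def[symmetric] by auto
    moreover have "h (i - 1) \<le> M" using M[of "i - 1"] i' by simp
    ultimately have "h (i - 1) < M" by simp
    moreover have "h (i + 1) \<le> M" using M i' by auto
    ultimately show False using conv[OF i'] i by auto
  qed
  then show ?thesis using M[OF \<open>j \<le> n\<close>] i by auto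
qed

section \<open>Powers of a self-adjoint matrix and words with one letter\<close>

primrec pw :: "nat \<Rightarrow> fm \<Rightarrow> nat \<Rightarrow> fm" where
  "pw d Y 0 = idm d"
| "pw d Y (Suc n) = Y * pw d Y n"

lemma bd_pw [simp]: "bd Y d \<Longrightarrow> bd (pw d Y n) d"
  by (induction n) (auto intro: bd_times)

lemma pw_add: "bd Y d \<Longrightarrow> pw d Y (a + b) = pw d Y a * pw d Y b"
  by (induction a) (auto simp: mult.assoc)

lemma pw_1 [simp]: "bd Y d \<Longrightarrow> pw d Y (Suc 0) = Y"
  by simp

lemma pw_Suc': "bd Y d \<Longrightarrow> pw d Y n * Y = Y * pw d Y n"
  using pw_add[of Y d n 1] pw_add[of Y d 1 n] by (simp add: add.commute)

lemma adj_pw [simp]: "Y \<in> sad d \<Longrightarrow> adj (pw d Y n) = pw d Y n"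
  by (induction n) (auto simp: sad_def adj_times pw_Suc')

lemma norm_pw_le: "norm (pw d Y n) \<le> norm Y ^ n * norm (idm d)"
proof (induction n)
  case (Suc n)
  have "norm (pw d Y (Suc n)) \<le> norm Y * norm (pw d Y n)" by (simp add: norm_mult_ineq)
  also have "\<dots> \<le> norm Y * (norm Y ^ n * norm (idm d))" by (intro mult_left_mono Suc) auto
  finally show ?case by (simp add: mult.assoc)
qed simp

text \<open>For self-adjoint arguments this is the trace of A^2 (1 + Y^(2m)). Words of total
  exponent between 0 and m are bounded by convexity through their two extreme exponents, and the two
  summands are the values at these ends.\<close>

definition QQ :: "nat \<Rightarrow> nat \<Rightarrow> fm \<Rightarrow> fm \<Rightarrow> real" where
  "QQ d m Y A = (norm A)\<^sup>2 + (norm (A * pw d Y m))\<^sup>2"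

lemma QQ_nonneg [simp]: "0 \<le> QQ d m Y A"
  by (simp add: QQ_def)

lemma inner_le_half_sq:
  fixes x y :: "'a :: real_inner"
  shows "2 * inner x y \<le> (norm x)\<^sup>2 + (norm y)\<^sup>2"
  using inner_ge_zero[of "x - y"]
  by (simp add: power2_norm_eq_inner inner_diff_left inner_diff_right inner_commute)

text \<open>By Cauchy-Schwarz the squared norm of Y^j A Y^(n-j) is convex in j. Since A and Y are
  self-adjoint, the two end values are both equal to the squared norm of A Y^n, so the position of
  the letter does not matter.\<close>

lemma norm_word_le:
  assumes Y: "Y \<in> sad d" and A: "A \<in> sad d" and acm: "a + c \<le> m"
  shows "(norm (pw d Y a * A * pw d Y c))\<^sup>2 \<le> QQ d m Y A"
proof -
  have bY: "bd Y d" and aY: "adj Y = Y" and bA: "bd A d" and aA: "adj A = A"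
    using Y A by (auto simp: sad_def)
  define n where "n = a + c"
  define h where "h j = (norm (pw d Y j * A * pw d Y (n - j)))\<^sup>2" for j
  have "h a \<le> max (h 0) (h n)"
  proof (rule convex_seq_le_max)
    fix j assume j: "0 < j" "j < n"
    obtain i where i: "j = Suc i" using j by (cases j) auto
    obtain l where l: "n - j = Suc l" using j by (cases "n - j") auto
    have e: "n - (j - 1) = Suc (Suc l)" "n - (j + 1) = l" using i l by auto
    define P where "P = pw d Y i * A * pw d Y (Suc l)"
    define S where "S = pw d Y j * A * pw d Y l"
    have 1: "pw d Y j * A * pw d Y (n - j) = Y * P"
      by (simp add: P_def i l[unfolded i] mult.assoc)
    have 2: "pw d Y j * A * pw d Y (n - j) = S * Y"
      by (simp only: S_def l mult.assoc pw_Suc'[OF bY] pw.simps)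
    have "h j = inner (Y * P) (S * Y)"
      unfolding h_def power2_norm_eq_inner using 1 2 by simp
    \<comment> \<open>A factor \<open>Y\<close> on the left of one argument and a factor
      \<open>Y\<close> on the right of the other change sides; the arguments become the words of
      index j - 1 and j + 1.\<close>
    also have "\<dots> = inner (P * Y) (Y * S)"
      by (metis aY inner_times_left inner_times_right mult.assoc)
    finally have "2 * h j \<le> (norm (P * Y))\<^sup>2 + (norm (Y * S))\<^sup>2"
      using inner_le_half_sq by simp
    moreover have "P * Y = pw d Y (j - 1) * A * pw d Y (n - (j - 1))"
      unfolding e P_def using i by (simp add: mult.assoc pw_Suc'[OF bY])
    moreover have "Y * S = pw d Y (j + 1) * A * pw d Y (n - (j + 1))"
      unfolding e S_def by (simp add: mult.assoc)
    ultimately show "2 * h j \<le> h (j - 1) + h (j + 1)" by (simp add: h_def)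
  qed (simp add: n_def)
  moreover have "h 0 = (norm (A * pw d Y n))\<^sup>2" using bA by (simp add: h_def)
  moreover have "h n = (norm (A * pw d Y n))\<^sup>2"
  proof -
    have "pw d Y n * A * pw d Y (n - n) = adj (A * pw d Y n)"
      using Y bA aA bY by (simp add: adj_times bd_times)
    then show ?thesis by (simp add: h_def)
  qed
  ultimately have 1: "h a \<le> (norm (A * pw d Y n))\<^sup>2" by simp
  \<comment> \<open>The same convexity, now in the exponent of a one-sided power, compares the
    exponent n with the exponents 0 and m that occur in \<open>QQ\<close>.\<close>
  define r where "r k = (norm (A * pw d Y k))\<^sup>2" for k
  have "r n \<le> max (r 0) (r m)"
  proof (rule convex_seq_le_max)
    fix j assume j: "0 < j" "j < m"
    obtain i where i: "j = Suc i" using j by (cases j) auto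
    have "r j = inner (A * pw d Y i * Y) (A * pw d Y j)"
      unfolding r_def power2_norm_eq_inner by (simp add: i mult.assoc pw_Suc'[OF bY])
    also have "\<dots> = inner (A * pw d Y i) (A * pw d Y (Suc j))"
      by (subst inner_times_right) (simp add: aY mult.assoc pw_Suc'[OF bY])
    finally show "2 * r j \<le> r (j - 1) + r (j + 1)"
      using inner_le_half_sq[of "A * pw d Y i" "A * pw d Y (Suc j)"] by (simp add: r_def i)
  qed (use acm n_def in auto)
  moreover have "r 0 = (norm A)\<^sup>2" using bA by (simp add: r_def)
  ultimately have "r n \<le> QQ d m Y A"
    unfolding QQ_def r_def[of m, symmetric] using zero_le_power2[of "norm A"]
    by (metis add.commute add_increasing add_increasing2 max_def r_def zero_le_power2)
  with 1 have "h a \<le> QQ d m Y A" unfolding r_def by (rule order_trans)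
  then show ?thesis by (simp add: h_def n_def)
qed

section \<open>Traces of words with two and three letters\<close>

definition tr :: "nat \<Rightarrow> fm \<Rightarrow> real" where "tr d x = inner (idm d) x"

lemma tr_mult: "bd y d \<Longrightarrow> bd x d \<Longrightarrow> tr d (x * y) = inner (adj x) y"
  unfolding tr_def by (subst inner_commute, subst inner_times_left) (simp add: bd_adj inner_commute)

lemma tr_cyc: "bd y d \<Longrightarrow> bd x d \<Longrightarrow> tr d (x * y) = tr d (y * x)"
  by (simp add: tr_mult) (metis adj_adj inner_adj inner_commute)

lemma abs_tr_le: "\<bar>tr d x\<bar> \<le> norm (idm d) * norm x"
  unfolding tr_def by (rule Cauchy_Schwarz_ineq2)

text \<open>An upper bound of the operator norm, in the form in which it is applied: left
  multiplication on matrices with the Frobenius norm. Acting column by column, it has the same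
  bounds as the action on vectors.\<close>

definition opb :: "fm \<Rightarrow> real \<Rightarrow> bool" where
  "opb B R \<longleftrightarrow> 0 \<le> R \<and> (\<forall>P. norm (B * P) \<le> R * norm P)"

lemma opbD: "opb B R \<Longrightarrow> norm (B * P) \<le> R * norm P"
  by (simp add: opb_def)

lemma sqrt_mult_le: "x\<^sup>2 \<le> q \<Longrightarrow> y\<^sup>2 \<le> q \<Longrightarrow> \<bar>x\<bar> * \<bar>y\<bar> \<le> (q::real)"
proof -
  assume "x\<^sup>2 \<le> q" "y\<^sup>2 \<le> q"
  moreover have "2 * (\<bar>x\<bar> * \<bar>y\<bar>) \<le> x\<^sup>2 + y\<^sup>2"
    using sum_squares_bound[of "\<bar>x\<bar>" "\<bar>y\<bar>"] by simp
  ultimately show ?thesis by linarith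
qed

text \<open>If neither of the first two gaps is too long, the last gap can be cut into
  \<open>ga + al\<close>, and cyclicity moves \<open>al\<close> powers in front of A. The words
  around A and around C then have exponents equal to the two halves of the total, hence at most m,
  and B is estimated in operator norm between them.\<close>

lemma word3_aux:
  assumes Y: "Y \<in> sad d" and A: "A \<in> sad d" and B: "B \<in> sad d" and C: "C \<in> sad d"
    and R: "opb B R" and M: "a + c + k \<le> 2 * m"
    and a: "a \<le> (a + c + k) div 2" and c: "c \<le> a + c + k - (a + c + k) div 2"
    and q: "QQ d m Y A \<le> q" "QQ d m Y C \<le> q"
  shows "\<bar>tr d (A * pw d Y a * B * pw d Y c * C * pw d Y k)\<bar> \<le> R * q"
proof -
  have [simp]: "bd Y d" "bd A d" "bd B d" "bd C d" and aA: "adj A = A" using Y A B C by (auto simp: sad_def)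
  define h where "h = (a + c + k) div 2"
  define al where "al = h - a"
  define ga where "ga = a + c + k - h - c"
  have k: "k = ga + al" using a c by (auto simp: al_def ga_def h_def)
  have "tr d (A * pw d Y a * B * pw d Y c * C * pw d Y k)
      = tr d ((A * pw d Y a * B * pw d Y c * C * pw d Y ga) * pw d Y al)"
    by (simp add: k pw_add mult.assoc)
  also have "\<dots> = tr d (pw d Y al * (A * pw d Y a * B * pw d Y c * C * pw d Y ga))"
    by (rule tr_cyc) (simp_all add: bd_times)
  also have "\<dots> = tr d ((pw d Y al * A * pw d Y a) * (B * (pw d Y c * C * pw d Y ga)))"
    by (simp add: mult.assoc)
  also have "\<dots> = inner (adj (pw d Y al * A * pw d Y a)) (B * (pw d Y c * C * pw d Y ga))"
    by (rule tr_mult) (simp_all add: bd_times)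
  also have "adj (pw d Y al * A * pw d Y a) = pw d Y a * A * pw d Y al"
    using Y aA by (simp add: adj_times mult.assoc)
  finally have "\<bar>tr d (A * pw d Y a * B * pw d Y c * C * pw d Y k)\<bar>
      \<le> norm (pw d Y a * A * pw d Y al) * norm (B * (pw d Y c * C * pw d Y ga))"
    by (metis Cauchy_Schwarz_ineq2)
  also have "\<dots> \<le> norm (pw d Y a * A * pw d Y al) * (R * norm (pw d Y c * C * pw d Y ga))"
    by (intro mult_left_mono opbD[OF R]) simp
  also have "\<dots> = R * (norm (pw d Y a * A * pw d Y al) * norm (pw d Y c * C * pw d Y ga))"
    by simp
  also have "\<dots> \<le> R * q"
  proof (rule mult_left_mono)
    have "(norm (pw d Y a * A * pw d Y al))\<^sup>2 \<le> q"
      by (rule order_trans[OF norm_word_le[OF Y A] q(1)]) (use a M in \<open>auto simp: al_def h_def\<close>)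
    moreover have "(norm (pw d Y c * C * pw d Y ga))\<^sup>2 \<le> q"
      by (rule order_trans[OF norm_word_le[OF Y C] q(2)]) (use a c M in \<open>auto simp: ga_def h_def\<close>)
    ultimately show "norm (pw d Y a * A * pw d Y al) * norm (pw d Y c * C * pw d Y ga) \<le> q"
      using sqrt_mult_le by fastforce
    show "0 \<le> R" using R by (simp add: opb_def)
  qed
  finally show ?thesis .
qed

text \<open>At most one of the three exponents exceeds half of their sum. By cyclicity of the trace it
  can be split between the two neighbouring letters, while the third letter is estimated in
  operator norm.\<close>

lemma word3:
  assumes Y: "Y \<in> sad d" and A: "A \<in> sad d" and B: "B \<in> sad d" and C: "C \<in> sad d"
    and R: "opb A R" "opb B R" "opb C R" and M: "a + c + k \<le> 2 * m"
    and q: "QQ d m Y A \<le> q" "QQ d m Y B \<le> q" "QQ d m Y C \<le> q"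
  shows "\<bar>tr d (A * pw d Y a * B * pw d Y c * C * pw d Y k)\<bar> \<le> R * q"
proof -
  have [simp]: "bd Y d" "bd A d" "bd B d" "bd C d" using Y A B C by (auto simp: sad_def)
  define M where "M = a + c + k"
  have r1: "tr d (A * pw d Y a * B * pw d Y c * C * pw d Y k)
      = tr d (B * pw d Y c * C * pw d Y k * A * pw d Y a)"
    using tr_cyc[of "B * pw d Y c * C * pw d Y k" d "A * pw d Y a"] by (simp add: mult.assoc bd_times)
  have r2: "tr d (A * pw d Y a * B * pw d Y c * C * pw d Y k)
      = tr d (C * pw d Y k * A * pw d Y a * B * pw d Y c)"
    using tr_cyc[of "C * pw d Y k" d "A * pw d Y a * B * pw d Y c"] by (simp add: mult.assoc bd_times)
  consider "a \<le> M div 2 \<and> c \<le> M - M div 2" | "a > M div 2" | "a \<le> M div 2 \<and> c > M - M div 2"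
    by linarith
  then show ?thesis
  proof cases
    case 1
    then show ?thesis unfolding M_def
      by (intro word3_aux) (use assms in auto)
  next
    case 2
    have e: "c + k + a = M" by (simp add: M_def)
    have "\<bar>tr d (B * pw d Y c * C * pw d Y k * A * pw d Y a)\<bar> \<le> R * q"
    proof (rule word3_aux[OF Y B C A R(3) _ _ _ q(2) q(1)])
      show "c \<le> (c + k + a) div 2" "k \<le> c + k + a - (c + k + a) div 2"
        using 2 unfolding e by (auto simp: M_def)
    qed (use M in simp)
    then show ?thesis unfolding r1 .
  next
    case 3
    have e: "k + a + c = M" by (simp add: M_def)
    have "\<bar>tr d (C * pw d Y k * A * pw d Y a * B * pw d Y c)\<bar> \<le> R * q"
    proof (rule word3_aux[OF Y C A B R(1) _ _ _ q(3) q(2)])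
      show "k \<le> (k + a + c) div 2" "a \<le> k + a + c - (k + a + c) div 2"
        using 3 unfolding e by (auto simp: M_def)
    qed (use M in simp)
    then show ?thesis unfolding r2 .
  qed
qed

text \<open>With two letters either gap may be cut, so that the two halves of the total exponent can
  always be distributed around A and around B. No case distinction arises and no operator norm is
  lost.\<close>

lemma word2:
  assumes Y: "Y \<in> sad d" and A: "A \<in> sad d" and B: "B \<in> sad d" and M: "a + c \<le> 2 * m"
    and q: "QQ d m Y A \<le> q" "QQ d m Y B \<le> q"
  shows "\<bar>tr d (A * pw d Y a * B * pw d Y c)\<bar> \<le> q"
proof -
  have [simp]: "bd Y d" "bd A d" "bd B d" and aA: "adj A = A" using Y A B by (auto simp: sad_def)
  define h where "h = (a + c) div 2"
  define a1 where "a1 = min a h"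
  define a2 where "a2 = a - a1"
  define al where "al = h - a1"
  define ga where "ga = a + c - h - a2"
  have c: "c = ga + al" and a: "a = a1 + a2" by (auto simp: al_def ga_def a1_def a2_def h_def)
  have "tr d (A * pw d Y a * B * pw d Y c) = tr d ((A * pw d Y a * B * pw d Y ga) * pw d Y al)"
    by (simp add: c pw_add mult.assoc)
  also have "\<dots> = tr d (pw d Y al * (A * pw d Y a * B * pw d Y ga))"
    by (rule tr_cyc) (simp_all add: bd_times)
  also have "\<dots> = tr d ((pw d Y al * A * pw d Y a1) * (pw d Y a2 * B * pw d Y ga))"
    by (simp add: mult.assoc a pw_add)
  also have "\<dots> = inner (adj (pw d Y al * A * pw d Y a1)) (pw d Y a2 * B * pw d Y ga)"
    by (rule tr_mult) (simp_all add: bd_times)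
  also have "adj (pw d Y al * A * pw d Y a1) = pw d Y a1 * A * pw d Y al"
    using Y aA by (simp add: adj_times mult.assoc)
  finally have "\<bar>tr d (A * pw d Y a * B * pw d Y c)\<bar>
      \<le> norm (pw d Y a1 * A * pw d Y al) * norm (pw d Y a2 * B * pw d Y ga)"
    by (metis Cauchy_Schwarz_ineq2)
  also have "\<dots> \<le> q"
  proof -
    have "(norm (pw d Y a1 * A * pw d Y al))\<^sup>2 \<le> q"
      by (rule order_trans[OF norm_word_le[OF Y A] q(1)]) (use M in \<open>auto simp: al_def a1_def h_def\<close>)
    moreover have "(norm (pw d Y a2 * B * pw d Y ga))\<^sup>2 \<le> q"
      by (rule order_trans[OF norm_word_le[OF Y B] q(2)])
        (use M in \<open>auto simp: ga_def a1_def a2_def h_def\<close>)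
    ultimately show ?thesis using sqrt_mult_le by fastforce
  qed
  finally show ?thesis .
qed

section \<open>The trace functional, its derivatives and their bounds\<close>

definition F0 :: "nat \<Rightarrow> nat \<Rightarrow> fm \<Rightarrow> real" where
  "F0 d m Y = real d + tr d (pw d Y (2 * m))"

definition F1 :: "nat \<Rightarrow> nat \<Rightarrow> fm \<Rightarrow> fm \<Rightarrow> real" where
  "F1 d m Y A = 2 * real m * tr d (A * pw d Y (2 * m - 1))"

definition F2 :: "nat \<Rightarrow> nat \<Rightarrow> fm \<Rightarrow> fm \<Rightarrow> fm \<Rightarrow> real" where
  "F2 d m Y A B = 2 * real m * (\<Sum>k<2*m-1. tr d (A * pw d Y k * B * pw d Y (2 * m - 1 - 1 - k)))"

text \<open>The two inner sums insert the third letter C into the first and into the second gap of a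
  word of \<open>F2\<close>.\<close>

definition F3 :: "nat \<Rightarrow> nat \<Rightarrow> fm \<Rightarrow> fm \<Rightarrow> fm \<Rightarrow> fm \<Rightarrow> real" where
  "F3 d m Y A B C = 2 * real m * (\<Sum>k<2*m-1.
      (\<Sum>j<k. tr d (A * pw d Y j * C * pw d Y (k - 1 - j) * B * pw d Y (2 * m - 1 - 1 - k)))
    + (\<Sum>j<2*m-1-1-k. tr d (A * pw d Y k * B * pw d Y j * C * pw d Y (2 * m - 1 - 1 - k - 1 - j))))"

text \<open>The functional is its own energy bound with the identity as letter. This gives
  positivity, makes the word bounds available for pure powers, and lets the sum of the energies of
  all summands be compared with the functional.\<close>

lemma F0_eq: "Y \<in> sad d \<Longrightarrow> F0 d m Y = QQ d m Y (idm d)"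
proof -
  assume Y: "Y \<in> sad d"
  then have [simp]: "bd Y d" by (simp add: sad_def)
  have "tr d (pw d Y (2 * m)) = tr d (pw d Y m * pw d Y m)" by (simp add: pw_add mult_2)
  also have "\<dots> = (norm (pw d Y m))\<^sup>2" using Y by (simp add: tr_mult power2_norm_eq_inner)
  finally show ?thesis by (simp add: F0_def QQ_def norm_idm)
qed

lemma F0_ge: "Y \<in> sad d \<Longrightarrow> real d \<le> F0 d m Y"
  by (simp add: F0_eq QQ_def norm_idm)

lemma has_vector_derivative_pw:
  assumes c: "(c has_vector_derivative H) (at u)" and bd: "\<And>u. bd (c u) d" and H: "bd H d"
  shows "((\<lambda>u. pw d (c u) n) has_vector_derivative (\<Sum>k<n. pw d (c u) k * H * pw d (c u) (n - 1 - k))) (at u)"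
proof (induction n)
  case 0
  show ?case by simp
next
  case (Suc n)
  have "((\<lambda>u. c u * pw d (c u) n) has_vector_derivative
      (c u * (\<Sum>k<n. pw d (c u) k * H * pw d (c u) (n - 1 - k)) + H * pw d (c u) n)) (at u)"
    by (rule has_vector_derivative_mult[OF c Suc])
  moreover have "c u * (\<Sum>k<n. pw d (c u) k * H * pw d (c u) (n - 1 - k)) + H * pw d (c u) n
      = (\<Sum>k<Suc n. pw d (c u) k * H * pw d (c u) (Suc n - 1 - k))"
    unfolding sum.lessThan_Suc_shift
    by (simp add: sum_distrib_left mult.assoc bd bd_times H)
  ultimately show ?case by simp
qed

lemma has_real_derivative_tr:
  "(c has_vector_derivative H) (at u) \<Longrightarrow> ((\<lambda>u. tr d (c u)) has_real_derivative tr d H) (at u)"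
  unfolding tr_def has_real_derivative_iff_has_vector_derivative
  by (rule bounded_linear.has_vector_derivative[OF bounded_linear_inner_right])

lemma tr_sum: "tr d (sum f I) = (\<Sum>i\<in>I. tr d (f i))"
  by (simp add: tr_def inner_sum_right)

lemma DERIV_F0:
  assumes c: "(c has_vector_derivative H) (at u)" and bd: "\<And>u. bd (c u) d" and H: "bd H d"
  shows "((\<lambda>u. F0 d m (c u)) has_real_derivative F1 d m (c u) H) (at u)"
proof -
  have "tr d (\<Sum>k<2*m. pw d (c u) k * H * pw d (c u) (2 * m - 1 - k))
      = (\<Sum>k<2*m. tr d (H * pw d (c u) (2 * m - 1)))"
    unfolding tr_sum
  proof (rule sum.cong[OF refl])
    fix k assume k: "k \<in> {..<2*m}"
    have "tr d (pw d (c u) k * H * pw d (c u) (2 * m - 1 - k))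
        = tr d (H * pw d (c u) (2 * m - 1 - k) * pw d (c u) k)"
      using tr_cyc[of "H * pw d (c u) (2 * m - 1 - k)" d "pw d (c u) k"] bd H
      by (simp add: bd_times mult.assoc)
    also have "\<dots> = tr d (H * pw d (c u) (2 * m - 1))"
      using k pw_add[OF bd[of u], of "2 * m - 1 - k" k] by (simp add: mult.assoc)
    finally show "tr d (pw d (c u) k * H * pw d (c u) (2 * m - 1 - k)) = tr d (H * pw d (c u) (2 * m - 1))" .
  qed
  then show ?thesis
    unfolding F0_def F1_def
    by (auto intro!: derivative_eq_intros has_real_derivative_tr[OF has_vector_derivative_pw[OF c bd H]])
qed

lemma has_vector_derivative_mult_const_left:
  fixes B :: "'a :: real_normed_algebra"
  shows "(c has_vector_derivative H) (at u) \<Longrightarrow> ((\<lambda>u. B * c u) has_vector_derivative (B * H)) (at u)"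
  by (rule bounded_linear.has_vector_derivative[OF bounded_linear_mult_right])

lemma has_vector_derivative_mult_const_right:
  fixes B :: "'a :: real_normed_algebra"
  shows "(c has_vector_derivative H) (at u) \<Longrightarrow> ((\<lambda>u. c u * B) has_vector_derivative (H * B)) (at u)"
  by (rule bounded_linear.has_vector_derivative[OF bounded_linear_mult_left])

text \<open>The direction A may move with the parameter, as it does along the rotation that yields
  the integration by parts.\<close>

lemma DERIV_F1:
  assumes c: "(c has_vector_derivative H) (at u)" and bd: "\<And>u. bd (c u) d" and H: "bd H d"
    and A: "(A has_vector_derivative A') (at u)"
  shows "((\<lambda>u. F1 d m (c u) (A u)) has_real_derivative F2 d m (c u) (A u) H + F1 d m (c u) A') (at u)"
proof -
  have "tr d (A u * (\<Sum>k<2*m-1. pw d (c u) k * H * pw d (c u) (2 * m - 1 - 1 - k)) + A' * pw d (c u) (2 * m - 1))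
     = (\<Sum>k<2*m-1. tr d (A u * pw d (c u) k * H * pw d (c u) (2 * m - 1 - 1 - k)))
       + tr d (A' * pw d (c u) (2 * m - 1))"
    by (simp add: sum_distrib_left mult.assoc tr_def inner_add_right inner_sum_right)
  then show ?thesis
    unfolding F2_def F1_def
    by (auto intro!: derivative_eq_intros has_real_derivative_tr[OF has_vector_derivative_mult[OF A
        has_vector_derivative_pw[OF c bd H]]] simp: distrib_right distrib_left mult.commute[of _ "2 * real m"])
qed

lemma DERIV_F2:
  assumes c: "(c has_vector_derivative H) (at u)" and bd: "\<And>u. bd (c u) d" and H: "bd H d"
  shows "((\<lambda>u. F2 d m (c u) A B) has_real_derivative F3 d m (c u) A B H) (at u)"
proof -
  have *: "((\<lambda>u. tr d (A * pw d (c u) k * B * pw d (c u) l)) has_real_derivative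
      ((\<Sum>j<k. tr d (A * pw d (c u) j * H * pw d (c u) (k - 1 - j) * B * pw d (c u) l))
      + (\<Sum>j<l. tr d (A * pw d (c u) k * B * pw d (c u) j * H * pw d (c u) (l - 1 - j))))) (at u)" for k l
  proof -
    have "((\<lambda>u. (A * pw d (c u) k * B) * pw d (c u) l) has_vector_derivative
      ((A * pw d (c u) k * B) * (\<Sum>j<l. pw d (c u) j * H * pw d (c u) (l - 1 - j))
       + (A * (\<Sum>j<k. pw d (c u) j * H * pw d (c u) (k - 1 - j)) * B) * pw d (c u) l)) (at u)"
      by (intro has_vector_derivative_mult has_vector_derivative_mult_const_left
          has_vector_derivative_mult_const_right has_vector_derivative_pw[OF c bd H])
    from has_real_derivative_tr[OF this, of d] show ?thesis
      by (simp add: tr_def inner_add_right inner_sum_right sum_distrib_left sum_distrib_right mult.assoc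
        add.commute)
  qed
  show ?thesis
    unfolding F2_def F3_def
    by (intro DERIV_cmult DERIV_sum *)
qed

lemma abs_sum_le_card:
  fixes f :: "nat \<Rightarrow> real"
  shows "(\<And>k. k < n \<Longrightarrow> \<bar>f k\<bar> \<le> b) \<Longrightarrow> \<bar>\<Sum>k<n. f k\<bar> \<le> real n * b"
  by (rule order_trans[OF sum_abs], rule order_trans[OF sum_bounded_above[of _ _ b]]) auto

text \<open>The exponent 2m - 1 is split into m, which stays with A, and m - 1, which is a word with
  the identity as its letter and so has norm at most the square root of \<open>F0\<close>.\<close>

lemma F1_bound:
  assumes Y: "Y \<in> sad d" and A: "A \<in> sad d" and m: "1 \<le> m"
  shows "\<bar>F1 d m Y A\<bar> \<le> 2 * real m * (sqrt (F0 d m Y) * norm (A * pw d Y m))"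
proof -
  have [simp]: "bd Y d" "bd A d" using Y A by (auto simp: sad_def)
  have e: "2 * m - 1 = m + (m - 1)" using m by simp
  have "tr d (A * pw d Y (2 * m - 1)) = tr d (A * pw d Y m * pw d Y (m - 1))"
    unfolding e by (simp add: pw_add mult.assoc)
  also have "\<dots> = tr d (pw d Y (m - 1) * (A * pw d Y m))"
    by (rule tr_cyc) (simp_all add: bd_times)
  also have "\<dots> = inner (pw d Y (m - 1)) (A * pw d Y m)"
    using Y by (simp add: tr_mult bd_times)
  finally have "\<bar>tr d (A * pw d Y (2 * m - 1))\<bar> \<le> norm (pw d Y (m - 1)) * norm (A * pw d Y m)"
    by (metis Cauchy_Schwarz_ineq2)
  also have "\<dots> \<le> sqrt (F0 d m Y) * norm (A * pw d Y m)"
  proof (rule mult_right_mono)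
    have "(norm (pw d Y (m - 1) * idm d * pw d Y 0))\<^sup>2 \<le> QQ d m Y (idm d)"
      by (rule norm_word_le) (use Y m in auto)
    then show "norm (pw d Y (m - 1)) \<le> sqrt (F0 d m Y)"
      by (simp add: F0_eq[OF Y] real_le_rsqrt bd_times)
  qed simp
  finally show ?thesis unfolding F1_def by (simp add: abs_mult mult_left_mono)
qed

lemma F1_le_R:
  assumes Y: "Y \<in> sad d" and A: "A \<in> sad d" and m: "1 \<le> m" and R: "opb A R"
  shows "\<bar>F1 d m Y A\<bar> \<le> 2 * real m * R * F0 d m Y"
proof -
  have F: "0 \<le> F0 d m Y" using F0_ge[OF Y, of m] by linarith
  have "norm (A * pw d Y m) \<le> R * norm (pw d Y m)" by (rule opbD[OF R])
  also have "\<dots> \<le> R * sqrt (F0 d m Y)"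
  proof (rule mult_left_mono)
    have "(norm (pw d Y m))\<^sup>2 \<le> F0 d m Y"
      using Y by (simp add: F0_eq QQ_def sad_def)
    then show "norm (pw d Y m) \<le> sqrt (F0 d m Y)" by (rule real_le_rsqrt)
    show "0 \<le> R" using R by (simp add: opb_def)
  qed
  finally have "sqrt (F0 d m Y) * norm (A * pw d Y m) \<le> sqrt (F0 d m Y) * (R * sqrt (F0 d m Y))"
    by (intro mult_left_mono) (auto simp: F)
  also have "\<dots> = R * F0 d m Y" using F by simp
  finally show ?thesis
    using F1_bound[OF Y A m] by (smt (verit) mult.assoc mult_left_mono of_nat_0_le_iff)
qed

text \<open>Two first derivatives yield one factor \<open>F0\<close> and one factor q. In this way
  the factors 1 / F0 from the derivatives of the outer function are compensated without spending the
  operator norm twice.\<close>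

lemma F1_prod:
  assumes Y: "Y \<in> sad d" and A: "A \<in> sad d" and B: "B \<in> sad d" and m: "1 \<le> m"
    and q: "QQ d m Y A \<le> q" "QQ d m Y B \<le> q"
  shows "\<bar>F1 d m Y A\<bar> * \<bar>F1 d m Y B\<bar> \<le> (2 * real m)\<^sup>2 * (q * F0 d m Y)"
proof -
  have F: "0 \<le> F0 d m Y" using F0_ge[OF Y, of m] by linarith
  define x y where "x = norm (A * pw d Y m)" and "y = norm (B * pw d Y m)"
  have "\<bar>F1 d m Y A\<bar> * \<bar>F1 d m Y B\<bar>
      \<le> (2 * real m * (sqrt (F0 d m Y) * x)) * (2 * real m * (sqrt (F0 d m Y) * y))"
    unfolding x_def y_def by (intro mult_mono F1_bound assms) (auto simp: F)
  also have "\<dots> = (2 * real m)\<^sup>2 * ((x * y) * F0 d m Y)"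
    using F by (simp add: power2_eq_square)
  also have "\<dots> \<le> (2 * real m)\<^sup>2 * (q * F0 d m Y)"
  proof (intro mult_left_mono mult_right_mono)
    have "x\<^sup>2 \<le> q" "y\<^sup>2 \<le> q" using q by (auto simp: QQ_def x_def y_def intro: order_trans[rotated])
    then show "x * y \<le> q" using sqrt_mult_le[of x q y] by (simp add: x_def y_def)
  qed (use F in auto)
  finally show ?thesis .
qed

lemma F2_bound:
  assumes Y: "Y \<in> sad d" and A: "A \<in> sad d" and B: "B \<in> sad d"
    and q: "QQ d m Y A \<le> q" "QQ d m Y B \<le> q"
  shows "\<bar>F2 d m Y A B\<bar> \<le> (2 * real m)\<^sup>2 * q"
proof -
  have q0: "0 \<le> q" using q(1) QQ_nonneg order_trans by blast
  have "\<bar>\<Sum>k<2*m-1. tr d (A * pw d Y k * B * pw d Y (2 * m - 1 - 1 - k))\<bar> \<le> real (2 * m - 1) * q"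
    by (intro abs_sum_le_card word2[where m = m] assms) auto
  also have "\<dots> \<le> 2 * real m * q" using q0 by (intro mult_right_mono) auto
  finally show ?thesis
    unfolding F2_def abs_mult power2_eq_square mult.assoc by (intro mult_mono) auto
qed

text \<open>There are fewer than (2m)^2 words, each bounded by \<open>word3\<close>; the third
  factor 2m is the outer one.\<close>

lemma F3_bound:
  assumes Y: "Y \<in> sad d" and A: "A \<in> sad d" and B: "B \<in> sad d" and C: "C \<in> sad d"
    and R: "opb A R" "opb B R" "opb C R"
    and q: "QQ d m Y A \<le> q" "QQ d m Y B \<le> q" "QQ d m Y C \<le> q"
  shows "\<bar>F3 d m Y A B C\<bar> \<le> (2 * real m) ^ 3 * (R * q)"
proof -
  have q0: "0 \<le> q" using q(1) QQ_nonneg order_trans by blast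
  have R0: "0 \<le> R" using R by (simp add: opb_def)
  have "\<bar>\<Sum>k<2*m-1.
      (\<Sum>j<k. tr d (A * pw d Y j * C * pw d Y (k - 1 - j) * B * pw d Y (2 * m - 1 - 1 - k)))
    + (\<Sum>j<2*m-1-1-k. tr d (A * pw d Y k * B * pw d Y j * C * pw d Y (2 * m - 1 - 1 - k - 1 - j)))\<bar>
     \<le> real (2 * m - 1) * (2 * real m * (R * q))"
  proof (rule abs_sum_le_card)
    fix k assume k: "k < 2 * m - 1"
    have 1: "\<bar>\<Sum>j<k. tr d (A * pw d Y j * C * pw d Y (k - 1 - j) * B * pw d Y (2 * m - 1 - 1 - k))\<bar>
        \<le> real k * (R * q)"
      by (intro abs_sum_le_card word3[where m = m] assms) (use k in auto)
    have 2: "\<bar>\<Sum>j<2*m-1-1-k. tr d (A * pw d Y k * B * pw d Y j * C * pw d Y (2 * m - 1 - 1 - k - 1 - j))\<bar>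
        \<le> real (2 * m - 1 - 1 - k) * (R * q)"
      by (intro abs_sum_le_card word3[where m = m] assms) (use k in auto)
    have 3: "real k * (R * q) + real (2 * m - 1 - 1 - k) * (R * q) \<le> 2 * real m * (R * q)"
      unfolding distrib_right[symmetric]
      by (intro mult_right_mono) (use k q0 R0 in auto)
    show "\<bar>(\<Sum>j<k. tr d (A * pw d Y j * C * pw d Y (k - 1 - j) * B * pw d Y (2 * m - 1 - 1 - k)))
      + (\<Sum>j<2*m-1-1-k. tr d (A * pw d Y k * B * pw d Y j * C * pw d Y (2 * m - 1 - 1 - k - 1 - j)))\<bar>
      \<le> 2 * real m * (R * q)"
      by (rule order_trans[OF abs_triangle_ineq order_trans[OF add_mono[OF 1 2] 3]])
  qed
  also have "\<dots> \<le> 2 * real m * (2 * real m * (R * q))" using q0 R0 by (intro mult_right_mono) auto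
  finally show ?thesis
    unfolding F3_def abs_mult power3_eq_cube mult.assoc by (intro mult_mono) auto
qed

definition QD :: "nat \<Rightarrow> nat \<Rightarrow> fm \<Rightarrow> fm \<Rightarrow> fm \<Rightarrow> real" where
  "QD d m Y A Z = 2 * inner (A * pw d Y m) (A * (\<Sum>k<m. pw d Y k * Z * pw d Y (m - 1 - k)))"

lemma DERIV_QQ:
  assumes c: "(c has_vector_derivative H) (at u)" and bd: "\<And>u. bd (c u) d" and H: "bd H d"
  shows "((\<lambda>u. QQ d m (c u) A) has_real_derivative QD d m (c u) A H) (at u)"
proof -
  let ?S = "\<Sum>k<m. pw d (c u) k * H * pw d (c u) (m - 1 - k)"
  have D: "((\<lambda>u. A * pw d (c u) m) has_vector_derivative A * ?S) (at u)"
    by (intro has_vector_derivative_mult_const_left has_vector_derivative_pw[OF c bd H])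
  have "((\<lambda>u. inner (A * pw d (c u) m) (A * pw d (c u) m)) has_vector_derivative
      (inner (A * pw d (c u) m) (A * ?S) + inner (A * ?S) (A * pw d (c u) m))) (at u)"
    by (rule bounded_bilinear.has_vector_derivative[OF bounded_bilinear_inner D D])
  then have "((\<lambda>u. (norm (A * pw d (c u) m))\<^sup>2) has_real_derivative QD d m (c u) A H) (at u)"
    by (simp add: has_real_derivative_iff_has_vector_derivative QD_def power2_norm_eq_inner inner_commute)
  from DERIV_add[OF DERIV_const[of "(norm A)\<^sup>2"] this] show ?thesis
    by (simp add: QQ_def[abs_def])
qed

lemma QD_bound:
  assumes Y: "Y \<in> sad d" and A: "A \<in> sad d" and Z: "Z \<in> sad d" and R: "opb A R"
    and q: "QQ d m Y A \<le> q" "QQ d m Y Z \<le> q"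
  shows "\<bar>QD d m Y A Z\<bar> \<le> 2 * real m * R * q"
proof -
  have aA: "adj A = A" using A by (simp add: sad_def)
  have R0: "0 \<le> R" using R by (simp add: opb_def)
  have "\<bar>\<Sum>k<m. inner (A * pw d Y m) (A * (pw d Y k * Z * pw d Y (m - 1 - k)))\<bar> \<le> real m * (R * q)"
  proof (rule abs_sum_le_card)
    fix k assume k: "k < m"
    have "inner (A * pw d Y m) (A * (pw d Y k * Z * pw d Y (m - 1 - k)))
        = inner (A * (A * pw d Y m)) (pw d Y k * Z * pw d Y (m - 1 - k))"
      by (metis aA inner_times_left inner_commute)
    also have "\<bar>\<dots>\<bar> \<le> norm (A * (A * pw d Y m)) * norm (pw d Y k * Z * pw d Y (m - 1 - k))"
      by (rule Cauchy_Schwarz_ineq2)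
    also have "\<dots> \<le> (R * norm (A * pw d Y m)) * norm (pw d Y k * Z * pw d Y (m - 1 - k))"
      by (intro mult_right_mono opbD[OF R]) simp
    also have "\<dots> = R * (norm (A * pw d Y m) * norm (pw d Y k * Z * pw d Y (m - 1 - k)))"
      by simp
    also have "\<dots> \<le> R * q"
    proof (rule mult_left_mono)
      have "(norm (pw d Y k * Z * pw d Y (m - 1 - k)))\<^sup>2 \<le> q"
        by (rule order_trans[OF norm_word_le[OF Y Z] q(2)]) (use k in auto)
      moreover have "(norm (A * pw d Y m))\<^sup>2 \<le> q"
        using q(1) unfolding QQ_def by (rule order_trans[rotated]) simp
      ultimately show "norm (A * pw d Y m) * norm (pw d Y k * Z * pw d Y (m - 1 - k)) \<le> q"
        using sqrt_mult_le by fastforce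
    qed (rule R0)
    finally show "\<bar>inner (A * pw d Y m) (A * (pw d Y k * Z * pw d Y (m - 1 - k)))\<bar> \<le> R * q" .
  qed
  then show ?thesis
    by (simp only: QD_def abs_mult sum_distrib_left[of A] inner_sum_right)
qed

text \<open>The outer function applied to the trace functional. Each derivative is bounded by the
  function itself over the matching power of x, as for a power of x; this makes all later estimates
  relative to the functional. The constant 6 is that of the third derivative of 1 / x. The bound
  \<open>growth\<close> serves integrability.\<close>

locale psi_fun =
  fixes \<psi> \<psi>1 \<psi>2 \<psi>3 :: "real \<Rightarrow> real"
  assumes D0: "\<And>x. 0 < x \<Longrightarrow> (\<psi> has_real_derivative \<psi>1 x) (at x)"
    and D1: "\<And>x. 0 < x \<Longrightarrow> (\<psi>1 has_real_derivative \<psi>2 x) (at x)"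
    and D2: "\<And>x. 0 < x \<Longrightarrow> (\<psi>2 has_real_derivative \<psi>3 x) (at x)"
    and pos: "\<And>x. 0 < x \<Longrightarrow> 0 < \<psi> x"
    and B1: "\<And>x. 0 < x \<Longrightarrow> \<bar>\<psi>1 x\<bar> \<le> 6 * \<psi> x / x"
    and B2: "\<And>x. 0 < x \<Longrightarrow> \<bar>\<psi>2 x\<bar> \<le> 6 * \<psi> x / x ^ 2"
    and B3: "\<And>x. 0 < x \<Longrightarrow> \<bar>\<psi>3 x\<bar> \<le> 6 * \<psi> x / x ^ 3"
    and growth: "\<And>x. 1 \<le> x \<Longrightarrow> \<psi> x \<le> x"
    and M0 [measurable]: "\<psi> \<in> borel_measurable borel"
    and M1 [measurable]: "\<psi>1 \<in> borel_measurable borel"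
    and M2 [measurable]: "\<psi>2 \<in> borel_measurable borel"

lemma psi_fun_id: "psi_fun (\<lambda>x. x) (\<lambda>x. 1) (\<lambda>x. 0) (\<lambda>x. 0)"
  by unfold_locales (auto intro!: derivative_eq_intros)

lemma psi_fun_inverse: "psi_fun (\<lambda>x. 1 / x) (\<lambda>x. - 1 / x\<^sup>2) (\<lambda>x. 2 / x ^ 3) (\<lambda>x. - 6 / x ^ 4)"
proof
  fix x :: real assume x: "0 < x"
  show "((\<lambda>x. 1 / x) has_real_derivative - 1 / x\<^sup>2) (at x)"
    using x by (auto intro!: derivative_eq_intros simp: power2_eq_square)
  show "((\<lambda>x. - 1 / x\<^sup>2) has_real_derivative 2 / x ^ 3) (at x)"
    using x by (auto intro!: derivative_eq_intros simp: power2_eq_square power3_eq_cube field_simps)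
  show "((\<lambda>x. 2 / x ^ 3) has_real_derivative - 6 / x ^ 4) (at x)"
    using x by (auto intro!: derivative_eq_intros simp: field_simps eval_nat_numeral)
next
  fix x :: real assume "1 \<le> x"
  then show "1 / x \<le> x" by (simp add: field_simps) (metis mult_mono mult_1 order_trans zero_le_one)
qed (auto simp: power2_eq_square power3_eq_cube power4_eq_xxxx abs_if field_simps)

section \<open>Derivatives of the composed functional and the local energy\<close>

context psi_fun
begin

definition "f0 d m Y = \<psi> (F0 d m Y)"
definition "f1 d m Y A = \<psi>1 (F0 d m Y) * F1 d m Y A"
definition "f2 d m Y A B = \<psi>2 (F0 d m Y) * F1 d m Y A * F1 d m Y B + \<psi>1 (F0 d m Y) * F2 d m Y A B"
definition "f3 d m Y A B C = \<psi>3 (F0 d m Y) * F1 d m Y C * F1 d m Y A * F1 d m Y B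
   + \<psi>2 (F0 d m Y) * (F2 d m Y A C * F1 d m Y B + F1 d m Y A * F2 d m Y B C)
   + (\<psi>2 (F0 d m Y) * F1 d m Y C * F2 d m Y A B + \<psi>1 (F0 d m Y) * F3 d m Y A B C)"
text \<open>The local energy of the letter A at Y, the unit in which third-order remainders are
  measured. For A = idm d it is the functional \<open>f0\<close> itself, and summed in mean over the
  summands it is at most v times \<open>f0\<close>, see \<open>sum_g0\<close>.\<close>

definition "g0 d m Y A = \<psi> (F0 d m Y) / F0 d m Y * QQ d m Y A"

lemma F0_pos: "1 \<le> d \<Longrightarrow> Y \<in> sad d \<Longrightarrow> 0 < F0 d m Y"
  using F0_ge[of Y d m] by linarith

lemma f0_pos: "1 \<le> d \<Longrightarrow> Y \<in> sad d \<Longrightarrow> 0 < f0 d m Y"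
  by (simp add: f0_def pos F0_pos)

lemma g0_nonneg: "1 \<le> d \<Longrightarrow> Y \<in> sad d \<Longrightarrow> 0 \<le> g0 d m Y A"
  using pos[OF F0_pos[of d Y m]] F0_pos[of d Y m] by (simp add: g0_def)

lemma DERIV_f0:
  assumes c: "(c has_vector_derivative H) (at u)" and sad: "\<And>u. c u \<in> sad d" and H: "bd H d" and d: "1 \<le> d"
  shows "((\<lambda>u. f0 d m (c u)) has_real_derivative f1 d m (c u) H) (at u)"
  unfolding f0_def f1_def
  by (rule DERIV_chain2[OF D0[OF F0_pos[OF d sad]] DERIV_F0[OF c _ H]]) (use sad in \<open>auto simp: sad_def\<close>)

lemma DERIV_f1:
  assumes c: "(c has_vector_derivative H) (at u)" and sad: "\<And>u. c u \<in> sad d" and H: "bd H d" and d: "1 \<le> d"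
    and A: "(A has_vector_derivative A') (at u)"
  shows "((\<lambda>u. f1 d m (c u) (A u)) has_real_derivative f2 d m (c u) (A u) H + f1 d m (c u) A') (at u)"
proof -
  have bd: "\<And>u. bd (c u) d" using sad by (auto simp: sad_def)
  have "((\<lambda>u. \<psi>1 (F0 d m (c u))) has_real_derivative \<psi>2 (F0 d m (c u)) * F1 d m (c u) H) (at u)"
    by (rule DERIV_chain2[OF D1[OF F0_pos[OF d sad]] DERIV_F0[OF c bd H]])
  from DERIV_mult[OF this DERIV_F1[OF c bd H A]] show ?thesis
    by (simp add: f1_def f2_def algebra_simps)
qed

lemma DERIV_f2:
  assumes c: "(c has_vector_derivative H) (at u)" and sad: "\<And>u. c u \<in> sad d" and H: "bd H d" and d: "1 \<le> d"
  shows "((\<lambda>u. f2 d m (c u) A B) has_real_derivative f3 d m (c u) A B H) (at u)"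
proof -
  have bd: "\<And>u. bd (c u) d" using sad by (auto simp: sad_def)
  have 1: "((\<lambda>u. \<psi>1 (F0 d m (c u))) has_real_derivative \<psi>2 (F0 d m (c u)) * F1 d m (c u) H) (at u)"
    by (rule DERIV_chain2[OF D1[OF F0_pos[OF d sad]] DERIV_F0[OF c bd H]])
  have 2: "((\<lambda>u. \<psi>2 (F0 d m (c u))) has_real_derivative \<psi>3 (F0 d m (c u)) * F1 d m (c u) H) (at u)"
    by (rule DERIV_chain2[OF D2[OF F0_pos[OF d sad]] DERIV_F0[OF c bd H]])
  have F1c: "((\<lambda>u. F1 d m (c u) A) has_real_derivative F2 d m (c u) A H) (at u)" for A
  proof -
    have "F1 d m (c u) 0 = 0" by (simp add: F1_def tr_def)
    with DERIV_F1[OF c bd H has_vector_derivative_const[of A], of m] show ?thesis by simp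
  qed
  show ?thesis
    using DERIV_add[OF DERIV_mult[OF DERIV_mult[OF 2 F1c[of A]] F1c[of B]] DERIV_mult[OF 1 DERIV_F2[OF c bd H, of m A B]]]
    by (simp add: f2_def f3_def algebra_simps)
qed

text \<open>In each of the five terms the powers of \<open>F0\<close> cancel down to a single 1 /
  F0: a derivative of the outer function contributes powers of 1 / F0, and the first derivatives
  that accompany it give them back. One factor R and one factor q survive. The constant is 5 times
  the 6 of \<open>psi_fun\<close>.\<close>

lemma f3_bound:
  assumes d: "1 \<le> d" and m: "1 \<le> m" and Y: "Y \<in> sad d" and A: "A \<in> sad d" and B: "B \<in> sad d" and C: "C \<in> sad d"
    and R: "opb A R" "opb B R" "opb C R"
    and q: "QQ d m Y A \<le> q" "QQ d m Y B \<le> q" "QQ d m Y C \<le> q"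
  shows "\<bar>f3 d m Y A B C\<bar> \<le> 30 * ((2 * real m) ^ 3 * R) * (\<psi> (F0 d m Y) / F0 d m Y * q)"
proof -
  define F where "F = F0 d m Y"
  define N where "N = 2 * real m"
  define p where "p = \<psi> F"
  have F: "0 < F" using F0_pos[OF d Y] by (simp add: F_def)
  have p: "0 < p" using pos[OF F] by (simp add: p_def)
  have N: "0 < N" using m by (simp add: N_def)
  have R0: "0 \<le> R" using R by (simp add: opb_def)
  have q0: "0 \<le> q" using q(1) QQ_nonneg order_trans by blast
  have mul: "\<bar>x\<bar> * \<bar>y\<bar> \<le> a * b" if "\<bar>x\<bar> \<le> a" "\<bar>y\<bar> \<le> b" for x y a b :: real
    using that by (intro mult_mono) auto
  have e1: "6 * p / F ^ 3 * ((N * R * F) * (N\<^sup>2 * (q * F))) = 6 * (N ^ 3 * R) * (p / F * q)"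
    using F by (simp add: field_simps eval_nat_numeral)
  have e2: "6 * p / F ^ 2 * ((N * R * F) * (N\<^sup>2 * q)) = 6 * (N ^ 3 * R) * (p / F * q)"
    using F by (simp add: field_simps eval_nat_numeral)
  have e3: "6 * p / F * (N ^ 3 * (R * q)) = 6 * (N ^ 3 * R) * (p / F * q)"
    by simp
  let ?X = "6 * (N ^ 3 * R) * (p / F * q)"
  note F1R = F1_le_R[OF Y _ m, folded N_def F_def]
  note F2q = F2_bound[where m = m, OF Y, folded N_def]
  have 1: "\<bar>\<psi>3 F * F1 d m Y C * F1 d m Y A * F1 d m Y B\<bar> \<le> ?X"
  proof -
    have "\<bar>\<psi>3 F * F1 d m Y C * F1 d m Y A * F1 d m Y B\<bar>
        = \<bar>\<psi>3 F\<bar> * \<bar>\<bar>F1 d m Y C\<bar> * \<bar>\<bar>F1 d m Y A\<bar> * \<bar>F1 d m Y B\<bar>\<bar>\<bar>" by (simp add: abs_mult mult.assoc)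
    also have "\<dots> \<le> 6 * p / F ^ 3 * ((N * R * F) * (N\<^sup>2 * (q * F)))"
      unfolding p_def
      by (intro mul B3[OF F])
        (use F1R[OF C R(3)] F1_prod[OF Y A B m q(1,2), folded N_def F_def] in
          \<open>auto simp: abs_mult intro!: mult_mono\<close>)
    finally show ?thesis unfolding e1 .
  qed
  have 2: "\<bar>\<psi>2 F * (x * y)\<bar> \<le> ?X" if "\<bar>x\<bar> \<le> N * R * F" "\<bar>y\<bar> \<le> N\<^sup>2 * q" for x y
  proof -
    have "\<bar>\<psi>2 F * (x * y)\<bar> = \<bar>\<psi>2 F\<bar> * \<bar>\<bar>x\<bar> * \<bar>y\<bar>\<bar>" by (simp add: abs_mult)
    also have "\<dots> \<le> 6 * p / F ^ 2 * ((N * R * F) * (N\<^sup>2 * q))"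
      unfolding p_def by (intro mul B2[OF F]) (use that in \<open>auto simp: abs_mult intro!: mult_mono\<close>)
    finally show ?thesis unfolding e2 .
  qed
  have 3: "\<bar>\<psi>1 F * F3 d m Y A B C\<bar> \<le> ?X"
  proof -
    have "\<bar>\<psi>1 F\<bar> * \<bar>F3 d m Y A B C\<bar> \<le> 6 * p / F * (N ^ 3 * (R * q))"
      unfolding p_def by (rule mul[OF B1[OF F] F3_bound[OF Y A B C R q, folded N_def]])
    then show ?thesis unfolding e3 abs_mult .
  qed
  have split: "f3 d m Y A B C = \<psi>3 F * F1 d m Y C * F1 d m Y A * F1 d m Y B
     + \<psi>2 F * (F1 d m Y B * F2 d m Y A C) + \<psi>2 F * (F1 d m Y A * F2 d m Y B C)
     + \<psi>2 F * (F1 d m Y C * F2 d m Y A B) + \<psi>1 F * F3 d m Y A B C"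
    by (simp add: f3_def F_def algebra_simps)
  have "\<bar>f3 d m Y A B C\<bar> \<le> ?X + ?X + ?X + ?X + ?X"
    unfolding split
    by (intro order_trans[OF abs_triangle_ineq] add_mono 1 2 3 F1R F2q A B C R q)
  also have "\<dots> = 30 * (N ^ 3 * R) * (p / F * q)" by simp
  finally show ?thesis unfolding N_def p_def F_def .
qed

lemma DERIV_g0:
  assumes c: "(c has_vector_derivative H) (at u)" and sad: "\<And>u. c u \<in> sad d" and H: "bd H d" and d: "1 \<le> d"
  shows "((\<lambda>u. g0 d m (c u) A) has_real_derivative
    ((\<psi>1 (F0 d m (c u)) - \<psi> (F0 d m (c u)) / F0 d m (c u)) * (F1 d m (c u) H / F0 d m (c u)) * QQ d m (c u) A
      + \<psi> (F0 d m (c u)) / F0 d m (c u) * QD d m (c u) A H)) (at u)"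
proof -
  have bd: "\<And>u. bd (c u) d" using sad by (auto simp: sad_def)
  have F: "0 < F0 d m (c u)" by (rule F0_pos[OF d sad])
  have 1: "((\<lambda>u. \<psi> (F0 d m (c u))) has_real_derivative \<psi>1 (F0 d m (c u)) * F1 d m (c u) H) (at u)"
    by (rule DERIV_chain2[OF D0[OF F0_pos[OF d sad]] DERIV_F0[OF c bd H]])
  show ?thesis
    unfolding g0_def
    by (rule DERIV_cong[OF DERIV_mult[OF DERIV_divide[OF 1 DERIV_F0[OF c bd H]] DERIV_QQ[OF c bd H]]])
      (use F in \<open>simp_all add: field_simps\<close>)
qed

text \<open>The energy changes at a relative rate of order m R. The factor
  \<open>\<psi> (F0) / F0\<close> contributes 7, namely 6 from \<open>B1\<close> and 1 from the
  quotient rule, and the derivative of \<open>QQ\<close> contributes 1.\<close>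

lemma g0_deriv_bound:
  assumes d: "1 \<le> d" and m: "1 \<le> m" and Y: "Y \<in> sad d" and A: "A \<in> sad d" and Z: "Z \<in> sad d"
    and R: "opb A R" "opb Z R" and q: "QQ d m Y A \<le> q" "QQ d m Y Z \<le> q"
  shows "\<bar>(\<psi>1 (F0 d m Y) - \<psi> (F0 d m Y) / F0 d m Y) * (F1 d m Y Z / F0 d m Y) * QQ d m Y A
      + \<psi> (F0 d m Y) / F0 d m Y * QD d m Y A Z\<bar> \<le> 8 * (2 * real m * R) * (\<psi> (F0 d m Y) / F0 d m Y * q)"
proof -
  define F where "F = F0 d m Y"
  define N where "N = 2 * real m"
  have F: "0 < F" using F0_pos[OF d Y] by (simp add: F_def)
  have p: "0 < \<psi> F" using pos[OF F] .
  have R0: "0 \<le> R" using R by (simp add: opb_def)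
  have q0: "0 \<le> q" using q(1) QQ_nonneg order_trans by blast
  have 1: "\<bar>\<psi>1 F - \<psi> F / F\<bar> \<le> 7 * (\<psi> F / F)"
    using B1[OF F] p F by (auto simp: abs_le_iff)
  have "\<bar>F1 d m Y Z\<bar> \<le> N * R * F" using F1_le_R[OF Y Z m R(2)] by (simp add: N_def F_def)
  then have 2: "\<bar>F1 d m Y Z / F\<bar> \<le> N * R" using F by (simp add: pos_divide_le_eq)
  have "\<bar>(\<psi>1 F - \<psi> F / F) * (F1 d m Y Z / F) * QQ d m Y A\<bar> \<le> 7 * (\<psi> F / F) * (N * R) * q"
    unfolding abs_mult by (intro mult_mono 1 2) (use q F p q0 R0 in \<open>auto simp: N_def\<close>)
  moreover have "\<bar>\<psi> F / F * QD d m Y A Z\<bar> \<le> \<psi> F / F * (N * R * q)"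
    unfolding abs_mult using QD_bound[OF Y A Z R(1) q] F p
    by (intro mult_mono) (auto simp: N_def)
  ultimately have "\<bar>(\<psi>1 F - \<psi> F / F) * (F1 d m Y Z / F) * QQ d m Y A + \<psi> F / F * QD d m Y A Z\<bar>
      \<le> 7 * (\<psi> F / F) * (N * R) * q + \<psi> F / F * (N * R * q)"
    by (intro order_trans[OF abs_triangle_ineq] add_mono)
  also have "\<dots> = 8 * (N * R) * (\<psi> F / F * q)" by (simp add: algebra_simps)
  finally show ?thesis unfolding N_def F_def .
qed

text \<open>W is the base point without the summand Z, and Z' will be an independent copy of Z. The
  first derivative in direction Z is expanded to second order in a, the second derivative in
  direction Z' only to first order, so that both remainders are third derivatives. In expectation
  the two Hessians at W cancel. The second inequality permits to return from W to the point that
  contains Z.\<close>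

lemma
  assumes d: "1 \<le> d" and m: "1 \<le> m" and W: "W \<in> sad d" and Z: "Z \<in> sad d" and Z': "Z' \<in> sad d"
    and R: "opb Z R" "opb Z' R" and a: "0 \<le> a" "a \<le> 1" and small: "64 * (2 * real m * R) \<le> 1"
  defines "G \<equiv> g0 d m W Z + g0 d m W Z'"
  shows pathwise_f: "\<bar>f1 d m (W + a *\<^sub>R Z) Z - f1 d m W Z - a * f2 d m W Z Z
      - (a * f2 d m (W + a *\<^sub>R Z) Z' Z' - a * f2 d m W Z' Z')\<bar> \<le> a\<^sup>2 * (120 * ((2 * real m) ^ 3 * R) * G)"
    and pathwise_g: "g0 d m W Z' \<le> g0 d m (W + a *\<^sub>R Z) Z' + 16 * (2 * real m * R) * G"
proof -
  define Y where "Y u = W + u *\<^sub>R Z" for u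
  have Ysad: "Y u \<in> sad d" for u using W Z by (auto simp: Y_def intro: sad_add sad_scaleR)
  have YD: "(Y has_vector_derivative Z) (at u)" for u
    unfolding Y_def by (auto intro!: derivative_eq_intros)
  have bZ: "bd Z d" using Z by (simp add: sad_def)
  have R0: "0 \<le> R" using R by (simp add: opb_def)
  define c where "c = 2 * real m * R"
  have c0: "0 \<le> c" using R0 by (simp add: c_def)
  define q where "q u = QQ d m (Y u) Z + QQ d m (Y u) Z'" for u
  define ch where "ch u = \<psi> (F0 d m (Y u)) / F0 d m (Y u)" for u
  define g where "g u = g0 d m (Y u) Z + g0 d m (Y u) Z'" for u
  have ch0: "0 \<le> ch u" for u
    using pos[OF F0_pos[OF d Ysad[of u], of m]] F0_pos[OF d Ysad[of u], of m] by (simp add: ch_def)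
  have gq: "g u = ch u * q u" for u by (simp add: g_def ch_def q_def g0_def distrib_left)
  have g0: "0 \<le> g u" for u unfolding gq using ch0 by (simp add: q_def)
  have qZ: "QQ d m (Y u) Z \<le> q u" "QQ d m (Y u) Z' \<le> q u" for u by (auto simp: q_def)
  define gd where "gd A u = (\<psi>1 (F0 d m (Y u)) - \<psi> (F0 d m (Y u)) / F0 d m (Y u))
      * (F1 d m (Y u) Z / F0 d m (Y u)) * QQ d m (Y u) A
      + \<psi> (F0 d m (Y u)) / F0 d m (Y u) * QD d m (Y u) A Z" for A u
  have gD: "((\<lambda>u. g0 d m (Y u) A) has_real_derivative gd A u) (at u)" for A u
    unfolding gd_def by (rule DERIV_g0[OF YD Ysad bZ d])
  have gdb: "\<bar>gd A u\<bar> \<le> 8 * c * g u" if "A = Z \<or> A = Z'" for A u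
    unfolding gd_def c_def gq ch_def
    by (rule g0_deriv_bound[OF d m Ysad _ Z]) (use that Z Z' R qZ in auto)
  \<comment> \<open>Gronwall: each of the two energies has derivative at most 8 c times their sum.
    As \<open>small\<close> gives 16 c at most 1/4, the sum at most doubles along the
    segment.\<close>
  have gle: "g u \<le> 2 * g 0" if u: "0 \<le> u" "u \<le> 1" for u
  proof -
    have "exp (- (16 * c) * u) * g u \<le> exp (- (16 * c) * 0) * g 0"
    proof (rule DERIV_nonpos_imp_nonincreasing[OF u(1)])
      fix x assume "0 \<le> x" "x \<le> u"
      have "((\<lambda>u. exp (- (16 * c) * u) * g u) has_real_derivative
          exp (- (16 * c) * x) * (gd Z x + gd Z' x - 16 * c * g x)) (at x)"
        unfolding g_def
        by (rule derivative_eq_intros gD refl)+ (simp add: algebra_simps)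
      moreover have "exp (- (16 * c) * x) * (gd Z x + gd Z' x - 16 * c * g x) \<le> 0"
        using gdb[of Z x] gdb[of Z' x] by (intro mult_nonneg_nonpos) (auto simp: abs_le_iff)
      ultimately show "\<exists>y. ((\<lambda>u. exp (- (16 * c) * u) * g u) has_real_derivative y) (at x) \<and> y \<le> 0"
        by blast
    qed
    then have "g u \<le> exp (16 * c * u) * g 0"
      by (simp add: exp_minus field_simps)
    also have "\<dots> \<le> 2 * g 0"
    proof (rule mult_right_mono[OF _ g0])
      have "16 * c * u \<le> 1/4 * 1" using small u c0 by (intro mult_mono) (auto simp: c_def)
      then have "exp (16 * c * u) \<le> exp (1/4)" by simp
      also have "\<dots> \<le> 2" using exp_bound[of "1/4"] by (simp add: power2_eq_square)
      finally show "exp (16 * c * u) \<le> 2" .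
    qed
    finally show ?thesis .
  qed
  have Gg: "G = g 0" by (simp add: G_def g_def Y_def)
  \<comment> \<open>The factor 2 is the growth allowed by \<open>gle\<close>; the remainders of the
    two expansions together contribute 2 K, hence the constant 120.\<close>
  define K where "K = 30 * ((2 * real m) ^ 3 * R) * (2 * G)"
  have K0: "0 \<le> K" using R0 g0[of 0] by (simp add: K_def Gg)
  have f3K: "\<bar>f3 d m (Y u) A A Z\<bar> \<le> K" if "A = Z \<or> A = Z'" "0 \<le> u" "u \<le> 1" for A u
  proof -
    have "\<bar>f3 d m (Y u) A A Z\<bar> \<le> 30 * ((2 * real m) ^ 3 * R) * (ch u * q u)"
      unfolding ch_def by (rule f3_bound[OF d m Ysad _ _ Z]) (use that Z Z' R qZ in auto)
    also have "\<dots> \<le> K"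
      unfolding K_def gq[symmetric] Gg using gle[of u] that R0 by (intro mult_left_mono) auto
    finally show ?thesis .
  qed
  have D2': "\<bar>f2 d m (Y u) A A - f2 d m (Y 0) A A\<bar> \<le> u * K" if A: "A = Z \<or> A = Z'" and u: "0 \<le> u" "u \<le> 1" for A u
  proof (cases "u = 0")
    case False
    have "\<exists>z>0. z < u \<and> f2 d m (Y u) A A - f2 d m (Y 0) A A = (u - 0) * f3 d m (Y z) A A Z"
      by (rule MVT2) (use False u in \<open>auto intro!: DERIV_f2[OF YD Ysad bZ d]\<close>)
    then obtain z where z: "0 < z" "z < u" "f2 d m (Y u) A A - f2 d m (Y 0) A A = u * f3 d m (Y z) A A Z" by auto
    then show ?thesis using f3K[OF A, of z] u by (auto simp: abs_mult intro!: mult_left_mono)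
  qed simp
  have D1': "\<bar>f1 d m (Y a) Z - f1 d m (Y 0) Z - a * f2 d m (Y 0) Z Z\<bar> \<le> a * (a * K)"
  proof (cases "a = 0")
    case False
    have "\<exists>z>0. z < a \<and> f1 d m (Y a) Z - f1 d m (Y 0) Z = (a - 0) * f2 d m (Y z) Z Z"
    proof (rule MVT2)
      fix x
      have "f1 d m (Y x) 0 = 0" by (simp add: f1_def F1_def tr_def)
      then show "((\<lambda>x. f1 d m (Y x) Z) has_real_derivative f2 d m (Y x) Z Z) (at x)"
        using DERIV_f1[OF YD[of x] Ysad bZ d has_vector_derivative_const[of Z], of m] by simp
    qed (use False a in auto)
    then obtain z where z: "0 < z" "z < a" "f1 d m (Y a) Z - f1 d m (Y 0) Z = a * f2 d m (Y z) Z Z" by auto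
    have "f1 d m (Y a) Z - f1 d m (Y 0) Z - a * f2 d m (Y 0) Z Z = a * (f2 d m (Y z) Z Z - f2 d m (Y 0) Z Z)"
      using z by (simp add: algebra_simps)
    moreover have "\<bar>f2 d m (Y z) Z Z - f2 d m (Y 0) Z Z\<bar> \<le> z * K" using D2'[of Z z] z a by auto
    moreover have "z * K \<le> a * K" using z K0 by (intro mult_right_mono) auto
    ultimately show ?thesis using a by (auto simp: abs_mult intro!: mult_left_mono)
  qed simp
  have "\<bar>a * f2 d m (Y a) Z' Z' - a * f2 d m (Y 0) Z' Z'\<bar> \<le> a * (a * K)"
    using D2'[of Z' a] a by (auto simp: abs_mult right_diff_distrib[symmetric] intro!: mult_left_mono)
  with D1' have "\<bar>f1 d m (Y a) Z - f1 d m (Y 0) Z - a * f2 d m (Y 0) Z Z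
      - (a * f2 d m (Y a) Z' Z' - a * f2 d m (Y 0) Z' Z')\<bar> \<le> a * (a * K) + a * (a * K)"
    by (rule order_trans[OF abs_triangle_ineq4 add_mono])
  also have "\<dots> = a\<^sup>2 * (120 * ((2 * real m) ^ 3 * R) * G)"
    by (simp add: K_def power2_eq_square)
  finally show "\<bar>f1 d m (W + a *\<^sub>R Z) Z - f1 d m W Z - a * f2 d m W Z Z
      - (a * f2 d m (W + a *\<^sub>R Z) Z' Z' - a * f2 d m W Z' Z')\<bar> \<le> a\<^sup>2 * (120 * ((2 * real m) ^ 3 * R) * G)"
    by (simp add: Y_def)
  have "g0 d m (Y 0) Z' \<le> g0 d m (Y a) Z' + 16 * c * G"
  proof (cases "a = 0")
    case True
    then show ?thesis using c0 g0[of 0] by (simp add: Gg)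
  next
    case False
    have "\<exists>z>0. z < a \<and> g0 d m (Y a) Z' - g0 d m (Y 0) Z' = (a - 0) * gd Z' z"
      by (rule MVT2) (use False a gD in auto)
    then obtain z where z: "0 < z" "z < a" "g0 d m (Y a) Z' - g0 d m (Y 0) Z' = a * gd Z' z" by auto
    have "\<bar>a * gd Z' z\<bar> \<le> 1 * (8 * c * g z)"
      unfolding abs_mult using gdb[of Z' z] a by (intro mult_mono) auto
    also have "\<dots> \<le> 8 * c * (2 * G)"
      unfolding Gg mult_1 using gle[of z] z a c0 by (intro mult_left_mono) auto
    finally show ?thesis using z by (simp add: abs_le_iff)
  qed
  then show "g0 d m W Z' \<le> g0 d m (W + a *\<^sub>R Z) Z' + 16 * (2 * real m * R) * G"
    by (simp add: Y_def c_def)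
qed

end

section \<open>Uniqueness of characteristic functions\<close>

lemma integral_iexp_bounded:
  fixes w :: "'a \<Rightarrow> complex"
  assumes "prob_space M" and [measurable]: "w \<in> borel_measurable M" "Y \<in> borel_measurable M"
    and "\<And>\<omega>. \<omega> \<in> space M \<Longrightarrow> cmod (w \<omega>) \<le> B"
  shows "integrable M (\<lambda>\<omega>. w \<omega> * iexp (t * Y \<omega>))"
proof -
  interpret prob_space M by fact
  show ?thesis
    by (rule integrable_const_bound[where B = B]) (use assms in \<open>auto simp: norm_mult intro!: AE_I2\<close>)
qed

lemma borel_measurable_cnj [measurable]: "cnj \<in> borel_measurable borel"
  by (intro borel_measurable_continuous_onI continuous_intros)

text \<open>A weight bounded away from 0 can be normalised to a probability density, and Levy's
  uniqueness theorem applies to the law of Y under it.\<close>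

lemma weighted_char_unique_real:
  fixes w1 Y1 :: "'a \<Rightarrow> real" and w2 Y2 :: "'b \<Rightarrow> real"
  assumes p1: "prob_space M1" and p2: "prob_space M2"
    and m1[measurable]: "w1 \<in> borel_measurable M1" "Y1 \<in> borel_measurable M1"
    and m2[measurable]: "w2 \<in> borel_measurable M2" "Y2 \<in> borel_measurable M2"
    and b1: "\<And>\<omega>. \<omega> \<in> space M1 \<Longrightarrow> 1 \<le> w1 \<omega> \<and> w1 \<omega> \<le> 3"
    and b2: "\<And>\<omega>. \<omega> \<in> space M2 \<Longrightarrow> 1 \<le> w2 \<omega> \<and> w2 \<omega> \<le> 3"
    and eq: "\<And>t. (CLINT \<omega>|M1. w1 \<omega> * iexp (t * Y1 \<omega>)) = (CLINT \<omega>|M2. w2 \<omega> * iexp (t * Y2 \<omega>))"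
    and B: "B \<in> sets borel"
  shows "(LINT \<omega>|M1. w1 \<omega> * indicator B (Y1 \<omega>)) = (LINT \<omega>|M2. w2 \<omega> * indicator B (Y2 \<omega>))"
proof -
  define c where "c = (LINT \<omega>|M1. w1 \<omega>)"
  have *: "real_distribution (distr (density M (\<lambda>\<omega>. ennreal (w \<omega> / (LINT \<omega>|M. w \<omega>)))) borel Y)
     \<and> char (distr (density M (\<lambda>\<omega>. ennreal (w \<omega> / (LINT \<omega>|M. w \<omega>)))) borel Y) t
        = (CLINT \<omega>|M. w \<omega> * iexp (t * Y \<omega>)) / (LINT \<omega>|M. w \<omega>)
     \<and> measure (distr (density M (\<lambda>\<omega>. ennreal (w \<omega> / (LINT \<omega>|M. w \<omega>)))) borel Y) B
        = (LINT \<omega>|M. w \<omega> * indicator B (Y \<omega>)) / (LINT \<omega>|M. w \<omega>)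
     \<and> 1 \<le> (LINT \<omega>|M. w \<omega>)"
    if "prob_space M" and [measurable]: "w \<in> borel_measurable M" "Y \<in> borel_measurable M"
      and b: "\<And>\<omega>. \<omega> \<in> space M \<Longrightarrow> 1 \<le> w \<omega> \<and> w \<omega> \<le> 3"
    for M :: "'c measure" and w Y t
  proof -
    interpret M: prob_space M by fact
    define c where "c = (LINT \<omega>|M. w \<omega>)"
    have intw: "integrable M w"
      by (rule M.integrable_const_bound[where B = 3]) (use b in \<open>force intro!: AE_I2\<close>)+
    have c1: "1 \<le> c"
      unfolding c_def using M.integral_ge_const[OF intw, of 1] b by (auto intro: AE_I2)
    have nn: "AE \<omega> in M. 0 \<le> w \<omega> / c" using b c1 by (intro AE_I2) (force intro!: divide_nonneg_nonneg)
    have "emeasure (density M (\<lambda>\<omega>. ennreal (w \<omega> / c))) (space M) = (\<integral>\<^sup>+\<omega>. ennreal (w \<omega> / c) \<partial>M)"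
      by (subst emeasure_density) (auto intro!: nn_integral_cong simp: indicator_def)
    also have "\<dots> = ennreal (LINT \<omega>|M. w \<omega> / c)"
      by (rule nn_integral_eq_integral) (use intw nn in auto)
    also have "\<dots> = 1" using c1 by (simp add: c_def[symmetric])
    finally have pD: "prob_space (density M (\<lambda>\<omega>. ennreal (w \<omega> / c)))"
      by (intro prob_spaceI) simp
    have rd: "real_distribution (distr (density M (\<lambda>\<omega>. ennreal (w \<omega> / c))) borel Y)"
      using prob_space.prob_space_distr[OF pD, of Y borel]
      by (auto simp: real_distribution_def real_distribution_axioms_def)
    have ch: "char (distr (density M (\<lambda>\<omega>. ennreal (w \<omega> / c))) borel Y) t
        = (CLINT \<omega>|M. w \<omega> * iexp (t * Y \<omega>)) / c"
    proof -
      have "char (distr (density M (\<lambda>\<omega>. ennreal (w \<omega> / c))) borel Y) t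
          = (CLINT \<omega>|density M (\<lambda>\<omega>. ennreal (w \<omega> / c)). iexp (t * Y \<omega>))"
        unfolding char_def by (subst integral_distr) auto
      also have "\<dots> = (CLINT \<omega>|M. (w \<omega> / c) *\<^sub>R iexp (t * Y \<omega>))"
        by (rule integral_density) (use nn in auto)
      also have "\<dots> = (CLINT \<omega>|M. (w \<omega> * iexp (t * Y \<omega>)) / c)"
        by (simp add: scaleR_conv_of_real)
      finally show ?thesis by simp
    qed
    have ms: "measure (distr (density M (\<lambda>\<omega>. ennreal (w \<omega> / c))) borel Y) B
        = (LINT \<omega>|M. w \<omega> * indicator B (Y \<omega>)) / c"
    proof -
      interpret D: real_distribution "distr (density M (\<lambda>\<omega>. ennreal (w \<omega> / c))) borel Y" by (rule rd)
      have "measure (distr (density M (\<lambda>\<omega>. ennreal (w \<omega> / c))) borel Y) B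
          = (LINT x|distr (density M (\<lambda>\<omega>. ennreal (w \<omega> / c))) borel Y. indicator B x)"
        using B by simp
      also have "\<dots> = (LINT \<omega>|density M (\<lambda>\<omega>. ennreal (w \<omega> / c)). indicator B (Y \<omega>))"
        using B by (subst integral_distr) auto
      also have "\<dots> = (LINT \<omega>|M. (w \<omega> / c) *\<^sub>R indicator B (Y \<omega>))"
        by (rule integral_density) (use nn B in auto)
      finally show ?thesis by simp
    qed
    show ?thesis using rd ch ms c1 by (simp add: c_def)
  qed
  note A1 = *[OF p1 m1 b1] and A2 = *[OF p2 m2 b2]
  \<comment> \<open>At t = 0 the hypothesis says that both weights have the same total mass, so the
    normalisations agree.\<close>
  have cc: "(LINT \<omega>|M1. w1 \<omega>) = (LINT \<omega>|M2. w2 \<omega>)"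
  proof -
    have "complex_of_real (LINT \<omega>|M1. w1 \<omega>) = complex_of_real (LINT \<omega>|M2. w2 \<omega>)"
      using eq[of 0] by (simp flip: integral_complex_of_real)
    then show ?thesis by simp
  qed
  have "distr (density M1 (\<lambda>\<omega>. ennreal (w1 \<omega> / (LINT \<omega>|M1. w1 \<omega>)))) borel Y1
      = distr (density M2 (\<lambda>\<omega>. ennreal (w2 \<omega> / (LINT \<omega>|M2. w2 \<omega>)))) borel Y2"
    by (rule Levy_uniqueness) (use A1 A2 eq cc in \<open>auto intro!: ext\<close>)
  then have "(LINT \<omega>|M1. w1 \<omega> * indicator B (Y1 \<omega>)) / (LINT \<omega>|M1. w1 \<omega>)
      = (LINT \<omega>|M2. w2 \<omega> * indicator B (Y2 \<omega>)) / (LINT \<omega>|M2. w2 \<omega>)"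
    using A1 A2 by metis
  then show ?thesis using A1 cc by auto
qed

lemma integral_cnj_iexp:
  "(CLINT \<omega>|M. cnj (W \<omega>) * iexp (t * Y \<omega>)) = cnj (CLINT \<omega>|M. W \<omega> * iexp ((-t) * Y \<omega>))"
  unfolding Bochner_Integration.integral_cnj[symmetric]
  by (intro Bochner_Integration.integral_cong) (simp_all add: exp_cnj)

lemma of_real_Re_mult: "complex_of_real (2 + Re z) * x = 2 * x + (z * x + cnj z * x) / 2"
  by (rule complex_eqI) (simp_all add: algebra_simps)

lemma of_real_Im_mult: "complex_of_real (2 + Im z) * x = 2 * x + (\<i> / 2) * (cnj z * x - z * x)"
  by (rule complex_eqI) (simp_all add: field_simps)

text \<open>For a complex weight W of modulus at most 1, both \<open>2 + Re W\<close> and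
  \<open>2 + Im W\<close> lie between 1 and 3, so the real case applies to them. The constant 2 is
  subtracted again by means of the unweighted identity.\<close>

lemma weighted_char_unique:
  fixes W1 :: "'a \<Rightarrow> complex" and W2 :: "'b \<Rightarrow> complex"
  assumes p1: "prob_space M1" and p2: "prob_space M2"
    and m1[measurable]: "W1 \<in> borel_measurable M1" "Y1 \<in> borel_measurable M1"
    and m2[measurable]: "W2 \<in> borel_measurable M2" "Y2 \<in> borel_measurable M2"
    and b1: "\<And>\<omega>. \<omega> \<in> space M1 \<Longrightarrow> cmod (W1 \<omega>) \<le> 1"
    and b2: "\<And>\<omega>. \<omega> \<in> space M2 \<Longrightarrow> cmod (W2 \<omega>) \<le> 1"
    and eq0: "\<And>t. (CLINT \<omega>|M1. iexp (t * Y1 \<omega>)) = (CLINT \<omega>|M2. iexp (t * Y2 \<omega>))"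
    and eq: "\<And>t. (CLINT \<omega>|M1. W1 \<omega> * iexp (t * Y1 \<omega>)) = (CLINT \<omega>|M2. W2 \<omega> * iexp (t * Y2 \<omega>))"
    and B: "B \<in> sets borel"
  shows "(CLINT \<omega>|M1. W1 \<omega> * indicator B (Y1 \<omega>)) = (CLINT \<omega>|M2. W2 \<omega> * indicator B (Y2 \<omega>))"
proof -
  interpret M1: prob_space M1 by fact
  interpret M2: prob_space M2 by fact
  note i1 = integral_iexp_bounded[OF p1 m1 b1] and i2 = integral_iexp_bounded[OF p2 m2 b2]
  have j1: "integrable M1 (\<lambda>\<omega>. cnj (W1 \<omega>) * iexp (t * Y1 \<omega>))" for t
    by (rule integral_iexp_bounded[OF p1 _ m1(2)]) (use b1 in auto)
  have j2: "integrable M2 (\<lambda>\<omega>. cnj (W2 \<omega>) * iexp (t * Y2 \<omega>))" for t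
    by (rule integral_iexp_bounded[OF p2 _ m2(2)]) (use b2 in auto)
  have k1: "integrable M1 (\<lambda>\<omega>. iexp (t * Y1 \<omega>))" for t
    using integral_iexp_bounded[OF p1, of "\<lambda>_. 1" Y1 1 t] by simp
  have k2: "integrable M2 (\<lambda>\<omega>. iexp (t * Y2 \<omega>))" for t
    using integral_iexp_bounded[OF p2, of "\<lambda>_. 1" Y2 1 t] by simp
  \<comment> \<open>Conjugation changes the sign of t, and the hypothesis holds for every t; so the
    conjugate weights satisfy it too, and with them the real and imaginary parts.\<close>
  have conj: "(CLINT \<omega>|M1. cnj (W1 \<omega>) * iexp (t * Y1 \<omega>)) = (CLINT \<omega>|M2. cnj (W2 \<omega>) * iexp (t * Y2 \<omega>))" for t
    using arg_cong[where f = cnj, OF eq[of "- t"]]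
    unfolding integral_cnj_iexp[of M1 W1 t Y1, symmetric] integral_cnj_iexp[of M2 W2 t Y2, symmetric] .
  have Re: "(LINT \<omega>|M1. (2 + Re (W1 \<omega>)) * indicator B (Y1 \<omega>)) = (LINT \<omega>|M2. (2 + Re (W2 \<omega>)) * indicator B (Y2 \<omega>))"
  proof (rule weighted_char_unique_real[OF p1 p2 _ _ _ _ _ _ _ B])
    show "1 \<le> 2 + Re (W1 \<omega>) \<and> 2 + Re (W1 \<omega>) \<le> 3" if "\<omega> \<in> space M1" for \<omega>
      using b1[OF that] abs_Re_le_cmod[of "W1 \<omega>"] by linarith
    show "1 \<le> 2 + Re (W2 \<omega>) \<and> 2 + Re (W2 \<omega>) \<le> 3" if "\<omega> \<in> space M2" for \<omega>
      using b2[OF that] abs_Re_le_cmod[of "W2 \<omega>"] by linarith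
    fix t
    show "(CLINT \<omega>|M1. complex_of_real (2 + Re (W1 \<omega>)) * iexp (t * Y1 \<omega>))
        = (CLINT \<omega>|M2. complex_of_real (2 + Re (W2 \<omega>)) * iexp (t * Y2 \<omega>))"
      unfolding of_real_Re_mult using i1[of t] i2[of t] j1[of t] j2[of t] k1[of t] k2[of t] eq[of t] conj[of t] eq0[of t]
      by simp
  qed auto
  have Im: "(LINT \<omega>|M1. (2 + Im (W1 \<omega>)) * indicator B (Y1 \<omega>)) = (LINT \<omega>|M2. (2 + Im (W2 \<omega>)) * indicator B (Y2 \<omega>))"
  proof (rule weighted_char_unique_real[OF p1 p2 _ _ _ _ _ _ _ B])
    show "1 \<le> 2 + Im (W1 \<omega>) \<and> 2 + Im (W1 \<omega>) \<le> 3" if "\<omega> \<in> space M1" for \<omega>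
      using b1[OF that] abs_Im_le_cmod[of "W1 \<omega>"] by linarith
    show "1 \<le> 2 + Im (W2 \<omega>) \<and> 2 + Im (W2 \<omega>) \<le> 3" if "\<omega> \<in> space M2" for \<omega>
      using b2[OF that] abs_Im_le_cmod[of "W2 \<omega>"] by linarith
    fix t
    show "(CLINT \<omega>|M1. complex_of_real (2 + Im (W1 \<omega>)) * iexp (t * Y1 \<omega>))
        = (CLINT \<omega>|M2. complex_of_real (2 + Im (W2 \<omega>)) * iexp (t * Y2 \<omega>))"
      unfolding of_real_Im_mult using i1[of t] i2[of t] j1[of t] j2[of t] k1[of t] k2[of t] eq[of t] conj[of t] eq0[of t]
      by simp
  qed auto
  have One: "(LINT \<omega>|M1. (1::real) * indicator B (Y1 \<omega>)) = (LINT \<omega>|M2. 1 * indicator B (Y2 \<omega>))"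
    by (rule weighted_char_unique_real[OF p1 p2 _ _ _ _ _ _ _ B]) (use eq0 in auto)
  have bi1: "integrable M1 (\<lambda>\<omega>. h (W1 \<omega>) * indicator B (Y1 \<omega>))"
    if "h = Re \<or> h = Im" for h :: "complex \<Rightarrow> real"
    by (rule M1.integrable_const_bound[where B = 1])
      (use that B b1 in \<open>auto intro!: AE_I2 simp: indicator_def intro: order_trans[OF abs_Re_le_cmod] order_trans[OF abs_Im_le_cmod]\<close>)
  have bi2: "integrable M2 (\<lambda>\<omega>. h (W2 \<omega>) * indicator B (Y2 \<omega>))"
    if "h = Re \<or> h = Im" for h :: "complex \<Rightarrow> real"
    by (rule M2.integrable_const_bound[where B = 1])
      (use that B b2 in \<open>auto intro!: AE_I2 simp: indicator_def intro: order_trans[OF abs_Re_le_cmod] order_trans[OF abs_Im_le_cmod]\<close>)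
  have ind1: "integrable M1 (\<lambda>\<omega>. indicator B (Y1 \<omega>) :: real)"
    by (rule M1.integrable_const_bound[where B = 1]) (use B in \<open>auto simp: indicator_def\<close>)
  have ind2: "integrable M2 (\<lambda>\<omega>. indicator B (Y2 \<omega>) :: real)"
    by (rule M2.integrable_const_bound[where B = 1]) (use B in \<open>auto simp: indicator_def\<close>)
  have R: "(LINT \<omega>|M1. Re (W1 \<omega>) * indicator B (Y1 \<omega>)) = (LINT \<omega>|M2. Re (W2 \<omega>) * indicator B (Y2 \<omega>))"
    using Re One bi1[of Re] bi2[of Re] ind1 ind2 by (simp add: distrib_right)
  have I: "(LINT \<omega>|M1. Im (W1 \<omega>) * indicator B (Y1 \<omega>)) = (LINT \<omega>|M2. Im (W2 \<omega>) * indicator B (Y2 \<omega>))"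
    using Im One bi1[of Im] bi2[of Im] ind1 ind2 by (simp add: distrib_right)
  have c1: "integrable M1 (\<lambda>\<omega>. W1 \<omega> * indicator B (Y1 \<omega>))"
    by (rule M1.integrable_const_bound[where B = 1]) (use B b1 in \<open>auto intro!: AE_I2 simp: indicator_def\<close>)
  have c2: "integrable M2 (\<lambda>\<omega>. W2 \<omega> * indicator B (Y2 \<omega>))"
    by (rule M2.integrable_const_bound[where B = 1]) (use B b2 in \<open>auto intro!: AE_I2 simp: indicator_def\<close>)
  have Re_ind: "Re (z * indicator B y) = Re z * indicator B y" "Im (z * indicator B y) = Im z * indicator B y"
    for z y by (auto simp: indicator_def)
  show ?thesis
    unfolding complex_eq_iff integral_Re[OF c1, symmetric] integral_Re[OF c2, symmetric]
      integral_Im[OF c1, symmetric] integral_Im[OF c2, symmetric] Re_ind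
    using R I by simp
qed

text \<open>Instead of inverting the multivariate Fourier transform, the coordinates are treated one at
  a time: the coordinates already dealt with enter as indicator weights, the remaining ones
  as exponential weights.\<close>

lemma cramer_wold:
  fixes V1 :: "'i \<Rightarrow> 'a \<Rightarrow> real" and V2 :: "'i \<Rightarrow> 'b \<Rightarrow> real"
  assumes p1: "prob_space M1" and p2: "prob_space M2" and I: "finite I"
    and m1[measurable]: "\<And>i. i \<in> I \<Longrightarrow> V1 i \<in> borel_measurable M1"
    and m2[measurable]: "\<And>i. i \<in> I \<Longrightarrow> V2 i \<in> borel_measurable M2"
    and eq: "\<And>\<theta>. (CLINT \<omega>|M1. iexp (\<Sum>i\<in>I. \<theta> i * V1 i \<omega>)) = (CLINT \<omega>|M2. iexp (\<Sum>i\<in>I. \<theta> i * V2 i \<omega>))"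
  shows "distr M1 (PiM I (\<lambda>_. borel)) (\<lambda>\<omega>. \<lambda>i\<in>I. V1 i \<omega>) = distr M2 (PiM I (\<lambda>_. borel)) (\<lambda>\<omega>. \<lambda>i\<in>I. V2 i \<omega>)"
proof -
  interpret M1: prob_space M1 by fact
  interpret M2: prob_space M2 by fact
  have key: "(CLINT \<omega>|M1. (\<Prod>j\<in>J. indicator (B j) (V1 j \<omega>)) * iexp (\<Sum>i\<in>I-J. \<theta> i * V1 i \<omega>))
      = (CLINT \<omega>|M2. (\<Prod>j\<in>J. indicator (B j) (V2 j \<omega>)) * iexp (\<Sum>i\<in>I-J. \<theta> i * V2 i \<omega>))"
    if "finite J" "J \<subseteq> I" "\<And>j. j \<in> I \<Longrightarrow> B j \<in> sets borel" for J B \<theta>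
    using that
  proof (induction J arbitrary: \<theta> rule: finite_induct)
    case empty
    then show ?case using eq by simp
  next
    case (insert k J)
    then have k: "k \<in> I" "k \<notin> J" and J: "J \<subseteq> I" "finite J" and B[measurable]: "\<And>j. j \<in> I \<Longrightarrow> B j \<in> sets borel" by auto
    have split: "(\<Sum>i\<in>I-J. \<theta> i * v i) = \<theta> k * v k + (\<Sum>i\<in>I-insert k J. \<theta> i * v i)" for \<theta> v :: "'i \<Rightarrow> real"
    proof -
      have "I - J - {k} = I - insert k J" by blast
      then show ?thesis
        using sum.remove[of "I - J" k "\<lambda>i. \<theta> i * v i"] I k by simp
    qed
    define W1 where "W1 \<omega> = (\<Prod>j\<in>J. indicator (B j) (V1 j \<omega>)) * iexp (\<Sum>i\<in>I-insert k J. \<theta> i * V1 i \<omega>)" for \<omega>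
    define W2 where "W2 \<omega> = (\<Prod>j\<in>J. indicator (B j) (V2 j \<omega>)) * iexp (\<Sum>i\<in>I-insert k J. \<theta> i * V2 i \<omega>)" for \<omega>
    have pb: "cmod (\<Prod>j\<in>J. indicator (B j) (v j)) \<le> 1" for v
      unfolding prod_norm[symmetric] by (rule prod_le_1) (auto simp: indicator_def)
    have "(CLINT \<omega>|M1. W1 \<omega> * indicator (B k) (V1 k \<omega>)) = (CLINT \<omega>|M2. W2 \<omega> * indicator (B k) (V2 k \<omega>))"
    proof (rule weighted_char_unique[OF p1 p2])
      have i1: "(\<lambda>\<omega>. indicator (B j) (V1 j \<omega>) :: complex) \<in> borel_measurable M1" if "j \<in> J" for j
        using that J m1 B by (intro measurable_compose[OF m1 borel_measurable_indicator]) auto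
      have i2: "(\<lambda>\<omega>. indicator (B j) (V2 j \<omega>) :: complex) \<in> borel_measurable M2" if "j \<in> J" for j
        using that J m2 B by (intro measurable_compose[OF m2 borel_measurable_indicator]) auto
      show "W1 \<in> borel_measurable M1"
        unfolding W1_def
        by (intro borel_measurable_times borel_measurable_prod i1 measurable_compose[OF _ borel_measurable_exp]
          borel_measurable_const measurable_compose[OF _ borel_measurable_of_real] borel_measurable_sum m1) auto
      show "W2 \<in> borel_measurable M2"
        unfolding W2_def
        by (intro borel_measurable_times borel_measurable_prod i2 measurable_compose[OF _ borel_measurable_exp]
          borel_measurable_const measurable_compose[OF _ borel_measurable_of_real] borel_measurable_sum m2) auto
      show "V1 k \<in> borel_measurable M1" "V2 k \<in> borel_measurable M2" "B k \<in> sets borel" using k by auto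
      show "cmod (W1 \<omega>) \<le> 1" for \<omega> unfolding W1_def norm_mult using pb by simp
      show "cmod (W2 \<omega>) \<le> 1" for \<omega> unfolding W2_def norm_mult using pb by simp
      fix t
      have s: "(\<Sum>i\<in>I. (if i = k then t else 0) * v i) = t * v k" for v :: "'i \<Rightarrow> real"
        using I k by (subst sum.remove[OF I k(1)]) (auto intro!: sum.neutral)
      show "(CLINT \<omega>|M1. iexp (t * V1 k \<omega>)) = (CLINT \<omega>|M2. iexp (t * V2 k \<omega>))"
        using eq[of "\<lambda>i. if i = k then t else 0"] by (simp only: s)
      have s': "(\<Sum>i\<in>I-J. (\<theta>(k := t)) i * v i) = t * v k + (\<Sum>i\<in>I-insert k J. \<theta> i * v i)" for v
        unfolding split by (intro arg_cong2[where f = "(+)"] sum.cong) auto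
      show "(CLINT \<omega>|M1. W1 \<omega> * iexp (t * V1 k \<omega>)) = (CLINT \<omega>|M2. W2 \<omega> * iexp (t * V2 k \<omega>))"
        using insert.IH[OF J(1), of "\<theta>(k := t)"] B unfolding s' W1_def W2_def
        by (simp add: exp_add distrib_left mult_ac)
    qed
    then show ?case unfolding W1_def W2_def using k J by (simp add: mult_ac)
  qed
  \<comment> \<open>When all coordinates are dealt with, no exponential weight is left: the two laws
    agree on rectangles, which generate the product \<sigma>-algebra.\<close>
  have fin: "emeasure M1 {\<omega>\<in>space M1. \<forall>i\<in>I. V1 i \<omega> \<in> B i} = emeasure M2 {\<omega>\<in>space M2. \<forall>i\<in>I. V2 i \<omega> \<in> B i}"
    if B[measurable]: "\<And>j. j \<in> I \<Longrightarrow> B j \<in> sets borel" for B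
  proof -
    have ind: "(\<Prod>j\<in>I. indicator (B j) (v j)) = complex_of_real (indicator {v. \<forall>i\<in>I. v i \<in> B i} v)" for v
      using I by (induction rule: finite_induct) (auto simp: indicator_def)
    have S1[measurable]: "{\<omega>\<in>space M1. \<forall>i\<in>I. V1 i \<omega> \<in> B i} \<in> sets M1"
      using I by (intro sets.sets_Collect_finite_All measurable_sets_Collect[OF m1]) (auto simp: B)
    have S2[measurable]: "{\<omega>\<in>space M2. \<forall>i\<in>I. V2 i \<omega> \<in> B i} \<in> sets M2"
      using I by (intro sets.sets_Collect_finite_All measurable_sets_Collect[OF m2]) (auto simp: B)
    have "complex_of_real (measure M1 {\<omega>\<in>space M1. \<forall>i\<in>I. V1 i \<omega> \<in> B i})
        = complex_of_real (LINT \<omega>|M1. indicator {\<omega>\<in>space M1. \<forall>i\<in>I. V1 i \<omega> \<in> B i} \<omega>)"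
      by simp
    also have "\<dots> = (CLINT \<omega>|M1. \<Prod>j\<in>I. indicator (B j) (V1 j \<omega>))"
      unfolding ind integral_complex_of_real[symmetric] by (intro Bochner_Integration.integral_cong) (auto simp: indicator_def)
    also have "\<dots> = (CLINT \<omega>|M2. \<Prod>j\<in>I. indicator (B j) (V2 j \<omega>))"
      using key[OF I order_refl, of B] B by simp
    also have "\<dots> = complex_of_real (LINT \<omega>|M2. indicator {\<omega>\<in>space M2. \<forall>i\<in>I. V2 i \<omega> \<in> B i} \<omega>)"
      unfolding ind integral_complex_of_real[symmetric] by (intro Bochner_Integration.integral_cong) (auto simp: indicator_def)
    also have "\<dots> = complex_of_real (measure M2 {\<omega>\<in>space M2. \<forall>i\<in>I. V2 i \<omega> \<in> B i})"
      by simp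
    finally show ?thesis by (simp add: M1.emeasure_eq_measure M2.emeasure_eq_measure)
  qed
  have r1[measurable]: "(\<lambda>\<omega>. \<lambda>i\<in>I. V1 i \<omega>) \<in> M1 \<rightarrow>\<^sub>M PiM I (\<lambda>_. borel)" by (rule measurable_restrict) (rule m1)
  have r2[measurable]: "(\<lambda>\<omega>. \<lambda>i\<in>I. V2 i \<omega>) \<in> M2 \<rightarrow>\<^sub>M PiM I (\<lambda>_. borel)" by (rule measurable_restrict) (rule m2)
  show ?thesis
  proof (rule measure_eqI_PiM_finite[OF I, where A = "\<lambda>_. space (PiM I (\<lambda>_. borel))"])
    fix B :: "'i \<Rightarrow> real set" assume B: "\<And>i. i \<in> I \<Longrightarrow> B i \<in> sets borel"
    have "Pi\<^sub>E I B \<in> sets (PiM I (\<lambda>_. borel))" by (rule sets_PiM_I_finite[OF I B])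
    then show "emeasure (distr M1 (PiM I (\<lambda>_. borel)) (\<lambda>\<omega>. \<lambda>i\<in>I. V1 i \<omega>)) (Pi\<^sub>E I B)
        = emeasure (distr M2 (PiM I (\<lambda>_. borel)) (\<lambda>\<omega>. \<lambda>i\<in>I. V2 i \<omega>)) (Pi\<^sub>E I B)"
      using fin[OF B] by (simp add: emeasure_distr vimage_def Int_def PiE_iff conj_commute)
  next
    have "space (PiM I (\<lambda>_. borel :: real measure)) \<in> prod_algebra I (\<lambda>_. borel)"
      unfolding space_PiM by (rule prod_algebraI_finite[OF I]) auto
    then show "range (\<lambda>_::nat. space (PiM I (\<lambda>_. borel :: real measure))) \<subseteq> prod_algebra I (\<lambda>_. borel)" by auto
    show "emeasure (distr M1 (PiM I (\<lambda>_. borel)) (\<lambda>\<omega>. \<lambda>i\<in>I. V1 i \<omega>)) (space (PiM I (\<lambda>_. borel))) \<noteq> \<infinity>"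
      by (simp add: emeasure_distr M1.emeasure_space_1)
  qed auto
qed

section \<open>Measurability and differentiation under the integral\<close>

text \<open>Generated by the entries, so that measurability is checked entry by entry and pairs of
  matrices need no countability argument about the norm topology.\<close>

definition FM :: "fm measure" where
  "FM = sigma UNIV {(\<lambda>A. ent A i j) -` S | i j S. S \<in> sets borel}"

lemma space_FM [simp]: "space FM = UNIV"
  by (simp add: FM_def)

lemma measurable_FM_iff: "f \<in> M \<rightarrow>\<^sub>M FM \<longleftrightarrow> (\<forall>i j. (\<lambda>x. ent (f x) i j) \<in> borel_measurable M)"
proof
  assume f: "f \<in> M \<rightarrow>\<^sub>M FM"
  have "(\<lambda>A. ent A i j) \<in> borel_measurable FM" for i j
  proof (rule measurableI)
    fix S :: "complex set" assume "S \<in> sets borel"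
    then have "(\<lambda>A. ent A i j) -` S \<in> sets FM" by (auto simp: FM_def intro: sigma_sets.Basic)
    then show "(\<lambda>A. ent A i j) -` S \<inter> space FM \<in> sets FM" by simp
  qed simp
  then show "\<forall>i j. (\<lambda>x. ent (f x) i j) \<in> borel_measurable M"
    using measurable_compose[OF f] by blast
next
  assume "\<forall>i j. (\<lambda>x. ent (f x) i j) \<in> borel_measurable M"
  then have "(\<lambda>x. ent (f x) i j) -` S \<inter> space M \<in> sets M" if "S \<in> sets borel" for i j S
    using that by (blast intro: measurable_sets)
  then show "f \<in> M \<rightarrow>\<^sub>M FM"
    unfolding FM_def by (intro measurable_measure_of) (auto simp: vimage_def)
qed

lemma measurable_FM_I: "(\<And>i j. (\<lambda>x. ent (f x) i j) \<in> borel_measurable M) \<Longrightarrow> f \<in> M \<rightarrow>\<^sub>M FM"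
  by (simp add: measurable_FM_iff)

lemma measurable_ent [measurable (raw)]:
  "f \<in> M \<rightarrow>\<^sub>M FM \<Longrightarrow> (\<lambda>x. ent (f x) i j) \<in> borel_measurable M"
  by (simp add: measurable_FM_iff)

lemma measurable_FM_add [measurable (raw)]:
  "f \<in> M \<rightarrow>\<^sub>M FM \<Longrightarrow> g \<in> M \<rightarrow>\<^sub>M FM \<Longrightarrow> (\<lambda>x. f x + g x) \<in> M \<rightarrow>\<^sub>M FM"
  by (rule measurable_FM_I) simp

lemma measurable_FM_diff [measurable (raw)]:
  "f \<in> M \<rightarrow>\<^sub>M FM \<Longrightarrow> g \<in> M \<rightarrow>\<^sub>M FM \<Longrightarrow> (\<lambda>x. f x - g x) \<in> M \<rightarrow>\<^sub>M FM"
  by (rule measurable_FM_I) simp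

lemma measurable_FM_scaleR [measurable (raw)]:
  "c \<in> borel_measurable M \<Longrightarrow> f \<in> M \<rightarrow>\<^sub>M FM \<Longrightarrow> (\<lambda>x. c x *\<^sub>R f x) \<in> M \<rightarrow>\<^sub>M FM"
  by (rule measurable_FM_I) simp

lemma measurable_FM_sum [measurable (raw)]:
  "(\<And>i. i \<in> I \<Longrightarrow> f i \<in> M \<rightarrow>\<^sub>M FM) \<Longrightarrow> (\<lambda>x. \<Sum>i\<in>I. f i x) \<in> M \<rightarrow>\<^sub>M FM"
  by (induction I rule: infinite_finite_induct) auto

text \<open>The number of terms of a product depends on the matrices. Written as a series over all
  indices it becomes a measurable function of the entries; the inner product below is treated in the
  same way.\<close>

lemma ent_times_suminf: "ent (A * B) i j = (\<Sum>k. ent A i k * ent B k j)"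
  unfolding ent_times[OF bd_dm[of A]]
  by (rule suminf_finite[symmetric]) (auto simp: bd_ent[OF bd_dm])

lemma measurable_FM_times [measurable (raw)]:
  "f \<in> M \<rightarrow>\<^sub>M FM \<Longrightarrow> g \<in> M \<rightarrow>\<^sub>M FM \<Longrightarrow> (\<lambda>x. f x * g x) \<in> M \<rightarrow>\<^sub>M FM"
  by (rule measurable_FM_I) (simp add: ent_times_suminf)

lemma inner_fm_suminf: "inner A B = (\<Sum>i. \<Sum>j. Re (ent A i j * cnj (ent B i j)))"
proof -
  have "(\<Sum>j. Re (ent A i j * cnj (ent B i j))) = (\<Sum>j<dm A. Re (ent A i j * cnj (ent B i j)))" for i
    by (rule suminf_finite) (auto simp: bd_ent[OF bd_dm])
  then have "(\<Sum>i. \<Sum>j. Re (ent A i j * cnj (ent B i j))) = (\<Sum>i. \<Sum>j<dm A. Re (ent A i j * cnj (ent B i j)))"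
    by simp
  also have "\<dots> = (\<Sum>i<dm A. \<Sum>j<dm A. Re (ent A i j * cnj (ent B i j)))"
    by (rule suminf_finite) (auto simp: bd_ent[OF bd_dm])
  finally show ?thesis by (simp add: inner_fm_bd[OF bd_dm])
qed

lemma measurable_FM_inner [measurable (raw)]:
  "f \<in> M \<rightarrow>\<^sub>M FM \<Longrightarrow> g \<in> M \<rightarrow>\<^sub>M FM \<Longrightarrow> (\<lambda>x. inner (f x) (g x)) \<in> borel_measurable M"
  by (simp add: inner_fm_suminf)

lemma measurable_FM_norm [measurable (raw)]:
  "f \<in> M \<rightarrow>\<^sub>M FM \<Longrightarrow> (\<lambda>x. norm (f x)) \<in> borel_measurable M"
  by (simp add: norm_eq_sqrt_inner)

lemma measurable_FM_pw [measurable (raw)]: "f \<in> M \<rightarrow>\<^sub>M FM \<Longrightarrow> (\<lambda>x. pw d (f x) n) \<in> M \<rightarrow>\<^sub>M FM"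
  by (induction n) auto

lemma measurable_tr [measurable (raw)]: "f \<in> M \<rightarrow>\<^sub>M FM \<Longrightarrow> (\<lambda>x. tr d (f x)) \<in> borel_measurable M"
  by (simp add: tr_def)

lemma measurable_QQ [measurable (raw)]:
  "f \<in> M \<rightarrow>\<^sub>M FM \<Longrightarrow> g \<in> M \<rightarrow>\<^sub>M FM \<Longrightarrow> (\<lambda>x. QQ d m (f x) (g x)) \<in> borel_measurable M"
  by (simp add: QQ_def)

lemma measurable_F0 [measurable (raw)]: "f \<in> M \<rightarrow>\<^sub>M FM \<Longrightarrow> (\<lambda>x. F0 d m (f x)) \<in> borel_measurable M"
  by (simp add: F0_def)

lemma measurable_F1 [measurable (raw)]:
  "f \<in> M \<rightarrow>\<^sub>M FM \<Longrightarrow> g \<in> M \<rightarrow>\<^sub>M FM \<Longrightarrow> (\<lambda>x. F1 d m (f x) (g x)) \<in> borel_measurable M"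
  by (simp add: F1_def)

lemma measurable_F2 [measurable (raw)]:
  "f \<in> M \<rightarrow>\<^sub>M FM \<Longrightarrow> g \<in> M \<rightarrow>\<^sub>M FM \<Longrightarrow> h \<in> M \<rightarrow>\<^sub>M FM \<Longrightarrow>
    (\<lambda>x. F2 d m (f x) (g x) (h x)) \<in> borel_measurable M"
  by (simp add: F2_def)

context psi_fun
begin

lemma measurable_f0 [measurable (raw)]: "f \<in> M \<rightarrow>\<^sub>M FM \<Longrightarrow> (\<lambda>x. f0 d m (f x)) \<in> borel_measurable M"
  by (simp add: f0_def)

lemma measurable_f1 [measurable (raw)]:
  "f \<in> M \<rightarrow>\<^sub>M FM \<Longrightarrow> g \<in> M \<rightarrow>\<^sub>M FM \<Longrightarrow> (\<lambda>x. f1 d m (f x) (g x)) \<in> borel_measurable M"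
  by (simp add: f1_def)

lemma measurable_f2 [measurable (raw)]:
  "f \<in> M \<rightarrow>\<^sub>M FM \<Longrightarrow> g \<in> M \<rightarrow>\<^sub>M FM \<Longrightarrow> h \<in> M \<rightarrow>\<^sub>M FM \<Longrightarrow>
    (\<lambda>x. f2 d m (f x) (g x) (h x)) \<in> borel_measurable M"
  by (simp add: f2_def)

lemma measurable_g0 [measurable (raw)]:
  "f \<in> M \<rightarrow>\<^sub>M FM \<Longrightarrow> g \<in> M \<rightarrow>\<^sub>M FM \<Longrightarrow> (\<lambda>x. g0 d m (f x) (g x)) \<in> borel_measurable M"
  by (simp add: g0_def)

end

text \<open>The mean value theorem bounds the difference quotients by the majorant w of the
  derivative, and dominated convergence applies along every sequence tending to 0.\<close>

lemma DERIV_integral: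
  fixes H :: "real \<Rightarrow> 'a \<Rightarrow> real"
  assumes int: "\<And>u. integrable M (H u)" and w: "integrable M w"
    and D: "\<And>u \<omega>. \<omega> \<in> space M \<Longrightarrow> ((\<lambda>u. H u \<omega>) has_real_derivative H' u \<omega>) (at u)"
    and b: "\<And>u \<omega>. \<omega> \<in> space M \<Longrightarrow> \<bar>H' u \<omega>\<bar> \<le> w \<omega>"
    and m[measurable]: "\<And>u. H' u \<in> borel_measurable M"
  shows "((\<lambda>u. LINT \<omega>|M. H u \<omega>) has_real_derivative (LINT \<omega>|M. H' u \<omega>)) (at u)"
  unfolding DERIV_def tendsto_at_iff_sequentially comp_def
proof safe
  fix X :: "nat \<Rightarrow> real" assume X: "\<forall>i. X i \<in> UNIV - {0}" "X \<longlonglongrightarrow> 0"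
  have "(\<lambda>i. LINT \<omega>|M. (H (u + X i) \<omega> - H u \<omega>) / X i) \<longlonglongrightarrow> (LINT \<omega>|M. H' u \<omega>)"
  proof (rule integral_dominated_convergence[OF _ _ w])
    show "(\<lambda>\<omega>. (H (u + X i) \<omega> - H u \<omega>) / X i) \<in> borel_measurable M" for i
      using int[of "u + X i"] int[of u] by (auto intro!: borel_measurable_divide borel_measurable_diff)
    show "AE \<omega> in M. (\<lambda>i. (H (u + X i) \<omega> - H u \<omega>) / X i) \<longlonglongrightarrow> H' u \<omega>"
    proof (rule AE_I2)
      fix \<omega> assume "\<omega> \<in> space M"
      from D[OF this, of u] show "(\<lambda>i. (H (u + X i) \<omega> - H u \<omega>) / X i) \<longlonglongrightarrow> H' u \<omega>"
        unfolding DERIV_def tendsto_at_iff_sequentially comp_def using X by blast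
    qed
    show "AE \<omega> in M. norm ((H (u + X i) \<omega> - H u \<omega>) / X i) \<le> w \<omega>" for i
    proof (rule AE_I2)
      fix \<omega> assume \<omega>: "\<omega> \<in> space M"
      have "norm (H (u + X i) \<omega> - H u \<omega>) \<le> w \<omega> * norm (u + X i - u)"
        by (rule field_differentiable_bound[where S = UNIV and f' = "\<lambda>u. H' u \<omega>"])
          (use D[OF \<omega>] b[OF \<omega>] in auto)
      moreover have "X i \<noteq> 0" using X by auto
      ultimately show "norm ((H (u + X i) \<omega> - H u \<omega>) / X i) \<le> w \<omega>"
        by (simp add: divide_le_eq)
    qed
  qed (rule m)
  then show "(\<lambda>i. ((LINT \<omega>|M. H (u + X i) \<omega>) - (LINT \<omega>|M. H u \<omega>)) / X i) \<longlonglongrightarrow> (LINT \<omega>|M. H' u \<omega>)"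
    using int by simp
qed

lemma F1_scaleR: "F1 d m Y (c *\<^sub>R A) = c * F1 d m Y A"
  by (simp add: F1_def tr_def)
lemma F1_add: "F1 d m Y (A + B) = F1 d m Y A + F1 d m Y B"
  by (simp add: F1_def tr_def distrib_right inner_add_right distrib_left)
lemma F2_scaleR_left: "F2 d m Y (c *\<^sub>R A) B = c * F2 d m Y A B"
  by (simp add: F2_def tr_def sum_distrib_left mult_ac)
lemma F2_scaleR_right: "F2 d m Y A (c *\<^sub>R B) = c * F2 d m Y A B"
  by (simp add: F2_def tr_def sum_distrib_left mult_ac)
lemma F2_add_left: "F2 d m Y (A + A') B = F2 d m Y A B + F2 d m Y A' B"
  by (simp add: F2_def tr_def distrib_right inner_add_right sum.distrib distrib_left)
lemma F2_add_right: "F2 d m Y A (B + B') = F2 d m Y A B + F2 d m Y A B'"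
  by (simp add: F2_def tr_def distrib_right inner_add_right sum.distrib distrib_left)

section \<open>Growth bounds for integrability\<close>

lemma power_le_one_plus_norm: "n \<le> k \<Longrightarrow> norm (Y::fm) ^ n \<le> (1 + norm Y) ^ k"
  by (rule order_trans[OF power_mono power_increasing]) auto

lemma F1_growth:
  assumes "1 \<le> m" shows "\<bar>F1 d m Y A\<bar> \<le> 2 * real m * (norm (idm d))\<^sup>2 * (norm A * (1 + norm Y) ^ (2 * m))"
proof -
  define D where "D = norm (idm d)"
  have "norm (A * pw d Y (2 * m - 1)) \<le> norm A * ((1 + norm Y) ^ (2 * m) * D)"
    by (rule order_trans[OF norm_mult_ineq], rule mult_left_mono,
        rule order_trans[OF norm_pw_le]) (auto simp: D_def intro!: mult_right_mono power_le_one_plus_norm)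
  then have "\<bar>tr d (A * pw d Y (2 * m - 1))\<bar> \<le> D * (norm A * ((1 + norm Y) ^ (2 * m) * D))"
    unfolding D_def by (intro order_trans[OF abs_tr_le] mult_left_mono) auto
  then show ?thesis
    unfolding F1_def abs_mult by (auto simp: D_def power2_eq_square mult_ac intro!: mult_left_mono)
qed

lemma F2_growth:
  "\<bar>F2 d m Y A B\<bar> \<le> (2 * real m)\<^sup>2 * (norm (idm d)) ^ 3 * (norm A * norm B * (1 + norm Y) ^ (2 * m))"
proof -
  define D where "D = norm (idm d)"
  define b where "b = D * (norm A * norm B * D\<^sup>2 * (1 + norm Y) ^ (2 * m))"
  have b0: "0 \<le> b" by (simp add: b_def D_def)
  have "\<bar>\<Sum>k<2*m-1. tr d (A * pw d Y k * B * pw d Y (2 * m - 1 - 1 - k))\<bar> \<le> real (2 * m - 1) * b"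
  proof (rule abs_sum_le_card)
    fix k assume k: "k < 2 * m - 1"
    let ?l = "2 * m - 1 - 1 - k"
    have "norm (A * pw d Y k * B * pw d Y ?l) \<le> norm A * norm (pw d Y k) * norm B * norm (pw d Y ?l)"
      by (intro order_trans[OF norm_mult_ineq] mult_right_mono) (auto intro: norm_mult_ineq)
    also have "\<dots> = norm A * norm B * (norm (pw d Y k) * norm (pw d Y ?l))" by simp
    also have "\<dots> \<le> norm A * norm B * ((norm Y ^ k * D) * (norm Y ^ ?l * D))"
      unfolding D_def by (intro mult_left_mono mult_mono norm_pw_le) auto
    also have "\<dots> = norm A * norm B * D\<^sup>2 * (norm Y ^ (k + ?l))"
      by (simp only: power_add power2_eq_square mult_ac)
    also have "\<dots> \<le> norm A * norm B * D\<^sup>2 * (1 + norm Y) ^ (2 * m)"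
      using k by (intro mult_left_mono power_le_one_plus_norm) auto
    finally show "\<bar>tr d (A * pw d Y k * B * pw d Y ?l)\<bar> \<le> b"
      unfolding b_def D_def by (intro order_trans[OF abs_tr_le] mult_left_mono) auto
  qed
  also have "\<dots> \<le> 2 * real m * b" using b0 by (intro mult_right_mono) auto
  finally have "2 * real m * \<bar>\<Sum>k<2*m-1. tr d (A * pw d Y k * B * pw d Y (2 * m - 1 - 1 - k))\<bar>
      \<le> 2 * real m * (2 * real m * b)" by (intro mult_left_mono) auto
  then show ?thesis
    unfolding F2_def abs_mult by (simp add: b_def D_def power2_eq_square power3_eq_cube mult_ac)
qed

lemma F0_growth: "\<bar>F0 d m Y\<bar> \<le> (real d + (norm (idm d))\<^sup>2) * (1 + norm Y) ^ (2 * m)"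
proof -
  define D where "D = norm (idm d)"
  have "norm (pw d Y (2 * m)) \<le> (1 + norm Y) ^ (2 * m) * D"
    by (rule order_trans[OF norm_pw_le]) (auto simp: D_def intro!: mult_right_mono power_le_one_plus_norm)
  then have "\<bar>tr d (pw d Y (2 * m))\<bar> \<le> D * ((1 + norm Y) ^ (2 * m) * D)"
    unfolding D_def by (intro order_trans[OF abs_tr_le] mult_left_mono) auto
  moreover have "real d * 1 \<le> real d * (1 + norm Y) ^ (2 * m)"
    by (intro mult_left_mono one_le_power) auto
  ultimately show ?thesis
    unfolding F0_def D_def[symmetric] by (simp add: distrib_right power2_eq_square mult_ac)
qed

context psi_fun
begin

lemma f1_scaleR: "f1 d m Y (c *\<^sub>R A) = c * f1 d m Y A"
  by (simp add: f1_def F1_scaleR)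
lemma f1_add: "f1 d m Y (A + B) = f1 d m Y A + f1 d m Y B"
  by (simp add: f1_def F1_add distrib_left)
lemma f1_zero [simp]: "f1 d m Y 0 = 0"
  using f1_scaleR[of d m Y 0 0] by simp
lemma f1_sum: "f1 d m Y (sum A I) = (\<Sum>i\<in>I. f1 d m Y (A i))"
  by (induction I rule: infinite_finite_induct) (auto simp: f1_add)
lemma f2_scaleR_left: "f2 d m Y (c *\<^sub>R A) B = c * f2 d m Y A B"
  by (simp add: f2_def F1_scaleR F2_scaleR_left algebra_simps)
lemma f2_scaleR_right: "f2 d m Y A (c *\<^sub>R B) = c * f2 d m Y A B"
  by (simp add: f2_def F1_scaleR F2_scaleR_right algebra_simps)
lemma f2_add_left: "f2 d m Y (A + A') B = f2 d m Y A B + f2 d m Y A' B"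
  by (simp add: f2_def F1_add F2_add_left algebra_simps)
lemma f2_add_right: "f2 d m Y A (B + B') = f2 d m Y A B + f2 d m Y A B'"
  by (simp add: f2_def F1_add F2_add_right algebra_simps)
lemma f2_sum_left: "f2 d m Y (sum A I) B = (\<Sum>i\<in>I. f2 d m Y (A i) B)"
proof (induction I rule: infinite_finite_induct)
  case empty then show ?case using f2_scaleR_left[of d m Y 0 0 B] by simp
next
  case (infinite I) then show ?case using f2_scaleR_left[of d m Y 0 0 B] by simp
qed (auto simp: f2_add_left)
lemma f2_sum_right: "f2 d m Y A (sum B I) = (\<Sum>i\<in>I. f2 d m Y A (B i))"
proof (induction I rule: infinite_finite_induct)
  case empty then show ?case using f2_scaleR_right[of d m Y A 0 0] by simp
next
  case (infinite I) then show ?case using f2_scaleR_right[of d m Y A 0 0] by simp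
qed (auto simp: f2_add_right)

text \<open>A crude constant that serves all four growth bounds below. It only has to be finite and
  does not enter the final estimates.\<close>

definition "KK d m = real d + (norm (idm d))\<^sup>2 + 12 * real m * (norm (idm d))\<^sup>2
  + 6 * (2 * real m)\<^sup>2 * ((norm (idm d)) ^ 4 + (norm (idm d)) ^ 3) + 1"

lemma KK_nonneg: "0 \<le> KK d m" by (simp add: KK_def)

text \<open>All four quantities are at most of order (1 + norm Y)^(4m). The exponential majorant is
  chosen because exponentials of the norm of a Gaussian matrix are integrable at every rate.\<close>

lemma
  assumes d: "1 \<le> d" and m: "1 \<le> m" and Y: "Y \<in> sad d"
  shows f0_growth: "\<bar>f0 d m Y\<bar> \<le> KK d m * exp (4 * real m * norm Y)"
    and f1_growth: "\<bar>f1 d m Y A\<bar> \<le> KK d m * norm A * exp (4 * real m * norm Y)"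
    and f2_growth: "\<bar>f2 d m Y A B\<bar> \<le> KK d m * norm A * norm B * exp (4 * real m * norm Y)"
    and g0_growth: "\<bar>g0 d m Y A\<bar> \<le> KK d m * (norm A)\<^sup>2 * exp (4 * real m * norm Y)"
proof -
  define F where "F = F0 d m Y"
  define D where "D = norm (idm d)"
  define y where "y = (1 + norm Y) ^ (2 * m)"
  have F: "1 \<le> F" using F0_ge[OF Y, of m] d unfolding F_def by linarith
  then have F': "0 < F" by simp
  have y1: "1 \<le> y" by (simp add: y_def)
  have y2: "y \<le> y\<^sup>2" using y1 by (simp add: power2_eq_square mult_left_le)
  have D0: "0 \<le> D" by (simp add: D_def)
  have yexp: "y\<^sup>2 \<le> exp (4 * real m * norm Y)"
  proof -
    have "y\<^sup>2 = (1 + norm Y) ^ (4 * m)" by (simp add: y_def power_mult[symmetric])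
    also have "\<dots> \<le> exp (norm Y) ^ (4 * m)" by (intro power_mono exp_ge_add_one_self) auto
    also have "\<dots> = exp (4 * real m * norm Y)" by (simp add: exp_of_nat_mult[symmetric])
    finally show ?thesis .
  qed
  have p: "0 < \<psi> F" "\<psi> F \<le> F" using pos[OF F'] growth[OF F] by auto
  have pF: "\<psi> F / F \<le> 1" using p F by (simp add: divide_le_eq)
  have b1: "\<bar>\<psi>1 F\<bar> \<le> 6" using B1[OF F'] pF by linarith
  have b2: "\<bar>\<psi>2 F\<bar> \<le> 6"
  proof -
    have "F \<le> F\<^sup>2" using F by (simp add: power2_eq_square mult_left_le)
    then have "6 * \<psi> F / F\<^sup>2 \<le> 6" using p F by (simp add: divide_le_eq)
    then show ?thesis using B2[OF F'] by linarith
  qed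
  have "\<bar>f0 d m Y\<bar> \<le> KK d m * y\<^sup>2"
  proof -
    have "\<bar>f0 d m Y\<bar> \<le> (real d + D\<^sup>2) * y"
      using F0_growth[of d m Y] p unfolding f0_def F_def[symmetric] D_def y_def by linarith
    also have "\<dots> \<le> KK d m * y\<^sup>2"
      using y2 y1 by (intro mult_mono) (auto simp: KK_def D_def)
    finally show ?thesis .
  qed
  then show "\<bar>f0 d m Y\<bar> \<le> KK d m * exp (4 * real m * norm Y)"
    using mult_left_mono[OF yexp KK_nonneg] by (rule order_trans)
  have F1b: "\<bar>F1 d m Y A\<bar> \<le> (2 * real m * D\<^sup>2) * (norm A * y)" for A
    using F1_growth[OF m] by (simp add: D_def y_def)
  have F2b: "\<bar>F2 d m Y A B\<bar> \<le> ((2 * real m)\<^sup>2 * D ^ 3) * (norm A * norm B * y)" for A B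
    using F2_growth by (simp add: D_def y_def)
  have "\<bar>f1 d m Y A\<bar> \<le> (KK d m * norm A) * y\<^sup>2"
  proof -
    have "\<bar>f1 d m Y A\<bar> \<le> 6 * ((2 * real m * D\<^sup>2) * (norm A * y))"
      unfolding f1_def abs_mult F_def[symmetric] by (intro mult_mono b1 F1b) auto
    also have "\<dots> = 12 * real m * D\<^sup>2 * (norm A * y)" by simp
    also have "\<dots> \<le> KK d m * (norm A * y\<^sup>2)"
      using y2 y1 D0 by (intro mult_mono) (auto simp: KK_def D_def)
    finally show ?thesis by (simp add: mult_ac)
  qed
  then show "\<bar>f1 d m Y A\<bar> \<le> KK d m * norm A * exp (4 * real m * norm Y)"
    using mult_left_mono[OF yexp, of "KK d m * norm A"] KK_nonneg[of d m] by (auto intro: order_trans)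
  have "\<bar>f2 d m Y A B\<bar> \<le> (KK d m * norm A * norm B) * y\<^sup>2"
  proof -
    have "\<bar>f2 d m Y A B\<bar> \<le> 6 * (((2 * real m * D\<^sup>2) * (norm A * y)) * ((2 * real m * D\<^sup>2) * (norm B * y)))
        + 6 * (((2 * real m)\<^sup>2 * D ^ 3) * (norm A * norm B * y))"
      unfolding f2_def F_def[symmetric] mult.assoc[of "\<psi>2 F"]
      by (rule order_trans[OF abs_triangle_ineq], unfold abs_mult, intro add_mono mult_mono b1 b2 F1b F2b)
        (use y1 in auto)
    also have "\<dots> = 6 * (2 * real m)\<^sup>2 * (norm A * norm B) * (D ^ 4 * y\<^sup>2 + D ^ 3 * y)"
      by (simp add: algebra_simps power2_eq_square power3_eq_cube power4_eq_xxxx)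
    also have "\<dots> \<le> 6 * (2 * real m)\<^sup>2 * (norm A * norm B) * ((D ^ 4 + D ^ 3) * y\<^sup>2)"
      using y2 D0 by (intro mult_left_mono) (auto simp: distrib_right intro!: mult_left_mono)
    also have "\<dots> = (6 * (2 * real m)\<^sup>2 * (D ^ 4 + D ^ 3)) * (norm A * norm B * y\<^sup>2)" by simp
    also have "\<dots> \<le> KK d m * (norm A * norm B * y\<^sup>2)"
      using D0 by (intro mult_right_mono) (auto simp: KK_def D_def)
    finally show ?thesis by (simp add: mult_ac)
  qed
  then show "\<bar>f2 d m Y A B\<bar> \<le> KK d m * norm A * norm B * exp (4 * real m * norm Y)"
    using mult_left_mono[OF yexp, of "KK d m * norm A * norm B"] KK_nonneg[of d m]
    by (auto intro: order_trans)
  have "\<bar>g0 d m Y A\<bar> \<le> (KK d m * (norm A)\<^sup>2) * y\<^sup>2"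
  proof -
    have n1: "norm (pw d Y m) \<le> y * D"
      unfolding y_def D_def
      by (rule order_trans[OF norm_pw_le]) (auto intro!: mult_right_mono power_le_one_plus_norm)
    have "norm (A * pw d Y m) \<le> norm A * (y * D)"
      by (rule order_trans[OF norm_mult_ineq], intro mult_left_mono n1) simp
    then have "(norm (A * pw d Y m))\<^sup>2 \<le> (norm A * (y * D))\<^sup>2" by (intro power_mono) auto
    then have "QQ d m Y A \<le> (norm A)\<^sup>2 * (1 + D\<^sup>2 * y\<^sup>2)"
      by (simp add: QQ_def power_mult_distrib algebra_simps)
    also have "\<dots> \<le> (norm A)\<^sup>2 * ((1 + D\<^sup>2) * y\<^sup>2)"
      using y1 y2 by (intro mult_left_mono) (auto simp: distrib_right)
    also have "\<dots> \<le> (norm A)\<^sup>2 * (KK d m * y\<^sup>2)"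
      using D0 by (intro mult_left_mono mult_right_mono) (auto simp: KK_def D_def)
    finally have "QQ d m Y A \<le> (norm A)\<^sup>2 * (KK d m * y\<^sup>2)" .
    moreover have "\<bar>g0 d m Y A\<bar> \<le> 1 * QQ d m Y A"
      unfolding g0_def F_def[symmetric] abs_mult using pF p F by (intro mult_mono) auto
    ultimately show ?thesis by (simp add: mult_ac)
  qed
  then show "\<bar>g0 d m Y A\<bar> \<le> KK d m * (norm A)\<^sup>2 * exp (4 * real m * norm Y)"
    using mult_left_mono[OF yexp, of "KK d m * (norm A)\<^sup>2"] KK_nonneg[of d m] by (auto intro: order_trans)
qed

end

section \<open>A real orthonormal basis of the matrices of size d\<close>

definition Ix :: "nat \<Rightarrow> (nat \<times> nat \<times> bool) set" where
  "Ix d = {..<d} \<times> {..<d} \<times> UNIV"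

definition bv :: "nat \<times> nat \<times> bool \<Rightarrow> fm" where
  "bv = (\<lambda>(i, j, r). mkfm (Suc (max i j)) (\<lambda>k l. if k = i \<and> l = j then (if r then 1 else \<i>) else 0))"

lemma finite_Ix [simp]: "finite (Ix d)" by (simp add: Ix_def)

lemma ent_bv: "ent (bv (i, j, r)) k l = (if k = i \<and> l = j then (if r then 1 else \<i>) else 0)"
  by (auto simp: bv_def ent_mkfm)

lemma inner_bv: "inner (bv (i, j, r)) A = (if r then Re (ent A i j) else Im (ent A i j))"
proof -
  have b: "bd (bv (i, j, r)) (Suc (max i j))" unfolding bv_def by (simp add: bd_mkfm)
  have "inner (bv (i, j, r)) A
      = (\<Sum>k<Suc (max i j). \<Sum>l<Suc (max i j). if k = i \<and> l = j then Re ((if r then 1 else \<i>) * cnj (ent A i j)) else 0)"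
    unfolding inner_fm_bd[OF b] by (intro sum.cong refl) (auto simp: ent_bv)
  also have "\<dots> = (\<Sum>k<Suc (max i j). if k = i then \<Sum>l<Suc (max i j). if l = j then Re ((if r then 1 else \<i>) * cnj (ent A i j)) else 0 else 0)"
    by (intro sum.cong refl) auto
  also have "\<dots> = Re ((if r then 1 else \<i>) * cnj (ent A i j))"
    by (subst sum.delta, simp, simp only: sum.delta finite_lessThan) auto
  finally show ?thesis by auto
qed

lemma sum_Ix: "(\<Sum>p\<in>Ix d. f p) = (\<Sum>i<d. \<Sum>j<d. f (i, j, True) + f (i, j, False))"
proof -
  have "(\<Sum>i<d. \<Sum>j<d. f (i, j, True) + f (i, j, False)) = (\<Sum>i<d. \<Sum>j<d. \<Sum>r\<in>UNIV. f (i, j, r))"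
    by (simp add: UNIV_bool add.commute)
  also have "\<dots> = (\<Sum>p\<in>Ix d. f p)"
    unfolding Ix_def sum.cartesian_product by (simp add: case_prod_unfold)
  finally show ?thesis by simp
qed

lemma fm_expand: "bd A d \<Longrightarrow> A = (\<Sum>p\<in>Ix d. inner (bv p) A *\<^sub>R bv p)"
proof (rule fm_eqI)
  fix k l assume A: "bd A d"
  have es: "ent (sum f I) k l = (\<Sum>i\<in>I. ent (f i) k l)" for f :: "'c \<Rightarrow> fm" and I
    by (induction I rule: infinite_finite_induct) auto
  have "ent (\<Sum>p\<in>Ix d. inner (bv p) A *\<^sub>R bv p) k l
      = (\<Sum>i<d. \<Sum>j<d. if k = i \<and> l = j then ent A i j else 0)"
    unfolding es sum_Ix
    by (intro sum.cong refl) (auto simp: inner_bv ent_bv complex_eq_iff)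
  also have "\<dots> = (\<Sum>i<d. if k = i then (\<Sum>j<d. if l = j then ent A k j else 0) else 0)"
    by (intro sum.cong refl) auto
  also have "\<dots> = ent A k l" by (auto simp: bd_ent[OF A] not_less)
  finally show "ent A k l = ent (\<Sum>p\<in>Ix d. inner (bv p) A *\<^sub>R bv p) k l" by simp
qed

lemma norm_bv: "norm (bv p) = 1"
proof (cases p)
  case (fields i j r)
  then show ?thesis by (simp add: norm_eq_sqrt_inner inner_bv ent_bv)
qed

lemma norm_le_sum_Ix: "bd A d \<Longrightarrow> norm A \<le> (\<Sum>p\<in>Ix d. \<bar>inner (bv p) A\<bar>)"
  by (subst fm_expand, assumption, rule order_trans[OF norm_sum]) (simp add: norm_bv)

section \<open>Gaussian rotation invariance and integration by parts\<close>

lemma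
  fixes f :: "'a \<Rightarrow> 'c :: {real_normed_field, banach, second_countable_topology}"
  assumes p1: "prob_space M1" and p2: "prob_space M2" and f: "integrable M1 f" and g: "integrable M2 g"
  shows integrable_pair_mult: "integrable (M1 \<Otimes>\<^sub>M M2) (\<lambda>p. f (fst p) * g (snd p))"
    and integral_pair_mult: "(LINT p|(M1 \<Otimes>\<^sub>M M2). f (fst p) * g (snd p)) = (LINT x|M1. f x) * (LINT y|M2. g y)"
proof -
  interpret M1: prob_space M1 by fact
  interpret M2: prob_space M2 by fact
  interpret pair_prob_space M1 M2 ..
  have [measurable]: "f \<in> borel_measurable M1" "g \<in> borel_measurable M2" using f g by auto
  show 1: "integrable (M1 \<Otimes>\<^sub>M M2) (\<lambda>p. f (fst p) * g (snd p))"
    by (rule Fubini_integrable) (use f g in \<open>auto simp: norm_mult\<close>)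
  show "(LINT p|(M1 \<Otimes>\<^sub>M M2). f (fst p) * g (snd p)) = (LINT x|M1. f x) * (LINT y|M2. g y)"
    using integral_fst'[OF 1] by simp
qed

lemma curve_deriv:
  "((\<lambda>t. cos t *\<^sub>R g + sin t *\<^sub>R (g' :: 'a :: real_normed_vector)) has_vector_derivative (- sin t *\<^sub>R g + cos t *\<^sub>R g')) (at t)"
  by (auto intro!: derivative_eq_intros)

lemma norm_rot_le:
  fixes x y :: "'a :: real_normed_vector"
  assumes "\<bar>a\<bar> \<le> 1" "\<bar>b\<bar> \<le> 1" shows "norm (a *\<^sub>R x + b *\<^sub>R y) \<le> norm x + norm y"
proof -
  have "norm (a *\<^sub>R x + b *\<^sub>R y) \<le> \<bar>a\<bar> * norm x + \<bar>b\<bar> * norm y"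
    by (rule order_trans[OF norm_triangle_ineq]) simp
  also have "\<dots> \<le> 1 * norm x + 1 * norm y" using assms by (intro add_mono mult_right_mono) auto
  finally show ?thesis by simp
qed

lemma measurable_FM_uminus [measurable (raw)]: "f \<in> M \<rightarrow>\<^sub>M FM \<Longrightarrow> (\<lambda>x. - f x) \<in> M \<rightarrow>\<^sub>M FM"
  by (rule measurable_FM_I) simp

text \<open>Joint Gaussianity is encoded through the real linear functionals, degenerate ones
  included. Both transforms are required: the characteristic function yields rotation invariance,
  the Laplace transform yields concentration and integrability.\<close>

locale gaussian_fm = N: prob_space N for N :: "'b measure" +
  fixes G :: "'b \<Rightarrow> fm" and d :: nat
  assumes G_meas [measurable]: "G \<in> N \<rightarrow>\<^sub>M FM"
    and G_sad: "\<And>\<omega>. \<omega> \<in> space N \<Longrightarrow> G \<omega> \<in> sad d"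
    and G_int2: "\<And>L. integrable N (\<lambda>\<omega>. (inner L (G \<omega>))\<^sup>2)"
    and G_mean: "\<And>L. (LINT \<omega>|N. inner L (G \<omega>)) = 0"
    and G_char: "\<And>L. (CLINT \<omega>|N. iexp (inner L (G \<omega>))) = exp (- complex_of_real (LINT \<omega>|N. (inner L (G \<omega>))\<^sup>2) / 2)"
    and G_exp: "\<And>L. integrable N (\<lambda>\<omega>. exp (inner L (G \<omega>)))"
    and G_mgf: "\<And>L. (LINT \<omega>|N. exp (inner L (G \<omega>))) = exp ((LINT \<omega>|N. (inner L (G \<omega>))\<^sup>2) / 2)"
begin

sublocale NN: pair_prob_space N N ..

lemma G_bd: "\<omega> \<in> space N \<Longrightarrow> bd (G \<omega>) d"
  using G_sad by (auto simp: sad_def)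

lemma G_int_prod: "integrable N (\<lambda>\<omega>. inner L (G \<omega>) * inner L' (G \<omega>))"
proof (rule Bochner_Integration.integrable_bound)
  show "integrable N (\<lambda>\<omega>. (inner L (G \<omega>))\<^sup>2 + (inner L' (G \<omega>))\<^sup>2)"
    by (intro Bochner_Integration.integrable_add G_int2)
  show "AE \<omega> in N. norm (inner L (G \<omega>) * inner L' (G \<omega>)) \<le> norm ((inner L (G \<omega>))\<^sup>2 + (inner L' (G \<omega>))\<^sup>2)"
  proof (rule AE_I2)
    fix \<omega>
    have "\<bar>x * y\<bar> \<le> x\<^sup>2 + y\<^sup>2" for x y :: real
    proof -
      have "2 * (\<bar>x\<bar> * \<bar>y\<bar>) \<le> x\<^sup>2 + y\<^sup>2" using sum_squares_bound[of "\<bar>x\<bar>" "\<bar>y\<bar>"] by simp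
      moreover have "0 \<le> \<bar>x\<bar> * \<bar>y\<bar>" by simp
      ultimately show ?thesis unfolding abs_mult by linarith
    qed
    then show "norm (inner L (G \<omega>) * inner L' (G \<omega>)) \<le> norm ((inner L (G \<omega>))\<^sup>2 + (inner L' (G \<omega>))\<^sup>2)"
      by simp
  qed
qed auto

lemma G_int1: "integrable N (\<lambda>\<omega>. inner L (G \<omega>))"
  by (rule N.square_integrable_imp_integrable[OF _ G_int2]) auto

text \<open>The norm is at most the number of coordinates times the largest coordinate in modulus,
  so its exponential is dominated by a sum of exponentials of linear functionals. The summand 1 in
  the majorant covers the case of no coordinates.\<close>

lemma exp_norm_integrable: "0 \<le> c \<Longrightarrow> integrable N (\<lambda>\<omega>. exp (c * norm (G \<omega>)))"
proof -
  assume c: "0 \<le> c"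
  define K where "K = real (card (Ix d))"
  let ?b = "\<lambda>\<omega>. 1 + (\<Sum>p\<in>Ix d. exp (inner ((c * K) *\<^sub>R bv p) (G \<omega>)) + exp (inner ((- (c * K)) *\<^sub>R bv p) (G \<omega>)))"
  show ?thesis
  proof (rule Bochner_Integration.integrable_bound)
    show "integrable N ?b"
      by (intro Bochner_Integration.integrable_add Bochner_Integration.integrable_sum G_exp) auto
    show "AE \<omega> in N. norm (exp (c * norm (G \<omega>))) \<le> norm (?b \<omega>)"
    proof (rule AE_I2)
      fix \<omega> assume \<omega>: "\<omega> \<in> space N"
      define x where "x p = inner (bv p) (G \<omega>)" for p
      have nle: "norm (G \<omega>) \<le> (\<Sum>p\<in>Ix d. \<bar>x p\<bar>)"
        unfolding x_def by (rule norm_le_sum_Ix[OF G_bd[OF \<omega>]])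
      have "exp (c * norm (G \<omega>)) \<le> 1 + (\<Sum>p\<in>Ix d. exp (c * K * x p) + exp (- (c * K * x p)))"
      proof (cases "Ix d = {}")
        case True
        then show ?thesis using nle c by (simp add: mult_nonneg_nonpos)
      next
        case False
        then obtain q where q: "q \<in> Ix d" "\<And>p. p \<in> Ix d \<Longrightarrow> \<bar>x p\<bar> \<le> \<bar>x q\<bar>"
          using obtains_MAX[of "Ix d" "\<lambda>p. \<bar>x p\<bar>"] by (metis Max_ge finite_Ix finite_imageI imageI)
        have "(\<Sum>p\<in>Ix d. \<bar>x p\<bar>) \<le> K * \<bar>x q\<bar>"
          unfolding K_def by (rule sum_bounded_above) (rule q)
        then have "exp (c * norm (G \<omega>)) \<le> exp (c * (K * \<bar>x q\<bar>))"
          using c nle by (auto intro!: mult_left_mono)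
        also have "\<dots> \<le> exp (c * K * x q) + exp (- (c * K * x q))"
          by (cases "0 \<le> x q") (auto simp: mult.assoc)
        also have "\<dots> \<le> (\<Sum>p\<in>Ix d. exp (c * K * x p) + exp (- (c * K * x p)))"
          using q by (intro member_le_sum[of q _ "\<lambda>p. exp (c * K * x p) + exp (- (c * K * x p))"])
            (auto intro: add_nonneg_nonneg)
        finally show ?thesis by simp
      qed
      also have "\<dots> = ?b \<omega>" by (simp add: x_def)
      finally show "norm (exp (c * norm (G \<omega>))) \<le> norm (?b \<omega>)" by simp
    qed
  qed auto
qed

lemma exp_norm_pair_integrable:
  "0 \<le> c \<Longrightarrow> integrable (N \<Otimes>\<^sub>M N) (\<lambda>p. exp (c * (norm (G (fst p)) + norm (G (snd p)))))"
  using integrable_pair_mult[OF N.prob_space_axioms N.prob_space_axioms exp_norm_integrable exp_norm_integrable]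
  by (simp add: distrib_left exp_add)

lemma pair_integrable_bound:
  fixes h :: "'b \<times> 'b \<Rightarrow> real"
  assumes [measurable]: "h \<in> borel_measurable (N \<Otimes>\<^sub>M N)" and "0 \<le> c"
    and "\<And>p. p \<in> space (N \<Otimes>\<^sub>M N) \<Longrightarrow> \<bar>h p\<bar> \<le> C * exp (c * (norm (G (fst p)) + norm (G (snd p))))"
  shows "integrable (N \<Otimes>\<^sub>M N) h"
proof (rule Bochner_Integration.integrable_bound)
  show "integrable (N \<Otimes>\<^sub>M N) (\<lambda>p. C * exp (c * (norm (G (fst p)) + norm (G (snd p)))))"
    using exp_norm_pair_integrable[OF assms(2)] by simp
  show "AE p in N \<Otimes>\<^sub>M N. norm (h p) \<le> norm (C * exp (c * (norm (G (fst p)) + norm (G (snd p)))))"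
    using assms(3) by (intro AE_I2) (auto intro: order_trans[OF _ abs_ge_self])
qed fact

lemma char_pair:
  "(CLINT p|(N \<Otimes>\<^sub>M N). iexp (inner A (G (fst p)) + inner B (G (snd p))))
    = exp (- complex_of_real ((LINT \<omega>|N. (inner A (G \<omega>))\<^sup>2) + (LINT \<omega>|N. (inner B (G \<omega>))\<^sup>2)) / 2)"
proof -
  have i: "integrable N (\<lambda>\<omega>. iexp (inner L (G \<omega>)))" for L
    by (rule N.integrable_const_bound[where B = 1]) auto
  have "(CLINT p|(N \<Otimes>\<^sub>M N). iexp (inner A (G (fst p)) + inner B (G (snd p))))
      = (CLINT p|(N \<Otimes>\<^sub>M N). iexp (inner A (G (fst p))) * iexp (inner B (G (snd p))))"
    by (simp add: distrib_left exp_add)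
  also have "\<dots> = (CLINT \<omega>|N. iexp (inner A (G \<omega>))) * (CLINT \<omega>|N. iexp (inner B (G \<omega>)))"
    by (rule integral_pair_mult[OF N.prob_space_axioms N.prob_space_axioms i i])
  also have "\<dots> = exp (- complex_of_real ((LINT \<omega>|N. (inner A (G \<omega>))\<^sup>2) + (LINT \<omega>|N. (inner B (G \<omega>))\<^sup>2)) / 2)"
    unfolding G_char exp_add[symmetric] by (simp add: add_divide_distrib diff_divide_distrib)
  finally show ?thesis .
qed

text \<open>Testing the rotated pair with (L1, L2) is testing the original pair with the functionals
  rotated back, and c^2 + s^2 = 1 preserves the sum of their variances. So the characteristic
  functions agree. Uniqueness is available for finite families of real variables; \<open>mk\<close>
  rebuilds the two matrices from their coordinates.\<close>

lemma rotation:
  fixes \<Phi> :: "fm \<times> fm \<Rightarrow> real"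
  assumes cs: "c\<^sup>2 + s\<^sup>2 = 1" and \<Phi>[measurable]: "\<Phi> \<in> borel_measurable (FM \<Otimes>\<^sub>M FM)"
  shows "(LINT p|(N \<Otimes>\<^sub>M N). \<Phi> (c *\<^sub>R G (fst p) + s *\<^sub>R G (snd p), (- s) *\<^sub>R G (fst p) + c *\<^sub>R G (snd p)))
    = (LINT p|(N \<Otimes>\<^sub>M N). \<Phi> (G (fst p), G (snd p)))"
proof -
  define I where "I = (UNIV :: bool set) \<times> Ix d"
  define X1 where "X1 p = c *\<^sub>R G (fst p) + s *\<^sub>R G (snd p)" for p
  define X2 where "X2 p = (- s) *\<^sub>R G (fst p) + c *\<^sub>R G (snd p)" for p
  have [measurable]: "X1 \<in> N \<Otimes>\<^sub>M N \<rightarrow>\<^sub>M FM" "X2 \<in> N \<Otimes>\<^sub>M N \<rightarrow>\<^sub>M FM" by (auto simp: X1_def[abs_def] X2_def[abs_def])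
  define V1 where "V1 i p = inner (bv (snd i)) (if fst i then X1 p else X2 p)" for i p
  define V2 where "V2 i p = inner (bv (snd i)) (if fst i then G (fst p) else G (snd p))" for i p
  define mk where "mk x = ((\<Sum>q\<in>Ix d. x (True, q) *\<^sub>R bv q), (\<Sum>q\<in>Ix d. x (False, q) *\<^sub>R bv q))" for x :: "bool \<times> nat \<times> nat \<times> bool \<Rightarrow> real"
  have I: "finite I" by (simp add: I_def)
  have m1: "V1 i \<in> borel_measurable (N \<Otimes>\<^sub>M N)" for i by (cases "fst i") (auto simp: V1_def[abs_def])
  have m2: "V2 i \<in> borel_measurable (N \<Otimes>\<^sub>M N)" for i by (cases "fst i") (auto simp: V2_def[abs_def])
  have "(\<lambda>x. x (r, q)) \<in> borel_measurable (PiM I (\<lambda>_. borel))" if "q \<in> Ix d" for r q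
    using that by (intro measurable_component_singleton) (auto simp: I_def)
  then have mk[measurable]: "mk \<in> PiM I (\<lambda>_. borel) \<rightarrow>\<^sub>M FM \<Otimes>\<^sub>M FM"
    unfolding mk_def by (intro measurable_Pair measurable_FM_sum measurable_FM_scaleR measurable_const) auto
  have sumI: "(\<Sum>i\<in>I. f i) = (\<Sum>q\<in>Ix d. f (True, q)) + (\<Sum>q\<in>Ix d. f (False, q))" for f :: "_ \<Rightarrow> real"
    unfolding I_def by (simp add: sum.cartesian_product[symmetric, of "\<lambda>r q. f (r, q)", simplified] UNIV_bool)
  have eq: "distr (N \<Otimes>\<^sub>M N) (PiM I (\<lambda>_. borel)) (\<lambda>\<omega>. \<lambda>i\<in>I. V1 i \<omega>)
      = distr (N \<Otimes>\<^sub>M N) (PiM I (\<lambda>_. borel)) (\<lambda>\<omega>. \<lambda>i\<in>I. V2 i \<omega>)"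
  proof (rule cramer_wold[OF NN.prob_space_axioms NN.prob_space_axioms I m1 m2])
    fix \<theta> :: "bool \<times> nat \<times> nat \<times> bool \<Rightarrow> real"
    define L1 where "L1 = (\<Sum>q\<in>Ix d. \<theta> (True, q) *\<^sub>R bv q)"
    define L2 where "L2 = (\<Sum>q\<in>Ix d. \<theta> (False, q) *\<^sub>R bv q)"
    have s1: "(\<Sum>i\<in>I. \<theta> i * V1 i p) = inner (c *\<^sub>R L1 - s *\<^sub>R L2) (G (fst p)) + inner (s *\<^sub>R L1 + c *\<^sub>R L2) (G (snd p))" for p
    proof -
      have "(\<Sum>i\<in>I. \<theta> i * V1 i p) = inner L1 (X1 p) + inner L2 (X2 p)"
        unfolding sumI V1_def L1_def L2_def by (simp add: inner_sum_left)
      also have "\<dots> = inner (c *\<^sub>R L1 - s *\<^sub>R L2) (G (fst p)) + inner (s *\<^sub>R L1 + c *\<^sub>R L2) (G (snd p))"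
        by (simp add: X1_def X2_def inner_add_left inner_add_right inner_diff_left algebra_simps)
      finally show ?thesis .
    qed
    have s2: "(\<Sum>i\<in>I. \<theta> i * V2 i p) = inner L1 (G (fst p)) + inner L2 (G (snd p))" for p
      unfolding sumI V2_def L1_def L2_def by (simp add: inner_sum_left)
    have "(LINT \<omega>|N. (inner (c *\<^sub>R L1 - s *\<^sub>R L2) (G \<omega>))\<^sup>2) + (LINT \<omega>|N. (inner (s *\<^sub>R L1 + c *\<^sub>R L2) (G \<omega>))\<^sup>2)
        = (LINT \<omega>|N. (inner (c *\<^sub>R L1 - s *\<^sub>R L2) (G \<omega>))\<^sup>2 + (inner (s *\<^sub>R L1 + c *\<^sub>R L2) (G \<omega>))\<^sup>2)"
      by (rule Bochner_Integration.integral_add[symmetric]) (rule G_int2)+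
    also have "\<dots> = (LINT \<omega>|N. (inner L1 (G \<omega>))\<^sup>2 + (inner L2 (G \<omega>))\<^sup>2)"
    proof (intro Bochner_Integration.integral_cong refl)
      fix \<omega>
      define x y where "x = inner L1 (G \<omega>)" and "y = inner L2 (G \<omega>)"
      have "(c * x - s * y)\<^sup>2 + (s * x + c * y)\<^sup>2 = (c\<^sup>2 + s\<^sup>2) * (x\<^sup>2 + y\<^sup>2)"
        by (simp add: power2_eq_square algebra_simps)
      then show "(inner (c *\<^sub>R L1 - s *\<^sub>R L2) (G \<omega>))\<^sup>2 + (inner (s *\<^sub>R L1 + c *\<^sub>R L2) (G \<omega>))\<^sup>2
          = (inner L1 (G \<omega>))\<^sup>2 + (inner L2 (G \<omega>))\<^sup>2"
        unfolding x_def y_def cs by (simp add: inner_diff_left inner_add_left)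
    qed
    also have "\<dots> = (LINT \<omega>|N. (inner L1 (G \<omega>))\<^sup>2) + (LINT \<omega>|N. (inner L2 (G \<omega>))\<^sup>2)"
      by (rule Bochner_Integration.integral_add) (rule G_int2)+
    finally show "(CLINT p|(N \<Otimes>\<^sub>M N). iexp (\<Sum>i\<in>I. \<theta> i * V1 i p)) = (CLINT p|(N \<Otimes>\<^sub>M N). iexp (\<Sum>i\<in>I. \<theta> i * V2 i p))"
      unfolding s1 s2 char_pair by simp
  qed
  have r1: "(\<lambda>\<omega>. \<lambda>i\<in>I. V1 i \<omega>) \<in> N \<Otimes>\<^sub>M N \<rightarrow>\<^sub>M PiM I (\<lambda>_. borel)" by (rule measurable_restrict) (rule m1)
  have r2: "(\<lambda>\<omega>. \<lambda>i\<in>I. V2 i \<omega>) \<in> N \<Otimes>\<^sub>M N \<rightarrow>\<^sub>M PiM I (\<lambda>_. borel)" by (rule measurable_restrict) (rule m2)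
  have Im: "(r, q) \<in> I" if "q \<in> Ix d" for r q using that by (simp add: I_def)
  have mk1: "mk (\<lambda>i\<in>I. V1 i p) = (X1 p, X2 p)" if "p \<in> space (N \<Otimes>\<^sub>M N)" for p
  proof -
    have "bd (G (fst p)) d" "bd (G (snd p)) d" using that G_bd by (auto simp: space_pair_measure)
    then have "bd (X1 p) d" "bd (X2 p) d" unfolding X1_def X2_def by (intro bd_add bd_scaleR; simp)+
    from fm_expand[OF this(1)] fm_expand[OF this(2)] show ?thesis
      by (simp add: mk_def Im V1_def cong: sum.cong)
  qed
  have mk2: "mk (\<lambda>i\<in>I. V2 i p) = (G (fst p), G (snd p))" if "p \<in> space (N \<Otimes>\<^sub>M N)" for p
  proof -
    have "bd (G (fst p)) d" "bd (G (snd p)) d" using that G_bd by (auto simp: space_pair_measure)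
    from fm_expand[OF this(1)] fm_expand[OF this(2)] show ?thesis
      by (simp add: mk_def Im V2_def cong: sum.cong)
  qed
  have "(LINT p|(N \<Otimes>\<^sub>M N). \<Phi> (X1 p, X2 p)) = (LINT p|(N \<Otimes>\<^sub>M N). \<Phi> (mk (\<lambda>i\<in>I. V1 i p)))"
    by (intro Bochner_Integration.integral_cong refl) (simp add: mk1)
  also have "\<dots> = (LINT x|(distr (N \<Otimes>\<^sub>M N) (PiM I (\<lambda>_. borel)) (\<lambda>\<omega>. \<lambda>i\<in>I. V1 i \<omega>)). \<Phi> (mk x))"
    by (rule integral_distr[symmetric, OF r1]) measurable
  also have "\<dots> = (LINT p|(N \<Otimes>\<^sub>M N). \<Phi> (mk (\<lambda>i\<in>I. V2 i p)))"
    unfolding eq by (rule integral_distr[OF r2]) measurable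
  also have "\<dots> = (LINT p|(N \<Otimes>\<^sub>M N). \<Phi> (G (fst p), G (snd p)))"
    by (intro Bochner_Integration.integral_cong refl) (simp add: mk2)
  finally show ?thesis by (simp add: X1_def X2_def)
qed

definition "Cov p q = (LINT \<omega>|N. inner (bv p) (G \<omega>) * inner (bv q) (G \<omega>))"

end

locale gaussian_psi = gaussian_fm N G d + psi_fun \<psi> \<psi>1 \<psi>2 \<psi>3
  for N :: "'b measure" and G d and \<psi> \<psi>1 \<psi>2 \<psi>3 :: "real \<Rightarrow> real"
begin

text \<open>The Hessian of the functional at Y contracted with the covariance of G. It depends on G
  through second moments only, hence is the same for the independent sum.\<close>

definition "VV m Y = (\<Sum>p\<in>Ix d. \<Sum>q\<in>Ix d. Cov p q * f2 d m Y (bv p) (bv q))"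

lemma f1_expand: "bd A d \<Longrightarrow> f1 d m Y A = (\<Sum>p\<in>Ix d. inner (bv p) A * f1 d m Y (bv p))"
  by (subst fm_expand[of A d]) (simp_all add: f1_sum f1_scaleR)

lemma f2_expand:
  assumes "bd A d"
  shows "f2 d m Y A A = (\<Sum>p\<in>Ix d. \<Sum>q\<in>Ix d. inner (bv p) A * inner (bv q) A * f2 d m Y (bv p) (bv q))"
proof -
  have "f2 d m Y A A = (\<Sum>p\<in>Ix d. inner (bv p) A * f2 d m Y (bv p) A)"
    using arg_cong[where f = "\<lambda>B. f2 d m Y B A", OF fm_expand[OF assms]]
    by (simp only: f2_sum_left f2_scaleR_left)
  moreover have "f2 d m Y B A = (\<Sum>q\<in>Ix d. inner (bv q) A * f2 d m Y B (bv q))" for B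
    using arg_cong[where f = "\<lambda>A. f2 d m Y B A", OF fm_expand[OF assms]]
    by (simp only: f2_sum_right f2_scaleR_right)
  ultimately show ?thesis by (simp add: sum_distrib_left mult.assoc)
qed

lemma VV_eq: "(LINT \<omega>|N. f2 d m Y (G \<omega>) (G \<omega>)) = VV m Y"
proof -
  have "(LINT \<omega>|N. f2 d m Y (G \<omega>) (G \<omega>))
      = (LINT \<omega>|N. (\<Sum>p\<in>Ix d. \<Sum>q\<in>Ix d. inner (bv p) (G \<omega>) * inner (bv q) (G \<omega>) * f2 d m Y (bv p) (bv q)))"
    by (intro Bochner_Integration.integral_cong refl f2_expand G_bd)
  also have "\<dots> = VV m Y"
    unfolding VV_def Cov_def
    by (simp add: Bochner_Integration.integral_sum Bochner_Integration.integrable_sum integrable_mult_left G_int_prod)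
  finally show ?thesis .
qed

lemma f1_G_mean: "(LINT \<omega>|N. f1 d m Y (G \<omega>)) = 0"
proof -
  have "(LINT \<omega>|N. f1 d m Y (G \<omega>)) = (LINT \<omega>|N. (\<Sum>p\<in>Ix d. inner (bv p) (G \<omega>) * f1 d m Y (bv p)))"
    by (intro Bochner_Integration.integral_cong refl f1_expand G_bd)
  also have "\<dots> = 0"
    by (subst Bochner_Integration.integral_sum) (auto simp: G_mean intro!: integrable_mult_left G_int1)
  finally show ?thesis .
qed

text \<open>Integration by parts: differentiate the identity \<open>E (D f (U + b G\<^sub>t) [G\<^sub>t']) = 0\<close>,
  where \<open>(G\<^sub>t, G\<^sub>t')\<close> is the pair of two independent copies rotated by the angle \<open>t\<close>.\<close>

lemma gauss_ibp:
  assumes d: "1 \<le> d" and m: "1 \<le> m" and U: "U \<in> sad d"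
  shows "(LINT \<omega>|N. f1 d m (U + b *\<^sub>R G \<omega>) (G \<omega>)) = b * (LINT \<omega>|N. VV m (U + b *\<^sub>R G \<omega>))"
proof -
  define P where "P = N \<Otimes>\<^sub>M N"
  define cv where "cv t p = U + b *\<^sub>R (cos t *\<^sub>R G (fst p) + sin t *\<^sub>R G (snd p))" for t p
  define A where "A t p = - sin t *\<^sub>R G (fst p) + cos t *\<^sub>R G (snd p)" for t p
  define A' where "A' t p = - cos t *\<^sub>R G (fst p) - sin t *\<^sub>R G (snd p)" for t p
  define H where "H t p = f1 d m (cv t p) (A t p)" for t p
  define H' where "H' t p = f2 d m (cv t p) (A t p) (b *\<^sub>R A t p) + f1 d m (cv t p) (A' t p)" for t p
  have [measurable]: "cv t \<in> P \<rightarrow>\<^sub>M FM" "A t \<in> P \<rightarrow>\<^sub>M FM" "A' t \<in> P \<rightarrow>\<^sub>M FM" for t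
    by (auto simp: cv_def[abs_def] A_def[abs_def] A'_def[abs_def] P_def)
  have sad: "G (fst p) \<in> sad d" "G (snd p) \<in> sad d" if "p \<in> space P" for p
    using that G_sad by (auto simp: P_def space_pair_measure)
  have cvs: "cv t p \<in> sad d" and As: "A t p \<in> sad d" if "p \<in> space P" for t p
    unfolding cv_def A_def by (intro sad_add sad_scaleR sad_diff U sad[OF that])+
  have cvd: "((\<lambda>t. cv t p) has_vector_derivative b *\<^sub>R A t p) (at t)" for t p
    unfolding cv_def A_def by (auto intro!: derivative_eq_intros curve_deriv)
  have Ad: "((\<lambda>t. A t p) has_vector_derivative A' t p) (at t)" for t p
    unfolding A_def A'_def by (auto intro!: derivative_eq_intros)
  define n where "n p = norm (G (fst p)) + norm (G (snd p))" for p
  have n0: "0 \<le> n p" for p by (simp add: n_def)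
  have nA: "norm (A t p) \<le> n p" for t p
    unfolding A_def n_def by (rule norm_rot_le) auto
  have nA': "norm (A' t p) \<le> n p" for t p
    using norm_rot_le[of "- cos t" "- sin t" "G (fst p)" "G (snd p)"] unfolding A'_def n_def by simp
  have ncv: "norm (cv t p) \<le> norm U + \<bar>b\<bar> * n p" for t p
    unfolding cv_def n_def
    by (rule order_trans[OF norm_triangle_ineq]) (auto intro!: mult_left_mono norm_rot_le)
  define E where "E p = exp (4 * real m * (norm U + \<bar>b\<bar> * n p))" for p
  have ecv: "exp (4 * real m * norm (cv t p)) \<le> E p" for t p
    unfolding E_def using ncv[of t p] by (auto intro!: mult_left_mono)
  define c where "c = 4 * real m * \<bar>b\<bar> + 2"
  have c0: "0 \<le> c" by (simp add: c_def)
  have en: "n p \<le> exp (2 * n p)" "(n p)\<^sup>2 \<le> exp (2 * n p)" for p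
  proof -
    have 1: "1 + n p \<le> exp (n p)" by (rule exp_ge_add_one_self)
    have 2: "exp (2 * n p) = (exp (n p))\<^sup>2" by (simp add: power2_eq_square exp_add[symmetric])
    have 3: "n p \<le> exp (n p)" using 1 by linarith
    show "(n p)\<^sup>2 \<le> exp (2 * n p)" unfolding 2 by (rule power_mono[OF 3 n0])
    show "n p \<le> exp (2 * n p)" by (rule order_trans[OF 3]) (use n0[of p] in simp)
  qed
  have E2: "exp (2 * n p) * E p = exp (4 * real m * norm U) * exp (c * n p)" for p
    by (simp add: E_def c_def exp_add[symmetric] algebra_simps)
  define K where "K = KK d m"
  have K0: "0 \<le> K" by (simp add: K_def KK_nonneg)
  define C where "C = K * (\<bar>b\<bar> + 1) * exp (4 * real m * norm U)"
  have f1b: "\<bar>f1 d m (cv t p) B\<bar> \<le> K * exp (2 * n p) * E p" if "p \<in> space P" "norm B \<le> n p" for t p B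
  proof -
    have "\<bar>f1 d m (cv t p) B\<bar> \<le> K * norm B * exp (4 * real m * norm (cv t p))"
      unfolding K_def by (rule f1_growth[OF d m cvs[OF that(1)]])
    also have "\<dots> \<le> K * exp (2 * n p) * E p"
      using that(2) en(1)[of p] K0 by (intro mult_mono ecv) (auto simp: E_def)
    finally show ?thesis .
  qed
  have Hb: "\<bar>H t p\<bar> \<le> C * exp (c * n p)" if "p \<in> space P" for t p
  proof -
    have "\<bar>H t p\<bar> \<le> K * exp (2 * n p) * E p" unfolding H_def by (rule f1b[OF that nA])
    also have "\<dots> = K * (exp (4 * real m * norm U) * exp (c * n p))" unfolding mult.assoc E2 ..
    also have "\<dots> \<le> C * exp (c * n p)"
      unfolding C_def mult.assoc
      using mult_right_mono[of 1 "\<bar>b\<bar> + 1" "exp (4 * real m * norm U) * exp (c * n p)"] K0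
      by (intro mult_left_mono) (simp_all add: mult.assoc)
    finally show ?thesis .
  qed
  have H'b: "\<bar>H' t p\<bar> \<le> C * exp (c * n p)" if "p \<in> space P" for t p
  proof -
    have "\<bar>f2 d m (cv t p) (A t p) (b *\<^sub>R A t p)\<bar> \<le> K * norm (A t p) * norm (b *\<^sub>R A t p) * exp (4 * real m * norm (cv t p))"
      unfolding K_def by (rule f2_growth[OF d m cvs[OF that]])
    also have "\<dots> \<le> K * n p * (\<bar>b\<bar> * n p) * E p"
      using nA[of t p] n0[of p] K0 by (intro mult_mono ecv) (auto simp: E_def intro!: mult_left_mono)
    also have "\<dots> = \<bar>b\<bar> * K * ((n p)\<^sup>2 * E p)" by (simp add: power2_eq_square)
    also have "\<dots> \<le> \<bar>b\<bar> * K * (exp (2 * n p) * E p)"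
      using en(2)[of p] K0 by (intro mult_left_mono mult_right_mono) (auto simp: E_def)
    finally have 1: "\<bar>f2 d m (cv t p) (A t p) (b *\<^sub>R A t p)\<bar> \<le> \<bar>b\<bar> * K * (exp (2 * n p) * E p)" .
    have 2: "\<bar>f1 d m (cv t p) (A' t p)\<bar> \<le> K * (exp (2 * n p) * E p)"
      using f1b[OF that nA'] by (simp add: mult.assoc)
    have "\<bar>H' t p\<bar> \<le> \<bar>b\<bar> * K * (exp (2 * n p) * E p) + K * (exp (2 * n p) * E p)"
      unfolding H'_def by (rule order_trans[OF abs_triangle_ineq add_mono[OF 1 2]])
    also have "\<dots> = C * exp (c * n p)" unfolding E2 C_def by (simp add: algebra_simps)
    finally show ?thesis .
  qed
  have [measurable]: "H t \<in> borel_measurable P" "H' t \<in> borel_measurable P" for t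
    by (auto simp: H_def[abs_def] H'_def[abs_def])
  have Hint: "integrable P (H t)" for t
    unfolding P_def by (rule pair_integrable_bound[OF _ c0, of _ C])
      (use Hb in \<open>auto simp: P_def[symmetric] n_def\<close>)
  have H'int: "integrable P (H' t)" for t
    unfolding P_def by (rule pair_integrable_bound[OF _ c0, of _ C])
      (use H'b in \<open>auto simp: P_def[symmetric] n_def\<close>)
  have wint: "integrable P (\<lambda>p. C * exp (c * n p))"
    using exp_norm_pair_integrable[OF c0] by (simp add: P_def n_def)
  have D: "((\<lambda>t. LINT p|P. H t p) has_real_derivative (LINT p|P. H' t p)) (at t)" for t
  proof (rule DERIV_integral[OF Hint wint])
    show "((\<lambda>t. H t p) has_real_derivative H' t p) (at t)" if p: "p \<in> space P" for t p
      unfolding H_def H'_def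
      by (rule DERIV_f1[OF cvd cvs[OF p] _ d Ad]) (use As[OF p, of t] in \<open>auto simp: sad_def intro!: bd_scaleR\<close>)
  qed (use H'b in auto)
  \<comment> \<open>Rotated back, the direction is a copy of G independent of the base point; it is
    centred and the derivative is linear in it.\<close>
  have Hzero: "(LINT p|P. H t p) = 0" for t
  proof -
    have "(LINT p|P. H t p) = (LINT p|P. f1 d m (U + b *\<^sub>R G (fst p)) (G (snd p)))"
      using rotation[of "cos t" "sin t" "\<lambda>z. f1 d m (U + b *\<^sub>R fst z) (snd z)"]
      by (simp add: H_def cv_def A_def P_def)
    also have "\<dots> = (LINT x|N. LINT y|N. f1 d m (U + b *\<^sub>R G x) (G y))"
      using NN.integral_fst'[of "\<lambda>p. f1 d m (U + b *\<^sub>R G (fst p)) (G (snd p))"] Hint[of 0]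
      by (simp add: H_def[abs_def] cv_def A_def P_def)
    also have "\<dots> = 0" by (simp add: f1_G_mean)
    finally show ?thesis .
  qed
  have "(LINT p|P. H' 0 p) = 0"
    using D[of 0] unfolding Hzero using DERIV_unique DERIV_const by blast
  \<comment> \<open>At angle 0 the base point contains the first copy and the direction is the
    second one. The moving base point produces the Hessian term, and the moving direction, whose
    derivative is minus the first copy, produces the left-hand side of the claim.\<close>
  moreover have "(LINT p|P. H' 0 p) = (LINT x|N. b * VV m (U + b *\<^sub>R G x) - f1 d m (U + b *\<^sub>R G x) (G x))"
  proof -
    have "(LINT p|P. H' 0 p) = (LINT x|N. LINT y|N. H' 0 (x, y))"
      using NN.integral_fst'[of "H' 0"] H'int[of 0] by (simp add: P_def)
    also have "\<dots> = (LINT x|N. b * VV m (U + b *\<^sub>R G x) - f1 d m (U + b *\<^sub>R G x) (G x))"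
    proof (intro Bochner_Integration.integral_cong refl)
      fix x assume x: "x \<in> space N"
      have fi: "integrable N (\<lambda>y. f2 d m (U + b *\<^sub>R G x) (G y) (G y))"
        by (subst Bochner_Integration.integrable_cong[OF refl f2_expand[OF G_bd]])
          (auto intro!: Bochner_Integration.integrable_sum integrable_mult_left G_int_prod)
      have "(LINT y|N. H' 0 (x, y)) = (LINT y|N. b * f2 d m (U + b *\<^sub>R G x) (G y) (G y) - f1 d m (U + b *\<^sub>R G x) (G x))"
        using f1_scaleR[of d m "U + b *\<^sub>R G x" "-1" "G x"]
        by (simp add: H'_def cv_def A_def A'_def f2_scaleR_right)
      also have "\<dots> = b * VV m (U + b *\<^sub>R G x) - f1 d m (U + b *\<^sub>R G x) (G x)"
        using fi by (simp add: VV_eq N.prob_space)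
      finally show "(LINT y|N. H' 0 (x, y)) = b * VV m (U + b *\<^sub>R G x) - f1 d m (U + b *\<^sub>R G x) (G x)" .
    qed
    finally show ?thesis .
  qed
  moreover have i1: "integrable N (\<lambda>x. f1 d m (U + b *\<^sub>R G x) (G x))"
    and i2: "integrable N (\<lambda>x. VV m (U + b *\<^sub>R G x))"
  proof -
    have ex: "integrable N (\<lambda>x. exp (c * norm (G x)))" by (rule exp_norm_integrable[OF c0])
    have bnd: "norm Y * exp (4 * real m * norm (U + b *\<^sub>R Y)) \<le> exp (4 * real m * norm U) * exp (c * norm Y)"
      "exp (4 * real m * norm (U + b *\<^sub>R Y)) \<le> exp (4 * real m * norm U) * exp (c * norm Y)" for Y
    proof -
      have 1: "norm Y \<le> exp (2 * norm Y)" using exp_ge_add_one_self[of "2 * norm Y"] norm_ge_zero[of Y] by linarith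
      have 2: "exp (4 * real m * norm (U + b *\<^sub>R Y)) \<le> exp (4 * real m * (norm U + \<bar>b\<bar> * norm Y))"
        using norm_triangle_ineq[of U "b *\<^sub>R Y"] by (auto intro!: mult_left_mono)
      have "norm Y * exp (4 * real m * norm (U + b *\<^sub>R Y)) \<le> exp (2 * norm Y) * exp (4 * real m * (norm U + \<bar>b\<bar> * norm Y))"
        by (intro mult_mono 1 2) auto
      also have "\<dots> = exp (4 * real m * norm U) * exp (c * norm Y)"
        by (simp add: c_def exp_add[symmetric] algebra_simps)
      finally show "norm Y * exp (4 * real m * norm (U + b *\<^sub>R Y)) \<le> exp (4 * real m * norm U) * exp (c * norm Y)" .
      have "exp (4 * real m * (norm U + \<bar>b\<bar> * norm Y)) \<le> exp (4 * real m * norm U) * exp (c * norm Y)"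
        by (simp add: c_def exp_add[symmetric] algebra_simps)
      with 2 show "exp (4 * real m * norm (U + b *\<^sub>R Y)) \<le> exp (4 * real m * norm U) * exp (c * norm Y)" by linarith
    qed
    have Us: "U + b *\<^sub>R G x \<in> sad d" if "x \<in> space N" for x
      by (intro sad_add sad_scaleR U G_sad that)
    show "integrable N (\<lambda>x. f1 d m (U + b *\<^sub>R G x) (G x))"
    proof (rule Bochner_Integration.integrable_bound)
      show "integrable N (\<lambda>x. K * (exp (4 * real m * norm U) * exp (c * norm (G x))))" using ex by simp
      show "AE x in N. norm (f1 d m (U + b *\<^sub>R G x) (G x)) \<le> norm (K * (exp (4 * real m * norm U) * exp (c * norm (G x))))"
      proof (rule AE_I2)
        fix x assume "x \<in> space N"
        from f1_growth[OF d m Us[OF this], of "G x"] mult_left_mono[OF bnd(1)[of "G x"] K0]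
        show "norm (f1 d m (U + b *\<^sub>R G x) (G x)) \<le> norm (K * (exp (4 * real m * norm U) * exp (c * norm (G x))))"
          using K0 by (simp add: K_def mult.assoc)
      qed
    qed measurable
    have f2i: "integrable N (\<lambda>x. f2 d m (U + b *\<^sub>R G x) (bv p) (bv q))" for p q
    proof (rule Bochner_Integration.integrable_bound)
      show "integrable N (\<lambda>x. K * (exp (4 * real m * norm U) * exp (c * norm (G x))))" using ex by simp
      show "AE x in N. norm (f2 d m (U + b *\<^sub>R G x) (bv p) (bv q)) \<le> norm (K * (exp (4 * real m * norm U) * exp (c * norm (G x))))"
      proof (rule AE_I2)
        fix x assume "x \<in> space N"
        from f2_growth[OF d m Us[OF this], of "bv p" "bv q"] mult_left_mono[OF bnd(2)[of "G x"] K0]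
        show "norm (f2 d m (U + b *\<^sub>R G x) (bv p) (bv q)) \<le> norm (K * (exp (4 * real m * norm U) * exp (c * norm (G x))))"
          using K0 by (simp add: K_def mult.assoc norm_bv)
      qed
    qed measurable
    then show "integrable N (\<lambda>x. VV m (U + b *\<^sub>R G x))"
      unfolding VV_def by (intro Bochner_Integration.integrable_sum integrable_mult_right)
  qed
  ultimately show ?thesis by simp
qed

end

section \<open>Gaussian concentration\<close>

lemma one_minus_cos_le: "1 - cos x \<le> x\<^sup>2 / (2::real)"
proof -
  have "1 - cos x = 2 * (sin (x / 2))\<^sup>2" using cos_double_sin[of "x / 2"] by simp
  also have "(sin (x / 2))\<^sup>2 \<le> (x / 2)\<^sup>2" by (rule abs_le_square_iff[THEN iffD1, OF abs_sin_x_le_abs_x])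
  finally show ?thesis by (simp add: power2_eq_square)
qed

lemma exp_sum_le_average:
  fixes x :: "nat \<Rightarrow> real"
  assumes n: "0 < n"
  shows "exp (\<Sum>j<n. x j) \<le> (\<Sum>j<n. exp (real n * x j)) / real n"
proof -
  have "exp (\<Sum>j<n. (1 / real n) *\<^sub>R (real n * x j)) \<le> (\<Sum>j<n. (1 / real n) * exp (real n * x j))"
    by (rule convex_on_sum[OF _ _ exp_convex]) (use n in auto)
  then show ?thesis using n by (simp add: sum_divide_distrib)
qed

context gaussian_fm
begin

text \<open>The Maurey-Pisier rotation argument, for a function f that is a maximum of linear
  functionals and so need not be differentiable. The quarter circle from one copy of G to the other
  is cut into n arcs. On each arc f is compared with the functional that attains it at one end, the
  exponential of the sum over the arcs is bounded by an average through convexity, and rotation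
  invariance makes all arcs alike.\<close>

lemma concentration_aux:
  fixes f :: "fm \<Rightarrow> real" and S :: "fm set"
  assumes f[measurable]: "f \<in> borel_measurable FM"
    and ex: "\<And>x. x \<in> sad d \<Longrightarrow> \<exists>L\<in>S. f x = inner L x"
    and le: "\<And>x L. x \<in> sad d \<Longrightarrow> L \<in> S \<Longrightarrow> inner L x \<le> f x"
    and nL: "\<And>L. L \<in> S \<Longrightarrow> norm L \<le> 1"
    and v: "\<And>L. L \<in> S \<Longrightarrow> (LINT \<omega>|N. (inner L (G \<omega>))\<^sup>2) \<le> v"
    and Z0: "Z0 \<in> sad d" and b: "0 \<le> b"
  shows "integrable N (\<lambda>\<omega>. exp (c * f (Z0 + G \<omega>)))" (is ?A)
    and "integrable N (\<lambda>\<omega>. f (Z0 + G \<omega>))" (is ?B)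
    and "(LINT p|(N \<Otimes>\<^sub>M N). exp (b * (f (Z0 + G (fst p)) - f (Z0 + G (snd p))))) \<le> exp (pi\<^sup>2 * b\<^sup>2 * v / 8)" (is ?C)
proof -
  have lip1: "\<exists>L\<in>S. f x - f y \<le> inner L (x - y)" if "x \<in> sad d" "y \<in> sad d" for x y
    using ex[OF that(1)] le[OF that(2)] by (metis diff_left_mono inner_diff_right)
  have lip: "\<bar>f x - f y\<bar> \<le> norm (x - y)" if "x \<in> sad d" "y \<in> sad d" for x y
  proof -
    have *: "f x - f y \<le> norm (x - y)" if xy: "x \<in> sad d" "y \<in> sad d" for x y
    proof -
      obtain L where L: "L \<in> S" "f x - f y \<le> inner L (x - y)" using lip1[OF xy] by auto
      have "inner L (x - y) \<le> norm L * norm (x - y)" by (rule norm_cauchy_schwarz)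
      also have "\<dots> \<le> 1 * norm (x - y)" using nL[OF L(1)] by (intro mult_right_mono) auto
      finally show ?thesis using L by simp
    qed
    show ?thesis using *[OF that] *[OF that(2,1)] by (auto simp: abs_le_iff norm_minus_commute)
  qed
  have sadG: "Z0 + G w \<in> sad d" if "w \<in> space N" for w
    by (intro sad_add Z0 G_sad that)
  have hb: "\<bar>f (Z0 + G w)\<bar> \<le> \<bar>f Z0\<bar> + norm (G w)" if "w \<in> space N" for w
    using lip[OF sadG[OF that] Z0] by simp
  have expi: "integrable N (\<lambda>\<omega>. exp (c * f (Z0 + G \<omega>)))" for c
  proof (rule Bochner_Integration.integrable_bound)
    show "integrable N (\<lambda>\<omega>. exp (\<bar>c\<bar> * \<bar>f Z0\<bar>) * exp (\<bar>c\<bar> * norm (G \<omega>)))"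
      using exp_norm_integrable[of "\<bar>c\<bar>"] by simp
    show "AE \<omega> in N. norm (exp (c * f (Z0 + G \<omega>))) \<le> norm (exp (\<bar>c\<bar> * \<bar>f Z0\<bar>) * exp (\<bar>c\<bar> * norm (G \<omega>)))"
    proof (rule AE_I2)
      fix w assume w: "w \<in> space N"
      have "c * f (Z0 + G w) \<le> \<bar>c\<bar> * \<bar>f (Z0 + G w)\<bar>" by (metis abs_ge_self abs_mult)
      also have "\<dots> \<le> \<bar>c\<bar> * (\<bar>f Z0\<bar> + norm (G w))" by (intro mult_left_mono hb[OF w]) auto
      finally show "norm (exp (c * f (Z0 + G w))) \<le> norm (exp (\<bar>c\<bar> * \<bar>f Z0\<bar>) * exp (\<bar>c\<bar> * norm (G w)))"
        by (simp add: exp_add[symmetric] distrib_left)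
    qed
  qed auto
  show ?A by (rule expi)
  show ?B
  proof (rule Bochner_Integration.integrable_bound)
    show "integrable N (\<lambda>\<omega>. exp (1 * f (Z0 + G \<omega>)) + exp (- 1 * f (Z0 + G \<omega>)))"
      by (intro Bochner_Integration.integrable_add expi)
    show "AE \<omega> in N. norm (f (Z0 + G \<omega>)) \<le> norm (exp (1 * f (Z0 + G \<omega>)) + exp (- 1 * f (Z0 + G \<omega>)))"
    proof (rule AE_I2)
      fix w
      have "\<bar>x\<bar> \<le> exp x + exp (- x)" for x :: real
        using exp_ge_add_one_self[of x] exp_ge_add_one_self[of "-x"] exp_gt_zero[of x] exp_gt_zero[of "-x"]
        by (cases "0 \<le> x") linarith+
      then show "norm (f (Z0 + G w)) \<le> norm (exp (1 * f (Z0 + G w)) + exp (- 1 * f (Z0 + G w)))"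
        using abs_ge_self order_trans by auto
    qed
  qed auto
  \<comment> \<open>An arc contributes a centred Gaussian functional with coefficient n b sin (pi /
    (2n)), at most b pi / 2; half of the square of this, times v, is the exponent.\<close>
  define K where "K = exp (pi\<^sup>2 * b\<^sup>2 * v / 8)"
  \<comment> \<open>The second-order error of an arc: 1 - cos (pi / (2n)) is of order 1 / n^2 and is
    multiplied by n, so it disappears as the number of arcs grows.\<close>
  define J where "J n = (LINT \<omega>|N. exp (b * pi\<^sup>2 / 8 / real (Suc n) * norm (G \<omega>)))" for n
  have step: "(LINT p|(N \<Otimes>\<^sub>M N). exp (b * (f (Z0 + G (fst p)) - f (Z0 + G (snd p))))) \<le> K * J k" for k
  proof -
    define n where "n = Suc k"
    define del where "del = pi / (2 * real n)"
    have n: "0 < n" by (simp add: n_def)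
    have del: "0 \<le> del" "del \<le> pi" "real n * del = pi / 2" using n by (auto simp: del_def field_simps)
    define X where "X j p = Z0 + (sin (real j * del) *\<^sub>R G (fst p) + cos (real j * del) *\<^sub>R G (snd p))" for j p
    have Xm[measurable]: "X j \<in> N \<Otimes>\<^sub>M N \<rightarrow>\<^sub>M FM" for j by (simp add: X_def[abs_def])
    define nn where "nn p = norm (G (fst p)) + norm (G (snd p))" for p
    have sadp: "G (fst p) \<in> sad d" "G (snd p) \<in> sad d" if "p \<in> space (N \<Otimes>\<^sub>M N)" for p
      using that G_sad by (auto simp: space_pair_measure)
    have Xs: "X j p \<in> sad d" if "p \<in> space (N \<Otimes>\<^sub>M N)" for j p
      unfolding X_def by (intro sad_add sad_scaleR Z0 sadp[OF that])
    have nX: "norm (X j p - Z0) \<le> nn p" for j p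
      unfolding X_def nn_def using norm_rot_le[of "sin (real j * del)" "cos (real j * del)"] by simp
    have Ei: "integrable (N \<Otimes>\<^sub>M N) (\<lambda>p. exp (c * (f (X i p) - f (X j p))))" for c i j
    proof (rule pair_integrable_bound[where c = "2 * \<bar>c\<bar>" and C = 1])
      fix p assume p: "p \<in> space (N \<Otimes>\<^sub>M N)"
      have "c * (f (X i p) - f (X j p)) \<le> \<bar>c\<bar> * \<bar>f (X i p) - f (X j p)\<bar>" by (metis abs_ge_self abs_mult)
      also have "\<dots> \<le> \<bar>c\<bar> * (2 * nn p)"
      proof (rule mult_left_mono)
        have "\<bar>f (X i p) - f (X j p)\<bar> \<le> norm ((X i p - Z0) - (X j p - Z0))"
          using lip[OF Xs[OF p] Xs[OF p], of i j] by simp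
        also have "\<dots> \<le> nn p + nn p" by (rule order_trans[OF norm_triangle_ineq4 add_mono[OF nX nX]])
        finally show "\<bar>f (X i p) - f (X j p)\<bar> \<le> 2 * nn p" by simp
      qed simp
      finally show "\<bar>exp (c * (f (X i p) - f (X j p)))\<bar> \<le> 1 * exp (2 * \<bar>c\<bar> * (norm (G (fst p)) + norm (G (snd p))))"
        by (simp add: nn_def mult_ac)
    qed auto
    have B: "(LINT p|(N \<Otimes>\<^sub>M N). exp (real n * (b * (f (X (Suc j) p) - f (X j p))))) \<le> K * J k" for j
    proof -
      define th where "th = real (Suc j) * del"
      define \<Phi> where "\<Phi> = (\<lambda>z. exp (real n * b * (f (Z0 + fst z) - f (Z0 + (cos del *\<^sub>R fst z + sin del *\<^sub>R snd z)))))"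
      have [measurable]: "\<Phi> \<in> borel_measurable (FM \<Otimes>\<^sub>M FM)" unfolding \<Phi>_def by measurable
      have th: "real j * del = th - del" by (simp add: th_def algebra_simps)
      \<comment> \<open>After a rotation by the angle of its end point the arc starts at the first
        copy itself; the second copy enters with the small coefficient sin del.\<close>
      have XX: "exp (real n * (b * (f (X (Suc j) p) - f (X j p))))
          = \<Phi> (sin th *\<^sub>R G (fst p) + cos th *\<^sub>R G (snd p), (- cos th) *\<^sub>R G (fst p) + sin th *\<^sub>R G (snd p))" for p
      proof -
        have "cos del *\<^sub>R (sin th *\<^sub>R G (fst p) + cos th *\<^sub>R G (snd p)) + sin del *\<^sub>R ((- cos th) *\<^sub>R G (fst p) + sin th *\<^sub>R G (snd p))
          = (sin th * cos del - cos th * sin del) *\<^sub>R G (fst p) + (cos th * cos del + sin th * sin del) *\<^sub>R G (snd p)"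
          by (simp add: scaleR_add_right scaleR_diff_left scaleR_add_left scaleR_diff_right algebra_simps)
        also have "\<dots> = sin (real j * del) *\<^sub>R G (fst p) + cos (real j * del) *\<^sub>R G (snd p)"
          unfolding th by (simp add: sin_diff cos_diff)
        finally show ?thesis
          unfolding \<Phi>_def X_def th_def[symmetric] by (simp add: mult.assoc)
      qed
      have "(LINT p|(N \<Otimes>\<^sub>M N). exp (real n * (b * (f (X (Suc j) p) - f (X j p)))))
          = (LINT p|(N \<Otimes>\<^sub>M N). \<Phi> (G (fst p), G (snd p)))"
        unfolding XX using rotation[of "sin th" "cos th" \<Phi>] by simp
      also have "\<dots> = (LINT x|N. LINT y|N. \<Phi> (G x, G y))"
      proof -
        have "integrable (N \<Otimes>\<^sub>M N) (\<lambda>p. \<Phi> (G (fst p), G (snd p)))"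
        proof (rule pair_integrable_bound[where c = "real n * b * 2" and C = 1])
          fix p assume p: "p \<in> space (N \<Otimes>\<^sub>M N)"
          let ?Y = "Z0 + (cos del *\<^sub>R G (fst p) + sin del *\<^sub>R G (snd p))"
          have "f (Z0 + G (fst p)) - f ?Y \<le> norm (G (fst p) - (cos del *\<^sub>R G (fst p) + sin del *\<^sub>R G (snd p)))"
            using lip[of "Z0 + G (fst p)" ?Y] sadp[OF p] Z0 by (auto simp: abs_le_iff intro!: sad_add sad_scaleR)
          also have "\<dots> \<le> norm (G (fst p)) + nn p"
            unfolding nn_def by (rule order_trans[OF norm_triangle_ineq4 add_left_mono[OF norm_rot_le]]) auto
          also have "\<dots> \<le> 2 * nn p" by (simp add: nn_def)
          finally have "real n * b * (f (Z0 + G (fst p)) - f ?Y) \<le> real n * b * (2 * nn p)"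
            using b by (intro mult_left_mono) auto
          then show "\<bar>\<Phi> (G (fst p), G (snd p))\<bar> \<le> 1 * exp (real n * b * 2 * (norm (G (fst p)) + norm (G (snd p))))"
            unfolding \<Phi>_def by (simp add: nn_def mult_ac)
        qed (use b in auto)
        from NN.integral_fst'[OF this] show ?thesis by simp
      qed
      also have "\<dots> \<le> (LINT x|N. K * exp (b * pi\<^sup>2 / 8 / real (Suc k) * norm (G x)))"
      proof (rule integral_mono')
        show "integrable N (\<lambda>x. K * exp (b * pi\<^sup>2 / 8 / real (Suc k) * norm (G x)))"
          using exp_norm_integrable[of "b * pi\<^sup>2 / 8 / real (Suc k)"] b by simp
        fix x assume x: "x \<in> space N"
        \<comment> \<open>The functional depends on x alone. Over y the bound is then the Laplace
          transform of a fixed Gaussian functional.\<close>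
        obtain L where L: "L \<in> S" "f (Z0 + G x) = inner L (Z0 + G x)" using ex[OF sadG[OF x]] by auto
        define a where "a = - (real n * b * sin del)"
        have pw: "\<Phi> (G x, G y) \<le> exp (real n * b * ((1 - cos del) * norm (G x))) * exp (inner (a *\<^sub>R L) (G y))"
          if y: "y \<in> space N" for y
        proof -
          let ?Y = "Z0 + (cos del *\<^sub>R G x + sin del *\<^sub>R G y)"
          have "f (Z0 + G x) - f ?Y \<le> inner L (Z0 + G x) - inner L ?Y"
            unfolding L(2) by (intro diff_left_mono le L sad_add sad_scaleR Z0 G_sad x y)
          also have "\<dots> = (1 - cos del) * inner L (G x) - sin del * inner L (G y)"
            by (simp add: inner_add_right algebra_simps)
          also have "\<dots> \<le> (1 - cos del) * norm (G x) - sin del * inner L (G y)"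
          proof -
            have "inner L (G x) \<le> norm L * norm (G x)" by (rule norm_cauchy_schwarz)
            also have "\<dots> \<le> 1 * norm (G x)" using nL[OF L(1)] by (intro mult_right_mono) auto
            finally show ?thesis by (intro diff_right_mono mult_left_mono) auto
          qed
          finally have "real n * b * (f (Z0 + G x) - f ?Y)
              \<le> real n * b * ((1 - cos del) * norm (G x) - sin del * inner L (G y))"
            using b by (intro mult_left_mono) auto
          then show ?thesis unfolding \<Phi>_def a_def by (simp add: exp_add[symmetric] algebra_simps)
        qed
        have "(LINT y|N. \<Phi> (G x, G y)) \<le> (LINT y|N. exp (real n * b * ((1 - cos del) * norm (G x))) * exp (inner (a *\<^sub>R L) (G y)))"
          by (rule integral_mono') (use pw G_exp[of "a *\<^sub>R L"] in \<open>auto simp: \<Phi>_def\<close>)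
        also have "\<dots> = exp (real n * b * ((1 - cos del) * norm (G x))) * exp ((LINT \<omega>|N. (inner (a *\<^sub>R L) (G \<omega>))\<^sup>2) / 2)"
          by (simp only: integral_mult_right_zero G_mgf)
        also have "\<dots> \<le> exp (b * pi\<^sup>2 / 8 / real (Suc k) * norm (G x)) * K"
        proof (rule mult_mono)
          have "real n * (1 - cos del) \<le> real n * (del\<^sup>2 / 2)" by (intro mult_left_mono one_minus_cos_le) auto
          also have "\<dots> = pi\<^sup>2 / 8 / real n" using n by (simp add: del_def power2_eq_square field_simps)
          finally have "b * (real n * (1 - cos del)) * norm (G x) \<le> b * (pi\<^sup>2 / 8 / real n) * norm (G x)"
            using b by (intro mult_right_mono mult_left_mono) auto
          then show "exp (real n * b * ((1 - cos del) * norm (G x))) \<le> exp (b * pi\<^sup>2 / 8 / real (Suc k) * norm (G x))"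
            by (simp add: n_def mult_ac)
          have "sin del \<le> del" using abs_sin_x_le_abs_x[of del] sin_ge_zero[of del] del by auto
          then have "real n * sin del \<le> pi / 2"
            using mult_left_mono[of "sin del" del "real n"] del(3) by simp
          then have "real n * b * sin del \<le> b * (pi / 2)"
            using b mult_left_mono[of "real n * sin del" "pi / 2" b] by (simp add: mult_ac)
          then have a2: "a\<^sup>2 \<le> (b * (pi / 2))\<^sup>2"
            using b sin_ge_zero[of del] del by (auto simp: a_def intro!: power_mono)
          have "(LINT \<omega>|N. (inner (a *\<^sub>R L) (G \<omega>))\<^sup>2) = a\<^sup>2 * (LINT \<omega>|N. (inner L (G \<omega>))\<^sup>2)"
            by (simp add: power_mult_distrib)
          also have "\<dots> \<le> (b * (pi / 2))\<^sup>2 * v"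
            using v[OF L(1)] by (intro mult_mono a2) (auto intro!: integral_nonneg_AE)
          finally show "exp ((LINT \<omega>|N. (inner (a *\<^sub>R L) (G \<omega>))\<^sup>2) / 2) \<le> K"
            by (simp add: K_def power2_eq_square mult_ac)
        qed auto
        finally show "(LINT y|N. \<Phi> (G x, G y)) \<le> K * exp (b * pi\<^sup>2 / 8 / real (Suc k) * norm (G x))"
          by (simp add: mult.commute)
        show "0 \<le> K * exp (b * pi\<^sup>2 / 8 / real (Suc k) * norm (G x))" by (simp add: K_def)
      qed
      also have "\<dots> = K * J k" by (simp add: J_def)
      finally show ?thesis .
    qed
    have "(LINT p|(N \<Otimes>\<^sub>M N). exp (b * (f (Z0 + G (fst p)) - f (Z0 + G (snd p)))))
        \<le> (LINT p|(N \<Otimes>\<^sub>M N). (\<Sum>j<n. exp (real n * (b * (f (X (Suc j) p) - f (X j p))))) / real n)"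
    proof (rule integral_mono')
      show "integrable (N \<Otimes>\<^sub>M N) (\<lambda>p. (\<Sum>j<n. exp (real n * (b * (f (X (Suc j) p) - f (X j p))))) / real n)"
        using Ei[of "real n * b"] by (intro integrable_divide Bochner_Integration.integrable_sum) (simp add: mult.assoc)
      fix p
      have X0: "X 0 p = Z0 + G (snd p)" by (simp add: X_def)
      have Xn: "X n p = Z0 + G (fst p)" unfolding X_def del(3) by simp
      have "b * (f (Z0 + G (fst p)) - f (Z0 + G (snd p))) = (\<Sum>j<n. b * (f (X (Suc j) p) - f (X j p)))"
        unfolding sum_distrib_left[symmetric] sum_lessThan_telescope[of "\<lambda>j. f (X j p)" n] X0 Xn ..
      then show "exp (b * (f (Z0 + G (fst p)) - f (Z0 + G (snd p)))) \<le> (\<Sum>j<n. exp (real n * (b * (f (X (Suc j) p) - f (X j p))))) / real n"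
        using exp_sum_le_average[OF n, of "\<lambda>j. b * (f (X (Suc j) p) - f (X j p))"] by simp
      show "0 \<le> (\<Sum>j<n. exp (real n * (b * (f (X (Suc j) p) - f (X j p))))) / real n"
        by (intro divide_nonneg_nonneg sum_nonneg) auto
    qed
    also have "\<dots> = (\<Sum>j<n. (LINT p|(N \<Otimes>\<^sub>M N). exp (real n * (b * (f (X (Suc j) p) - f (X j p)))))) / real n"
      using Ei[of "real n * b"] by (simp add: Bochner_Integration.integral_sum mult.assoc)
    also have "\<dots> \<le> (\<Sum>j<n. K * J k) / real n"
      by (intro divide_right_mono sum_mono B) auto
    also have "\<dots> = K * J k" using n by simp
    finally show ?thesis .
  qed
  have "J \<longlonglongrightarrow> (LINT \<omega>|N. exp (0 * norm (G \<omega>)))"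
    unfolding J_def
  proof (rule integral_dominated_convergence)
    show "integrable N (\<lambda>\<omega>. exp (b * pi\<^sup>2 / 8 * norm (G \<omega>)))" by (rule exp_norm_integrable) (use b in auto)
    have "(\<lambda>n. b * pi\<^sup>2 / 8 / real (Suc n)) \<longlonglongrightarrow> 0"
      by (rule tendsto_divide_0[OF tendsto_const]) (rule filterlim_compose[OF filterlim_real_at_infinity_sequentially filterlim_Suc])
    then show "AE \<omega> in N. (\<lambda>n. exp (b * pi\<^sup>2 / 8 / real (Suc n) * norm (G \<omega>))) \<longlonglongrightarrow> exp (0 * norm (G \<omega>))"
      by (intro AE_I2 tendsto_intros)
    show "AE \<omega> in N. norm (exp (b * pi\<^sup>2 / 8 / real (Suc n) * norm (G \<omega>))) \<le> exp (b * pi\<^sup>2 / 8 * norm (G \<omega>))" for n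
    proof (rule AE_I2)
      fix w
      have "b * pi\<^sup>2 / 8 / real (Suc n) \<le> b * pi\<^sup>2 / 8 / 1" using b by (intro divide_left_mono) auto
      from mult_right_mono[OF this, of "norm (G w)"]
      show "norm (exp (b * pi\<^sup>2 / 8 / real (Suc n) * norm (G w))) \<le> exp (b * pi\<^sup>2 / 8 * norm (G w))" by simp
    qed
  qed auto
  then have "(\<lambda>k. K * J k) \<longlonglongrightarrow> K * 1" by (intro tendsto_intros) (simp add: N.prob_space)
  then show ?C using LIMSEQ_le_const[of "\<lambda>k. K * J k" "K * 1"] step by (auto simp: K_def)
qed

text \<open>The moment of the difference of two independent copies is the product of the two
  one-sided moments about the mean. By Jensen's inequality each factor is at least 1, so each is at
  most the product.\<close>

lemma concentration:
  fixes f :: "fm \<Rightarrow> real" and S :: "fm set"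
  assumes f[measurable]: "f \<in> borel_measurable FM"
    and ex: "\<And>x. x \<in> sad d \<Longrightarrow> \<exists>L\<in>S. f x = inner L x"
    and le: "\<And>x L. x \<in> sad d \<Longrightarrow> L \<in> S \<Longrightarrow> inner L x \<le> f x"
    and nL: "\<And>L. L \<in> S \<Longrightarrow> norm L \<le> 1"
    and v: "\<And>L. L \<in> S \<Longrightarrow> (LINT \<omega>|N. (inner L (G \<omega>))\<^sup>2) \<le> v"
    and Z0: "Z0 \<in> sad d" and b: "0 \<le> b"
  defines "\<mu> \<equiv> (LINT \<omega>|N. f (Z0 + G \<omega>))"
  shows "(LINT \<omega>|N. exp (b * (f (Z0 + G \<omega>) - \<mu>))) \<le> exp (pi\<^sup>2 * b\<^sup>2 * v / 8)" (is "?A \<le> ?K")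
    and "(LINT \<omega>|N. exp (- b * (f (Z0 + G \<omega>) - \<mu>))) \<le> exp (pi\<^sup>2 * b\<^sup>2 * v / 8)" (is "?B \<le> ?K")
proof -
  note aux = concentration_aux[OF f ex le nL v Z0 b]
  define h where "h w = f (Z0 + G w) - \<mu>" for w
  have ei: "integrable N (\<lambda>w. exp (c * h w))" for c
  proof -
    have "integrable N (\<lambda>w. exp (c * f (Z0 + G w)) * exp (- c * \<mu>))" using aux(1)[of c] by simp
    then show ?thesis by (simp add: h_def exp_add[symmetric] algebra_simps)
  qed
  have hi: "integrable N h" and h0: "(LINT w|N. h w) = 0"
    using aux(2) by (auto simp: h_def[abs_def] \<mu>_def N.prob_space)
  have ge1: "1 \<le> (LINT w|N. exp (c * h w))" for c
  proof -
    have "(LINT w|N. 1 + c * h w) \<le> (LINT w|N. exp (c * h w))"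
      by (rule integral_mono) (use hi ei exp_ge_add_one_self in \<open>auto\<close>)
    then show ?thesis using hi h0 by (simp add: N.prob_space)
  qed
  have "(LINT w|N. exp (b * h w)) * (LINT w|N. exp (- b * h w))
      = (LINT p|(N \<Otimes>\<^sub>M N). exp (b * h (fst p)) * exp (- b * h (snd p)))"
    by (rule integral_pair_mult[symmetric, OF N.prob_space_axioms N.prob_space_axioms ei ei])
  also have "\<dots> = (LINT p|(N \<Otimes>\<^sub>M N). exp (b * (f (Z0 + G (fst p)) - f (Z0 + G (snd p)))))"
    by (simp add: h_def exp_add[symmetric] algebra_simps)
  also have "\<dots> \<le> ?K" by (rule aux(3))
  finally have prod: "(LINT w|N. exp (b * h w)) * (LINT w|N. exp (- b * h w)) \<le> ?K" .
  have "x \<le> K \<and> y \<le> K" if "1 \<le> x" "1 \<le> y" "x * y \<le> K" for x y K :: real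
  proof -
    have "x * 1 \<le> x * y" "1 * y \<le> x * y"
      using that by (intro mult_left_mono mult_right_mono; simp)+
    from this[unfolded mult_1 mult_1_right] that show ?thesis by linarith
  qed
  from this[OF ge1 ge1 prod] show "?A \<le> ?K" "?B \<le> ?K" by (auto simp: h_def)
qed

end

section \<open>Interpolation\<close>

text \<open>The summands and G may live on different spaces; their independence comes from the
  product measure. \<open>Z_var\<close> is the bound of the matrix variance by v as a quadratic
  form, and \<open>small\<close> keeps the energies comparable when a single summand is
  added.\<close>

locale interp = gaussian_psi N G d \<psi> \<psi>1 \<psi>2 \<psi>3 + M: prob_space M
  for N :: "'b measure" and G d and \<psi> \<psi>1 \<psi>2 \<psi>3 :: "real \<Rightarrow> real" and M :: "'a measure" +
  fixes Z :: "nat \<Rightarrow> 'a \<Rightarrow> fm" and n :: nat and Z0 :: fm and R v :: real and m :: nat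
  assumes d1: "1 \<le> d" and m1: "1 \<le> m" and R0: "0 \<le> R"
    and small: "64 * (2 * real m * R) \<le> 1"
    and Z0_sad: "Z0 \<in> sad d"
    and Z_sad: "\<And>k \<omega>. k \<in> {1..n} \<Longrightarrow> \<omega> \<in> space M \<Longrightarrow> Z k \<omega> \<in> sad d"
    and Z_op: "\<And>k \<omega>. k \<in> {1..n} \<Longrightarrow> \<omega> \<in> space M \<Longrightarrow> opb (Z k \<omega>) R"
    and Z_ind: "M.indep_vars (\<lambda>_. FM) Z {1..n}"
    and Z_mean: "\<And>k L. k \<in> {1..n} \<Longrightarrow> (LINT \<omega>|M. inner L (Z k \<omega>)) = 0"
    and Z_cov: "\<And>L L'. (LINT \<omega>|N. inner L (G \<omega>) * inner L' (G \<omega>))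
        = (\<Sum>k=1..n. LINT \<omega>|M. inner L (Z k \<omega>) * inner L' (Z k \<omega>))"
    and Z_var: "\<And>P. bd P d \<Longrightarrow> (\<Sum>k=1..n. LINT \<omega>|M. (norm (Z k \<omega> * P))\<^sup>2) \<le> v * (norm P)\<^sup>2"
begin

sublocale MM: pair_prob_space M M ..
sublocale MN: pair_prob_space M N ..

lemma Z_meas: "k \<in> {1..n} \<Longrightarrow> Z k \<in> M \<rightarrow>\<^sub>M FM"
  using Z_ind by (auto simp: M.indep_vars_def)

definition "BB = R * norm (idm d)"

lemma BB0: "0 \<le> BB" by (simp add: BB_def R0)

lemma norm_Z: "k \<in> {1..n} \<Longrightarrow> \<omega> \<in> space M \<Longrightarrow> norm (Z k \<omega>) \<le> BB"
  using opbD[OF Z_op, of k \<omega> "idm d"] Z_sad[of k \<omega>] by (simp add: BB_def sad_def)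

lemma v0: "0 \<le> v"
proof -
  have "0 \<le> (\<Sum>k=1..n. LINT \<omega>|M. (norm (Z k \<omega> * idm d))\<^sup>2)"
    by (intro sum_nonneg integral_nonneg_AE) auto
  also have "\<dots> \<le> v * real d" using Z_var[of "idm d"] by (simp add: norm_idm)
  finally show ?thesis using d1 by (simp add: zero_le_mult_iff)
qed

definition "SS I \<omega> = (\<Sum>k\<in>I. Z k \<omega>)"

lemma SS_meas: "I \<subseteq> {1..n} \<Longrightarrow> SS I \<in> M \<rightarrow>\<^sub>M FM"
  unfolding SS_def[abs_def] by (intro measurable_FM_sum Z_meas) auto

lemma SS_sad: "I \<subseteq> {1..n} \<Longrightarrow> \<omega> \<in> space M \<Longrightarrow> SS I \<omega> \<in> sad d"
  unfolding SS_def by (intro sad_sum Z_sad) auto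

lemma norm_SS: "I \<subseteq> {1..n} \<Longrightarrow> \<omega> \<in> space M \<Longrightarrow> norm (SS I \<omega>) \<le> real n * BB"
proof -
  assume I: "I \<subseteq> {1..n}" and \<omega>: "\<omega> \<in> space M"
  have "norm (SS I \<omega>) \<le> real (card I) * BB"
    unfolding SS_def by (rule order_trans[OF norm_sum]) (rule sum_bounded_above, use I \<omega> norm_Z in blast)
  also have "\<dots> \<le> real n * BB"
    using card_mono[OF _ I] by (intro mult_right_mono BB0) simp
  finally show ?thesis .
qed

lemma integral_fst_MM: "integrable M g \<Longrightarrow> (LINT p|(M \<Otimes>\<^sub>M M). g (fst p)) = (LINT \<omega>|M. g \<omega>)" for g :: "'a \<Rightarrow> real"
  using integral_pair_mult[OF M.prob_space_axioms M.prob_space_axioms, of g "\<lambda>_. 1"] by (simp add: M.prob_space)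

text \<open>The summand i is independent of the sum of the others, so it may be read off a second
  copy of the sample space. This provides the Z' of the pathwise bounds.\<close>

lemma decouple:
  fixes h :: "fm \<times> fm \<Rightarrow> real"
  assumes i: "i \<in> {1..n}" and [measurable]: "h \<in> borel_measurable (FM \<Otimes>\<^sub>M FM)"
  shows "(LINT \<omega>|M. h (SS ({1..n} - {i}) \<omega>, Z i \<omega>)) = (LINT p|(M \<Otimes>\<^sub>M M). h (SS ({1..n} - {i}) (fst p), Z i (snd p)))"
proof -
  define S where "S = SS ({1..n} - {i})"
  have [measurable]: "S \<in> M \<rightarrow>\<^sub>M FM" "Z i \<in> M \<rightarrow>\<^sub>M FM" by (auto simp: S_def intro: SS_meas Z_meas i)
  have "M.indep_var (PiM ({1..n} - {i}) (\<lambda>_. FM)) (\<lambda>\<omega>. restrict (\<lambda>k. Z k \<omega>) ({1..n} - {i}))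
      (PiM {i} (\<lambda>_. FM)) (\<lambda>\<omega>. restrict (\<lambda>k. Z k \<omega>) {i})"
    by (rule M.indep_var_restrict[OF Z_ind]) (use i in auto)
  from M.indep_var_compose[OF this, of "\<lambda>x. \<Sum>k\<in>{1..n}-{i}. x k" FM "\<lambda>x. x i" FM]
  have "M.indep_var FM ((\<lambda>x. \<Sum>k\<in>{1..n}-{i}. x k) \<circ> (\<lambda>\<omega>. restrict (\<lambda>k. Z k \<omega>) ({1..n} - {i})))
      FM ((\<lambda>x. x i) \<circ> (\<lambda>\<omega>. restrict (\<lambda>k. Z k \<omega>) {i}))"
    by (simp add: measurable_FM_sum measurable_component_singleton)
  moreover have "(\<lambda>x. \<Sum>k\<in>{1..n}-{i}. x k) \<circ> (\<lambda>\<omega>. restrict (\<lambda>k. Z k \<omega>) ({1..n} - {i})) = S"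
    by (rule ext) (simp add: S_def SS_def)
  moreover have "(\<lambda>x. x i) \<circ> (\<lambda>\<omega>. restrict (\<lambda>k. Z k \<omega>) {i}) = Z i" by (rule ext) simp
  ultimately have "M.indep_var FM S FM (Z i)" by simp
  then have "distr M FM S \<Otimes>\<^sub>M distr M FM (Z i) = distr M (FM \<Otimes>\<^sub>M FM) (\<lambda>\<omega>. (S \<omega>, Z i \<omega>))"
    by (simp add: M.indep_var_distribution_eq)
  moreover have "distr M FM S \<Otimes>\<^sub>M distr M FM (Z i) = distr (M \<Otimes>\<^sub>M M) (FM \<Otimes>\<^sub>M FM) (\<lambda>(x, y). (S x, Z i y))"
    by (rule pair_measure_distr[OF _ _ prob_space_imp_sigma_finite[OF M.prob_space_distr]]) measurable
  ultimately have eq: "distr M (FM \<Otimes>\<^sub>M FM) (\<lambda>\<omega>. (S \<omega>, Z i \<omega>)) = distr (M \<Otimes>\<^sub>M M) (FM \<Otimes>\<^sub>M FM) (\<lambda>(x, y). (S x, Z i y))"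
    by simp
  have "(LINT \<omega>|M. h (S \<omega>, Z i \<omega>)) = (LINT z|(distr M (FM \<Otimes>\<^sub>M FM) (\<lambda>\<omega>. (S \<omega>, Z i \<omega>))). h z)"
    by (rule integral_distr[symmetric]) measurable
  also have "\<dots> = (LINT p|(M \<Otimes>\<^sub>M M). h (S (fst p), Z i (snd p)))"
    unfolding eq by (subst integral_distr) (auto simp: case_prod_unfold)
  finally show ?thesis by (simp only: S_def)
qed

lemma int_bounded_M:
  fixes h :: "'a \<Rightarrow> real"
  assumes "h \<in> borel_measurable M" "\<And>\<omega>. \<omega> \<in> space M \<Longrightarrow> \<bar>h \<omega>\<bar> \<le> C" shows "integrable M h"
  by (rule M.integrable_const_bound[where B = C]) (use assms in \<open>auto intro: AE_I2\<close>)

lemma int_bounded_MM: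
  fixes h :: "'a \<times> 'a \<Rightarrow> real"
  assumes "h \<in> borel_measurable (M \<Otimes>\<^sub>M M)" "\<And>p. p \<in> space (M \<Otimes>\<^sub>M M) \<Longrightarrow> \<bar>h p\<bar> \<le> C"
  shows "integrable (M \<Otimes>\<^sub>M M) h"
  by (rule MM.integrable_const_bound[where B = C]) (use assms in \<open>auto intro: AE_I2\<close>)

lemma f1_Z_mean: "k \<in> {1..n} \<Longrightarrow> (LINT \<omega>|M. f1 d m Y (Z k \<omega>)) = 0"
proof -
  assume k: "k \<in> {1..n}"
  have [measurable]: "Z k \<in> M \<rightarrow>\<^sub>M FM" by (rule Z_meas[OF k])
  have i: "integrable M (\<lambda>\<omega>. inner L (Z k \<omega>))" for L
    by (rule int_bounded_M[where C = "norm L * BB"])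
      (auto intro!: order_trans[OF Cauchy_Schwarz_ineq2] mult_left_mono norm_Z k)
  have "(LINT \<omega>|M. f1 d m Y (Z k \<omega>)) = (LINT \<omega>|M. (\<Sum>p\<in>Ix d. inner (bv p) (Z k \<omega>) * f1 d m Y (bv p)))"
    by (intro Bochner_Integration.integral_cong refl f1_expand) (use Z_sad[OF k] in \<open>auto simp: sad_def\<close>)
  also have "\<dots> = 0"
    by (simp add: Bochner_Integration.integral_sum integrable_mult_left i Z_mean[OF k])
  finally show ?thesis .
qed

text \<open>The place where the interpolation uses the equality of covariances: the Hessian terms of
  the independent sum add up to those of the Gaussian matrix.\<close>

lemma VV_eq_Z: "(\<Sum>k=1..n. LINT \<omega>|M. f2 d m Y (Z k \<omega>) (Z k \<omega>)) = VV m Y"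
proof -
  have i: "integrable M (\<lambda>\<omega>. inner L (Z k \<omega>) * inner L' (Z k \<omega>))" if k: "k \<in> {1..n}" for L L' k
  proof (rule int_bounded_M[where C = "(norm L * BB) * (norm L' * BB)"])
    show "(\<lambda>\<omega>. inner L (Z k \<omega>) * inner L' (Z k \<omega>)) \<in> borel_measurable M" using Z_meas[OF k] by measurable
    fix \<omega> assume \<omega>: "\<omega> \<in> space M"
    have "\<bar>inner L (Z k \<omega>)\<bar> \<le> norm L * BB" for L
      by (rule order_trans[OF Cauchy_Schwarz_ineq2]) (intro mult_left_mono norm_Z k \<omega>, simp)
    then show "\<bar>inner L (Z k \<omega>) * inner L' (Z k \<omega>)\<bar> \<le> (norm L * BB) * (norm L' * BB)"
      unfolding abs_mult by (intro mult_mono) (auto simp: BB0)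
  qed
  have "(LINT \<omega>|M. f2 d m Y (Z k \<omega>) (Z k \<omega>))
      = (\<Sum>p\<in>Ix d. \<Sum>q\<in>Ix d. (LINT \<omega>|M. inner (bv p) (Z k \<omega>) * inner (bv q) (Z k \<omega>)) * f2 d m Y (bv p) (bv q))"
    if k: "k \<in> {1..n}" for k
  proof -
    have "(LINT \<omega>|M. f2 d m Y (Z k \<omega>) (Z k \<omega>))
      = (LINT \<omega>|M. (\<Sum>p\<in>Ix d. \<Sum>q\<in>Ix d. inner (bv p) (Z k \<omega>) * inner (bv q) (Z k \<omega>) * f2 d m Y (bv p) (bv q)))"
      by (intro Bochner_Integration.integral_cong refl f2_expand) (use Z_sad[OF k] in \<open>auto simp: sad_def\<close>)
    then show ?thesis
      by (simp add: Bochner_Integration.integral_sum Bochner_Integration.integrable_sum integrable_mult_left i[OF k])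
  qed
  then have "(\<Sum>k=1..n. LINT \<omega>|M. f2 d m Y (Z k \<omega>) (Z k \<omega>))
      = (\<Sum>k=1..n. \<Sum>p\<in>Ix d. \<Sum>q\<in>Ix d. (LINT \<omega>|M. inner (bv p) (Z k \<omega>) * inner (bv q) (Z k \<omega>)) * f2 d m Y (bv p) (bv q))"
    by simp
  also have "\<dots> = (\<Sum>p\<in>Ix d. \<Sum>k=1..n. \<Sum>q\<in>Ix d. (LINT \<omega>|M. inner (bv p) (Z k \<omega>) * inner (bv q) (Z k \<omega>)) * f2 d m Y (bv p) (bv q))"
    by (rule sum.swap)
  also have "\<dots> = (\<Sum>p\<in>Ix d. \<Sum>q\<in>Ix d. \<Sum>k=1..n. (LINT \<omega>|M. inner (bv p) (Z k \<omega>) * inner (bv q) (Z k \<omega>)) * f2 d m Y (bv p) (bv q))"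
    by (rule sum.cong[OF refl], rule sum.swap)
  also have "\<dots> = VV m Y"
    unfolding VV_def Cov_def Z_cov by (simp add: sum_distrib_right)
  finally show ?thesis .
qed

lemma measurable_VV [measurable (raw)]: "f \<in> M' \<rightarrow>\<^sub>M FM \<Longrightarrow> (\<lambda>x. VV m (f x)) \<in> borel_measurable M'"
  unfolding VV_def
  by (intro borel_measurable_sum borel_measurable_times borel_measurable_const measurable_f2 measurable_const) auto

lemma VV_growth: "\<exists>C\<ge>0. \<forall>Y\<in>sad d. \<bar>VV m Y\<bar> \<le> C * exp (4 * real m * norm Y)"
proof (intro exI conjI ballI)
  show "0 \<le> (\<Sum>p\<in>Ix d. \<Sum>q\<in>Ix d. \<bar>Cov p q\<bar> * KK d m)"
    by (intro sum_nonneg mult_nonneg_nonneg KK_nonneg) auto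
  fix Y assume Y: "Y \<in> sad d"
  have b: "\<bar>f2 d m Y (bv p) (bv q)\<bar> \<le> KK d m * exp (4 * real m * norm Y)" for p q
    using f2_growth[OF d1 m1 Y, of "bv p" "bv q"] by (simp add: norm_bv)
  have "\<bar>VV m Y\<bar> \<le> (\<Sum>p\<in>Ix d. \<Sum>q\<in>Ix d. \<bar>Cov p q\<bar> * (KK d m * exp (4 * real m * norm Y)))"
    unfolding VV_def
    by (intro order_trans[OF sum_abs] sum_mono) (auto simp: abs_mult intro!: mult_left_mono b)
  then show "\<bar>VV m Y\<bar> \<le> (\<Sum>p\<in>Ix d. \<Sum>q\<in>Ix d. \<bar>Cov p q\<bar> * KK d m) * exp (4 * real m * norm Y)"
    by (simp add: sum_distrib_right mult.assoc)
qed

text \<open>The analogue of integration by parts for one summand. Around the point W without that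
  summand, the zero-order term vanishes because the summand is centred and independent of W, and the
  Hessian term is the same for the summand and for its copy. Moving the base point back to X leaves
  a Hessian in the direction of a copy that is independent of all of X.\<close>

lemma exchange_one:
  assumes i: "i \<in> {1..n}" and Y0: "Y0 \<in> sad d" and a: "0 \<le> a" "a \<le> 1"
  defines "X \<equiv> \<lambda>\<omega>. Y0 + a *\<^sub>R SS {1..n} \<omega>"
  shows "\<bar>(LINT \<omega>|M. f1 d m (X \<omega>) (Z i \<omega>)) - a * (LINT p|(M \<Otimes>\<^sub>M M). f2 d m (X (fst p)) (Z i (snd p)) (Z i (snd p)))\<bar>
    \<le> a\<^sup>2 * (480 * ((2 * real m) ^ 3 * R)) * (LINT p|(M \<Otimes>\<^sub>M M). g0 d m (X (fst p)) (Z i (snd p)))"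
proof -
  define P where "P = M \<Otimes>\<^sub>M M"
  define S where "S = SS ({1..n} - {i})"
  define W where "W \<omega> = Y0 + a *\<^sub>R S \<omega>" for \<omega>
  have [measurable]: "Z i \<in> M \<rightarrow>\<^sub>M FM" "S \<in> M \<rightarrow>\<^sub>M FM" "SS {1..n} \<in> M \<rightarrow>\<^sub>M FM"
    by (auto simp: S_def intro: SS_meas Z_meas i)
  have [measurable]: "W \<in> M \<rightarrow>\<^sub>M FM" "X \<in> M \<rightarrow>\<^sub>M FM" unfolding W_def[abs_def] X_def by measurable
  have XW: "X \<omega> = W \<omega> + a *\<^sub>R Z i \<omega>" for \<omega>
  proof -
    have "SS {1..n} \<omega> = Z i \<omega> + S \<omega>" unfolding SS_def S_def by (rule sum.remove) (use i in auto)
    then show ?thesis by (simp add: X_def W_def scaleR_add_right add_ac)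
  qed
  have Ws: "W \<omega> \<in> sad d" and Xs: "X \<omega> \<in> sad d" if "\<omega> \<in> space M" for \<omega>
    unfolding W_def X_def S_def by (intro sad_add sad_scaleR Y0 SS_sad that; auto)+
  define D where "D = norm Y0 + real n * BB"
  have Wn: "norm (W \<omega>) \<le> D" and Xn: "norm (X \<omega>) \<le> D" if \<omega>: "\<omega> \<in> space M" for \<omega>
  proof -
    have *: "norm (Y0 + a *\<^sub>R SS I \<omega>) \<le> D" if "I \<subseteq> {1..n}" for I
    proof -
      have "norm (Y0 + a *\<^sub>R SS I \<omega>) \<le> norm Y0 + a * norm (SS I \<omega>)"
        using a by (intro order_trans[OF norm_triangle_ineq]) simp
      also have "a * norm (SS I \<omega>) \<le> 1 * (real n * BB)"
        using a norm_SS[OF that \<omega>] by (intro mult_mono) auto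
      finally show ?thesis by (simp add: D_def)
    qed
    show "norm (W \<omega>) \<le> D" unfolding W_def S_def by (rule *) auto
    show "norm (X \<omega>) \<le> D" unfolding X_def by (rule *) auto
  qed
  define E where "E = exp (4 * real m * D)"
  have eE: "exp (4 * real m * norm Y) \<le> E" if "norm Y \<le> D" for Y :: fm
    using that by (auto simp: E_def intro!: mult_left_mono)
  have Zn: "norm (Z i \<omega>) \<le> BB" if "\<omega> \<in> space M" for \<omega> by (rule norm_Z[OF i that])
  have E0: "0 \<le> E" by (simp add: E_def)
  have b1: "\<bar>f1 d m Y A\<bar> \<le> KK d m * BB * E" if "Y \<in> sad d" "norm Y \<le> D" "norm A \<le> BB" for Y A
    by (rule order_trans[OF f1_growth[OF d1 m1 that(1)]])
      (intro mult_mono eE that order_refl KK_nonneg, auto simp: KK_nonneg BB0)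
  have b2: "\<bar>f2 d m Y A A\<bar> \<le> KK d m * BB * BB * E" if "Y \<in> sad d" "norm Y \<le> D" "norm A \<le> BB" for Y A
    by (rule order_trans[OF f2_growth[OF d1 m1 that(1)]])
      (intro mult_mono eE that order_refl KK_nonneg, auto simp: KK_nonneg BB0)
  have b3: "\<bar>g0 d m Y A\<bar> \<le> KK d m * BB\<^sup>2 * E" if "Y \<in> sad d" "norm Y \<le> D" "norm A \<le> BB" for Y A
    by (rule order_trans[OF g0_growth[OF d1 m1 that(1)]])
      (intro mult_mono eE that order_refl KK_nonneg power_mono, auto simp: KK_nonneg BB0)
  have sp: "fst p \<in> space M" "snd p \<in> space M" if "p \<in> space P" for p
    using that by (auto simp: P_def space_pair_measure)
  \<comment> \<open>\<open>t1\<close> and \<open>t2\<close> are the two terms of the claim at X,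
    \<open>t3\<close> to \<open>t5\<close> the Taylor terms at W. In \<open>ga\<close> the energy is
    that of the summand, in \<open>gb\<close> that of its copy, and \<open>gc\<close> is the energy
    of the copy at X.\<close>
  define t1 where "t1 p = f1 d m (X (fst p)) (Z i (fst p))" for p :: "'a \<times> 'a"
  define t2 where "t2 p = a * f2 d m (X (fst p)) (Z i (snd p)) (Z i (snd p))" for p :: "'a \<times> 'a"
  define t3 where "t3 p = f1 d m (W (fst p)) (Z i (fst p))" for p :: "'a \<times> 'a"
  define t4 where "t4 p = a * f2 d m (W (fst p)) (Z i (fst p)) (Z i (fst p))" for p :: "'a \<times> 'a"
  define t5 where "t5 p = a * f2 d m (W (fst p)) (Z i (snd p)) (Z i (snd p))" for p :: "'a \<times> 'a"
  define ga where "ga p = g0 d m (W (fst p)) (Z i (fst p))" for p :: "'a \<times> 'a"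
  define gb where "gb p = g0 d m (W (fst p)) (Z i (snd p))" for p :: "'a \<times> 'a"
  define gc where "gc p = g0 d m (X (fst p)) (Z i (snd p))" for p :: "'a \<times> 'a"
  have m_t: "t1 \<in> borel_measurable P" "t2 \<in> borel_measurable P" "t3 \<in> borel_measurable P"
    "t4 \<in> borel_measurable P" "t5 \<in> borel_measurable P" "ga \<in> borel_measurable P" "gb \<in> borel_measurable P" "gc \<in> borel_measurable P"
    unfolding t1_def t2_def t3_def t4_def t5_def ga_def gb_def gc_def P_def by measurable
  have i1: "integrable P t1" "integrable P t3"
    unfolding P_def by (rule int_bounded_MM[where C = "KK d m * BB * E"];
      use m_t b1 Xs Ws Xn Wn Zn sp in \<open>auto simp: t1_def t3_def P_def[symmetric]\<close>)+
  have i2: "integrable P t2" "integrable P t4" "integrable P t5"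
    unfolding P_def by (rule int_bounded_MM[where C = "a * (KK d m * BB * BB * E)"];
      use m_t b2 Xs Ws Xn Wn Zn sp a in \<open>auto simp: t2_def t4_def t5_def P_def[symmetric] abs_mult intro!: mult_left_mono\<close>)+
  have i3: "integrable P ga" "integrable P gb" "integrable P gc"
    unfolding P_def by (rule int_bounded_MM[where C = "KK d m * BB\<^sup>2 * E"];
      use m_t b3 Xs Ws Xn Wn Zn sp in \<open>auto simp: ga_def gb_def gc_def P_def[symmetric]\<close>)+
  have dec: "(LINT p|P. h (W (fst p), Z i (fst p))) = (LINT p|P. h (W (fst p), Z i (snd p)))"
    if h: "h \<in> borel_measurable (FM \<Otimes>\<^sub>M FM)" and b: "\<And>\<omega>. \<omega> \<in> space M \<Longrightarrow> \<bar>h (W \<omega>, Z i \<omega>)\<bar> \<le> C" for h :: "fm \<times> fm \<Rightarrow> real" and C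
  proof -
    note [measurable] = h
    have "(LINT p|P. h (W (fst p), Z i (fst p))) = (LINT \<omega>|M. h (W \<omega>, Z i \<omega>))"
      unfolding P_def by (rule integral_fst_MM[of "\<lambda>\<omega>. h (W \<omega>, Z i \<omega>)"], rule int_bounded_M[OF _ b]) measurable
    also have "\<dots> = (LINT p|P. h (W (fst p), Z i (snd p)))"
      using decouple[OF i, of "\<lambda>z. h (Y0 + a *\<^sub>R fst z, snd z)"] by (simp add: W_def S_def P_def)
    finally show ?thesis .
  qed
  have e3: "(LINT p|P. t3 p) = 0"
  proof -
    have "(LINT p|P. t3 p) = (LINT p|P. f1 d m (W (fst p)) (Z i (snd p)))"
      using dec[of "\<lambda>z. f1 d m (fst z) (snd z)" "KK d m * BB * E"] b1 Ws Wn Zn by (simp add: t3_def)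
    also have "\<dots> = (LINT x|M. LINT y|M. f1 d m (W x) (Z i y))"
    proof -
      have "integrable P (\<lambda>p. f1 d m (W (fst p)) (Z i (snd p)))"
        unfolding P_def
      proof (rule int_bounded_MM[where C = "KK d m * BB * E"])
        show "(\<lambda>p. f1 d m (W (fst p)) (Z i (snd p))) \<in> borel_measurable (M \<Otimes>\<^sub>M M)" by measurable
      qed (use b1 Ws Wn Zn sp in \<open>auto simp: P_def[symmetric]\<close>)
      from MM.integral_fst'[OF this[unfolded P_def]] show ?thesis by (simp add: P_def)
    qed
    also have "\<dots> = 0" by (simp add: f1_Z_mean[OF i])
    finally show ?thesis .
  qed
  have e45: "(LINT p|P. t4 p) = (LINT p|P. t5 p)"
    using dec[of "\<lambda>z. a * f2 d m (fst z) (snd z) (snd z)" "a * (KK d m * BB * BB * E)"] b2 Ws Wn Zn a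
    by (simp add: t4_def t5_def abs_mult mult_left_mono)
  have gab: "(LINT p|P. ga p) = (LINT p|P. gb p)"
    using dec[of "\<lambda>z. g0 d m (fst z) (snd z)" "KK d m * BB\<^sup>2 * E"] b3 Ws Wn Zn
    by (simp add: ga_def gb_def)
  define c where "c = 2 * real m * R"
  define K where "K = 120 * ((2 * real m) ^ 3 * R)"
  have K0: "0 \<le> K" using R0 by (simp add: K_def)
  have pf: "\<bar>t1 p - t3 p - t4 p - (t2 p - t5 p)\<bar> \<le> a\<^sup>2 * (K * (ga p + gb p))"
    and pg: "gb p \<le> gc p + 16 * c * (ga p + gb p)" if "p \<in> space P" for p
  proof -
    note s = sp[OF that]
    note pw = pathwise_f[OF d1 m1 Ws[OF s(1)] Z_sad[OF i s(1)] Z_sad[OF i s(2)] Z_op[OF i s(1)] Z_op[OF i s(2)] a small]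
      pathwise_g[OF d1 m1 Ws[OF s(1)] Z_sad[OF i s(1)] Z_sad[OF i s(2)] Z_op[OF i s(1)] Z_op[OF i s(2)] a small]
    show "\<bar>t1 p - t3 p - t4 p - (t2 p - t5 p)\<bar> \<le> a\<^sup>2 * (K * (ga p + gb p))"
      using pw(1) by (simp add: t1_def t2_def t3_def t4_def t5_def ga_def gb_def K_def XW mult.assoc)
    show "gb p \<le> gc p + 16 * c * (ga p + gb p)"
      using pw(2) by (simp add: ga_def gb_def gc_def c_def XW mult.assoc)
  qed
  define \<gamma> where "\<gamma> = (LINT p|P. gb p)"
  define \<gamma>' where "\<gamma>' = (LINT p|P. gc p)"
  have \<gamma>0: "0 \<le> \<gamma>" unfolding \<gamma>_def gb_def
    by (intro integral_nonneg_AE AE_I2 g0_nonneg d1 Ws sp)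
  have g1: "\<gamma> \<le> \<gamma>' + 16 * c * (\<gamma> + \<gamma>)"
  proof -
    have "\<gamma> \<le> (LINT p|P. gc p + 16 * c * (ga p + gb p))"
      unfolding \<gamma>_def by (rule integral_mono) (use i3 pg in auto)
    also have "\<dots> = \<gamma>' + 16 * c * (\<gamma> + \<gamma>)" using i3 gab by (simp add: \<gamma>_def \<gamma>'_def)
    finally show ?thesis .
  qed
  \<comment> \<open>The summand and its copy have the same mean energy at W, so the error is 32 c
    \<gamma>, and 64 c is at most 1: it can be absorbed on the left. The mean energy at W is thus at
    most twice that at X, which turns 120 into 480.\<close>
  have "32 * c * \<gamma> \<le> 1/2 * \<gamma>" using small \<gamma>0 by (intro mult_right_mono) (auto simp: c_def)
  then have g2: "\<gamma> \<le> 2 * \<gamma>'" using g1 by (simp add: algebra_simps)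
  have "\<bar>LINT p|P. (t1 p - t3 p - t4 p - (t2 p - t5 p))\<bar> \<le> (LINT p|P. a\<^sup>2 * (K * (ga p + gb p)))"
    by (rule order_trans[OF integral_abs_bound], rule integral_mono) (use i1 i2 i3 pf in auto)
  also have "\<dots> = a\<^sup>2 * (K * (2 * \<gamma>))" using i3 gab by (simp add: \<gamma>_def)
  also have "\<dots> \<le> a\<^sup>2 * (K * (2 * (2 * \<gamma>')))" using g2 K0 by (intro mult_left_mono) auto
  also have "(LINT p|P. (t1 p - t3 p - t4 p - (t2 p - t5 p))) = (LINT p|P. t1 p) - (LINT p|P. t2 p)"
    using i1 i2 e3 e45 by simp
  also have "(LINT p|P. t1 p) = (LINT \<omega>|M. f1 d m (X \<omega>) (Z i \<omega>))"
    unfolding t1_def P_def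
    by (rule integral_fst_MM[of "\<lambda>\<omega>. f1 d m (X \<omega>) (Z i \<omega>)"], rule int_bounded_M[where C = "KK d m * BB * E"])
      (use b1 Xs Xn Zn in auto)
  finally show ?thesis
    by (simp add: t2_def[abs_def] K_def \<gamma>'_def gc_def[abs_def] P_def mult_ac)
qed

text \<open>The energy is a sum of the squared norms of Z P for P = idm d and P = Y^m. The variance
  bound at these two matrices gives v times \<open>F0\<close>, and the prefactor of the energy turns
  \<open>F0\<close> into the functional.\<close>

lemma sum_g0:
  assumes Y: "Y \<in> sad d"
  shows "(\<Sum>k=1..n. LINT \<omega>|M. g0 d m Y (Z k \<omega>)) \<le> v * f0 d m Y"
proof -
  define c where "c = \<psi> (F0 d m Y) / F0 d m Y"
  have F: "0 < F0 d m Y" by (rule F0_pos[OF d1 Y])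
  have c0: "0 \<le> c" using pos[OF F] F by (simp add: c_def)
  have bY: "bd Y d" using Y by (simp add: sad_def)
  have i: "integrable M (\<lambda>\<omega>. (norm (Z k \<omega> * P))\<^sup>2)" if k: "k \<in> {1..n}" for k P
  proof (rule int_bounded_M[where C = "(BB * norm P)\<^sup>2"])
    show "(\<lambda>\<omega>. (norm (Z k \<omega> * P))\<^sup>2) \<in> borel_measurable M" using Z_meas[OF k] by measurable
    fix \<omega> assume "\<omega> \<in> space M"
    then have "norm (Z k \<omega> * P) \<le> BB * norm P"
      by (intro order_trans[OF norm_mult_ineq] mult_right_mono norm_Z k) auto
    then show "\<bar>(norm (Z k \<omega> * P))\<^sup>2\<bar> \<le> (BB * norm P)\<^sup>2" by (simp add: power_mono)
  qed
  have "(LINT \<omega>|M. g0 d m Y (Z k \<omega>)) = c * ((LINT \<omega>|M. (norm (Z k \<omega> * idm d))\<^sup>2) + (LINT \<omega>|M. (norm (Z k \<omega> * pw d Y m))\<^sup>2))"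
    if k: "k \<in> {1..n}" for k
  proof -
    have "(LINT \<omega>|M. g0 d m Y (Z k \<omega>)) = (LINT \<omega>|M. c * ((norm (Z k \<omega> * idm d))\<^sup>2 + (norm (Z k \<omega> * pw d Y m))\<^sup>2))"
      by (intro Bochner_Integration.integral_cong refl)
        (use Z_sad[OF k] in \<open>auto simp: g0_def QQ_def c_def sad_def\<close>)
    then show ?thesis using i[OF k] by simp
  qed
  then have "(\<Sum>k=1..n. LINT \<omega>|M. g0 d m Y (Z k \<omega>))
      = c * ((\<Sum>k=1..n. LINT \<omega>|M. (norm (Z k \<omega> * idm d))\<^sup>2) + (\<Sum>k=1..n. LINT \<omega>|M. (norm (Z k \<omega> * pw d Y m))\<^sup>2))"
    by (simp add: sum_distrib_left sum.distrib distrib_left)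
  also have "\<dots> \<le> c * (v * (norm (idm d))\<^sup>2 + v * (norm (pw d Y m))\<^sup>2)"
    by (intro mult_left_mono add_mono Z_var c0) (auto simp: bY)
  also have "\<dots> = c * (v * F0 d m Y)" using bY by (simp add: F0_eq[OF Y] QQ_def distrib_left)
  also have "\<dots> = v * f0 d m Y" using F by (simp add: c_def f0_def)
  finally show ?thesis .
qed

text \<open>Summed over the summands, the Hessians give \<open>VV\<close> and the energies give v
  times the functional itself. That the error is again a multiple of the functional is what closes
  the differential inequality.\<close>

lemma exchange_all:
  assumes Y0: "Y0 \<in> sad d" and a: "0 \<le> a" "a \<le> 1"
  defines "X \<equiv> \<lambda>\<omega>. Y0 + a *\<^sub>R SS {1..n} \<omega>"
  shows "\<bar>(LINT \<omega>|M. f1 d m (X \<omega>) (SS {1..n} \<omega>)) - a * (LINT \<omega>|M. VV m (X \<omega>))\<bar>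
    \<le> a\<^sup>2 * (480 * ((2 * real m) ^ 3 * R * v)) * (LINT \<omega>|M. f0 d m (X \<omega>))"
proof -
  define K where "K = 480 * ((2 * real m) ^ 3 * R)"
  have K0: "0 \<le> K" using R0 by (simp add: K_def)
  have [measurable]: "SS {1..n} \<in> M \<rightarrow>\<^sub>M FM" by (rule SS_meas) simp
  have [measurable]: "X \<in> M \<rightarrow>\<^sub>M FM" unfolding X_def by measurable
  have Xs: "X \<omega> \<in> sad d" if "\<omega> \<in> space M" for \<omega>
    unfolding X_def by (intro sad_add sad_scaleR Y0 SS_sad that) auto
  define D where "D = norm Y0 + real n * BB"
  define E where "E = exp (4 * real m * D)"
  have Xn: "norm (X \<omega>) \<le> D" if \<omega>: "\<omega> \<in> space M" for \<omega>
  proof -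
    have "norm (X \<omega>) \<le> norm Y0 + a * norm (SS {1..n} \<omega>)"
      unfolding X_def using a by (intro order_trans[OF norm_triangle_ineq]) simp
    also have "a * norm (SS {1..n} \<omega>) \<le> 1 * (real n * BB)"
      using a norm_SS[OF order_refl \<omega>] by (intro mult_mono) auto
    finally show ?thesis by (simp add: D_def)
  qed
  have eE: "exp (4 * real m * norm (X \<omega>)) \<le> E" if "\<omega> \<in> space M" for \<omega>
    using Xn[OF that] by (auto simp: E_def intro!: mult_left_mono)
  have b1: "\<bar>f1 d m (X \<omega>) A\<bar> \<le> KK d m * BB * E" if "\<omega> \<in> space M" "norm A \<le> BB" for \<omega> A
    by (rule order_trans[OF f1_growth[OF d1 m1 Xs[OF that(1)]]])
      (intro mult_mono eE that order_refl KK_nonneg, auto simp: KK_nonneg BB0)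
  have b2: "\<bar>f2 d m (X \<omega>) A A\<bar> \<le> KK d m * BB * BB * E" if "\<omega> \<in> space M" "norm A \<le> BB" for \<omega> A
    by (rule order_trans[OF f2_growth[OF d1 m1 Xs[OF that(1)]]])
      (intro mult_mono eE that order_refl KK_nonneg, auto simp: KK_nonneg BB0)
  have b3: "\<bar>g0 d m (X \<omega>) A\<bar> \<le> KK d m * BB\<^sup>2 * E" if "\<omega> \<in> space M" "norm A \<le> BB" for \<omega> A
    by (rule order_trans[OF g0_growth[OF d1 m1 Xs[OF that(1)]]])
      (intro mult_mono eE that order_refl KK_nonneg power_mono, auto simp: KK_nonneg BB0)
  have b0: "\<bar>f0 d m (X \<omega>)\<bar> \<le> KK d m * E" if "\<omega> \<in> space M" for \<omega>
    by (rule order_trans[OF f0_growth[OF d1 m1 Xs[OF that(1)]]])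
      (intro mult_mono eE that order_refl KK_nonneg, auto simp: KK_nonneg BB0)
  have f1i: "integrable M (\<lambda>\<omega>. f1 d m (X \<omega>) (Z k \<omega>))" if k: "k \<in> {1..n}" for k
    by (rule int_bounded_M[where C = "KK d m * BB * E"]) (use Z_meas[OF k] b1 norm_Z[OF k] in auto)
  have f2i: "integrable (M \<Otimes>\<^sub>M M) (\<lambda>p. f2 d m (X (fst p)) (Z k (snd p)) (Z k (snd p)))" if k: "k \<in> {1..n}" for k
    by (rule int_bounded_MM[where C = "KK d m * BB * BB * E"])
      (use Z_meas[OF k] b2 norm_Z[OF k] in \<open>auto simp: space_pair_measure\<close>)
  have g0i: "integrable (M \<Otimes>\<^sub>M M) (\<lambda>p. g0 d m (X (fst p)) (Z k (snd p)))" if k: "k \<in> {1..n}" for k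
    by (rule int_bounded_MM[where C = "KK d m * BB\<^sup>2 * E"])
      (use Z_meas[OF k] b3 norm_Z[OF k] in \<open>auto simp: space_pair_measure\<close>)
  have f0i: "integrable M (\<lambda>\<omega>. f0 d m (X \<omega>))"
    by (rule int_bounded_M[where C = "KK d m * E"]) (use b0 in auto)
  have A: "(LINT \<omega>|M. f1 d m (X \<omega>) (SS {1..n} \<omega>)) = (\<Sum>k=1..n. LINT \<omega>|M. f1 d m (X \<omega>) (Z k \<omega>))"
    unfolding SS_def f1_sum by (rule Bochner_Integration.integral_sum) (use f1i in \<open>auto simp: X_def SS_def\<close>)
  have B: "(LINT \<omega>|M. VV m (X \<omega>)) = (\<Sum>k=1..n. LINT p|(M \<Otimes>\<^sub>M M). f2 d m (X (fst p)) (Z k (snd p)) (Z k (snd p)))"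
  proof -
    have "(LINT p|(M \<Otimes>\<^sub>M M). f2 d m (X (fst p)) (Z k (snd p)) (Z k (snd p)))
        = (LINT x|M. LINT y|M. f2 d m (X x) (Z k y) (Z k y))" if "k \<in> {1..n}" for k
      using MM.integral_fst'[OF f2i[OF that]] by simp
    then have "(\<Sum>k=1..n. LINT p|(M \<Otimes>\<^sub>M M). f2 d m (X (fst p)) (Z k (snd p)) (Z k (snd p)))
        = (\<Sum>k=1..n. LINT x|M. LINT y|M. f2 d m (X x) (Z k y) (Z k y))" by simp
    also have "\<dots> = (LINT x|M. (\<Sum>k=1..n. LINT y|M. f2 d m (X x) (Z k y) (Z k y)))"
      by (rule Bochner_Integration.integral_sum[symmetric]) (use MM.integrable_fst'[OF f2i] in auto)
    also have "\<dots> = (LINT x|M. VV m (X x))" by (simp only: VV_eq_Z)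
    finally show ?thesis by simp
  qed
  have C: "(\<Sum>k=1..n. LINT p|(M \<Otimes>\<^sub>M M). g0 d m (X (fst p)) (Z k (snd p))) \<le> v * (LINT \<omega>|M. f0 d m (X \<omega>))"
  proof -
    have "(LINT p|(M \<Otimes>\<^sub>M M). g0 d m (X (fst p)) (Z k (snd p)))
        = (LINT x|M. LINT y|M. g0 d m (X x) (Z k y))" if "k \<in> {1..n}" for k
      using MM.integral_fst'[OF g0i[OF that]] by simp
    then have "(\<Sum>k=1..n. LINT p|(M \<Otimes>\<^sub>M M). g0 d m (X (fst p)) (Z k (snd p)))
        = (\<Sum>k=1..n. LINT x|M. LINT y|M. g0 d m (X x) (Z k y))" by simp
    also have "\<dots> = (LINT x|M. (\<Sum>k=1..n. LINT y|M. g0 d m (X x) (Z k y)))"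
      by (rule Bochner_Integration.integral_sum[symmetric]) (use MM.integrable_fst'[OF g0i] in auto)
    also have "\<dots> \<le> (LINT x|M. v * f0 d m (X x))"
      by (rule integral_mono) (use MM.integrable_fst'[OF g0i] f0i sum_g0 Xs in auto)
    also have "\<dots> = v * (LINT \<omega>|M. f0 d m (X \<omega>))" by simp
    finally show ?thesis .
  qed
  have "\<bar>(LINT \<omega>|M. f1 d m (X \<omega>) (SS {1..n} \<omega>)) - a * (LINT \<omega>|M. VV m (X \<omega>))\<bar>
      = \<bar>\<Sum>k=1..n. (LINT \<omega>|M. f1 d m (X \<omega>) (Z k \<omega>)) - a * (LINT p|(M \<Otimes>\<^sub>M M). f2 d m (X (fst p)) (Z k (snd p)) (Z k (snd p)))\<bar>"
    unfolding A B by (simp add: sum_subtractf sum_distrib_left)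
  also have "\<dots> \<le> (\<Sum>k=1..n. a\<^sup>2 * K * (LINT p|(M \<Otimes>\<^sub>M M). g0 d m (X (fst p)) (Z k (snd p))))"
    unfolding K_def X_def by (intro order_trans[OF sum_abs] sum_mono exchange_one Y0 a) 
  also have "\<dots> \<le> a\<^sup>2 * K * (v * (LINT \<omega>|M. f0 d m (X \<omega>)))"
    unfolding sum_distrib_left[symmetric] using C K0 by (intro mult_left_mono) auto
  finally show ?thesis by (simp add: K_def mult_ac)
qed

text \<open>The angle runs from the Gaussian matrix at t = 0 to the independent sum at pi / 2. The
  derivative consists of a term in the direction of the sum, worth cos t sin t times the mean of
  \<open>VV\<close> up to the exchange error, and a Gaussian term of the same size and opposite
  sign.\<close>

lemma interpolation:
  "(LINT \<omega>|M. f0 d m (Z0 + SS {1..n} \<omega>))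
    \<le> exp (960 * ((2 * real m) ^ 3 * R * v)) * (LINT \<omega>|N. f0 d m (Z0 + G \<omega>))"
proof -
  define P where "P = M \<Otimes>\<^sub>M N"
  define S where "S = SS {1..n}"
  have [measurable]: "S \<in> M \<rightarrow>\<^sub>M FM" unfolding S_def by (rule SS_meas) simp
  define X where "X t p = Z0 + (sin t *\<^sub>R S (fst p) + cos t *\<^sub>R G (snd p))" for t and p :: "'a \<times> 'b"
  define X' where "X' t p = cos t *\<^sub>R S (fst p) - sin t *\<^sub>R G (snd p)" for t and p :: "'a \<times> 'b"
  have [measurable]: "X t \<in> P \<rightarrow>\<^sub>M FM" "X' t \<in> P \<rightarrow>\<^sub>M FM" for t
    unfolding X_def[abs_def] X'_def[abs_def] P_def by measurable
  have [measurable]: "(\<lambda>p. S (fst p)) \<in> P \<rightarrow>\<^sub>M FM" "(\<lambda>p. G (snd p)) \<in> P \<rightarrow>\<^sub>M FM"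
    unfolding P_def by measurable
  have sp: "fst p \<in> space M" "snd p \<in> space N" if "p \<in> space P" for p
    using that by (auto simp: P_def space_pair_measure)
  have Ss: "S \<omega> \<in> sad d" if "\<omega> \<in> space M" for \<omega> unfolding S_def by (rule SS_sad[OF order_refl that])
  have Xs: "X t p \<in> sad d" and X's: "X' t p \<in> sad d" if "p \<in> space P" for t p
    unfolding X_def X'_def by (intro sad_add sad_diff sad_scaleR Z0_sad Ss G_sad sp[OF that])+
  have Xd: "((\<lambda>t. X t p) has_vector_derivative X' t p) (at t)" for t p
    unfolding X_def X'_def by (auto intro!: derivative_eq_intros)
  define B where "B = real n * BB"
  have B0: "0 \<le> B" by (simp add: B_def BB0)
  have nS: "norm (S \<omega>) \<le> B" if "\<omega> \<in> space M" for \<omega>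
    unfolding S_def B_def by (rule norm_SS[OF order_refl that])
  define E where "E p = exp (4 * real m * (norm Z0 + B + norm (G (snd p))))" for p :: "'a \<times> 'b"
  have eE: "exp (4 * real m * norm (X t p)) \<le> E p" if p: "p \<in> space P" for t p
  proof -
    have "norm (X t p) \<le> norm Z0 + (norm (S (fst p)) + norm (G (snd p)))"
      unfolding X_def by (rule order_trans[OF norm_triangle_ineq add_left_mono[OF norm_rot_le]]) auto
    also have "\<dots> \<le> norm Z0 + B + norm (G (snd p))" using nS[OF sp(1)[OF p]] by simp
    finally show ?thesis by (auto simp: E_def intro!: mult_left_mono)
  qed
  have pint: "integrable P h"
    if h: "h \<in> borel_measurable P" and c: "0 \<le> c" and b: "\<And>p. p \<in> space P \<Longrightarrow> \<bar>h p\<bar> \<le> C * exp (c * norm (G (snd p)))"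
    for h :: "'a \<times> 'b \<Rightarrow> real" and C c
  proof (rule Bochner_Integration.integrable_bound[OF _ h])
    show "integrable P (\<lambda>p. C * exp (c * norm (G (snd p))))"
      using integrable_pair_mult[OF M.prob_space_axioms N.prob_space_axioms _ exp_norm_integrable[OF c], of "\<lambda>_. C"]
      by (simp add: P_def)
    show "AE p in P. norm (h p) \<le> norm (C * exp (c * norm (G (snd p))))"
      using b by (intro AE_I2) (auto intro: order_trans[OF _ abs_ge_self])
  qed
  define c where "c = 4 * real m + 1"
  define D where "D = KK d m * (B + 1) * exp (4 * real m * (norm Z0 + B))"
  have c0: "0 \<le> c" by (simp add: c_def)
  have Eexp: "E p = exp (4 * real m * (norm Z0 + B)) * exp (4 * real m * norm (G (snd p)))" for p
    by (simp add: E_def exp_add[symmetric] algebra_simps)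
  have f1b: "\<bar>f1 d m (X t p) A\<bar> \<le> D * exp (c * norm (G (snd p)))"
    if p: "p \<in> space P" and A: "norm A \<le> B + norm (G (snd p))" for t p A
  proof -
    have "norm A \<le> (B + 1) * exp (norm (G (snd p)))"
    proof -
      have "norm (G (snd p)) \<le> exp (norm (G (snd p)))" using exp_ge_add_one_self[of "norm (G (snd p))"] by linarith
      moreover have "B * 1 \<le> B * exp (norm (G (snd p)))" using B0 by (intro mult_left_mono) auto
      ultimately show ?thesis using A by (simp add: distrib_right)
    qed
    then have "\<bar>f1 d m (X t p) A\<bar> \<le> KK d m * ((B + 1) * exp (norm (G (snd p)))) * E p"
      by (intro order_trans[OF f1_growth[OF d1 m1 Xs[OF p]]] mult_mono eE p) (auto simp: KK_nonneg B0)
    also have "\<dots> = D * exp (c * norm (G (snd p)))"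
    proof -
      have ee: "exp (c * x) = exp (4 * real m * x) * exp x" for x
        by (simp add: c_def exp_add[symmetric] algebra_simps)
      show ?thesis unfolding Eexp D_def ee by (simp only: mult_ac)
    qed
    finally show ?thesis .
  qed
  have f0b: "\<bar>f0 d m (X t p)\<bar> \<le> D * exp (c * norm (G (snd p)))" if p: "p \<in> space P" for t p
  proof -
    have "\<bar>f0 d m (X t p)\<bar> \<le> (KK d m * 1) * E p"
      using order_trans[OF f0_growth[OF d1 m1 Xs[OF p]] mult_left_mono[OF eE[OF p] KK_nonneg]] by simp
    also have "\<dots> \<le> (KK d m * (B + 1)) * (exp (4 * real m * (norm Z0 + B)) * exp (c * norm (G (snd p))))"
      unfolding Eexp using B0 by (intro mult_mono) (auto simp: KK_nonneg c_def distrib_right)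
    finally show ?thesis by (simp add: D_def mult.assoc)
  qed
  have nX': "norm (X' t p) \<le> B + norm (G (snd p))" if p: "p \<in> space P" for t p
    using norm_rot_le[of "cos t" "- sin t" "S (fst p)" "G (snd p)"] nS[OF sp(1)[OF p]] by (simp add: X'_def)
  have f0i: "integrable P (\<lambda>p. f0 d m (X t p))" for t
    by (rule pint[OF _ c0 f0b]) auto
  have f1i: "integrable P (\<lambda>p. f1 d m (X t p) (A p))"
    if "A \<in> P \<rightarrow>\<^sub>M FM" "\<And>p. p \<in> space P \<Longrightarrow> norm (A p) \<le> B + norm (G (snd p))" for t A
    by (rule pint[OF _ c0 f1b]) (use that in auto)
  obtain C where C: "0 \<le> C" "\<And>Y. Y \<in> sad d \<Longrightarrow> \<bar>VV m Y\<bar> \<le> C * exp (4 * real m * norm Y)"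
    using VV_growth by auto
  have VVi: "integrable P (\<lambda>p. VV m (X t p))" for t
  proof (rule pint[of "\<lambda>p. VV m (X t p)" "4 * real m" "C * exp (4 * real m * (norm Z0 + B))"])
    fix p assume p: "p \<in> space P"
    show "\<bar>VV m (X t p)\<bar> \<le> C * exp (4 * real m * (norm Z0 + B)) * exp (4 * real m * norm (G (snd p)))"
      using order_trans[OF C(2)[OF Xs[OF p]] mult_left_mono[OF eE[OF p] C(1)]] by (simp add: Eexp mult.assoc)
  qed auto
  define k where "k t = (LINT p|P. f0 d m (X t p))" for t
  have kD: "(k has_real_derivative (LINT p|P. f1 d m (X t p) (X' t p))) (at t)" for t
    unfolding k_def
  proof (rule DERIV_integral[OF f0i])
    show "integrable P (\<lambda>p. D * exp (c * norm (G (snd p))))"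
      by (rule pint[OF _ c0, of _ D]) (use B0 in \<open>auto simp: D_def abs_mult KK_nonneg\<close>)
    show "((\<lambda>t. f0 d m (X t p)) has_real_derivative f1 d m (X t p) (X' t p)) (at t)" if "p \<in> space P" for t p
      by (rule DERIV_f0[OF Xd Xs[OF that] _ d1]) (use X's[OF that] in \<open>auto simp: sad_def\<close>)
    show "\<bar>f1 d m (X t p) (X' t p)\<bar> \<le> D * exp (c * norm (G (snd p)))" if "p \<in> space P" for t p
      by (rule f1b[OF that nX'[OF that]])
  qed auto
  define \<kappa> where "\<kappa> = 480 * ((2 * real m) ^ 3 * R * v)"
  have \<kappa>0: "0 \<le> \<kappa>" using R0 v0 by (simp add: \<kappa>_def)
  have k0: "0 \<le> k t" for t
    unfolding k_def by (intro integral_nonneg_AE AE_I2 less_imp_le f0_pos d1 Xs)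
  have kd: "(LINT p|P. f1 d m (X t p) (X' t p)) \<le> \<kappa> * k t" if t: "0 \<le> t" "t \<le> pi / 2" for t
  proof -
    have s: "0 \<le> sin t" "sin t \<le> 1" and co: "0 \<le> cos t" "cos t \<le> 1"
      using t by (auto intro: sin_ge_zero cos_ge_zero)
    have iS: "integrable P (\<lambda>p. f1 d m (X t p) (S (fst p)))"
      by (rule f1i) (use nS sp in \<open>auto intro: order_trans add_increasing2\<close>)
    have iG: "integrable P (\<lambda>p. f1 d m (X t p) (G (snd p)))"
      by (rule f1i) (use B0 in auto)
    have split: "f1 d m (X t p) (X' t p) = cos t * f1 d m (X t p) (S (fst p)) - sin t * f1 d m (X t p) (G (snd p))" for p
      using f1_add[of d m "X t p" "cos t *\<^sub>R S (fst p)" "(- sin t) *\<^sub>R G (snd p)"]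
      by (simp only: f1_scaleR) (simp add: X'_def)
    have "(LINT p|P. f1 d m (X t p) (X' t p))
        = cos t * (LINT p|P. f1 d m (X t p) (S (fst p))) - sin t * (LINT p|P. f1 d m (X t p) (G (snd p)))"
      unfolding split using iS iG by simp
    also have "(LINT p|P. f1 d m (X t p) (G (snd p))) = cos t * (LINT p|P. VV m (X t p))"
    proof -
      have "(LINT p|P. f1 d m (X t p) (G (snd p))) = (LINT x|M. LINT y|N. f1 d m (X t (x, y)) (G y))"
        using MN.integral_fst'[OF iG[unfolded P_def]] by (simp add: P_def)
      also have "\<dots> = (LINT x|M. cos t * (LINT y|N. VV m (X t (x, y))))"
      proof (intro Bochner_Integration.integral_cong refl)
        fix x assume x: "x \<in> space M"
        have U: "Z0 + sin t *\<^sub>R S x \<in> sad d" by (intro sad_add sad_scaleR Z0_sad Ss x)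
        show "(LINT y|N. f1 d m (X t (x, y)) (G y)) = cos t * (LINT y|N. VV m (X t (x, y)))"
          using gauss_ibp[OF d1 m1 U, of "cos t"] by (simp add: X_def add.assoc)
      qed
      also have "\<dots> = cos t * (LINT p|P. VV m (X t p))"
        using MN.integral_fst'[OF VVi[of t, unfolded P_def]] by (simp add: P_def)
      finally show ?thesis .
    qed
    \<comment> \<open>Integration by parts has supplied the factor cos t, so that it can be taken
      out and only the exchange error of the independent sum remains.\<close>
    also have "cos t * (LINT p|P. f1 d m (X t p) (S (fst p))) - sin t * (cos t * (LINT p|P. VV m (X t p)))
        = cos t * ((LINT p|P. f1 d m (X t p) (S (fst p))) - sin t * (LINT p|P. VV m (X t p)))"
      by (simp add: algebra_simps)
    also have "\<dots> \<le> 1 * ((sin t)\<^sup>2 * \<kappa> * k t)"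
    proof (rule order_trans[OF mult_left_mono mult_right_mono])
      have sw: "(LINT p|P. h p) = (LINT y|N. LINT x|M. h (x, y))" "integrable N (\<lambda>y. LINT x|M. h (x, y))"
        if "integrable P h" for h :: "'a \<times> 'b \<Rightarrow> real"
        using MN.integral_snd[of "\<lambda>x y. h (x, y)"] MN.integrable_snd[of "\<lambda>x y. h (x, y)"] that by (auto simp: P_def)
      have "(LINT p|P. f1 d m (X t p) (S (fst p))) - sin t * (LINT p|P. VV m (X t p))
          = (LINT y|N. (LINT x|M. f1 d m (X t (x, y)) (S x)) - sin t * (LINT x|M. VV m (X t (x, y))))"
        using sw(2)[OF iS] sw(2)[OF VVi[of t]] by (simp add: sw(1)[OF iS] sw(1)[OF VVi])
      also have "\<dots> \<le> (LINT y|N. (sin t)\<^sup>2 * \<kappa> * (LINT x|M. f0 d m (X t (x, y))))"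
      proof (rule integral_mono)
        fix y assume y: "y \<in> space N"
        \<comment> \<open>The Gaussian part is frozen and joins the deterministic part of the base
          point.\<close>
        have U: "Z0 + cos t *\<^sub>R G y \<in> sad d" by (intro sad_add sad_scaleR Z0_sad G_sad y)
        have XY: "X t (x, y) = (Z0 + cos t *\<^sub>R G y) + sin t *\<^sub>R SS {1..n} x" for x
          by (simp only: X_def S_def fst_conv snd_conv add_ac)
        have "\<bar>(LINT x|M. f1 d m (X t (x, y)) (S x)) - sin t * (LINT x|M. VV m (X t (x, y)))\<bar>
            \<le> (sin t)\<^sup>2 * \<kappa> * (LINT x|M. f0 d m (X t (x, y)))"
          unfolding XY S_def \<kappa>_def by (rule exchange_all[OF U s])
        then show "(LINT x|M. f1 d m (X t (x, y)) (S x)) - sin t * (LINT x|M. VV m (X t (x, y)))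
            \<le> (sin t)\<^sup>2 * \<kappa> * (LINT x|M. f0 d m (X t (x, y)))" by linarith
      qed (use sw(2)[OF iS] sw(2)[OF VVi[of t]] sw(2)[OF f0i[of t]] in auto)
      also have "\<dots> = (sin t)\<^sup>2 * \<kappa> * k t" by (simp add: k_def sw(1)[OF f0i])
      finally show "(LINT p|P. f1 d m (X t p) (S (fst p))) - sin t * (LINT p|P. VV m (X t p)) \<le> (sin t)\<^sup>2 * \<kappa> * k t" .
    qed (use co k0 \<kappa>0 in auto)
    also have "\<dots> \<le> \<kappa> * k t"
    proof -
      have "(sin t)\<^sup>2 \<le> 1" using s by (simp add: power_le_one)
      from mult_right_mono[OF this, of "\<kappa> * k t"] show ?thesis using \<kappa>0 k0[of t] by (simp add: mult.assoc)
    qed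
    finally show ?thesis .
  qed
  have "exp (- \<kappa> * (pi / 2)) * k (pi / 2) \<le> exp (- \<kappa> * 0) * k 0"
  proof (rule DERIV_nonpos_imp_nonincreasing[where f = "\<lambda>t. exp (- \<kappa> * t) * k t" and a = 0 and b = "pi / 2"])
    fix t assume t: "0 \<le> t" "t \<le> pi / 2"
    have e: "((\<lambda>t. exp (- \<kappa> * t)) has_real_derivative exp (- \<kappa> * t) * (- \<kappa>)) (at t)"
      by (auto intro!: derivative_eq_intros)
    have "((\<lambda>t. exp (- \<kappa> * t) * k t) has_real_derivative
        exp (- \<kappa> * t) * ((LINT p|P. f1 d m (X t p) (X' t p)) - \<kappa> * k t)) (at t)"
      by (rule DERIV_cong[OF DERIV_mult[OF e kD]]) (simp add: algebra_simps)
    moreover have "exp (- \<kappa> * t) * ((LINT p|P. f1 d m (X t p) (X' t p)) - \<kappa> * k t) \<le> 0"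
      using kd[OF t] by (intro mult_nonneg_nonpos) auto
    ultimately show "\<exists>y. ((\<lambda>t. exp (- \<kappa> * t) * k t) has_real_derivative y) (at t) \<and> y \<le> 0" by blast
  qed simp
  then have "k (pi / 2) \<le> exp (\<kappa> * (pi / 2)) * k 0" by (simp add: exp_minus field_simps)
  \<comment> \<open>The length pi / 2 of the interval is rounded up to 2, which doubles the constant
    480.\<close>
  also have "\<dots> \<le> exp (2 * \<kappa>) * k 0"
    using mult_left_mono[OF less_imp_le[OF pi_half_less_two] \<kappa>0]
    by (intro mult_right_mono k0) (simp add: mult.commute)
  also have "k (pi / 2) = (LINT \<omega>|M. f0 d m (Z0 + S \<omega>))"
  proof -
    have "(LINT p|P. f0 d m (X (pi / 2) p)) = (LINT x|M. LINT y|N. f0 d m (X (pi / 2) (x, y)))"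
      using MN.integral_fst'[OF f0i[unfolded P_def]] by (simp add: P_def)
    then show ?thesis by (simp add: k_def X_def N.prob_space)
  qed
  also have "k 0 = (LINT \<omega>|N. f0 d m (Z0 + G \<omega>))"
  proof -
    have "(LINT p|P. f0 d m (X 0 p)) = (LINT y|N. LINT x|M. f0 d m (X 0 (x, y)))"
      using MN.integral_snd[of "\<lambda>x y. f0 d m (X 0 (x, y))"] f0i[of 0] by (simp add: P_def case_prod_unfold)
    then show ?thesis by (simp add: k_def X_def M.prob_space)
  qed
  finally show ?thesis by (simp add: \<kappa>_def S_def)
qed

end

section \<open>Spectral theory\<close>

definition toF :: "nat \<Rightarrow> complex mat \<Rightarrow> fm" where "toF d A = mkfm d (\<lambda>i j. A $$ (i, j))"
definition ofF :: "nat \<Rightarrow> fm \<Rightarrow> complex mat" where "ofF d x = mat d d (\<lambda>(i, j). ent x i j)"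
text \<open>A vector becomes a matrix supported on its first column, so that vectors and matrices
  share one product and one norm.\<close>

definition cvF :: "nat \<Rightarrow> complex Matrix.vec \<Rightarrow> fm" where "cvF d v = mkfm d (\<lambda>i j. if j = 0 then vec_index v i else 0)"

lemma ent_toF: "ent (toF d A) i j = (if i < d \<and> j < d then A $$ (i, j) else 0)"
  by (simp add: toF_def ent_mkfm)

lemma bd_toF [simp]: "bd (toF d A) d"
  by (simp add: toF_def bd_mkfm)

lemma ofF_carrier [simp]: "ofF d x \<in> carrier_mat d d"
  by (simp add: ofF_def)

lemma toF_ofF [simp]: "bd x d \<Longrightarrow> toF d (ofF d x) = x"
  by (rule fm_eqI) (auto simp: ent_toF ofF_def bd_ent)

lemma ofF_toF [simp]: "A \<in> carrier_mat d d \<Longrightarrow> ofF d (toF d A) = A"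
  by (rule eq_matI) (auto simp: ent_toF ofF_def)

lemma toF_times:
  assumes A: "A \<in> carrier_mat d d" and B: "B \<in> carrier_mat d d"
  shows "toF d (A * B) = toF d A * toF d B"
proof (rule fm_eqI)
  fix i j
  show "ent (toF d (A * B)) i j = ent (toF d A * toF d B) i j"
    unfolding ent_times[OF bd_toF] using A B
    by (auto simp: ent_toF scalar_prod_def lessThan_atLeast0 intro!: sum.cong)
qed

lemma toF_one: "toF d (1\<^sub>m d) = idm d"
  by (rule fm_eqI) (auto simp: ent_toF ent_idm)

lemma toF_sad: "self_adjoint d A \<Longrightarrow> toF d A \<in> sad d"
proof -
  assume sa: "self_adjoint d A"
  have A: "A \<in> carrier_mat d d" and aA: "mat_adjoint A = A" using sa by (auto simp: self_adjoint_def)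
  have *: "A $$ (i, j) = cnj (A $$ (j, i))" if "i < d" "j < d" for i j
  proof -
    have "mat_adjoint A $$ (i, j) = cnj (A $$ (j, i))"
      using A that unfolding mat_adjoint_def by (simp add: mat_of_rows_index)
    then show ?thesis using aA by simp
  qed
  have "adj (toF d A) = toF d A"
  proof (rule fm_eqI)
    fix i j
    show "ent (adj (toF d A)) i j = ent (toF d A) i j" using *[of i j] by (simp add: ent_toF)
  qed
  then show ?thesis by (simp add: sad_def)
qed

lemma ent_cvF: "ent (cvF d v) i j = (if i < d \<and> j = 0 then vec_index v i else 0)"
  by (auto simp: cvF_def ent_mkfm)

lemma toF_cvF:
  assumes A: "A \<in> carrier_mat d d" and v: "v \<in> carrier_vec d"
  shows "toF d A * cvF d v = cvF d (A *\<^sub>v v)"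
proof (rule fm_eqI)
  fix i j
  show "ent (toF d A * cvF d v) i j = ent (cvF d (A *\<^sub>v v)) i j"
    unfolding ent_times[OF bd_toF] using A v
    by (auto simp: ent_toF ent_cvF scalar_prod_def lessThan_atLeast0 intro!: sum.cong)
qed

lemma norm_cvF: "v \<in> carrier_vec d \<Longrightarrow> norm (cvF d v) = vnorm v"
proof -
  assume v: "v \<in> carrier_vec d"
  have b: "bd (cvF d v) (Suc d)" unfolding cvF_def by (rule bd_mono[OF bd_mkfm]) simp
  have "(norm (cvF d v))\<^sup>2 = (\<Sum>i<Suc d. \<Sum>j<Suc d. if j = 0 then (cmod (ent (cvF d v) i 0))\<^sup>2 else 0)"
    unfolding norm_fm_sq[OF b] by (intro sum.cong refl) (auto simp: ent_cvF)
  also have "\<dots> = (\<Sum>i<Suc d. (cmod (ent (cvF d v) i 0))\<^sup>2)" by (simp only: sum.delta finite_lessThan) simp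
  also have "\<dots> = (\<Sum>i<d. (cmod (vec_index v i))\<^sup>2)" by (simp add: ent_cvF)
  finally have "(norm (cvF d v))\<^sup>2 = (vnorm v)\<^sup>2" using v by (simp add: vnorm_def sum_nonneg)
  moreover have "0 \<le> vnorm v" by (simp add: vnorm_def sum_nonneg)
  ultimately show ?thesis by (metis norm_ge_zero power2_eq_imp_eq)
qed

lemma cvF_smult: "v \<in> carrier_vec d \<Longrightarrow> cvF d (complex_of_real c \<cdot>\<^sub>v v) = c *\<^sub>R cvF d v"
  by (rule fm_eqI) (auto simp: ent_cvF scaleR_conv_of_real)

text \<open>Multiplication by \<open>idm 1\<close> keeps only the first column, so the equation says
  that nothing else is present: these are the column vectors. Accordingly \<open>lamS\<close> is the
  supremum of the Rayleigh quotient.\<close>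

definition colm :: "nat \<Rightarrow> fm set" where "colm d = {P. bd P d \<and> P * idm 1 = P}"
definition unitc :: "nat \<Rightarrow> fm set" where "unitc d = {P \<in> colm d. norm P = 1}"
definition lamS :: "nat \<Rightarrow> fm \<Rightarrow> real" where "lamS d x = (SUP P\<in>unitc d. inner P (x * P))"

lemma ent_times_idm1: "ent (P * idm (Suc 0)) i j = (if j = 0 then ent P i 0 else 0)"
proof -
  have "ent (P * idm (Suc 0)) i j = (\<Sum>k<Suc 0. ent P i k * ent (idm (Suc 0)) k j)" by (rule ent_times'[OF bd_idm])
  then show ?thesis by (auto simp: ent_idm)
qed

lemma cvF_colm: "1 \<le> d \<Longrightarrow> cvF d v \<in> colm d"
  unfolding colm_def by (auto simp: bd_def ent_cvF ent_times_idm1 intro!: fm_eqI)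

lemma colm_cvF: "P \<in> colm d \<Longrightarrow> P = cvF d (Matrix.vec d (\<lambda>i. ent P i 0))"
proof -
  assume "P \<in> colm d"
  then have b: "bd P d" and e: "P * idm 1 = P" by (auto simp: colm_def)
  show ?thesis
  proof (rule fm_eqI)
    fix i j
    have "ent P i j = ent (P * idm 1) i j" using e by simp
    then show "ent P i j = ent (cvF d (Matrix.vec d (\<lambda>i. ent P i 0))) i j"
      using bd_ent[OF b, of i j] bd_ent[OF b, of i 0] by (auto simp: ent_times_idm1 ent_cvF not_less)
  qed
qed

lemma colm_times: "P \<in> colm d \<Longrightarrow> bd x d \<Longrightarrow> x * P \<in> colm d"
  by (auto simp: colm_def mult.assoc intro: bd_times)

lemma colm_add: "P \<in> colm d \<Longrightarrow> Q \<in> colm d \<Longrightarrow> P + Q \<in> colm d"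
  by (auto simp: colm_def distrib_right intro: bd_add)

lemma colm_scaleR: "P \<in> colm d \<Longrightarrow> c *\<^sub>R P \<in> colm d"
  by (auto simp: colm_def intro: bd_scaleR)

lemma unitc_nonempty: "1 \<le> d \<Longrightarrow> unitc d \<noteq> {}"
proof -
  assume d: "1 \<le> d"
  have "bv (0, 0, True) \<in> unitc d"
    using d by (auto simp: unitc_def colm_def norm_bv bd_def ent_bv ent_times_idm1 intro!: fm_eqI)
  then show ?thesis by auto
qed

lemma abs_form_le: "\<bar>inner P (x * P)\<bar> \<le> norm x * (norm (P :: fm))\<^sup>2"
proof -
  have "\<bar>inner P (x * P)\<bar> \<le> norm P * norm (x * P)" by (rule Cauchy_Schwarz_ineq2)
  also have "\<dots> \<le> norm P * (norm x * norm P)" by (intro mult_left_mono norm_mult_ineq) auto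
  finally show ?thesis by (simp add: power2_eq_square mult_ac)
qed

lemma form_le_norm: "P \<in> unitc d \<Longrightarrow> inner P (x * P) \<le> norm x"
  using abs_form_le[of P x] by (simp add: unitc_def abs_le_iff)

lemma bdd_lamS: "bdd_above ((\<lambda>P. inner P (x * P)) ` unitc d)"
  by (rule bdd_aboveI2[where M = "norm x"]) (rule form_le_norm)

lemma lamS_upper: "P \<in> unitc d \<Longrightarrow> inner P (x * P) \<le> lamS d x"
  unfolding lamS_def by (rule cSUP_upper[OF _ bdd_lamS])

lemma lamS_form: "P \<in> colm d \<Longrightarrow> inner P (x * P) \<le> lamS d x * (norm P)\<^sup>2"
proof (cases "P = 0")
  case False
  assume P: "P \<in> colm d"
  define Q where "Q = (1 / norm P) *\<^sub>R P"
  have "Q \<in> unitc d" using P False by (auto simp: Q_def unitc_def intro: colm_scaleR)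
  from lamS_upper[OF this] have "inner Q (x * Q) \<le> lamS d x" .
  moreover have "inner Q (x * Q) = inner P (x * P) / (norm P)\<^sup>2"
    by (simp add: Q_def power2_eq_square)
  ultimately show ?thesis using False by (simp add: divide_le_eq)
qed simp

lemma lamS_le: "1 \<le> d \<Longrightarrow> (\<And>P. P \<in> unitc d \<Longrightarrow> inner P (x * P) \<le> c) \<Longrightarrow> lamS d x \<le> c"
  unfolding lamS_def by (intro cSUP_least unitc_nonempty)

lemma abs_lamS_le: "1 \<le> d \<Longrightarrow> \<bar>lamS d x\<bar> \<le> norm x"
proof -
  assume d: "1 \<le> d"
  obtain P where P: "P \<in> unitc d" using unitc_nonempty[OF d] by auto
  have "lamS d x \<le> norm x"
    by (rule lamS_le[OF d]) (rule form_le_norm)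
  moreover have "- norm x \<le> lamS d x"
    using abs_form_le[of P x] lamS_upper[OF P, of x] P by (auto simp: unitc_def abs_le_iff)
  ultimately show ?thesis by simp
qed

text \<open>If the supremum of the Rayleigh quotient were not an eigenvalue, then \<open>T = lamS d x - x\<close>
  would be invertible and positive semidefinite, hence bounded below.\<close>

lemma lamS_eigen:
  assumes d: "1 \<le> d" and x: "x \<in> sad d"
  shows "eigenvalue (ofF d x) (complex_of_real (lamS d x))"
proof (rule ccontr)
  define A where "A = ofF d x"
  define l where "l = lamS d x"
  assume "\<not> eigenvalue (ofF d x) (complex_of_real (lamS d x))"
  then have ne: "det (char_matrix A (complex_of_real l)) \<noteq> 0"
    using eigenvalue_det[of A d] by (simp add: A_def l_def)
  have bx: "bd x d" and ax: "adj x = x" using x by (auto simp: sad_def)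
  have A: "A \<in> carrier_mat d d" by (simp add: A_def)
  have B: "char_matrix A (complex_of_real l) \<in> carrier_mat d d" using A by (simp add: char_matrix_def)
  from det_non_zero_imp_unit[OF B ne, of "()"] obtain C where C: "C \<in> carrier_mat d d" "C * char_matrix A (complex_of_real l) = 1\<^sub>m d"
    unfolding Units_def by (auto simp: ring_mat_simps)
  define T where "T = l *\<^sub>R idm d - x"
  have Ts: "T \<in> sad d" unfolding T_def by (intro sad_diff sad_scaleR sad_idm x)
  then have bT: "bd T d" and aT: "adj T = T" by (auto simp: sad_def)
  have "toF d (char_matrix A (complex_of_real l)) = - T"
    by (rule fm_eqI)
      (use A bd_ent[OF bx] in \<open>auto simp: ent_toF char_matrix_def T_def ent_idm A_def ofF_def scaleR_conv_of_real not_less\<close>)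
  then have inv: "toF d C * (- T) = idm d"
    using toF_times[OF C(1) B] C(2) by (simp add: toF_one)
  have Tform: "inner P (T * P) = l * (norm P)\<^sup>2 - inner P (x * P)" if "P \<in> colm d" for P
    using that by (simp add: T_def left_diff_distrib inner_diff_right colm_def power2_norm_eq_inner)
  have psd: "0 \<le> inner P (T * P)" if "P \<in> colm d" for P
    using lamS_form[OF that, of x] by (simp add: Tform[OF that] l_def)
  define c where "c = norm (toF d C)"
  have lower: "1 \<le> c * norm (T * P)" if P: "P \<in> unitc d" for P
  proof -
    have "toF d C * (- (T * P)) = idm d * P"
      using inv by (metis mult.assoc mult_minus_left mult_minus_right)
    then have "norm P = norm (toF d C * (- (T * P)))" using P by (simp add: unitc_def colm_def)
    also have "\<dots> \<le> c * norm (- (T * P))" unfolding c_def by (rule norm_mult_ineq)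
    finally show ?thesis using P by (simp add: unitc_def)
  qed
  obtain P0 where P0: "P0 \<in> unitc d" using unitc_nonempty[OF d] by auto
  have T0: "0 < norm T" using lower[OF P0] by (cases "T = 0") auto
  have c0: "0 < c" using lower[OF P0] by (cases "c = 0") (auto simp: c_def)
  have key: "1 / (c\<^sup>2 * norm T) \<le> inner P (T * P)" if P: "P \<in> unitc d" for P
  proof -
    have Pc: "P \<in> colm d" using P by (simp add: unitc_def)
    \<comment> \<open>A gradient step: the form of the positive semidefinite T is nonnegative at P -
      t T P, and the step t = 1 / norm T turns this into a lower bound of the form at P by t times
      the squared norm of T P.\<close>
    define t where "t = 1 / norm T"
    define V where "V = T * P"
    have Q: "P + (- t) *\<^sub>R V \<in> colm d" unfolding V_def by (intro colm_add colm_scaleR colm_times Pc bT)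
    have s: "inner P (T * V) = (norm V)\<^sup>2"
      unfolding V_def power2_norm_eq_inner by (metis aT inner_times_left)
    have s': "inner V (T * P) = (norm V)\<^sup>2" by (simp add: V_def power2_norm_eq_inner)
    have "0 \<le> inner (P + (- t) *\<^sub>R V) (T * (P + (- t) *\<^sub>R V))" by (rule psd[OF Q])
    also have "\<dots> = inner P (T * P) - 2 * t * (norm V)\<^sup>2 + t\<^sup>2 * inner V (T * V)"
      by (simp add: distrib_left right_diff_distrib inner_add_left inner_diff_left inner_diff_right inner_add_right s s' power2_eq_square algebra_simps)
    also have "t\<^sup>2 * inner V (T * V) \<le> t\<^sup>2 * (norm T * (norm V)\<^sup>2)"
      using abs_form_le[of V T] by (intro mult_left_mono) (auto simp: abs_le_iff)
    also have "t\<^sup>2 * (norm T * (norm V)\<^sup>2) = t * (norm V)\<^sup>2"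
      using T0 by (simp add: t_def power2_eq_square)
    finally have 1: "t * (norm V)\<^sup>2 \<le> inner P (T * P)" by simp
    have "1 / c \<le> norm V" using lower[OF P] c0 by (simp add: V_def field_simps)
    then have "(1 / c)\<^sup>2 \<le> (norm V)\<^sup>2" using c0 by (intro power_mono) auto
    then have "t * (1 / c)\<^sup>2 \<le> t * (norm V)\<^sup>2" by (intro mult_left_mono) (auto simp: t_def)
    moreover have "t * (1 / c)\<^sup>2 = 1 / (c\<^sup>2 * norm T)" by (simp add: t_def power_divide field_simps)
    ultimately show ?thesis using 1 by linarith
  qed
  have "lamS d x \<le> l - 1 / (c\<^sup>2 * norm T)"
  proof (rule lamS_le[OF d])
    fix P assume P: "P \<in> unitc d"
    have Pc: "P \<in> colm d" and nP: "norm P = 1" using P by (auto simp: unitc_def)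
    show "inner P (x * P) \<le> l - 1 / (c\<^sup>2 * norm T)"
      using key[OF P] Tform[OF Pc] nP by simp
  qed
  moreover have "0 < 1 / (c\<^sup>2 * norm T)" using c0 T0 by simp
  ultimately show False by (simp add: l_def)
qed

lemma eigen_unitc:
  assumes d: "1 \<le> d" and x: "bd x d" and e: "eigenvalue (ofF d x) (complex_of_real t)"
  shows "\<exists>P\<in>unitc d. x * P = t *\<^sub>R P"
proof -
  obtain v where v: "v \<in> carrier_vec d" "v \<noteq> 0\<^sub>v d" "ofF d x *\<^sub>v v = complex_of_real t \<cdot>\<^sub>v v"
    using e unfolding eigenvalue_def eigenvector_def by (auto simp: ofF_def)
  define P where "P = cvF d v"
  have P0: "P \<noteq> 0"
  proof
    assume "P = 0"
    then have "vec_index v i = 0" if "i < d" for i using that ent_cvF[of d v i 0] by (simp add: P_def)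
    then have "v = 0\<^sub>v d" using v by (intro eq_vecI) auto
    with v show False by simp
  qed
  have xP: "x * P = t *\<^sub>R P"
    using toF_cvF[of "ofF d x" d v] v x by (simp add: P_def cvF_smult)
  have "(1 / norm P) *\<^sub>R P \<in> unitc d"
    using P0 cvF_colm[OF d, of v] by (auto simp: unitc_def P_def intro: colm_scaleR)
  moreover have "x * ((1 / norm P) *\<^sub>R P) = t *\<^sub>R ((1 / norm P) *\<^sub>R P)" using xP by simp
  ultimately show ?thesis by blast
qed

lemma lamS_attained:
  "1 \<le> d \<Longrightarrow> x \<in> sad d \<Longrightarrow> \<exists>P\<in>unitc d. x * P = lamS d x *\<^sub>R P"
  by (rule eigen_unitc) (auto simp: sad_def lamS_eigen)

lemma lambda_max_toF:
  assumes d: "1 \<le> d" and A: "self_adjoint d A"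
  shows "lambda_max A = lamS d (toF d A)"
proof -
  have Ac: "A \<in> carrier_mat d d" using A by (simp add: self_adjoint_def)
  have x: "toF d A \<in> sad d" by (rule toF_sad[OF A])
  let ?E = "{t :: real. eigenvalue A (complex_of_real t)}"
  have "complex_of_real ` ?E \<subseteq> spectrum A" by (auto simp: spectrum_def)
  then have "finite (complex_of_real ` ?E)" using card_finite_spectrum(1)[OF Ac] finite_subset by blast
  then have fin: "finite ?E" by (rule finite_imageD) (simp add: inj_on_def)
  have mem: "lamS d (toF d A) \<in> ?E" using lamS_eigen[OF d x] Ac by simp
  moreover have "t \<le> lamS d (toF d A)" if "t \<in> ?E" for t
  proof -
    have "eigenvalue (ofF d (toF d A)) (complex_of_real t)" using that Ac by simp
    from eigen_unitc[OF d bd_toF this] obtain P where P: "P \<in> unitc d" "toF d A * P = t *\<^sub>R P" by auto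
    from lamS_upper[OF P(1), of "toF d A"] P show ?thesis
      by (simp add: unitc_def power2_norm_eq_inner[symmetric])
  qed
  ultimately show ?thesis unfolding lambda_max_def using fin by (intro Max_eqI) auto
qed

text \<open>Both sides are sums over the columns of the matrix. A matrix P larger than d is first
  cut to its first d rows, the only ones that x sees; this can only decrease the norm, and \<rho> is
  nonnegative.\<close>

lemma form_columns:
  assumes d: "1 \<le> d" and x: "bd x d" and h: "\<And>P. P \<in> colm d \<Longrightarrow> inner P (x * P) \<le> \<rho> * (norm P)\<^sup>2" and r: "0 \<le> \<rho>"
  shows "inner P (x * P) \<le> \<rho> * (norm P)\<^sup>2"
proof -
  define n where "n = max d (dm P)"
  define Q where "Q = idm d * P"
  \<comment> \<open>Multiplication by \<open>u j\<close> moves column j to the first column and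
    erases the others.\<close>
  define u where "u j = bv (j, 0, True)" for j
  have bP: "bd P n" and bi: "bd (idm d) n" by (auto simp: n_def intro: bd_mono[OF bd_dm] bd_mono[OF bd_idm])
  have bQ: "bd Q n" unfolding Q_def by (rule bd_times[OF bi bP])
  have iQ: "idm d * Q = Q" unfolding Q_def mult.assoc[symmetric] by simp
  have xQ: "x * P = x * Q" unfolding Q_def mult.assoc[symmetric] using x by simp
  have usum: "(\<Sum>j<n. u j * adj (u j)) = idm n"
  proof (rule fm_eqI)
    fix k l
    have es: "ent (sum f I) k l = (\<Sum>i\<in>I. ent (f i) k l)" for f :: "nat \<Rightarrow> fm" and I
      by (induction I rule: infinite_finite_induct) auto
    have ub: "bd (u j) (Suc j)" for j by (auto simp: u_def bd_def ent_bv)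
    have "ent (u j * adj (u j)) k l = (if k = j then if l = j then 1 else 0 else 0)" for j
      unfolding ent_times[OF ub] by (auto simp: u_def ent_bv if_distrib sum.If_cases cong: if_cong)
    then show "ent (\<Sum>j<n. u j * adj (u j)) k l = ent (idm n) k l"
      unfolding es by (auto simp: ent_idm)
  qed
  have col: "Q * u j \<in> colm d" for j
  proof -
    have "u j * idm 1 = u j" by (rule fm_eqI) (auto simp: ent_times_idm1 u_def ent_bv)
    then have 1: "Q * u j * idm 1 = Q * u j" by (simp add: mult.assoc)
    have "ent (Q * u j) k l = 0" if "d \<le> k \<or> d \<le> l" for k l
    proof -
      have "ent (Q * u j) k l = ent (Q * u j * idm 1) k l" by (simp only: 1)
      moreover have "ent (Q * u j) k l = (\<Sum>i<d. ent (idm d) k i * ent (Q * u j) i l)"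
        using ent_times[OF bd_idm, of d "Q * u j" k l] by (simp add: mult.assoc[symmetric] iQ)
      ultimately show ?thesis using that d by (auto simp: ent_times_idm1 ent_idm)
    qed
    then show ?thesis using 1 by (simp add: colm_def bd_def)
  qed
  have dec: "inner Q (y * Q) = (\<Sum>j<n. inner (Q * u j) (y * (Q * u j)))" for y
  proof -
    have "inner Q (y * Q) = inner Q (y * (Q * idm n))" using bQ by simp
    also have "\<dots> = (\<Sum>j<n. inner Q (y * (Q * (u j * adj (u j)))))"
      unfolding usum[symmetric] by (simp add: sum_distrib_left inner_sum_right)
    also have "\<dots> = (\<Sum>j<n. inner (Q * u j) (y * (Q * u j)))"
      by (simp add: inner_times_right[of Q] mult.assoc)
    finally show ?thesis .
  qed
  have nQ: "(norm Q)\<^sup>2 = (\<Sum>j<n. (norm (Q * u j))\<^sup>2)"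
  proof -
    have "inner Q Q = inner Q (Q * idm n)" using bQ by simp
    also have "\<dots> = (\<Sum>j<n. inner Q (Q * (u j * adj (u j))))"
      unfolding usum[symmetric] by (simp add: sum_distrib_left inner_sum_right)
    also have "\<dots> = (\<Sum>j<n. inner (Q * u j) (Q * u j))"
      by (simp add: inner_times_right[of Q] mult.assoc)
    finally show ?thesis by (simp add: power2_norm_eq_inner)
  qed
  have QP: "norm Q \<le> norm P"
  proof -
    have "(norm Q)\<^sup>2 = inner P Q"
      unfolding power2_norm_eq_inner using iQ by (simp add: Q_def inner_times_left)
    also have "\<dots> \<le> norm P * norm Q" by (rule norm_cauchy_schwarz)
    finally show ?thesis by (cases "norm Q = 0") (auto simp: power2_eq_square)
  qed
  have "inner P (x * P) = inner P (idm d * (x * Q))"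
    unfolding xQ using x by (simp add: mult.assoc[symmetric])
  also have "\<dots> = inner Q (x * Q)" unfolding Q_def by (subst inner_times_left) simp
  also have "\<dots> \<le> (\<Sum>j<n. \<rho> * (norm (Q * u j))\<^sup>2)"
    unfolding dec by (intro sum_mono h col)
  also have "\<dots> = \<rho> * (norm Q)\<^sup>2" by (simp add: nQ sum_distrib_left)
  also have "\<dots> \<le> \<rho> * (norm P)\<^sup>2" using QP r by (intro mult_left_mono power_mono) auto
  finally show ?thesis .
qed

text \<open>Polarisation: the form at u + w and at u - w controls the bilinear expression, and a
  suitable multiple of x P as u gives the bound of x P.\<close>

lemma opb_of_form:
  assumes d: "1 \<le> d" and x: "x \<in> sad d" and r: "0 \<le> \<rho>"
    and h: "\<And>P. P \<in> colm d \<Longrightarrow> \<bar>inner P (x * P)\<bar> \<le> \<rho> * (norm P)\<^sup>2"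
  shows "opb x \<rho>"
proof -
  have bx: "bd x d" and ax: "adj x = x" using x by (auto simp: sad_def)
  have up: "inner P (x * P) \<le> \<rho> * (norm P)\<^sup>2" for P
    by (rule form_columns[OF d bx _ r]) (use h in \<open>auto simp: abs_le_iff\<close>)
  have "bd (- x) d" using bx by (auto simp: bd_def)
  then have "inner P (- x * P) \<le> \<rho> * (norm P)\<^sup>2" for P
    by (rule form_columns[OF d _ _ r]) (use h in \<open>auto simp: abs_le_iff\<close>)
  then have lo: "- (\<rho> * (norm P)\<^sup>2) \<le> inner P (x * P)" for P by (metis inner_minus_right minus_le_iff mult_minus_left)
  have pol: "2 * inner u (x * w) \<le> \<rho> * ((norm u)\<^sup>2 + (norm w)\<^sup>2)" for u w
  proof -
    have s: "inner w (x * u) = inner u (x * w)" by (metis ax inner_commute inner_times_left)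
    have "4 * inner u (x * w) = inner (u + w) (x * (u + w)) - inner (u - w) (x * (u - w))"
      using s by (simp add: distrib_left right_diff_distrib inner_add_left inner_add_right inner_diff_left inner_diff_right)
    also have "\<dots> \<le> \<rho> * (norm (u + w))\<^sup>2 + \<rho> * (norm (u - w))\<^sup>2"
      using up[of "u + w"] lo[of "u - w"] by linarith
    also have "\<dots> = 2 * (\<rho> * ((norm u)\<^sup>2 + (norm w)\<^sup>2))"
      by (simp add: power2_norm_eq_inner inner_add_left inner_add_right inner_diff_left inner_diff_right inner_commute algebra_simps)
    finally show ?thesis by simp
  qed
  have "norm (x * P) \<le> \<rho> * norm P" for P
  proof (cases "\<rho> = 0")
    case True
    then show ?thesis using pol[of "x * P" P] by (simp add: power2_norm_eq_inner[symmetric])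
  next
    case False
    then have r0: "0 < \<rho>" using r by simp
    define V where "V = x * P"
    \<comment> \<open>The factor 1 / \<rho> balances the two squares on the right, which loses
      nothing in the constant.\<close>
    have "2 * inner ((1 / \<rho>) *\<^sub>R V) V \<le> \<rho> * ((norm ((1 / \<rho>) *\<^sub>R V))\<^sup>2 + (norm P)\<^sup>2)"
      unfolding V_def by (rule pol)
    then have "2 * (norm V)\<^sup>2 / \<rho> \<le> (norm V)\<^sup>2 / \<rho> + \<rho> * (norm P)\<^sup>2"
      using r0 by (simp add: power2_norm_eq_inner[symmetric] power_divide distrib_left power2_eq_square)
    then have "(norm V)\<^sup>2 / \<rho> \<le> \<rho> * (norm P)\<^sup>2" by simp
    then have "(norm V)\<^sup>2 \<le> (\<rho> * (norm P)\<^sup>2) * \<rho>" unfolding pos_divide_le_eq[OF r0] .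
    also have "\<dots> = (\<rho> * norm P)\<^sup>2" by (simp only: power2_eq_square mult_ac)
    finally have "(norm V)\<^sup>2 \<le> (\<rho> * norm P)\<^sup>2" .
    then show ?thesis unfolding V_def by (rule power2_le_imp_le) (use r in simp)
  qed
  then show ?thesis using r by (simp add: opb_def)
qed

definition opS :: "nat \<Rightarrow> fm \<Rightarrow> real" where "opS d x = max (lamS d x) (lamS d (- x))"

lemma lamS_sum_nonneg: "1 \<le> d \<Longrightarrow> 0 \<le> lamS d x + lamS d (- x)"
proof -
  assume d: "1 \<le> d"
  obtain P where P: "P \<in> unitc d" using unitc_nonempty[OF d] by auto
  from lamS_upper[OF P, of x] lamS_upper[OF P, of "- x"] show ?thesis by simp
qed

lemma opS_nonneg: "1 \<le> d \<Longrightarrow> 0 \<le> opS d x"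
  using lamS_sum_nonneg[of d x] by (auto simp: opS_def)

lemma opb_opS: "1 \<le> d \<Longrightarrow> x \<in> sad d \<Longrightarrow> opb x (opS d x)"
proof (rule opb_of_form)
  fix P assume P: "P \<in> colm d"
  have "inner P (x * P) \<le> opS d x * (norm P)\<^sup>2"
    by (rule order_trans[OF lamS_form[OF P]]) (auto simp: opS_def intro!: mult_right_mono)
  moreover have "inner P (- x * P) \<le> opS d x * (norm P)\<^sup>2"
    by (rule order_trans[OF lamS_form[OF P]]) (auto simp: opS_def intro!: mult_right_mono)
  ultimately show "\<bar>inner P (x * P)\<bar> \<le> opS d x * (norm P)\<^sup>2" by (simp add: abs_le_iff)
qed (auto simp: opS_nonneg)

lemma sad_uminus: "x \<in> sad d \<Longrightarrow> - x \<in> sad d"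
  using sad_scaleR[of x d "-1"] by simp

lemma opS_attained:
  assumes d: "1 \<le> d" and x: "x \<in> sad d"
  shows "\<exists>P\<in>unitc d. \<exists>t. x * P = t *\<^sub>R P \<and> \<bar>t\<bar> = opS d x"
proof (cases "lamS d (- x) \<le> lamS d x")
  case True
  then have "opS d x = lamS d x" "0 \<le> lamS d x" using opS_nonneg[OF d, of x] by (auto simp: opS_def)
  then show ?thesis using lamS_attained[OF d x] by fastforce
next
  case False
  then have e: "opS d x = lamS d (- x)" "0 \<le> lamS d (- x)" using opS_nonneg[OF d, of x] by (auto simp: opS_def)
  obtain P where P: "P \<in> unitc d" "- x * P = lamS d (- x) *\<^sub>R P"
    using lamS_attained[OF d sad_uminus[OF x]] by auto
  then have "x * P = (- lamS d (- x)) *\<^sub>R P" by (metis minus_minus mult_minus_left scaleR_minus_left)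
  then show ?thesis using P e by (intro bexI[of _ P] exI[of _ "- lamS d (- x)"]) auto
qed

lemma opnorm_toF:
  assumes d: "1 \<le> d" and A: "self_adjoint d A"
  shows "opnorm A = opS d (toF d A)"
proof -
  have Ac: "A \<in> carrier_mat d d" using A by (simp add: self_adjoint_def)
  have x: "toF d A \<in> sad d" by (rule toF_sad[OF A])
  have nv: "vnorm (A *\<^sub>v v) = norm (toF d A * cvF d v)" if "v \<in> carrier_vec d" for v
    using that Ac by (simp add: toF_cvF norm_cvF)
  have up: "vnorm (A *\<^sub>v v) \<le> opS d (toF d A)" if "v \<in> unit_vecs d" for v
    using that opbD[OF opb_opS[OF d x], of "cvF d v"] by (simp add: nv norm_cvF unit_vecs_def)
  obtain P t where P: "P \<in> unitc d" "toF d A * P = t *\<^sub>R P" "\<bar>t\<bar> = opS d (toF d A)"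
    using opS_attained[OF d x] by auto
  define v where "v = Matrix.vec d (\<lambda>i. ent P i 0)"
  have Pv: "P = cvF d v" unfolding v_def by (rule colm_cvF) (use P in \<open>simp add: unitc_def\<close>)
  have vc: "v \<in> carrier_vec d" by (simp add: v_def)
  have "vnorm v = 1" using norm_cvF[OF vc] P(1) unfolding Pv[symmetric] by (simp add: unitc_def)
  then have v: "v \<in> unit_vecs d" by (simp add: unit_vecs_def vc)
  have att: "vnorm (A *\<^sub>v v) = opS d (toF d A)"
    unfolding nv[OF vc] Pv[symmetric] P(2) using P(1,3) by (simp add: unitc_def)
  have dc: "dim_col A = d" using Ac by simp
  show ?thesis
    unfolding opnorm_def dc
  proof (rule antisym)
    show "(SUP v\<in>unit_vecs d. vnorm (A *\<^sub>v v)) \<le> opS d (toF d A)"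
      by (rule cSUP_least) (use v up in auto)
    show "opS d (toF d A) \<le> (SUP v\<in>unit_vecs d. vnorm (A *\<^sub>v v))"
      unfolding att[symmetric] by (rule cSUP_upper[OF v]) (rule bdd_aboveI2[OF up])
  qed
qed

lemma pw_eigen: "bd Y d \<Longrightarrow> P \<in> colm d \<Longrightarrow> Y * P = t *\<^sub>R P \<Longrightarrow> pw d Y k * P = t ^ k *\<^sub>R P"
  by (induction k) (auto simp: mult.assoc colm_def mult.commute)

lemma norm_pw_ge:
  assumes "bd Y d" "P \<in> unitc d" "Y * P = t *\<^sub>R P"
  shows "\<bar>t\<bar> ^ k \<le> norm (pw d Y k)"
proof -
  have "\<bar>t\<bar> ^ k = norm (pw d Y k * P)" using assms pw_eigen[OF assms(1) _ assms(3), of k] by (simp add: unitc_def power_abs)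
  also have "\<dots> \<le> norm (pw d Y k) * norm P" by (rule norm_mult_ineq)
  finally show ?thesis using assms by (simp add: unitc_def)
qed

lemma norm_pw_opb: "opb Y \<rho> \<Longrightarrow> norm (pw d Y k) \<le> \<rho> ^ k * norm (idm d)"
proof (induction k)
  case (Suc k)
  have "norm (Y * pw d Y k) \<le> \<rho> * norm (pw d Y k)" by (rule opbD[OF Suc.prems])
  also have "\<dots> \<le> \<rho> * (\<rho> ^ k * norm (idm d))"
    using Suc by (intro mult_left_mono) (auto simp: opb_def)
  finally show ?case by (simp add: mult.assoc)
qed simp

text \<open>Gelfand's formula for a self-adjoint matrix: the Frobenius norm of a power lies between
  the power of the operator norm and \<open>norm (idm d)\<close> times it, and the root removes this
  factor in the limit. It exhibits the operator norm as a limit of measurable functions.\<close>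

lemma opS_lim:
  assumes d: "1 \<le> d" and x: "x \<in> sad d"
  shows "(\<lambda>k. root (Suc k) (norm (pw d x (Suc k)))) \<longlonglongrightarrow> opS d x"
proof (rule tendsto_sandwich[OF always_eventually always_eventually])
  have bx: "bd x d" using x by (simp add: sad_def)
  have o: "0 \<le> opS d x" by (rule opS_nonneg[OF d])
  obtain P t where P: "P \<in> unitc d" "x * P = t *\<^sub>R P" "\<bar>t\<bar> = opS d x" using opS_attained[OF d x] by auto
  show "\<forall>k. opS d x \<le> root (Suc k) (norm (pw d x (Suc k)))"
  proof
    fix k
    have "opS d x = root (Suc k) (opS d x ^ Suc k)" using o by (simp only: real_root_power_cancel zero_less_Suc)
    also have "\<dots> \<le> root (Suc k) (norm (pw d x (Suc k)))"
      using norm_pw_ge[OF bx P(1,2), of "Suc k"] unfolding P(3) by (intro real_root_le_mono) auto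
    finally show "opS d x \<le> root (Suc k) (norm (pw d x (Suc k)))" .
  qed
  show "\<forall>k. root (Suc k) (norm (pw d x (Suc k))) \<le> opS d x * root (Suc k) (norm (idm d))"
  proof
    fix k
    have "root (Suc k) (norm (pw d x (Suc k))) \<le> root (Suc k) (opS d x ^ Suc k * norm (idm d))"
      using norm_pw_opb[OF opb_opS[OF d x], of d "Suc k"] by (intro real_root_le_mono) auto
    also have "\<dots> = opS d x * root (Suc k) (norm (idm d))"
      using o by (simp only: real_root_mult real_root_power_cancel zero_less_Suc)
    finally show "root (Suc k) (norm (pw d x (Suc k))) \<le> opS d x * root (Suc k) (norm (idm d))" .
  qed
  have "0 < (norm (idm d))\<^sup>2" using d by (simp add: norm_idm)
  then have "0 < norm (idm d)" by simp
  from LIMSEQ_root_const[OF this] have "(\<lambda>k. root (Suc k) (norm (idm d))) \<longlonglongrightarrow> 1" by (rule LIMSEQ_Suc)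
  then have "(\<lambda>k. opS d x * root (Suc k) (norm (idm d))) \<longlonglongrightarrow> opS d x * 1" by (intro tendsto_intros)
  then show "(\<lambda>k. opS d x * root (Suc k) (norm (idm d))) \<longlonglongrightarrow> opS d x" by simp
qed simp

lemma lamS_shift:
  assumes d: "1 \<le> d" shows "lamS d (x + c *\<^sub>R idm d) = lamS d x + c"
proof -
  have *: "lamS d (y + c *\<^sub>R idm d) \<le> lamS d y + c" for y c
  proof (rule lamS_le[OF d])
    fix P assume P: "P \<in> unitc d"
    have "inner P ((y + c *\<^sub>R idm d) * P) = inner P (y * P) + c"
      using P by (simp add: distrib_right inner_add_right unitc_def colm_def power2_norm_eq_inner[symmetric])
    then show "inner P ((y + c *\<^sub>R idm d) * P) \<le> lamS d y + c" using lamS_upper[OF P, of y] by simp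
  qed
  from *[of x c] *[of "x + c *\<^sub>R idm d" "- c"] show ?thesis by simp
qed

text \<open>Agrees with \<open>lamS\<close> on self-adjoint matrices, but is measurable on the whole space.\<close>

definition lamM :: "nat \<Rightarrow> fm \<Rightarrow> real" where
  "lamM d x = lim (\<lambda>k. root (Suc k) (norm (pw d (x + norm x *\<^sub>R idm d) (Suc k)))) - norm x"

lemma measurable_lamM [measurable]: "lamM d \<in> borel_measurable FM"
proof -
  have [measurable]: "idm d \<in> space FM" by simp
  show ?thesis unfolding lamM_def
    by (intro borel_measurable_diff borel_measurable_lim_metric measurable_compose[OF _ borel_measurable_root] measurable_FM_norm
      measurable_FM_pw measurable_FM_add measurable_FM_scaleR measurable_ident_sets[OF refl] measurable_const)
    simp
qed

text \<open>The shift by the norm of x makes the spectrum nonnegative; the operator norm of the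
  shifted matrix is then its largest eigenvalue, and the shift is subtracted again.\<close>

lemma lamM_eq:
  assumes d: "1 \<le> d" and x: "x \<in> sad d"
  shows "lamM d x = lamS d x"
proof -
  define y where "y = x + norm x *\<^sub>R idm d"
  have y: "y \<in> sad d" unfolding y_def by (intro sad_add sad_scaleR sad_idm x)
  have "- y = - x + (- norm x) *\<^sub>R idm d" by (simp add: y_def)
  then have "lamS d (- y) = lamS d (- x) + (- norm x)" using lamS_shift[OF d, of "- x" "- norm x"] by simp
  moreover have "lamS d y = lamS d x + norm x" unfolding y_def by (rule lamS_shift[OF d])
  ultimately have "opS d y = lamS d x + norm x"
    using abs_lamS_le[OF d, of x] abs_lamS_le[OF d, of "- x"] by (auto simp: opS_def abs_le_iff)
  then show ?thesis using limI[OF opS_lim[OF d y]] by (simp add: lamM_def y_def)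
qed

section \<open>Exponential moments\<close>

lemma exp_two_le_one_plus: "- (1/2) \<le> y \<Longrightarrow> exp (- (2 * \<bar>y\<bar>)) \<le> 1 + (y::real)"
proof (cases "0 \<le> y")
  case False
  assume y: "- (1/2) \<le> y"
  define z where "z = - y"
  have z: "0 \<le> z" "z \<le> 1/2" using False y by (auto simp: z_def)
  have "1 \<le> 1 + z * (1 - 2 * z)" using z by simp
  also have "\<dots> = (1 + 2 * z) * (1 - z)" by (simp add: algebra_simps)
  also have "\<dots> \<le> exp (2 * z) * (1 - z)"
    using exp_ge_add_one_self[of "2 * z"] z by (intro mult_right_mono) auto
  finally have "exp (- (2 * z)) * 1 \<le> exp (- (2 * z)) * (exp (2 * z) * (1 - z))"
    by (intro mult_left_mono) auto
  then have "exp (- (2 * z)) \<le> 1 - z" by (simp add: mult.assoc[symmetric] exp_add[symmetric])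
  then show ?thesis using False by (simp add: z_def)
qed (auto intro: order_trans[of _ 1])

text \<open>A majorant, uniform in m, for reciprocals of the approximate exponential. Where the
  power may come close to 0, that is for x below - m, the summand with 4^m takes over, because
  4^(-m) is at least exp (- 2m).\<close>

lemma inverse_power_bound:
  fixes x :: real
  assumes d: "1 \<le> d" and m: "1 \<le> m"
  shows "1 / (real d / 4 ^ m + (1 + x / (2 * real m)) ^ (2 * m)) \<le> exp (2 * \<bar>x\<bar>)"
proof -
  have "exp (- (2 * \<bar>x\<bar>)) \<le> real d / 4 ^ m + (1 + x / (2 * real m)) ^ (2 * m)"
  proof (cases "- real m \<le> x")
    case True
    define y where "y = x / (2 * real m)"
    have y: "- (1/2) \<le> y" using True m by (simp add: y_def field_simps)
    have "exp (- (2 * \<bar>x\<bar>)) = exp (- (2 * \<bar>y\<bar>)) ^ (2 * m)"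
      using m by (simp add: exp_of_nat_mult[symmetric] y_def abs_divide)
    also have "\<dots> \<le> (1 + y) ^ (2 * m)" by (intro power_mono exp_two_le_one_plus y) auto
    finally show ?thesis by (simp add: y_def add_increasing)
  next
    case False
    have "(2::real) ^ 2 \<le> exp 1 ^ 2" using exp_ge_add_one_self[of 1] by (intro power_mono) auto
    moreover have "exp (1::real) ^ 2 = exp 2" by (simp add: power2_eq_square exp_add[symmetric])
    ultimately have e2: "4 \<le> exp (2::real)" by simp
    have "exp (- (2 * \<bar>x\<bar>)) \<le> exp (- (2 * real m))" using False by auto
    also have "\<dots> = 1 / exp 2 ^ m" by (simp add: exp_minus inverse_eq_divide exp_of_nat_mult[symmetric] mult.commute)
    also have "\<dots> \<le> 1 / 4 ^ m" using e2 by (intro divide_left_mono power_mono) auto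
    also have "\<dots> \<le> real d / 4 ^ m" using d by (intro divide_right_mono) auto
    finally show ?thesis by (simp add: add_increasing2)
  qed
  then have "1 / (real d / 4 ^ m + (1 + x / (2 * real m)) ^ (2 * m)) \<le> 1 / exp (- (2 * \<bar>x\<bar>))"
    by (intro divide_left_mono mult_pos_pos) (auto intro: less_le_trans[OF exp_gt_zero])
  then show ?thesis by (simp add: exp_minus inverse_eq_divide)
qed

lemma exp_limit_even: "(\<lambda>m. (1 + x / (2 * real (Suc m))) ^ (2 * Suc m)) \<longlonglongrightarrow> exp (x::real)"
proof -
  have "filterlim (\<lambda>m. 2 * Suc m) at_top sequentially"
    by (rule filterlim_subseq) (auto simp: strict_mono_def)
  from filterlim_compose[OF tendsto_exp_limit_sequentially[of x] this] show ?thesis by (simp add: mult.commute)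
qed

section \<open>Even powers and the largest eigenvalue\<close>

text \<open>An eigenvector for the largest eigenvalue of s X is also one for Y, and the norm of Y^m
  is at least the m-th power of that eigenvalue. The sign s lets one statement serve both ends of
  the spectrum of X.\<close>

lemma F0_lower:
  assumes d: "1 \<le> d" and m: "1 \<le> m" and X: "X \<in> sad d" and s: "s\<^sup>2 = (1::real)"
  shows "real d / 4 ^ m + (1 + \<beta> * lamS d (s *\<^sub>R X) / (2 * real m)) ^ (2 * m)
    \<le> F0 d m (2 *\<^sub>R idm d + (s * \<beta> / real m) *\<^sub>R X) / 4 ^ m"
proof -
  define l where "l = lamS d (s *\<^sub>R X)"
  define Y where "Y = 2 *\<^sub>R idm d + (s * \<beta> / real m) *\<^sub>R X"
  have Y: "Y \<in> sad d" unfolding Y_def by (intro sad_add sad_scaleR sad_idm X)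
  then have bY: "bd Y d" by (simp add: sad_def)
  obtain P where P: "P \<in> unitc d" "(s *\<^sub>R X) * P = l *\<^sub>R P"
    using lamS_attained[OF d sad_scaleR[OF X, of s]] by (auto simp: l_def)
  have "X * P = (s * s) *\<^sub>R (X * P)" using s by (simp add: power2_eq_square)
  also have "\<dots> = (s * l) *\<^sub>R P" using P(2) by (metis mult_scaleR_left scaleR_scaleR)
  finally have XP: "X * P = (s * l) *\<^sub>R P" .
  define t where "t = 2 + \<beta> * l / real m"
  have "Y * P = 2 *\<^sub>R P + ((s * \<beta> / real m) * (s * l)) *\<^sub>R P"
    using P XP by (simp add: Y_def distrib_right unitc_def colm_def)
  also have "(s * \<beta> / real m) * (s * l) = (s * s) * (\<beta> * l / real m)" by simp
  finally have "Y * P = t *\<^sub>R P" using s by (simp add: t_def scaleR_add_left power2_eq_square)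
  from norm_pw_ge[OF bY P(1) this, of m] have "(\<bar>t\<bar> ^ m)\<^sup>2 \<le> (norm (pw d Y m))\<^sup>2" by (intro power_mono) auto
  moreover have "(\<bar>t\<bar> ^ m)\<^sup>2 = t ^ (2 * m)" by (simp add: power_mult[symmetric] mult.commute power_even_abs)
  ultimately have "real d + t ^ (2 * m) \<le> F0 d m Y" using bY by (simp add: F0_eq[OF Y] QQ_def norm_idm)
  then have "(real d + t ^ (2 * m)) / 4 ^ m \<le> F0 d m Y / 4 ^ m" by (intro divide_right_mono) auto
  moreover have "t ^ (2 * m) / 4 ^ m = (1 + \<beta> * l / (2 * real m)) ^ (2 * m)"
  proof -
    have "t = 2 * (1 + \<beta> * l / (2 * real m))" using m by (simp add: t_def field_simps)
    then have "t ^ (2 * m) = (2 * (1 + \<beta> * l / (2 * real m))) ^ (2 * m)" by simp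
    also have "\<dots> = 4 ^ m * (1 + \<beta> * l / (2 * real m)) ^ (2 * m)"
      unfolding power_mult_distrib by (simp add: power_mult)
    finally show ?thesis by simp
  qed
  ultimately show ?thesis by (simp add: add_divide_distrib Y_def l_def)
qed

text \<open>The even power also sees the lower end of the spectrum of Y. There the modulus is at
  most \<beta> l' / m - 2, the shift by 2 now acting against it, and this costs a factor exp (- 4m)
  that kills the contribution as m grows.\<close>

lemma F0_upper:
  assumes d: "1 \<le> d" and m: "1 \<le> m" and X: "X \<in> sad d" and s: "s\<^sup>2 = (1::real)" and b: "0 \<le> \<beta>"
  shows "F0 d m (2 *\<^sub>R idm d + (s * \<beta> / real m) *\<^sub>R X) / 4 ^ m
    \<le> real d / 4 ^ m + real d * exp (\<beta> * lamS d (s *\<^sub>R X)) + real d * (exp (\<beta> * lamS d (- (s *\<^sub>R X))) * exp (- 2 * real m))"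
proof -
  define l where "l = lamS d (s *\<^sub>R X)"
  define l' where "l' = lamS d (- (s *\<^sub>R X))"
  define Y where "Y = 2 *\<^sub>R idm d + (s * \<beta> / real m) *\<^sub>R X"
  have Y: "Y \<in> sad d" unfolding Y_def by (intro sad_add sad_scaleR sad_idm X)
  then have bY: "bd Y d" by (simp add: sad_def)
  define r1 where "r1 = 2 + \<beta> / real m * l"
  define r2 where "r2 = \<beta> / real m * l' - 2"
  define \<rho> where "\<rho> = max r1 r2"
  have ll: "0 \<le> l + l'" unfolding l_def l'_def by (rule lamS_sum_nonneg[OF d])
  have "r1 + r2 = \<beta> / real m * (l + l')" by (simp add: r1_def r2_def algebra_simps add_divide_distrib)
  also have "0 \<le> \<dots>" using ll b by (intro mult_nonneg_nonneg) auto
  finally have r0: "0 \<le> \<rho>" by (auto simp: \<rho>_def)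
  have bm: "0 \<le> \<beta> / real m" using b by simp
  have "opb Y \<rho>"
  proof (rule opb_of_form[OF d Y r0])
    fix P assume P: "P \<in> colm d"
    have form: "inner P (Y * P) = 2 * (norm P)\<^sup>2 + \<beta> / real m * inner P ((s *\<^sub>R X) * P)"
      using P by (simp add: Y_def distrib_right inner_add_right colm_def power2_norm_eq_inner)
    have "inner P (Y * P) \<le> 2 * (norm P)\<^sup>2 + \<beta> / real m * (l * (norm P)\<^sup>2)"
      unfolding form l_def by (intro add_left_mono mult_left_mono lamS_form P bm)
    also have "\<dots> = r1 * (norm P)\<^sup>2" by (simp add: r1_def algebra_simps)
    also have "\<dots> \<le> \<rho> * (norm P)\<^sup>2" by (intro mult_right_mono) (auto simp: \<rho>_def)
    finally have 1: "inner P (Y * P) \<le> \<rho> * (norm P)\<^sup>2" .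
    have "\<beta> / real m * inner P (- (s *\<^sub>R X) * P) \<le> \<beta> / real m * (l' * (norm P)\<^sup>2)"
      unfolding l'_def by (intro mult_left_mono lamS_form P bm)
    then have "- inner P (Y * P) \<le> r2 * (norm P)\<^sup>2" unfolding form by (simp add: r2_def algebra_simps)
    also have "\<dots> \<le> \<rho> * (norm P)\<^sup>2" by (intro mult_right_mono) (auto simp: \<rho>_def)
    finally show "\<bar>inner P (Y * P)\<bar> \<le> \<rho> * (norm P)\<^sup>2" using 1 by (simp add: abs_le_iff)
  qed
  from norm_pw_opb[OF this, of d m] have "(norm (pw d Y m))\<^sup>2 \<le> (\<rho> ^ m * norm (idm d))\<^sup>2" by (intro power_mono) auto
  also have "\<dots> = \<rho> ^ (2 * m) * real d" by (simp add: power_mult_distrib norm_idm power_mult[symmetric] mult.commute)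
  finally have F: "F0 d m Y \<le> real d + \<rho> ^ (2 * m) * real d" using bY by (simp add: F0_eq[OF Y] QQ_def norm_idm)
  have pe: "(2 * (1 + y)) ^ (2 * m) / 4 ^ m \<le> exp (2 * real m * y)" if "0 \<le> 1 + y" for y :: real
  proof -
    have "(2 * (1 + y)) ^ (2 * m) / 4 ^ m = (1 + y) ^ (2 * m)" unfolding power_mult_distrib by (simp add: power_mult)
    also have "\<dots> \<le> exp y ^ (2 * m)" using that by (intro power_mono exp_ge_add_one_self)
    finally show ?thesis by (simp add: exp_of_nat_mult[symmetric])
  qed
  have "\<rho> ^ (2 * m) / 4 ^ m \<le> exp (\<beta> * l) + exp (\<beta> * l') * exp (- 2 * real m)"
  proof (cases "r2 \<le> r1")
    case True
    have "\<rho> = 2 * (1 + \<beta> * l / (2 * real m))" using True m by (simp add: \<rho>_def r1_def field_simps)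
    then have "\<rho> ^ (2 * m) / 4 ^ m \<le> exp (2 * real m * (\<beta> * l / (2 * real m)))" using pe[of "\<beta> * l / (2 * real m)"] r0 by simp
    also have "2 * real m * (\<beta> * l / (2 * real m)) = \<beta> * l" using m by simp
    finally show ?thesis by (simp add: add_increasing2)
  next
    case False
    have "\<rho> = 2 * (1 + (\<beta> * l' / (2 * real m) - 2))" using False m by (simp add: \<rho>_def r2_def field_simps)
    then have "\<rho> ^ (2 * m) / 4 ^ m \<le> exp (2 * real m * (\<beta> * l' / (2 * real m) - 2))"
      using pe[of "\<beta> * l' / (2 * real m) - 2"] r0 by simp
    also have "2 * real m * (\<beta> * l' / (2 * real m) - 2) = \<beta> * l' - 4 * real m" using m by (simp add: field_simps)
    also have "exp (\<beta> * l' - 4 * real m) \<le> exp (\<beta> * l') * exp (- 2 * real m)" by (simp add: exp_add[symmetric])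
    finally show ?thesis by (simp add: add_increasing)
  qed
  then have "\<rho> ^ (2 * m) / 4 ^ m * real d \<le> (exp (\<beta> * l) + exp (\<beta> * l') * exp (- 2 * real m)) * real d"
    by (intro mult_right_mono) auto
  moreover have "F0 d m Y / 4 ^ m \<le> real d / 4 ^ m + \<rho> ^ (2 * m) / 4 ^ m * real d"
    using divide_right_mono[OF F, of "4 ^ m"] by (simp add: add_divide_distrib)
  ultimately have "F0 d m Y / 4 ^ m \<le> real d / 4 ^ m + (exp (\<beta> * l) + exp (\<beta> * l') * exp (- 2 * real m)) * real d" by linarith
  also have "\<dots> = real d / 4 ^ m + real d * exp (\<beta> * l) + real d * (exp (\<beta> * l') * exp (- 2 * real m))"
    by (simp add: algebra_simps)
  finally show ?thesis by (simp only: Y_def l_def l'_def)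
qed

lemma (in gaussian_fm) gaussian_fm_scale: "gaussian_fm N (\<lambda>\<omega>. c *\<^sub>R G \<omega>) d"
proof
  have e: "inner L (c *\<^sub>R G \<omega>) = inner (c *\<^sub>R L) (G \<omega>)" for L \<omega> by simp
  show "(\<lambda>\<omega>. c *\<^sub>R G \<omega>) \<in> N \<rightarrow>\<^sub>M FM" by measurable
  show "c *\<^sub>R G \<omega> \<in> sad d" if "\<omega> \<in> space N" for \<omega> by (intro sad_scaleR G_sad that)
  show "integrable N (\<lambda>\<omega>. (inner L (c *\<^sub>R G \<omega>))\<^sup>2)" for L unfolding e by (rule G_int2)
  show "(LINT \<omega>|N. inner L (c *\<^sub>R G \<omega>)) = 0" for L unfolding e by (rule G_mean)
  show "(CLINT \<omega>|N. iexp (inner L (c *\<^sub>R G \<omega>))) = exp (- complex_of_real (LINT \<omega>|N. (inner L (c *\<^sub>R G \<omega>))\<^sup>2) / 2)" for L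
    unfolding e by (rule G_char)
  show "integrable N (\<lambda>\<omega>. exp (inner L (c *\<^sub>R G \<omega>)))" for L unfolding e by (rule G_exp)
  show "(LINT \<omega>|N. exp (inner L (c *\<^sub>R G \<omega>))) = exp ((LINT \<omega>|N. (inner L (c *\<^sub>R G \<omega>))\<^sup>2) / 2)" for L
    unfolding e by (rule G_mgf)
qed

lemma opb_scaleR: "opb A R \<Longrightarrow> opb (c *\<^sub>R A) (\<bar>c\<bar> * R)"
  by (auto simp: opb_def mult.assoc intro!: mult_left_mono)

text \<open>The situation before rescaling: v stands for \<sigma>^2 and w for the square of
  \<sigma>_*. The functional \<open>inner (P * adj P)\<close> is the quadratic form at the column
  vector P.\<close>

locale model = gaussian_fm N G d + M: prob_space M
  for N :: "'b measure" and G d and M :: "'a measure" +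
  fixes Z :: "nat \<Rightarrow> 'a \<Rightarrow> fm" and n :: nat and Z0 :: fm and R v w :: real
  assumes d1: "1 \<le> d" and R0: "0 \<le> R"
    and Z0_sad: "Z0 \<in> sad d"
    and Z_sad: "\<And>k \<omega>. k \<in> {1..n} \<Longrightarrow> \<omega> \<in> space M \<Longrightarrow> Z k \<omega> \<in> sad d"
    and Z_op: "\<And>k \<omega>. k \<in> {1..n} \<Longrightarrow> \<omega> \<in> space M \<Longrightarrow> opb (Z k \<omega>) R"
    and Z_ind: "M.indep_vars (\<lambda>_. FM) Z {1..n}"
    and Z_mean: "\<And>k L. k \<in> {1..n} \<Longrightarrow> (LINT \<omega>|M. inner L (Z k \<omega>)) = 0"
    and Z_cov: "\<And>L L'. (LINT \<omega>|N. inner L (G \<omega>) * inner L' (G \<omega>))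
        = (\<Sum>k=1..n. LINT \<omega>|M. inner L (Z k \<omega>) * inner L' (Z k \<omega>))"
    and Z_var: "\<And>P. bd P d \<Longrightarrow> (\<Sum>k=1..n. LINT \<omega>|M. (norm (Z k \<omega> * P))\<^sup>2) \<le> v * (norm P)\<^sup>2"
    and G_var: "\<And>P. P \<in> unitc d \<Longrightarrow> (LINT \<omega>|N. (inner (P * adj P) (G \<omega>))\<^sup>2) \<le> w"
begin

definition "XX \<omega> = Z0 + (\<Sum>k=1..n. Z k \<omega>)"
definition "GG \<omega> = Z0 + G \<omega>"

lemma Z_meas: "k \<in> {1..n} \<Longrightarrow> Z k \<in> M \<rightarrow>\<^sub>M FM"
  using Z_ind by (auto simp: M.indep_vars_def)

lemma XX_meas [measurable]: "XX \<in> M \<rightarrow>\<^sub>M FM"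
  unfolding XX_def[abs_def] by (intro measurable_FM_add measurable_FM_sum Z_meas measurable_const) auto

lemma GG_meas [measurable]: "GG \<in> N \<rightarrow>\<^sub>M FM"
  unfolding GG_def[abs_def] by measurable

lemma XX_sad: "\<omega> \<in> space M \<Longrightarrow> XX \<omega> \<in> sad d"
  unfolding XX_def by (intro sad_add Z0_sad sad_sum Z_sad)

lemma GG_sad: "\<omega> \<in> space N \<Longrightarrow> GG \<omega> \<in> sad d"
  unfolding GG_def by (intro sad_add Z0_sad G_sad)

text \<open>The interpolation applied to multiples of the two matrices. A factor c turns R into |c|
  R and v into c^2 v, and the shift by y0 only changes the deterministic part.\<close>

lemma comparison:
  assumes p: "psi_fun \<psi> \<psi>1 \<psi>2 \<psi>3" and m: "1 \<le> m" and small: "64 * (2 * real m * (\<bar>c\<bar> * R)) \<le> 1"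
  shows "(LINT \<omega>|M. \<psi> (F0 d m (y0 *\<^sub>R idm d + c *\<^sub>R XX \<omega>)))
    \<le> exp (960 * ((2 * real m) ^ 3 * (\<bar>c\<bar> * R) * (c\<^sup>2 * v))) * (LINT \<omega>|N. \<psi> (F0 d m (y0 *\<^sub>R idm d + c *\<^sub>R GG \<omega>)))"
proof -
  interpret psi_fun \<psi> \<psi>1 \<psi>2 \<psi>3 by (rule p)
  interpret sc: gaussian_fm N "\<lambda>\<omega>. c *\<^sub>R G \<omega>" d by (rule gaussian_fm_scale)
  interpret I: interp N "\<lambda>\<omega>. c *\<^sub>R G \<omega>" d \<psi> \<psi>1 \<psi>2 \<psi>3 M "\<lambda>k \<omega>. c *\<^sub>R Z k \<omega>" n "y0 *\<^sub>R idm d + c *\<^sub>R Z0" "\<bar>c\<bar> * R" "c\<^sup>2 * v" m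
  proof
    show "1 \<le> d" "1 \<le> m" "0 \<le> \<bar>c\<bar> * R" using d1 m R0 by auto
    show "64 * (2 * real m * (\<bar>c\<bar> * R)) \<le> 1" by (rule small)
    show "y0 *\<^sub>R idm d + c *\<^sub>R Z0 \<in> sad d" by (intro sad_add sad_scaleR sad_idm Z0_sad)
    show "c *\<^sub>R Z k \<omega> \<in> sad d" if "k \<in> {1..n}" "\<omega> \<in> space M" for k \<omega> by (intro sad_scaleR Z_sad that)
    show "opb (c *\<^sub>R Z k \<omega>) (\<bar>c\<bar> * R)" if "k \<in> {1..n}" "\<omega> \<in> space M" for k \<omega> by (intro opb_scaleR Z_op that)
    show "M.indep_vars (\<lambda>_. FM) (\<lambda>k \<omega>. c *\<^sub>R Z k \<omega>) {1..n}"
      by (rule M.indep_vars_compose2[OF Z_ind, of "\<lambda>_ A. c *\<^sub>R A"]) measurable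
    show "(LINT \<omega>|M. inner L (c *\<^sub>R Z k \<omega>)) = 0" if "k \<in> {1..n}" for k L
      using Z_mean[OF that, of "c *\<^sub>R L"] by simp
    show "(LINT \<omega>|N. inner L (c *\<^sub>R G \<omega>) * inner L' (c *\<^sub>R G \<omega>))
        = (\<Sum>k=1..n. LINT \<omega>|M. inner L (c *\<^sub>R Z k \<omega>) * inner L' (c *\<^sub>R Z k \<omega>))" for L L'
      using Z_cov[of "c *\<^sub>R L" "c *\<^sub>R L'"] by simp
    show "(\<Sum>k=1..n. LINT \<omega>|M. (norm (c *\<^sub>R Z k \<omega> * P))\<^sup>2) \<le> c\<^sup>2 * v * (norm P)\<^sup>2" if "bd P d" for P
      using mult_left_mono[OF Z_var[OF that], of "c\<^sup>2"]
      by (simp add: power_mult_distrib sum_distrib_left[symmetric] mult.assoc)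
  qed
  have e1: "y0 *\<^sub>R idm d + c *\<^sub>R Z0 + I.SS {1..n} \<omega> = y0 *\<^sub>R idm d + c *\<^sub>R XX \<omega>" for \<omega>
    by (simp add: I.SS_def XX_def scaleR_add_right scaleR_sum_right add.assoc)
  have e2: "y0 *\<^sub>R idm d + c *\<^sub>R Z0 + c *\<^sub>R G \<omega> = y0 *\<^sub>R idm d + c *\<^sub>R GG \<omega>" for \<omega>
    by (simp add: GG_def scaleR_add_right add.assoc)
  show ?thesis using I.interpolation by (simp only: f0_def e1 e2)
qed

definition "BX = norm Z0 + real n * (R * norm (idm d))"

lemma norm_XX: "\<omega> \<in> space M \<Longrightarrow> norm (XX \<omega>) \<le> BX"
proof -
  assume \<omega>: "\<omega> \<in> space M"
  have "norm (Z k \<omega>) \<le> R * norm (idm d)" if "k \<in> {1..n}" for k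
    using opbD[OF Z_op[OF that \<omega>], of "idm d"] Z_sad[OF that \<omega>] by (simp add: sad_def)
  then have "norm (\<Sum>k=1..n. Z k \<omega>) \<le> real (card {1..n}) * (R * norm (idm d))"
    by (intro order_trans[OF norm_sum] sum_bounded_above)
  then show ?thesis unfolding XX_def BX_def by (intro order_trans[OF norm_triangle_ineq] add_left_mono) simp
qed

definition "fs s x = lamM d (s *\<^sub>R x)"

lemma fs_meas [measurable]: "fs s \<in> borel_measurable FM"
  unfolding fs_def by (rule measurable_compose[OF _ measurable_lamM]) measurable

lemma fs_eq: "x \<in> sad d \<Longrightarrow> fs s x = lamS d (s *\<^sub>R x)"
  unfolding fs_def by (intro lamM_eq d1 sad_scaleR)

lemma abs_fs_le: "x \<in> sad d \<Longrightarrow> s\<^sup>2 = 1 \<Longrightarrow> \<bar>fs s x\<bar> \<le> norm x"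
  using abs_lamS_le[OF d1, of "s *\<^sub>R x"] by (auto simp: fs_eq power2_eq_1_iff)

text \<open>The largest eigenvalue is the maximum of the forms at unit vectors, that is, of linear
  functionals given by rank-one matrices of norm at most 1. Their Gaussian variance is bounded by w,
  so concentration applies.\<close>

lemma GG_conc:
  assumes s: "s\<^sup>2 = 1" and b: "0 \<le> b"
  defines "\<mu> \<equiv> LINT \<omega>|N. fs s (GG \<omega>)"
  shows "(LINT \<omega>|N. exp (b * (fs s (GG \<omega>) - \<mu>))) \<le> exp (pi\<^sup>2 * b\<^sup>2 * w / 8)"
    and "(LINT \<omega>|N. exp (- b * (fs s (GG \<omega>) - \<mu>))) \<le> exp (pi\<^sup>2 * b\<^sup>2 * w / 8)"
    and "integrable N (\<lambda>\<omega>. exp (c * fs s (GG \<omega>)))"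
    and "integrable N (\<lambda>\<omega>. fs s (GG \<omega>))"
proof -
  let ?S = "(\<lambda>P. s *\<^sub>R (P * adj P)) ` unitc d"
  have ip: "inner (s *\<^sub>R (P * adj P)) x = inner P ((s *\<^sub>R x) * P)" for P x
    by (simp add: inner_times_right)
  have ex: "\<exists>L\<in>?S. fs s x = inner L x" if x: "x \<in> sad d" for x
  proof -
    obtain P where P: "P \<in> unitc d" "(s *\<^sub>R x) * P = lamS d (s *\<^sub>R x) *\<^sub>R P"
      using lamS_attained[OF d1 sad_scaleR[OF x]] by auto
    have "inner (s *\<^sub>R (P * adj P)) x = inner P (lamS d (s *\<^sub>R x) *\<^sub>R P)" unfolding ip P(2) ..
    also have "\<dots> = fs s x" using P(1) by (simp add: fs_eq[OF x] unitc_def power2_norm_eq_inner[symmetric])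
    finally show ?thesis using P(1) by force
  qed
  have le: "inner L x \<le> fs s x" if x: "x \<in> sad d" and L: "L \<in> ?S" for x L
  proof -
    obtain P where P: "P \<in> unitc d" "L = s *\<^sub>R (P * adj P)" using L by auto
    show ?thesis unfolding P(2) ip fs_eq[OF x] by (rule lamS_upper[OF P(1)])
  qed
  have nL: "norm L \<le> 1" if L: "L \<in> ?S" for L
  proof -
    obtain P where P: "P \<in> unitc d" "L = s *\<^sub>R (P * adj P)" using L by auto
    have "norm L = norm (P * adj P)" using s P by (auto simp: power2_eq_1_iff)
    also have "\<dots> \<le> norm P * norm (adj P)" by (rule norm_mult_ineq)
    finally show ?thesis using P by (simp add: unitc_def)
  qed
  have v: "(LINT \<omega>|N. (inner L (G \<omega>))\<^sup>2) \<le> w" if "L \<in> ?S" for L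
    using that G_var s by (auto simp: power_mult_distrib)
  note c = concentration[OF fs_meas ex le nL v Z0_sad b] concentration_aux[OF fs_meas ex le nL v Z0_sad b]
  show "(LINT \<omega>|N. exp (b * (fs s (GG \<omega>) - \<mu>))) \<le> exp (pi\<^sup>2 * b\<^sup>2 * w / 8)"
    "(LINT \<omega>|N. exp (- b * (fs s (GG \<omega>) - \<mu>))) \<le> exp (pi\<^sup>2 * b\<^sup>2 * w / 8)"
    "integrable N (\<lambda>\<omega>. exp (c * fs s (GG \<omega>)))" "integrable N (\<lambda>\<omega>. fs s (GG \<omega>))"
    using c(1,2,4) c(3)[of c] unfolding \<mu>_def GG_def by simp_all
qed

lemma XX_int: "s\<^sup>2 = 1 \<Longrightarrow> integrable M (\<lambda>\<omega>. exp (c * fs s (XX \<omega>)))"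
proof (rule M.integrable_const_bound[where B = "exp (\<bar>c\<bar> * BX)"])
  assume s: "s\<^sup>2 = 1"
  show "AE \<omega> in M. norm (exp (c * fs s (XX \<omega>))) \<le> exp (\<bar>c\<bar> * BX)"
  proof (rule AE_I2)
    fix \<omega> assume \<omega>: "\<omega> \<in> space M"
    have "c * fs s (XX \<omega>) \<le> \<bar>c\<bar> * \<bar>fs s (XX \<omega>)\<bar>" by (metis abs_ge_self abs_mult)
    also have "\<dots> \<le> \<bar>c\<bar> * BX"
      using abs_fs_le[OF XX_sad[OF \<omega>] s] norm_XX[OF \<omega>] by (intro mult_left_mono) auto
    finally show "norm (exp (c * fs s (XX \<omega>))) \<le> exp (\<bar>c\<bar> * BX)" by simp
  qed
qed auto

text \<open>The three derivatives cost m^3 and the scaling \<beta> / m gives it back. The comparison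
  factor and the smallness condition are thus independent of m, and m can tend to infinity.\<close>

lemma kappa_simp:
  assumes m: "1 \<le> m" and s: "s\<^sup>2 = 1" and b: "0 \<le> \<beta>"
  shows "960 * ((2 * real m) ^ 3 * (\<bar>s * \<beta> / real m\<bar> * R) * ((s * \<beta> / real m)\<^sup>2 * v)) = 7680 * (\<beta> ^ 3 * R * v)"
    and "64 * (2 * real m * (\<bar>s * \<beta> / real m\<bar> * R)) = 128 * \<beta> * R"
proof -
  have "\<bar>s\<bar> = 1" using s by (auto simp: power2_eq_1_iff)
  then have e: "\<bar>s * \<beta> / real m\<bar> = \<beta> / real m" "(s * \<beta> / real m)\<^sup>2 = (\<beta> / real m)\<^sup>2"
    using b s by (auto simp: abs_mult power_divide power_mult_distrib)
  show "64 * (2 * real m * (\<bar>s * \<beta> / real m\<bar> * R)) = 128 * \<beta> * R" unfolding e using m by simp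
  show "960 * ((2 * real m) ^ 3 * (\<bar>s * \<beta> / real m\<bar> * R) * ((s * \<beta> / real m)\<^sup>2 * v)) = 7680 * (\<beta> ^ 3 * R * v)"
    unfolding e using m by (simp add: power2_eq_square power3_eq_cube field_simps)
qed

text \<open>The outer function is the identity. \<open>F0_lower\<close> is applied to X and
  \<open>F0_upper\<close> to G; the factor d, the number of eigenvalues in the trace, is therefore
  spent on the Gaussian side.\<close>

lemma exp_upper:
  assumes s: "s\<^sup>2 = 1" and b: "0 \<le> \<beta>" and small: "128 * \<beta> * R \<le> 1"
  shows "(LINT \<omega>|M. exp (\<beta> * fs s (XX \<omega>)))
    \<le> exp (7680 * (\<beta> ^ 3 * R * v)) * (real d * (LINT \<omega>|N. exp (\<beta> * fs s (GG \<omega>))))"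
proof -
  define \<kappa> where "\<kappa> = exp (7680 * (\<beta> ^ 3 * R * v))"
  have s': "(- s)\<^sup>2 = 1" using s by simp
  define A where "A = (LINT \<omega>|N. exp (\<beta> * fs s (GG \<omega>)))"
  define A' where "A' = (LINT \<omega>|N. exp (\<beta> * fs (- s) (GG \<omega>)))"
  have step: "(LINT \<omega>|M. (1 + \<beta> * fs s (XX \<omega>) / (2 * real (Suc k))) ^ (2 * Suc k))
      \<le> \<kappa> * (real d / 4 ^ Suc k + real d * A + real d * (A' * exp (- 2 * real (Suc k))))" for k
  proof -
    define m where "m = Suc k"
    have m: "1 \<le> m" by (simp add: m_def)
    define c where "c = s * \<beta> / real m"
    have sm: "64 * (2 * real m * (\<bar>c\<bar> * R)) \<le> 1" unfolding c_def kappa_simp(2)[OF m s b] by (rule small)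
    have YX: "2 *\<^sub>R idm d + c *\<^sub>R XX \<omega> \<in> sad d" if "\<omega> \<in> space M" for \<omega>
      by (intro sad_add sad_scaleR sad_idm XX_sad that)
    have "(LINT \<omega>|M. (1 + \<beta> * fs s (XX \<omega>) / (2 * real m)) ^ (2 * m))
        \<le> (LINT \<omega>|M. F0 d m (2 *\<^sub>R idm d + c *\<^sub>R XX \<omega>) / 4 ^ m)"
    proof (rule integral_mono')
      show "integrable M (\<lambda>\<omega>. F0 d m (2 *\<^sub>R idm d + c *\<^sub>R XX \<omega>) / 4 ^ m)"
      proof (rule M.integrable_const_bound[where B = "real d / 4 ^ m + real d * exp (\<beta> * BX) + real d * (exp (\<beta> * BX) * exp (- 2 * real m))"])
        show "AE \<omega> in M. norm (F0 d m (2 *\<^sub>R idm d + c *\<^sub>R XX \<omega>) / 4 ^ m)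
            \<le> real d / 4 ^ m + real d * exp (\<beta> * BX) + real d * (exp (\<beta> * BX) * exp (- 2 * real m))"
        proof (rule AE_I2)
          fix \<omega> assume \<omega>: "\<omega> \<in> space M"
          have l: "lamS d (t *\<^sub>R XX \<omega>) \<le> BX" if "t\<^sup>2 = 1" for t
            using abs_fs_le[OF XX_sad[OF \<omega>] that] norm_XX[OF \<omega>] by (simp add: fs_eq[OF XX_sad[OF \<omega>]] abs_le_iff)
          have "F0 d m (2 *\<^sub>R idm d + c *\<^sub>R XX \<omega>) / 4 ^ m
              \<le> real d / 4 ^ m + real d * exp (\<beta> * lamS d (s *\<^sub>R XX \<omega>)) + real d * (exp (\<beta> * lamS d (- (s *\<^sub>R XX \<omega>))) * exp (- 2 * real m))"
            unfolding c_def by (rule F0_upper[OF d1 m XX_sad[OF \<omega>] s b])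
          also have "\<dots> \<le> real d / 4 ^ m + real d * exp (\<beta> * BX) + real d * (exp (\<beta> * BX) * exp (- 2 * real m))"
            using l[OF s] l[OF s'] b by (intro add_mono mult_left_mono mult_right_mono order_refl) (auto intro!: mult_left_mono)
          finally show "norm (F0 d m (2 *\<^sub>R idm d + c *\<^sub>R XX \<omega>) / 4 ^ m)
            \<le> real d / 4 ^ m + real d * exp (\<beta> * BX) + real d * (exp (\<beta> * BX) * exp (- 2 * real m))"
            using F0_ge[OF YX[OF \<omega>], of m] by simp
        qed
      qed measurable
      fix \<omega> assume \<omega>: "\<omega> \<in> space M"
      show "(1 + \<beta> * fs s (XX \<omega>) / (2 * real m)) ^ (2 * m) \<le> F0 d m (2 *\<^sub>R idm d + c *\<^sub>R XX \<omega>) / 4 ^ m"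
        unfolding c_def fs_eq[OF XX_sad[OF \<omega>]]
        by (rule order_trans[OF _ F0_lower[OF d1 m XX_sad[OF \<omega>] s]]) simp
      show "0 \<le> F0 d m (2 *\<^sub>R idm d + c *\<^sub>R XX \<omega>) / 4 ^ m" using F0_ge[OF YX[OF \<omega>], of m] by simp
    qed
    also have "\<dots> \<le> (\<kappa> * (LINT \<omega>|N. F0 d m (2 *\<^sub>R idm d + c *\<^sub>R GG \<omega>))) / 4 ^ m"
      using comparison[OF psi_fun_id m sm, of 2] unfolding c_def kappa_simp(1)[OF m s b] \<kappa>_def
      by (simp add: divide_right_mono)
    also have "\<dots> = \<kappa> * (LINT \<omega>|N. F0 d m (2 *\<^sub>R idm d + c *\<^sub>R GG \<omega>) / 4 ^ m)" by simp
    also have "\<dots> \<le> \<kappa> * (LINT \<omega>|N. real d / 4 ^ m + real d * exp (\<beta> * fs s (GG \<omega>)) + real d * (exp (\<beta> * fs (- s) (GG \<omega>)) * exp (- 2 * real m)))"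
    proof (intro mult_left_mono integral_mono')
      show "integrable N (\<lambda>\<omega>. real d / 4 ^ m + real d * exp (\<beta> * fs s (GG \<omega>)) + real d * (exp (\<beta> * fs (- s) (GG \<omega>)) * exp (- 2 * real m)))"
        using GG_conc(3)[OF s b] GG_conc(3)[OF s' b] by simp
      fix \<omega> assume \<omega>: "\<omega> \<in> space N"
      show "F0 d m (2 *\<^sub>R idm d + c *\<^sub>R GG \<omega>) / 4 ^ m
          \<le> real d / 4 ^ m + real d * exp (\<beta> * fs s (GG \<omega>)) + real d * (exp (\<beta> * fs (- s) (GG \<omega>)) * exp (- 2 * real m))"
        using F0_upper[OF d1 m GG_sad[OF \<omega>] s b] by (simp add: c_def fs_eq[OF GG_sad[OF \<omega>]])
    qed (auto simp: \<kappa>_def)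
    also have "\<dots> = \<kappa> * (real d / 4 ^ m + real d * A + real d * (A' * exp (- 2 * real m)))"
      using GG_conc(3)[OF s b] GG_conc(3)[OF s' b] by (simp add: A_def A'_def N.prob_space)
    finally show ?thesis by (simp only: m_def)
  qed
  have lim1: "(\<lambda>k. LINT \<omega>|M. (1 + \<beta> * fs s (XX \<omega>) / (2 * real (Suc k))) ^ (2 * Suc k)) \<longlonglongrightarrow> (LINT \<omega>|M. exp (\<beta> * fs s (XX \<omega>)))"
  proof (rule integral_dominated_convergence)
    show "integrable M (\<lambda>_. exp (\<beta> * BX))" by simp
    show "AE \<omega> in M. (\<lambda>k. (1 + \<beta> * fs s (XX \<omega>) / (2 * real (Suc k))) ^ (2 * Suc k)) \<longlonglongrightarrow> exp (\<beta> * fs s (XX \<omega>))"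
      by (intro AE_I2 exp_limit_even)
    show "AE \<omega> in M. norm ((1 + \<beta> * fs s (XX \<omega>) / (2 * real (Suc k))) ^ (2 * Suc k)) \<le> exp (\<beta> * BX)" for k
    proof (rule AE_I2)
      fix \<omega> assume \<omega>: "\<omega> \<in> space M"
      define y where "y = \<beta> * fs s (XX \<omega>) / (2 * real (Suc k))"
      have "\<bar>1 + y\<bar> \<le> exp \<bar>y\<bar>" using exp_ge_add_one_self[of "\<bar>y\<bar>"] by linarith
      then have "\<bar>1 + y\<bar> ^ (2 * Suc k) \<le> exp \<bar>y\<bar> ^ (2 * Suc k)" by (intro power_mono) auto
      also have "\<dots> = exp (\<bar>\<beta> * fs s (XX \<omega>)\<bar>)"
      proof -
        have r: "real (2 * Suc k) = 2 * real (Suc k)" by simp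
        show ?thesis unfolding exp_of_nat_mult[symmetric] y_def abs_divide r by (simp del: of_nat_Suc)
      qed
      also have "\<dots> \<le> exp (\<beta> * BX)"
        using abs_fs_le[OF XX_sad[OF \<omega>] s] norm_XX[OF \<omega>] b by (auto simp: abs_mult intro!: mult_left_mono)
      finally show "norm ((1 + \<beta> * fs s (XX \<omega>) / (2 * real (Suc k))) ^ (2 * Suc k)) \<le> exp (\<beta> * BX)"
        unfolding y_def by (simp only: real_norm_def power_abs)
    qed
  qed measurable
  have z1: "(\<lambda>k. real d / 4 ^ Suc k) \<longlonglongrightarrow> 0"
    by (intro LIMSEQ_Suc LIMSEQ_divide_realpow_zero) simp
  have z2: "(\<lambda>k. exp (- 2 * real (Suc k))) \<longlonglongrightarrow> 0" by real_asymp
  have "(\<lambda>k. \<kappa> * (real d / 4 ^ Suc k + real d * A + real d * (A' * exp (- 2 * real (Suc k))))) \<longlonglongrightarrow> \<kappa> * (0 + real d * A + real d * (A' * 0))"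
    by (intro tendsto_intros z1 z2)
  from LIMSEQ_le[OF lim1 this] step show ?thesis by (simp add: \<kappa>_def A_def)
qed

text \<open>The outer function is the reciprocal, which exchanges the roles: now
  \<open>F0_upper\<close> is applied to X and \<open>F0_lower\<close> to G, and the factor d comes
  from the side of X.\<close>

lemma exp_lower:
  assumes s: "s\<^sup>2 = 1" and b: "0 \<le> \<beta>" and small: "128 * \<beta> * R \<le> 1"
  shows "(LINT \<omega>|M. exp (- \<beta> * fs s (XX \<omega>)))
    \<le> exp (7680 * (\<beta> ^ 3 * R * v)) * (real d * (LINT \<omega>|N. exp (- \<beta> * fs s (GG \<omega>))))"
proof -
  define \<kappa> where "\<kappa> = exp (7680 * (\<beta> ^ 3 * R * v))"
  have s': "(- s)\<^sup>2 = 1" using s by simp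
  have d0: "0 < real d" using d1 by simp
  \<comment> \<open>\<open>u\<close> bounds the normalised functional of X from above and
    \<open>g\<close> that of G from below; as m grows they tend to d exp (\<beta> \<lambda>) and to
    exp (\<beta> \<lambda>), with \<lambda> the value of \<open>fs s\<close> at X and at G.\<close>
  define u where "u m \<omega> = real d / 4 ^ m + real d * exp (\<beta> * fs s (XX \<omega>)) + real d * (exp (\<beta> * fs (- s) (XX \<omega>)) * exp (- 2 * real m))" for m :: nat and \<omega>
  define g where "g m \<omega> = real d / 4 ^ m + (1 + \<beta> * fs s (GG \<omega>) / (2 * real m)) ^ (2 * m)" for m :: nat and \<omega>
  have um[measurable]: "u m \<in> borel_measurable M" for m unfolding u_def by measurable
  have gm[measurable]: "g m \<in> borel_measurable N" for m unfolding g_def by measurable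
  have u0: "0 < u m \<omega>" for m \<omega> unfolding u_def using d0 by (intro add_pos_nonneg) auto
  have g0: "0 < g m \<omega>" for m \<omega> unfolding g_def using d0 by (intro add_pos_nonneg) auto
  have step: "(LINT \<omega>|M. 1 / u (Suc k) \<omega>) \<le> \<kappa> * (LINT \<omega>|N. 1 / g (Suc k) \<omega>)" for k
  proof -
    define m where "m = Suc k"
    have m: "1 \<le> m" by (simp add: m_def)
    define c where "c = s * \<beta> / real m"
    have sm: "64 * (2 * real m * (\<bar>c\<bar> * R)) \<le> 1" unfolding c_def kappa_simp(2)[OF m s b] by (rule small)
    have Y: "2 *\<^sub>R idm d + c *\<^sub>R x \<in> sad d" if "x \<in> sad d" for x
      by (intro sad_add sad_scaleR sad_idm that)
    have Fpos: "0 < F0 d m (2 *\<^sub>R idm d + c *\<^sub>R x)" if "x \<in> sad d" for x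
      using F0_ge[OF Y[OF that], of m] d0 by linarith
    have "(LINT \<omega>|M. 1 / u m \<omega>) \<le> (LINT \<omega>|M. 4 ^ m * (1 / F0 d m (2 *\<^sub>R idm d + c *\<^sub>R XX \<omega>)))"
    proof (rule integral_mono')
      show "integrable M (\<lambda>\<omega>. 4 ^ m * (1 / F0 d m (2 *\<^sub>R idm d + c *\<^sub>R XX \<omega>)))"
      proof (rule M.integrable_const_bound[where B = "4 ^ m * (1 / real d)"])
        show "AE \<omega> in M. norm (4 ^ m * (1 / F0 d m (2 *\<^sub>R idm d + c *\<^sub>R XX \<omega>))) \<le> 4 ^ m * (1 / real d)"
        proof (rule AE_I2)
          fix \<omega> assume "\<omega> \<in> space M"
          note x = XX_sad[OF this]
          have "1 / F0 d m (2 *\<^sub>R idm d + c *\<^sub>R XX \<omega>) \<le> 1 / real d"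
            using F0_ge[OF Y[OF x], of m] Fpos[OF x] d0 by (intro divide_left_mono) auto
          from mult_left_mono[OF this, of "4 ^ m"]
          show "norm (4 ^ m * (1 / F0 d m (2 *\<^sub>R idm d + c *\<^sub>R XX \<omega>))) \<le> 4 ^ m * (1 / real d)"
            using Fpos[OF x] by (simp add: abs_mult)
        qed
      qed measurable
      fix \<omega> assume "\<omega> \<in> space M"
      note x = XX_sad[OF this]
      have "F0 d m (2 *\<^sub>R idm d + c *\<^sub>R XX \<omega>) / 4 ^ m \<le> u m \<omega>"
        using F0_upper[OF d1 m x s b] by (simp add: c_def fs_eq[OF x] u_def)
      then have "1 / u m \<omega> \<le> 1 / (F0 d m (2 *\<^sub>R idm d + c *\<^sub>R XX \<omega>) / 4 ^ m)"
        using Fpos[OF x] u0 by (intro divide_left_mono) auto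
      then show "1 / u m \<omega> \<le> 4 ^ m * (1 / F0 d m (2 *\<^sub>R idm d + c *\<^sub>R XX \<omega>))" by simp
      show "0 \<le> 4 ^ m * (1 / F0 d m (2 *\<^sub>R idm d + c *\<^sub>R XX \<omega>))" using Fpos[OF x] by simp
    qed
    also have "\<dots> = 4 ^ m * (LINT \<omega>|M. 1 / F0 d m (2 *\<^sub>R idm d + c *\<^sub>R XX \<omega>))" by (rule integral_mult_right_zero)
    also have "\<dots> \<le> 4 ^ m * (\<kappa> * (LINT \<omega>|N. 1 / F0 d m (2 *\<^sub>R idm d + c *\<^sub>R GG \<omega>)))"
      using comparison[OF psi_fun_inverse m sm, of 2] unfolding c_def kappa_simp(1)[OF m s b] \<kappa>_def
      by (intro mult_left_mono) auto
    also have "\<dots> = \<kappa> * (LINT \<omega>|N. 4 ^ m * (1 / F0 d m (2 *\<^sub>R idm d + c *\<^sub>R GG \<omega>)))"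
      by (simp only: integral_mult_right_zero mult.left_commute)
    also have "\<dots> \<le> \<kappa> * (LINT \<omega>|N. 1 / g m \<omega>)"
    proof (intro mult_left_mono integral_mono')
      show "integrable N (\<lambda>\<omega>. 1 / g m \<omega>)"
      proof (rule N.integrable_const_bound[where B = "4 ^ m"])
        show "AE \<omega> in N. norm (1 / g m \<omega>) \<le> 4 ^ m"
        proof (rule AE_I2)
          fix \<omega>
          have "1 / 4 ^ m \<le> real d / 4 ^ m" using d1 by (intro divide_right_mono) auto
          also have "\<dots> \<le> g m \<omega>" by (simp add: g_def)
          finally have "1 / g m \<omega> \<le> 1 / (1 / 4 ^ m)" using g0 by (intro divide_left_mono) auto
          then show "norm (1 / g m \<omega>) \<le> 4 ^ m" using g0[of m \<omega>] by simp
        qed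
      qed measurable
      fix \<omega> assume "\<omega> \<in> space N"
      note x = GG_sad[OF this]
      have "g m \<omega> \<le> F0 d m (2 *\<^sub>R idm d + c *\<^sub>R GG \<omega>) / 4 ^ m"
        using F0_lower[OF d1 m x s, of \<beta>] by (simp add: c_def fs_eq[OF x] g_def)
      then have "1 / (F0 d m (2 *\<^sub>R idm d + c *\<^sub>R GG \<omega>) / 4 ^ m) \<le> 1 / g m \<omega>"
        using Fpos[OF x] g0 by (intro divide_left_mono) auto
      then show "4 ^ m * (1 / F0 d m (2 *\<^sub>R idm d + c *\<^sub>R GG \<omega>)) \<le> 1 / g m \<omega>" by simp
      show "0 \<le> 1 / g m \<omega>" using g0[of m \<omega>] by simp
    qed (simp add: \<kappa>_def)
    finally show ?thesis by (simp only: m_def)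
  qed
  have z1: "(\<lambda>k. real d / 4 ^ Suc k) \<longlonglongrightarrow> 0"
    by (intro LIMSEQ_Suc LIMSEQ_divide_realpow_zero) simp
  have z2: "(\<lambda>k. exp (- 2 * real (Suc k))) \<longlonglongrightarrow> 0" by real_asymp
  have lim1: "(\<lambda>k. LINT \<omega>|M. 1 / u (Suc k) \<omega>) \<longlonglongrightarrow> (LINT \<omega>|M. 1 / (real d * exp (\<beta> * fs s (XX \<omega>))))"
  proof (rule integral_dominated_convergence)
    show "integrable M (\<lambda>\<omega>. 1 / real d * exp (- \<beta> * fs s (XX \<omega>)))" using XX_int[OF s, of "- \<beta>"] by simp
    show "AE \<omega> in M. (\<lambda>k. 1 / u (Suc k) \<omega>) \<longlonglongrightarrow> 1 / (real d * exp (\<beta> * fs s (XX \<omega>)))"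
    proof (rule AE_I2)
      fix \<omega>
      have "(\<lambda>k. u (Suc k) \<omega>) \<longlonglongrightarrow> 0 + real d * exp (\<beta> * fs s (XX \<omega>)) + real d * (exp (\<beta> * fs (- s) (XX \<omega>)) * 0)"
        unfolding u_def by (intro tendsto_intros z1 z2)
      then show "(\<lambda>k. 1 / u (Suc k) \<omega>) \<longlonglongrightarrow> 1 / (real d * exp (\<beta> * fs s (XX \<omega>)))"
        using d0 by (intro tendsto_divide tendsto_const) auto
    qed
    show "AE \<omega> in M. norm (1 / u (Suc k) \<omega>) \<le> 1 / real d * exp (- \<beta> * fs s (XX \<omega>))" for k
    proof (rule AE_I2)
      fix \<omega>
      have "real d * exp (\<beta> * fs s (XX \<omega>)) \<le> u (Suc k) \<omega>" by (simp add: u_def)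
      then have "1 / u (Suc k) \<omega> \<le> 1 / (real d * exp (\<beta> * fs s (XX \<omega>)))"
        using u0[of "Suc k" \<omega>] d0 by (intro divide_left_mono) auto
      then show "norm (1 / u (Suc k) \<omega>) \<le> 1 / real d * exp (- \<beta> * fs s (XX \<omega>))"
        using u0[of "Suc k" \<omega>] by (simp add: exp_minus divide_inverse)
    qed
  qed (use d0 in measurable)
  have lim2: "(\<lambda>k. LINT \<omega>|N. 1 / g (Suc k) \<omega>) \<longlonglongrightarrow> (LINT \<omega>|N. 1 / exp (\<beta> * fs s (GG \<omega>)))"
  proof (rule integral_dominated_convergence)
    \<comment> \<open>G is unbounded, and the reciprocals are close to exp (- \<beta> \<lambda>)
      only where \<lambda> is small against m. The doubled rate is what
      \<open>inverse_power_bound\<close> requires for a majorant uniform in m.\<close>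
    show "integrable N (\<lambda>\<omega>. exp (2 * \<beta> * fs s (GG \<omega>)) + exp (- (2 * \<beta>) * fs s (GG \<omega>)))"
      by (intro Bochner_Integration.integrable_add GG_conc(3)[OF s b])
    show "AE \<omega> in N. (\<lambda>k. 1 / g (Suc k) \<omega>) \<longlonglongrightarrow> 1 / exp (\<beta> * fs s (GG \<omega>))"
    proof (rule AE_I2)
      fix \<omega>
      have "(\<lambda>k. g (Suc k) \<omega>) \<longlonglongrightarrow> 0 + exp (\<beta> * fs s (GG \<omega>))"
        unfolding g_def by (intro tendsto_add z1 exp_limit_even)
      then show "(\<lambda>k. 1 / g (Suc k) \<omega>) \<longlonglongrightarrow> 1 / exp (\<beta> * fs s (GG \<omega>))"
        by (intro tendsto_divide tendsto_const) auto
    qed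
    show "AE \<omega> in N. norm (1 / g (Suc k) \<omega>) \<le> exp (2 * \<beta> * fs s (GG \<omega>)) + exp (- (2 * \<beta>) * fs s (GG \<omega>))" for k
    proof (rule AE_I2)
      fix \<omega>
      have "1 / g (Suc k) \<omega> \<le> exp (2 * \<bar>\<beta> * fs s (GG \<omega>)\<bar>)"
        unfolding g_def by (rule inverse_power_bound[OF d1]) simp
      also have "\<dots> \<le> exp (2 * \<beta> * fs s (GG \<omega>)) + exp (- (2 * \<beta>) * fs s (GG \<omega>))"
        by (cases "0 \<le> \<beta> * fs s (GG \<omega>)") (auto simp: mult.assoc)
      finally show "norm (1 / g (Suc k) \<omega>) \<le> exp (2 * \<beta> * fs s (GG \<omega>)) + exp (- (2 * \<beta>) * fs s (GG \<omega>))"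
        using g0[of "Suc k" \<omega>] by simp
    qed
  qed measurable
  have "(LINT \<omega>|M. 1 / (real d * exp (\<beta> * fs s (XX \<omega>)))) \<le> \<kappa> * (LINT \<omega>|N. 1 / exp (\<beta> * fs s (GG \<omega>)))"
    using LIMSEQ_le[OF lim1 tendsto_mult[OF tendsto_const[of \<kappa>] lim2]] step by auto
  moreover have "1 / (real d * exp (\<beta> * fs s (XX \<omega>))) = (1 / real d) * exp (- \<beta> * fs s (XX \<omega>))" for \<omega>
    by (simp add: exp_minus divide_inverse)
  ultimately have "(1 / real d) * (LINT \<omega>|M. exp (- \<beta> * fs s (XX \<omega>))) \<le> \<kappa> * (LINT \<omega>|N. exp (- \<beta> * fs s (GG \<omega>)))"
    by (simp add: exp_minus divide_inverse)
  then have "real d * ((1 / real d) * (LINT \<omega>|M. exp (- \<beta> * fs s (XX \<omega>)))) \<le> real d * (\<kappa> * (LINT \<omega>|N. exp (- \<beta> * fs s (GG \<omega>))))"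
    using d0 by (intro mult_left_mono) auto
  then show ?thesis using d0 by (simp add: \<kappa>_def mult_ac)
qed

end

section \<open>Tail and mean bounds\<close>

context prob_space
begin

lemma exp_moment_tail:
  fixes U :: "'a \<Rightarrow> real"
  assumes i: "integrable M (\<lambda>\<omega>. exp (\<beta> * \<bar>U \<omega>\<bar>))" and K: "(LINT \<omega>|M. exp (\<beta> * \<bar>U \<omega>\<bar>)) \<le> K" and b: "0 < \<beta>"
  shows "prob {\<omega> \<in> space M. \<bar>U \<omega>\<bar> > r} \<le> K * exp (- \<beta> * r)"
proof -
  have [measurable]: "(\<lambda>\<omega>. exp (\<beta> * \<bar>U \<omega>\<bar>)) \<in> borel_measurable M" using i by simp
  have "{\<omega> \<in> space M. \<bar>U \<omega>\<bar> > r} \<subseteq> {\<omega> \<in> space M. exp (\<beta> * r) \<le> exp (\<beta> * \<bar>U \<omega>\<bar>)}" using b by auto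
  then have "prob {\<omega> \<in> space M. \<bar>U \<omega>\<bar> > r} \<le> prob {\<omega> \<in> space M. exp (\<beta> * r) \<le> exp (\<beta> * \<bar>U \<omega>\<bar>)}"
    by (rule finite_measure_mono) measurable
  also have "\<dots> \<le> (LINT \<omega>|M. exp (\<beta> * \<bar>U \<omega>\<bar>)) / exp (\<beta> * r)"
    by (rule integral_Markov_inequality_measure[where A = "{}"]) (use i in auto)
  also have "\<dots> \<le> K / exp (\<beta> * r)" by (intro divide_right_mono K) simp
  finally show ?thesis by (simp add: exp_minus divide_inverse)
qed

text \<open>Jensen's inequality, obtained by integrating the tangent of the exponential at \<beta>
  times the mean of |U|.\<close>

lemma exp_moment_mean:
  fixes U :: "'a \<Rightarrow> real"
  assumes [measurable]: "U \<in> borel_measurable M"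
    and i: "integrable M (\<lambda>\<omega>. exp (\<beta> * \<bar>U \<omega>\<bar>))" and K: "(LINT \<omega>|M. exp (\<beta> * \<bar>U \<omega>\<bar>)) \<le> exp k" and b: "0 < \<beta>"
  shows "integrable M U" and "(LINT \<omega>|M. \<bar>U \<omega>\<bar>) \<le> k / \<beta>"
proof -
  have lin: "\<beta> * \<bar>U \<omega>\<bar> \<le> exp (\<beta> * \<bar>U \<omega>\<bar>)" for \<omega> using exp_ge_add_one_self[of "\<beta> * \<bar>U \<omega>\<bar>"] by linarith
  show iU: "integrable M U"
  proof (rule Bochner_Integration.integrable_bound)
    show "integrable M (\<lambda>\<omega>. 1 / \<beta> * exp (\<beta> * \<bar>U \<omega>\<bar>))" using i by simp
    show "AE \<omega> in M. norm (U \<omega>) \<le> norm (1 / \<beta> * exp (\<beta> * \<bar>U \<omega>\<bar>))"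
      using lin b by (auto simp: field_simps)
  qed simp
  define a where "a = \<beta> * (LINT \<omega>|M. \<bar>U \<omega>\<bar>)"
  have "exp a = (LINT \<omega>|M. exp a * (1 + (\<beta> * \<bar>U \<omega>\<bar> - a)))"
    using iU by (simp add: a_def prob_space)
  also have "\<dots> \<le> (LINT \<omega>|M. exp (\<beta> * \<bar>U \<omega>\<bar>))"
  proof (rule integral_mono)
    show "integrable M (\<lambda>\<omega>. exp a * (1 + (\<beta> * \<bar>U \<omega>\<bar> - a)))" using iU by simp
    show "exp a * (1 + (\<beta> * \<bar>U \<omega>\<bar> - a)) \<le> exp (\<beta> * \<bar>U \<omega>\<bar>)" for \<omega>
    proof -
      have "exp a * (1 + (\<beta> * \<bar>U \<omega>\<bar> - a)) \<le> exp a * exp (\<beta> * \<bar>U \<omega>\<bar> - a)"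
        by (intro mult_left_mono exp_ge_add_one_self) simp
      then show ?thesis by (simp add: exp_add[symmetric])
    qed
  qed (rule i)
  also note K
  finally have "a \<le> k" by simp
  then show "(LINT \<omega>|M. \<bar>U \<omega>\<bar>) \<le> k / \<beta>" using b by (simp add: a_def field_simps)
qed

text \<open>The events with a larger threshold increase to the event in question. This covers the
  case that \<epsilon>(t) vanishes, in which the rate t / (128 \<epsilon>) is meaningless: every
  larger value may be used instead.\<close>

lemma tail_right_limit:
  fixes U :: "'a \<Rightarrow> real"
  assumes [measurable]: "U \<in> borel_measurable M" and q: "\<And>r'. r < r' \<Longrightarrow> prob {\<omega> \<in> space M. U \<omega> > r'} \<le> q"
  shows "prob {\<omega> \<in> space M. U \<omega> > r} \<le> q"
proof -
  define A where "A k = {\<omega> \<in> space M. U \<omega> > r + 1 / real (Suc k)}" for k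
  have "(\<lambda>k. prob (A k)) \<longlonglongrightarrow> prob (\<Union>k. A k)"
  proof (rule finite_Lim_measure_incseq)
    show "range A \<subseteq> sets M" by (auto simp: A_def)
    show "incseq A"
    proof (rule monoI)
      fix k l :: nat assume "k \<le> l"
      then have "1 / real (Suc l) \<le> 1 / real (Suc k)" by (intro divide_left_mono) auto
      then show "A k \<subseteq> A l" by (auto simp: A_def)
    qed
  qed
  moreover have "(\<Union>k. A k) = {\<omega> \<in> space M. U \<omega> > r}"
  proof (intro equalityI subsetI)
    fix \<omega> assume "\<omega> \<in> (\<Union>k. A k)"
    then obtain k where "\<omega> \<in> space M" "U \<omega> > r + 1 / real (Suc k)" by (auto simp: A_def)
    moreover have "0 < 1 / real (Suc k)" by simp
    ultimately have "\<omega> \<in> space M \<and> r < U \<omega>" by linarith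
    then show "\<omega> \<in> {\<omega> \<in> space M. U \<omega> > r}" by simp
  next
    fix \<omega> assume "\<omega> \<in> {\<omega> \<in> space M. U \<omega> > r}"
    then have \<omega>: "\<omega> \<in> space M" "0 < U \<omega> - r" by auto
    obtain k where "inverse (real (Suc k)) < U \<omega> - r" using reals_Archimedean[OF \<omega>(2)] by auto
    then show "\<omega> \<in> (\<Union>k. A k)" using \<omega> by (auto simp: A_def inverse_eq_divide intro!: exI[of _ k])
  qed
  ultimately have "(\<lambda>k. prob (A k)) \<longlonglongrightarrow> prob {\<omega> \<in> space M. U \<omega> > r}" by simp
  moreover have "prob (A k) \<le> q" for k unfolding A_def by (rule q) simp
  ultimately show ?thesis by (intro LIMSEQ_le_const2) auto
qed

end

text \<open>U and V are the spectral functionals of X and of G, both centred at the same constant;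
  \<tau> is \<sigma>_*. Only the exponential moments of each variable by itself are used, so that
  their joint law may be arbitrary.\<close>

locale moment_pair = prob_space M for M :: "'a measure" +
  fixes U V :: "'a \<Rightarrow> real" and d :: nat and R \<sigma> \<tau> :: real
  assumes d2: "2 \<le> d" and nonneg: "0 \<le> R" "0 \<le> \<sigma>" "0 \<le> \<tau>"
    and meas [measurable]: "U \<in> borel_measurable M" "V \<in> borel_measurable M"
    and int_UV: "\<And>\<beta>. 0 \<le> \<beta> \<Longrightarrow> integrable M (\<lambda>\<omega>. exp (\<beta> * \<bar>U \<omega>\<bar>))"
      "\<And>\<beta>. 0 \<le> \<beta> \<Longrightarrow> integrable M (\<lambda>\<omega>. exp (\<beta> * \<bar>V \<omega>\<bar>))"
    and moment: "\<And>\<beta>. 0 \<le> \<beta> \<Longrightarrow> 128 * \<beta> * R \<le> 1 \<Longrightarrow>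
      (LINT \<omega>|M. exp (\<beta> * \<bar>U \<omega>\<bar>)) \<le> 4 * real d * exp (7680 * (\<beta> ^ 3 * R * \<sigma>\<^sup>2) + 2 * (\<beta>\<^sup>2 * \<tau>\<^sup>2))"
      "\<And>\<beta>. 0 \<le> \<beta> \<Longrightarrow> 128 * \<beta> * R \<le> 1 \<Longrightarrow>
      (LINT \<omega>|M. exp (\<beta> * \<bar>V \<omega>\<bar>)) \<le> 4 * real d * exp (7680 * (\<beta> ^ 3 * R * \<sigma>\<^sup>2) + 2 * (\<beta>\<^sup>2 * \<tau>\<^sup>2))"
begin

definition "eps t = \<tau> * t powr (1/2) + R powr (1/3) * (\<sigma> powr (2/3) * t powr (2/3)) + R * t"

lemma eps_nonneg: "0 \<le> t \<Longrightarrow> 0 \<le> eps t"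
  using nonneg by (simp add: eps_def)

text \<open>The rate \<open>\<beta> = t / (128 e)\<close> makes each of the three terms of the exponent at most a small
  multiple of \<open>t\<close>, one for each summand of \<open>\<epsilon>(t)\<close>.\<close>

lemma moment_t:
  assumes t: "ln (real d) \<le> t" and e: "0 < e" "eps t \<le> e"
  shows "0 < t / (128 * e)"
    and "(LINT \<omega>|M. exp (t / (128 * e) * \<bar>U \<omega>\<bar>)) \<le> exp (4 * t)"
    and "(LINT \<omega>|M. exp (t / (128 * e) * \<bar>V \<omega>\<bar>)) \<le> exp (4 * t)"
proof -
  have l2: "0 < ln (real d)" using d2 by simp
  then have t0: "0 < t" using t by simp
  define \<beta> where "\<beta> = t / (128 * e)"
  show b: "0 < t / (128 * e)" using t0 e by simp
  have p: "0 \<le> \<tau> * t powr (1/2)" "0 \<le> R powr (1/3) * (\<sigma> powr (2/3) * t powr (2/3))" "0 \<le> R * t"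
    using nonneg t0 by auto
  have e3: "\<tau> * t powr (1/2) \<le> e" "R powr (1/3) * (\<sigma> powr (2/3) * t powr (2/3)) \<le> e" "R * t \<le> e"
    using e p unfolding eps_def by linarith+
  have small: "128 * \<beta> * R \<le> 1" using e3(3) e by (simp add: \<beta>_def field_simps)
  have "(\<tau> * t powr (1/2))\<^sup>2 \<le> e\<^sup>2" by (intro power_mono e3 p)
  then have w: "\<tau>\<^sup>2 * t \<le> e\<^sup>2" using t0 by (simp add: power_mult_distrib powr_half_sqrt)
  have "(R powr (1/3) * (\<sigma> powr (2/3) * t powr (2/3))) ^ 3 \<le> e ^ 3" by (intro power_mono e3 p)
  moreover have "(x powr (1/3)) ^ 3 = x" "(x powr (2/3)) ^ 3 = x\<^sup>2" if "0 \<le> x" for x :: real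
  proof -
    have "(x powr a) ^ 3 = x powr (a * 3)" for a
      by (cases "x = 0") (simp_all add: powr_power mult.commute)
    from this[of "1/3"] this[of "2/3"] show "(x powr (1/3)) ^ 3 = x" "(x powr (2/3)) ^ 3 = x\<^sup>2"
      using that powr_numeral[of x "num.Bit0 num.One"] by simp_all
  qed
  ultimately have v: "R * \<sigma>\<^sup>2 * t\<^sup>2 \<le> e ^ 3" using nonneg t0 by (simp add: power_mult_distrib)
  have "\<beta> ^ 3 * R * \<sigma>\<^sup>2 = t * (R * \<sigma>\<^sup>2 * t\<^sup>2) / (128 ^ 3 * e ^ 3)"
    using e by (simp add: \<beta>_def field_simps power2_eq_square power3_eq_cube)
  also have "\<dots> \<le> t * e ^ 3 / (128 ^ 3 * e ^ 3)" using v t0 e by (intro divide_right_mono mult_left_mono) auto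
  also have "\<dots> = t / 128 ^ 3" using e by simp
  finally have x1: "\<beta> ^ 3 * R * \<sigma>\<^sup>2 \<le> t / 2097152" by simp
  have "\<beta>\<^sup>2 * \<tau>\<^sup>2 = t * (\<tau>\<^sup>2 * t) / (128\<^sup>2 * e\<^sup>2)"
    using e by (simp add: \<beta>_def field_simps power2_eq_square)
  also have "\<dots> \<le> t * e\<^sup>2 / (128\<^sup>2 * e\<^sup>2)" using w t0 e by (intro divide_right_mono mult_left_mono) auto
  also have "\<dots> = t / 16384" using e by simp
  finally have x2: "\<beta>\<^sup>2 * \<tau>\<^sup>2 \<le> t / 16384" .
  \<comment> \<open>Since d is at least 2, the prefactor 4 d is at most d^3, and t is at least log
    d. The three small terms of the exponent fit into the remaining factor exp t.\<close>
  have "4 * real d \<le> real d * (real d * real d)"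
    using d2 mult_mono[of 2 "real d" 2 "real d"] by (simp add: mult.commute)
  also have "\<dots> = exp (ln (real d) + (ln (real d) + ln (real d)))" unfolding exp_add using d2 by simp
  also have "\<dots> \<le> exp (3 * t)" using t by simp
  finally have d3: "4 * real d \<le> exp (3 * t)" .
  have "4 * real d * exp (7680 * (\<beta> ^ 3 * R * \<sigma>\<^sup>2) + 2 * (\<beta>\<^sup>2 * \<tau>\<^sup>2)) \<le> exp (3 * t) * exp t"
    using x1 x2 t0 by (intro mult_mono d3) auto
  also have "\<dots> = exp (4 * t)" by (simp add: exp_add[symmetric])
  finally have K: "4 * real d * exp (7680 * (\<beta> ^ 3 * R * \<sigma>\<^sup>2) + 2 * (\<beta>\<^sup>2 * \<tau>\<^sup>2)) \<le> exp (4 * t)" .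
  have b0: "0 \<le> \<beta>" using b by (simp add: \<beta>_def)
  show "(LINT \<omega>|M. exp (t / (128 * e) * \<bar>U \<omega>\<bar>)) \<le> exp (4 * t)"
    "(LINT \<omega>|M. exp (t / (128 * e) * \<bar>V \<omega>\<bar>)) \<le> exp (4 * t)"
    using moment[OF b0 small] K unfolding \<beta>_def by linarith+
qed

lemma int_U: "integrable M U" and int_V: "integrable M V"
proof -
  have *: "integrable M (\<lambda>\<omega>. exp (1 * \<bar>U \<omega>\<bar>))" "integrable M (\<lambda>\<omega>. exp (1 * \<bar>V \<omega>\<bar>))"
    by (rule int_UV; simp)+
  have pos: "0 < (LINT \<omega>|M. exp (1 * \<bar>W \<omega>\<bar>))" if "integrable M (\<lambda>\<omega>. exp (1 * \<bar>W \<omega>\<bar>))" for W :: "'a \<Rightarrow> real"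
    using integral_mono[OF _ that, of "\<lambda>_. 1"] by (simp add: prob_space)
  show "integrable M U" by (rule exp_moment_mean(1)[OF meas(1) *(1), of "ln (LINT \<omega>|M. exp (1 * \<bar>U \<omega>\<bar>))"]) (use pos[OF *(1)] in simp_all)
  show "integrable M V" by (rule exp_moment_mean(1)[OF meas(2) *(2), of "ln (LINT \<omega>|M. exp (1 * \<bar>V \<omega>\<bar>))"]) (use pos[OF *(2)] in simp_all)
qed

text \<open>Both means in modulus are at most 4 t / \<beta> = 512 e, which makes 1024 e in total.
  The surplus h allows a positive e when \<epsilon>(t) is 0.\<close>

lemma means:
  assumes t: "ln (real d) \<le> t"
  shows "\<bar>(LINT \<omega>|M. U \<omega>) - (LINT \<omega>|M. V \<omega>)\<bar> \<le> 1536 * eps t"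
proof (rule field_le_epsilon)
  fix h :: real assume h: "0 < h"
  have t0: "0 < t" using t d2 ln_gt_zero[of "real d"] by linarith
  define e where "e = eps t + h / 1536"
  have e: "0 < e" "eps t \<le> e" using h eps_nonneg[of t] t0 by (auto simp: e_def)
  note m = moment_t[OF t e]
  have b: "0 \<le> t / (128 * e)" using m(1) by simp
  have "\<bar>(LINT \<omega>|M. U \<omega>) - (LINT \<omega>|M. V \<omega>)\<bar> \<le> (LINT \<omega>|M. \<bar>U \<omega>\<bar>) + (LINT \<omega>|M. \<bar>V \<omega>\<bar>)"
    using integral_abs_bound[of M U] integral_abs_bound[of M V] by linarith
  also have "\<dots> \<le> 4 * t / (t / (128 * e)) + 4 * t / (t / (128 * e))"
    by (intro add_mono exp_moment_mean(2)[OF meas(1) int_UV(1)[OF b] m(2,1)] exp_moment_mean(2)[OF meas(2) int_UV(2)[OF b] m(3,1)])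
  also have "\<dots> = 1024 * e" using t0 e by (simp add: field_simps)
  also have "\<dots> \<le> 1536 * eps t + h" using h eps_nonneg[of t] t0 by (simp add: e_def)
  finally show "\<bar>(LINT \<omega>|M. U \<omega>) - (LINT \<omega>|M. V \<omega>)\<bar> \<le> 1536 * eps t + h" .
qed

text \<open>For t below log d the right-hand side exceeds 1. Otherwise the threshold 1536 e = 12 *
  128 e gives \<beta> r = 12 t: splitting it in halves leaves exp (4t - 6t) for each of U and V, and
  subtracting the mean of V, at most 4 t / \<beta>, leaves exp (4t - 8t) for U.\<close>

lemma tails:
  assumes t: "0 \<le> t"
  shows "prob {\<omega> \<in> space M. \<bar>U \<omega> - V \<omega>\<bar> > 1536 * eps t} \<le> real d * exp (- t)"
    and "prob {\<omega> \<in> space M. \<bar>U \<omega> - (LINT \<omega>'|M. V \<omega>')\<bar> > 1536 * eps t} \<le> real d * exp (- t)"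
proof -
  have "prob {\<omega> \<in> space M. \<bar>U \<omega> - V \<omega>\<bar> > 1536 * eps t} \<le> real d * exp (- t) \<and>
    prob {\<omega> \<in> space M. \<bar>U \<omega> - (LINT \<omega>'|M. V \<omega>')\<bar> > 1536 * eps t} \<le> real d * exp (- t)"
  proof (cases "ln (real d) \<le> t")
    case False
    have "1 = exp (ln (real d)) * exp (- ln (real d))" by (simp add: exp_add[symmetric])
    also have "\<dots> \<le> real d * exp (- t)" using False d2 by (intro mult_mono) auto
    finally show ?thesis by (auto intro: order_trans[OF prob_le_1])
  next
    case True
    have t0: "0 < t" using True d2 ln_gt_zero[of "real d"] by linarith
    have d1: "exp (- t) \<le> real d * exp (- t)" using d2 by simp
    have "ln 2 \<le> t" using True d2 by (intro order_trans[OF _ True]) auto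
    then have two: "2 \<le> exp t" by (metis exp_le_cancel_iff exp_ln zero_less_numeral)
    have main: "prob {\<omega> \<in> space M. \<bar>U \<omega> - V \<omega>\<bar> > r} \<le> real d * exp (- t) \<and>
      prob {\<omega> \<in> space M. \<bar>U \<omega> - (LINT \<omega>'|M. V \<omega>')\<bar> > r} \<le> real d * exp (- t)" if r: "1536 * eps t < r" for r
    proof -
      define e where "e = r / 1536"
      have e: "0 < e" "eps t \<le> e" using r eps_nonneg[OF t] by (auto simp: e_def)
      note m = moment_t[OF True e]
      define \<beta> where "\<beta> = t / (128 * e)"
      have b: "0 < \<beta>" "0 \<le> \<beta>" using m(1) by (auto simp: \<beta>_def)
      have br: "\<beta> * r = 12 * t" using e t0 by (simp add: \<beta>_def e_def)
      note mU = m(2)[folded \<beta>_def] and mV = m(3)[folded \<beta>_def]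
      have "prob {\<omega> \<in> space M. \<bar>U \<omega> - V \<omega>\<bar> > r}
        \<le> prob ({\<omega> \<in> space M. \<bar>U \<omega>\<bar> > r / 2} \<union> {\<omega> \<in> space M. \<bar>V \<omega>\<bar> > r / 2})"
        by (rule finite_measure_mono) auto
      also have "\<dots> \<le> prob {\<omega> \<in> space M. \<bar>U \<omega>\<bar> > r / 2} + prob {\<omega> \<in> space M. \<bar>V \<omega>\<bar> > r / 2}"
        by (rule measure_Un_le) measurable
      also have "\<dots> \<le> exp (4 * t) * exp (- \<beta> * (r / 2)) + exp (4 * t) * exp (- \<beta> * (r / 2))"
        by (intro add_mono exp_moment_tail[OF int_UV(1)[OF b(2)] mU b(1)] exp_moment_tail[OF int_UV(2)[OF b(2)] mV b(1)])
      also have "\<dots> = 2 * exp (- 2 * t)" using br by (simp add: exp_add[symmetric])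
      also have "\<dots> \<le> exp t * exp (- 2 * t)" by (intro mult_right_mono two) simp
      also have "\<dots> = exp (- t)" by (simp add: exp_add[symmetric])
      finally have 1: "prob {\<omega> \<in> space M. \<bar>U \<omega> - V \<omega>\<bar> > r} \<le> real d * exp (- t)" using d1 by linarith
      have "\<bar>LINT \<omega>'|M. V \<omega>'\<bar> \<le> 4 * t / \<beta>"
        using integral_abs_bound[of M V] exp_moment_mean(2)[OF meas(2) int_UV(2)[OF b(2)] mV b(1)] by linarith
      then have "{\<omega> \<in> space M. \<bar>U \<omega> - (LINT \<omega>'|M. V \<omega>')\<bar> > r} \<subseteq> {\<omega> \<in> space M. \<bar>U \<omega>\<bar> > r - 4 * t / \<beta>}"
        by auto
      then have "prob {\<omega> \<in> space M. \<bar>U \<omega> - (LINT \<omega>'|M. V \<omega>')\<bar> > r} \<le> prob {\<omega> \<in> space M. \<bar>U \<omega>\<bar> > r - 4 * t / \<beta>}"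
        by (rule finite_measure_mono) measurable
      also have "\<dots> \<le> exp (4 * t) * exp (- \<beta> * (r - 4 * t / \<beta>))"
        by (rule exp_moment_tail[OF int_UV(1)[OF b(2)] mU b(1)])
      also have "- \<beta> * (r - 4 * t / \<beta>) = - 8 * t" using br b by (simp add: right_diff_distrib)
      also have "exp (4 * t) * exp (- 8 * t) \<le> exp (- t)" using t0 by (simp add: exp_add[symmetric])
      finally show ?thesis using 1 d1 by linarith
    qed
    have UV: "(\<lambda>\<omega>. \<bar>U \<omega> - V \<omega>\<bar>) \<in> borel_measurable M" "(\<lambda>\<omega>. \<bar>U \<omega> - (LINT \<omega>'|M. V \<omega>')\<bar>) \<in> borel_measurable M"
      by measurable
    show ?thesis
      using tail_right_limit[OF UV(1), of "1536 * eps t"] tail_right_limit[OF UV(2), of "1536 * eps t"] main by blast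
  qed
  then show "prob {\<omega> \<in> space M. \<bar>U \<omega> - V \<omega>\<bar> > 1536 * eps t} \<le> real d * exp (- t)"
    "prob {\<omega> \<in> space M. \<bar>U \<omega> - (LINT \<omega>'|M. V \<omega>')\<bar> > 1536 * eps t} \<le> real d * exp (- t)" by auto
qed

end

text \<open>At an index where one of the two maxima is attained, the difference at that index is
  already as large as the difference of the maxima. The norm is treated in this way, centred at the
  maximum of the means; the mean of the maximum need not be known.\<close>

lemma abs_Max_diff_exp:
  fixes f \<mu> :: "'i \<Rightarrow> real"
  assumes S: "finite S" "S \<noteq> {}" and b: "0 \<le> \<beta>"
  shows "exp (\<beta> * \<bar>Max (f ` S) - Max (\<mu> ` S)\<bar>) \<le> (\<Sum>s\<in>S. exp (\<beta> * (f s - \<mu> s)) + exp (- \<beta> * (f s - \<mu> s)))"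
proof -
  have fin: "finite (f ` S)" "finite (\<mu> ` S)" using S by auto
  have ne: "f ` S \<noteq> {}" "\<mu> ` S \<noteq> {}" using S by auto
  obtain i where i: "i \<in> S" "Max (f ` S) = f i" using Max_in[OF fin(1) ne(1)] by auto
  obtain j where j: "j \<in> S" "Max (\<mu> ` S) = \<mu> j" using Max_in[OF fin(2) ne(2)] by auto
  have ij: "\<mu> i \<le> \<mu> j" "f j \<le> f i" using i j fin by (metis Max_ge imageI)+
  have "\<exists>k\<in>S. \<bar>f i - \<mu> j\<bar> \<le> \<bar>f k - \<mu> k\<bar>"
  proof (cases "\<mu> j \<le> f i")
    case True
    then have "\<bar>f i - \<mu> j\<bar> \<le> \<bar>f i - \<mu> i\<bar>" using ij by simp
    then show ?thesis using i(1) by auto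
  next
    case False
    then have "\<bar>f i - \<mu> j\<bar> \<le> \<bar>f j - \<mu> j\<bar>" using ij by simp
    then show ?thesis using j(1) by auto
  qed
  then obtain k where k: "k \<in> S" "\<bar>f i - \<mu> j\<bar> \<le> \<bar>f k - \<mu> k\<bar>" by auto
  have "exp (\<beta> * \<bar>f i - \<mu> j\<bar>) \<le> exp (\<beta> * \<bar>f k - \<mu> k\<bar>)" using k b by (simp add: mult_left_mono)
  also have "\<dots> \<le> exp (\<beta> * (f k - \<mu> k)) + exp (- \<beta> * (f k - \<mu> k))"
    by (cases "0 \<le> f k - \<mu> k") (auto simp: algebra_simps)
  also have "\<dots> \<le> (\<Sum>s\<in>S. exp (\<beta> * (f s - \<mu> s)) + exp (- \<beta> * (f s - \<mu> s)))"
    by (rule member_le_sum[OF k(1)]) (auto simp: S add_nonneg_nonneg)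
  finally show ?thesis unfolding i j .
qed

context model
begin

definition "fmax S x = Max ((\<lambda>s. fs s x) ` S)"

lemma fmax_meas:
  assumes "finite S" "S \<noteq> {}"
  shows "fmax S \<in> borel_measurable FM"
  unfolding fmax_def[abs_def] using assms
proof (induction rule: finite_ne_induct)
  case (insert s S)
  have "(\<lambda>x. Max ((\<lambda>s. fs s x) ` insert s S)) = (\<lambda>x. max (fs s x) (Max ((\<lambda>s. fs s x) ` S)))"
    using insert by (simp add: Max_insert)
  then show ?case using insert by simp
qed simp

text \<open>\<open>{1}\<close> stands for the largest eigenvalue and \<open>{1, - 1}\<close> for the
  norm. The constant 4 counts two signs s and two signs of the exponent, and pi^2 / 8 is rounded up
  to 2.\<close>

lemma two_sided:
  assumes S: "S = {1} \<or> S = {1, - 1}" and w0: "0 \<le> w"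
  defines "\<mu> \<equiv> Max ((\<lambda>s. LINT \<omega>|N. fs s (GG \<omega>)) ` S)"
  assumes b: "0 \<le> \<beta>"
  shows "integrable M (\<lambda>\<omega>. exp (\<beta> * \<bar>fmax S (XX \<omega>) - \<mu>\<bar>))" (is "integrable M ?X")
    and "integrable N (\<lambda>\<omega>. exp (\<beta> * \<bar>fmax S (GG \<omega>) - \<mu>\<bar>))" (is "integrable N ?G")
    and "128 * \<beta> * R \<le> 1 \<Longrightarrow> (LINT \<omega>|M. exp (\<beta> * \<bar>fmax S (XX \<omega>) - \<mu>\<bar>)) \<le> 4 * real d * exp (7680 * (\<beta> ^ 3 * R * v) + 2 * (\<beta>\<^sup>2 * w))"
    and "(LINT \<omega>|N. exp (\<beta> * \<bar>fmax S (GG \<omega>) - \<mu>\<bar>)) \<le> 4 * exp (2 * (\<beta>\<^sup>2 * w))"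
proof -
  have Sf: "finite S" "S \<noteq> {}" "real (card S) \<le> 2" using S by (auto simp: card_insert_if)
  have s2: "s\<^sup>2 = 1" if "s \<in> S" for s using that S by auto
  define m where "m s = (LINT \<omega>|N. fs s (GG \<omega>))" for s
  define h where "h s x = exp (\<beta> * (fs s x - m s)) + exp (- \<beta> * (fs s x - m s))" for s x
  have le: "exp (\<beta> * \<bar>fmax S x - \<mu>\<bar>) \<le> (\<Sum>s\<in>S. h s x)" for x
    unfolding fmax_def \<mu>_def h_def m_def by (rule abs_Max_diff_exp[OF Sf(1,2) b])
  have h_eq: "h s x = exp (- \<beta> * m s) * exp (\<beta> * fs s x) + exp (\<beta> * m s) * exp (- \<beta> * fs s x)" for s x
    by (simp add: h_def exp_add[symmetric] algebra_simps)
  have iX: "integrable M (\<lambda>\<omega>. h s (XX \<omega>))" if "s \<in> S" for s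
    unfolding h_eq by (intro Bochner_Integration.integrable_add integrable_mult_right XX_int s2 that)
  have iG: "integrable N (\<lambda>\<omega>. h s (GG \<omega>))" if "s \<in> S" for s
    unfolding h_eq by (intro Bochner_Integration.integrable_add integrable_mult_right GG_conc(3)[OF s2 b] that)
  note [measurable] = fmax_meas[OF Sf(1,2)]
  show "integrable M ?X"
    by (rule Bochner_Integration.integrable_bound[OF Bochner_Integration.integrable_sum[OF iX]])
       (use le in \<open>auto intro!: AE_I2 intro: order_trans[OF _ abs_ge_self]\<close>)
  show "integrable N ?G"
    by (rule Bochner_Integration.integrable_bound[OF Bochner_Integration.integrable_sum[OF iG]])
       (use le in \<open>auto intro!: AE_I2 intro: order_trans[OF _ abs_ge_self]\<close>)
  have "pi\<^sup>2 \<le> 4\<^sup>2" using pi_less_4 pi_ge_zero by (intro power_mono) auto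
  then have "pi\<^sup>2 * (\<beta>\<^sup>2 * w) \<le> 16 * (\<beta>\<^sup>2 * w)" using w0 by (intro mult_right_mono) auto
  then have pi: "exp (pi\<^sup>2 * \<beta>\<^sup>2 * w / 8) \<le> exp (2 * (\<beta>\<^sup>2 * w))" by (simp add: mult.assoc)
  define E where "E = exp (2 * (\<beta>\<^sup>2 * w))"
  have G1: "(LINT \<omega>|N. exp (\<beta> * (fs s (GG \<omega>) - m s))) \<le> E" "(LINT \<omega>|N. exp (- \<beta> * (fs s (GG \<omega>) - m s))) \<le> E"
    if "s \<in> S" for s
    using GG_conc(1,2)[OF s2[OF that] b] pi unfolding m_def E_def by linarith+
  have iG1: "integrable N (\<lambda>\<omega>. exp (c * (fs s (GG \<omega>) - m s)))" if "s \<in> S" for s c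
  proof -
    have "exp (c * (fs s (GG \<omega>) - m s)) = exp (- c * m s) * exp (c * fs s (GG \<omega>))" for \<omega>
      by (simp add: exp_add[symmetric] algebra_simps)
    then show ?thesis using GG_conc(3)[OF s2[OF that] b, of c] by simp
  qed
  have "(LINT \<omega>|N. ?G \<omega>) \<le> (LINT \<omega>|N. (\<Sum>s\<in>S. h s (GG \<omega>)))"
    by (rule integral_mono) (use le iG \<open>integrable N ?G\<close> in auto)
  also have "\<dots> = (\<Sum>s\<in>S. LINT \<omega>|N. h s (GG \<omega>))" by (rule Bochner_Integration.integral_sum[OF iG])
  also have "\<dots> \<le> (\<Sum>s\<in>S. 2 * E)"
  proof (rule sum_mono)
    fix s assume s: "s \<in> S"
    have "(LINT \<omega>|N. h s (GG \<omega>)) = (LINT \<omega>|N. exp (\<beta> * (fs s (GG \<omega>) - m s))) + (LINT \<omega>|N. exp (- \<beta> * (fs s (GG \<omega>) - m s)))"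
      unfolding h_def by (intro Bochner_Integration.integral_add iG1 s)
    then show "(LINT \<omega>|N. h s (GG \<omega>)) \<le> 2 * E" using G1[OF s] by linarith
  qed
  also have "\<dots> = real (card S) * (2 * E)" by simp
  also have "\<dots> \<le> 2 * (2 * E)" using Sf(3) by (intro mult_right_mono) (auto simp: E_def)
  finally show "(LINT \<omega>|N. ?G \<omega>) \<le> 4 * exp (2 * (\<beta>\<^sup>2 * w))" by (simp add: E_def)
  assume small: "128 * \<beta> * R \<le> 1"
  define \<kappa> where "\<kappa> = exp (7680 * (\<beta> ^ 3 * R * v))"
  have "(LINT \<omega>|M. ?X \<omega>) \<le> (LINT \<omega>|M. (\<Sum>s\<in>S. h s (XX \<omega>)))"
    by (rule integral_mono) (use le iX \<open>integrable M ?X\<close> in auto)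
  also have "\<dots> = (\<Sum>s\<in>S. LINT \<omega>|M. h s (XX \<omega>))" by (rule Bochner_Integration.integral_sum[OF iX])
  also have "\<dots> \<le> (\<Sum>s\<in>S. 2 * (\<kappa> * (real d * E)))"
  proof (rule sum_mono)
    fix s assume s: "s \<in> S"
    have e: "exp (- \<beta> * m s) * (LINT \<omega>|N. exp (\<beta> * fs s (GG \<omega>))) \<le> E"
      "exp (\<beta> * m s) * (LINT \<omega>|N. exp (- \<beta> * fs s (GG \<omega>))) \<le> E"
      using G1[OF s] unfolding integral_mult_right_zero[symmetric]
      by (simp_all add: exp_add[symmetric] algebra_simps)
    have "(LINT \<omega>|M. h s (XX \<omega>)) = exp (- \<beta> * m s) * (LINT \<omega>|M. exp (\<beta> * fs s (XX \<omega>))) + exp (\<beta> * m s) * (LINT \<omega>|M. exp (- \<beta> * fs s (XX \<omega>)))"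
      unfolding h_eq integral_mult_right_zero[symmetric]
      by (intro Bochner_Integration.integral_add integrable_mult_right XX_int s2 s)
    also have "\<dots> \<le> exp (- \<beta> * m s) * (\<kappa> * (real d * (LINT \<omega>|N. exp (\<beta> * fs s (GG \<omega>)))))
       + exp (\<beta> * m s) * (\<kappa> * (real d * (LINT \<omega>|N. exp (- \<beta> * fs s (GG \<omega>)))))"
      unfolding \<kappa>_def by (intro add_mono mult_left_mono exp_upper exp_lower s2 s b small) auto
    also have "\<dots> = \<kappa> * (real d * (exp (- \<beta> * m s) * (LINT \<omega>|N. exp (\<beta> * fs s (GG \<omega>)))))
       + \<kappa> * (real d * (exp (\<beta> * m s) * (LINT \<omega>|N. exp (- \<beta> * fs s (GG \<omega>)))))"
      by (simp only: mult_ac)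
    also have "\<dots> \<le> \<kappa> * (real d * E) + \<kappa> * (real d * E)"
      using e by (intro add_mono mult_left_mono) (auto simp: \<kappa>_def)
    finally show "(LINT \<omega>|M. h s (XX \<omega>)) \<le> 2 * (\<kappa> * (real d * E))" by (simp only: mult_2)
  qed
  also have "\<dots> = real (card S) * (2 * (\<kappa> * (real d * E)))" by simp
  also have "\<dots> \<le> 2 * (2 * (\<kappa> * (real d * E)))" using Sf(3) by (intro mult_right_mono) (auto simp: E_def \<kappa>_def)
  finally show "(LINT \<omega>|M. ?X \<omega>) \<le> 4 * real d * exp (7680 * (\<beta> ^ 3 * R * v) + 2 * (\<beta>\<^sup>2 * w))"
    by (simp add: E_def \<kappa>_def exp_add mult_ac)
qed

end

text \<open>Here X and G share one sample space. The interpolation took place on products of this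
  space with itself and yields the moments of X and of G separately, so the given joint law does not
  interfere.\<close>

lemma model_moment_pair:
  assumes mo: "model M G d M Z n Z0 R (\<sigma>\<^sup>2) (\<tau>\<^sup>2)" and S: "S = {1} \<or> S = {1, - 1}"
    and d2: "2 \<le> d" and nn: "0 \<le> \<sigma>" "0 \<le> \<tau>"
  defines "\<mu> \<equiv> Max ((\<lambda>s. LINT \<omega>|M. model.fs d s (Z0 + G \<omega>)) ` S)"
  shows "moment_pair M (\<lambda>\<omega>. model.fmax d S (Z0 + (\<Sum>k=1..n. Z k \<omega>)) - \<mu>) (\<lambda>\<omega>. model.fmax d S (Z0 + G \<omega>) - \<mu>) d R \<sigma> \<tau>"
proof -
  interpret model M G d M Z n Z0 R "\<sigma>\<^sup>2" "\<tau>\<^sup>2" by (rule mo)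
  have Sf: "finite S" "S \<noteq> {}" using S by auto
  have w0: "0 \<le> \<tau>\<^sup>2" by simp
  note ts = two_sided[OF S w0, unfolded XX_def[abs_def] GG_def[abs_def], folded \<mu>_def]
  note [measurable] = fmax_meas[OF Sf]
  have XX'[measurable]: "(\<lambda>\<omega>. Z0 + (\<Sum>k=1..n. Z k \<omega>)) \<in> M \<rightarrow>\<^sub>M FM" using XX_meas by (simp add: XX_def[abs_def])
  show ?thesis
  proof
    show "2 \<le> d" "0 \<le> R" "0 \<le> \<sigma>" "0 \<le> \<tau>" using d2 R0 nn by auto
    show "(\<lambda>\<omega>. fmax S (Z0 + (\<Sum>k=1..n. Z k \<omega>)) - \<mu>) \<in> borel_measurable M"
      "(\<lambda>\<omega>. fmax S (Z0 + G \<omega>) - \<mu>) \<in> borel_measurable M" by measurable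
    fix \<beta> :: real assume b: "0 \<le> \<beta>"
    show "integrable M (\<lambda>\<omega>. exp (\<beta> * \<bar>fmax S (Z0 + (\<Sum>k=1..n. Z k \<omega>)) - \<mu>\<bar>))" by (rule ts(1)[OF b])
    show "integrable M (\<lambda>\<omega>. exp (\<beta> * \<bar>fmax S (Z0 + G \<omega>) - \<mu>\<bar>))" by (rule ts(2)[OF b])
    assume small: "128 * \<beta> * R \<le> 1"
    show "(LINT \<omega>|M. exp (\<beta> * \<bar>fmax S (Z0 + (\<Sum>k=1..n. Z k \<omega>)) - \<mu>\<bar>)) \<le> 4 * real d * exp (7680 * (\<beta> ^ 3 * R * \<sigma>\<^sup>2) + 2 * (\<beta>\<^sup>2 * \<tau>\<^sup>2))"
      by (rule ts(3)[OF b small])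
    have "(LINT \<omega>|M. exp (\<beta> * \<bar>fmax S (Z0 + G \<omega>) - \<mu>\<bar>)) \<le> 4 * exp (2 * (\<beta>\<^sup>2 * \<tau>\<^sup>2))" by (rule ts(4)[OF b])
    also have "\<dots> \<le> 4 * real d * exp (7680 * (\<beta> ^ 3 * R * \<sigma>\<^sup>2) + 2 * (\<beta>\<^sup>2 * \<tau>\<^sup>2))"
      using d2 R0 b by (intro mult_mono) auto
    finally show "(LINT \<omega>|M. exp (\<beta> * \<bar>fmax S (Z0 + G \<omega>) - \<mu>\<bar>)) \<le> 4 * real d * exp (7680 * (\<beta> ^ 3 * R * \<sigma>\<^sup>2) + 2 * (\<beta>\<^sup>2 * \<tau>\<^sup>2))" .
  qed
qed

section \<open>Random matrices\<close>

context prob_space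
begin

section \<open>Moments and transforms of Gaussian variables\<close>

lemma std_normal_exp_moments:
  assumes D: "distributed M lborel X std_normal_density"
  shows "integrable M (\<lambda>\<omega>. (X \<omega>)\<^sup>2)" and "(LINT \<omega>|M. (X \<omega>)\<^sup>2) = 1" and "integrable M X"
    and "integrable M (\<lambda>\<omega>. exp (t * X \<omega>))" and "(LINT \<omega>|M. exp (t * X \<omega>)) = exp (t\<^sup>2 / 2)"
    and "(CLINT \<omega>|M. iexp (t * X \<omega>)) = exp (- complex_of_real (t\<^sup>2) / 2)"
proof -
  have nn: "\<And>x. x \<in> space lborel \<Longrightarrow> 0 \<le> std_normal_density x" by simp
  show "integrable M (\<lambda>\<omega>. (X \<omega>)\<^sup>2)"
    using distributed_integrable[OF D _ nn, of "\<lambda>x. x\<^sup>2"] integrable_std_normal_moment[of 2] by simp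
  show "(LINT \<omega>|M. (X \<omega>)\<^sup>2) = 1"
    using standard_normal_distributed_variance[OF D] standard_normal_distributed_expectation[OF D] by simp
  show "integrable M X"
    using distributed_integrable[OF D _ nn, of "\<lambda>x. x"] integrable_std_normal_moment[of 1] by simp
  \<comment> \<open>Completing the square: the exponentially tilted standard density is a multiple
    of the normal density with mean t.\<close>
  have e: "std_normal_density x * exp (t * x) = exp (t\<^sup>2 / 2) * normal_density t 1 x" for x
    by (simp add: normal_density_def exp_add[symmetric] power2_eq_square field_simps)
  show "integrable M (\<lambda>\<omega>. exp (t * X \<omega>))"
    using distributed_integrable[OF D _ nn, of "\<lambda>x. exp (t * x)"] by (simp add: e)
  show "(LINT \<omega>|M. exp (t * X \<omega>)) = exp (t\<^sup>2 / 2)"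
    using distributed_integral[OF D _ nn, of "\<lambda>x. exp (t * x)"] by (simp add: e)
  have [measurable]: "X \<in> borel_measurable M" using distributed_measurable[OF D] by simp
  have "(CLINT \<omega>|M. iexp (t * X \<omega>)) = (CLINT x|distr M lborel X. iexp (t * x))"
    by (subst integral_distr) auto
  also have "\<dots> = char std_normal_distribution t"
    unfolding char_def distributed_distr_eq_density[OF D] ..
  finally show "(CLINT \<omega>|M. iexp (t * X \<omega>)) = exp (- complex_of_real (t\<^sup>2) / 2)"
    by (simp add: char_std_normal_distribution exp_of_real[symmetric])
qed

text \<open>A degenerate variable is almost surely equal to its mean and has s = 0; any other one is
  reduced to the standard normal variable. Both cases share the same formulas.\<close>

lemma gaussian_var_centered:
  assumes Y: "gaussian_var M Y"
  defines "m \<equiv> expectation Y"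
  defines "s \<equiv> LINT \<omega>|M. (Y \<omega> - m)\<^sup>2"
  shows "integrable M Y" and "integrable M (\<lambda>\<omega>. (Y \<omega> - m)\<^sup>2)" and "integrable M (\<lambda>\<omega>. exp (Y \<omega> - m))"
    and "(LINT \<omega>|M. exp (Y \<omega> - m)) = exp (s / 2)"
    and "(CLINT \<omega>|M. iexp (Y \<omega> - m)) = exp (- complex_of_real s / 2)"
proof -
  have Ym [measurable]: "Y \<in> borel_measurable M" using Y by (simp add: gaussian_var_def)
  have "integrable M Y \<and> integrable M (\<lambda>\<omega>. (Y \<omega> - m)\<^sup>2) \<and> integrable M (\<lambda>\<omega>. exp (Y \<omega> - m)) \<and>
    (LINT \<omega>|M. exp (Y \<omega> - m)) = exp (s / 2) \<and> (CLINT \<omega>|M. iexp (Y \<omega> - m)) = exp (- complex_of_real s / 2)"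
  proof (cases "\<exists>\<mu>. AE \<omega> in M. Y \<omega> = \<mu>")
    case True
    then obtain \<mu> where ae: "AE \<omega> in M. Y \<omega> = \<mu>" by auto
    have "m = (LINT \<omega>|M. \<mu>)" unfolding m_def by (rule integral_cong_AE) (use ae in auto)
    then have m: "m = \<mu>" by (simp add: prob_space)
    have "s = (LINT \<omega>|M. 0)" unfolding s_def by (rule integral_cong_AE) (use ae m in auto)
    then have s: "s = 0" by simp
    have 1: "integrable M Y" by (rule integrable_cong_AE_imp[where g = "\<lambda>_. \<mu>"]) (use ae in auto)
    have 2: "integrable M (\<lambda>\<omega>. (Y \<omega> - m)\<^sup>2)"
      by (rule integrable_cong_AE_imp[where g = "\<lambda>_. 0"]) (use ae m in auto)
    have 3: "integrable M (\<lambda>\<omega>. exp (Y \<omega> - m))"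
      by (rule integrable_cong_AE_imp[where g = "\<lambda>_. 1"]) (use ae m in auto)
    have "(LINT \<omega>|M. exp (Y \<omega> - m)) = (LINT \<omega>|M. 1)" by (rule integral_cong_AE) (use ae m in auto)
    moreover have "(CLINT \<omega>|M. iexp (Y \<omega> - m)) = (CLINT \<omega>|M. 1)" by (rule integral_cong_AE) (use ae m in auto)
    ultimately show ?thesis using 1 2 3 by (simp add: s prob_space)
  next
    case False
    then obtain \<mu> \<tau> where t: "0 < \<tau>" and D: "distributed M lborel Y (normal_density \<mu> \<tau>)"
      using Y by (auto simp: gaussian_var_def)
    have m: "m = \<mu>" unfolding m_def by (rule normal_distributed_expectation[OF t D])
    define X where "X \<omega> = (Y \<omega> - \<mu>) / \<tau>" for \<omega>
    have DX: "distributed M lborel X std_normal_density"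
      using D unfolding normal_standard_normal_convert[OF t] X_def[abs_def] .
    have YX: "Y \<omega> - m = \<tau> * X \<omega>" for \<omega> using t by (simp add: X_def m)
    have Ye: "Y = (\<lambda>\<omega>. m + \<tau> * X \<omega>)" using YX by (auto simp: fun_eq_iff algebra_simps)
    note st = std_normal_exp_moments[OF DX]
    have s: "s = \<tau>\<^sup>2" using st(2) by (simp add: s_def YX power_mult_distrib)
    have "integrable M Y" unfolding Ye using st(3) by simp
    then show ?thesis using st(1) st(4-6)[of \<tau>] by (simp add: YX s power_mult_distrib)
  qed
  then show "integrable M Y" "integrable M (\<lambda>\<omega>. (Y \<omega> - m)\<^sup>2)" "integrable M (\<lambda>\<omega>. exp (Y \<omega> - m))"
    "(LINT \<omega>|M. exp (Y \<omega> - m)) = exp (s / 2)" "(CLINT \<omega>|M. iexp (Y \<omega> - m)) = exp (- complex_of_real s / 2)"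
    by auto
qed

end

lemma integrable_mult_of_squares:
  fixes a b :: "'a \<Rightarrow> real"
  assumes [measurable]: "a \<in> borel_measurable M" "b \<in> borel_measurable M"
    and i: "integrable M (\<lambda>\<omega>. (a \<omega>)\<^sup>2)" "integrable M (\<lambda>\<omega>. (b \<omega>)\<^sup>2)"
  shows "integrable M (\<lambda>\<omega>. a \<omega> * b \<omega>)"
proof (rule Bochner_Integration.integrable_bound)
  show "integrable M (\<lambda>\<omega>. (a \<omega>)\<^sup>2 + (b \<omega>)\<^sup>2)" by (intro Bochner_Integration.integrable_add i)
  have "\<bar>a \<omega> * b \<omega>\<bar> \<le> (a \<omega>)\<^sup>2 + (b \<omega>)\<^sup>2" for \<omega>
  proof -
    have "2 * (\<bar>a \<omega>\<bar> * \<bar>b \<omega>\<bar>) \<le> (a \<omega>)\<^sup>2 + (b \<omega>)\<^sup>2"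
      using sum_squares_bound[of "\<bar>a \<omega>\<bar>" "\<bar>b \<omega>\<bar>"] by (simp add: mult.assoc)
    moreover have "0 \<le> \<bar>a \<omega>\<bar> * \<bar>b \<omega>\<bar>" by simp
    ultimately show ?thesis unfolding abs_mult by linarith
  qed
  then show "AE \<omega> in M. norm (a \<omega> * b \<omega>) \<le> norm ((a \<omega>)\<^sup>2 + (b \<omega>)\<^sup>2)" by simp
qed measurable

section \<open>Measurability, means and covariances of random matrices\<close>

lemma space_mat_borel [simp]: "space (mat_borel d) = carrier_mat d d"
  by (simp add: mat_borel_def)

lemma measurable_mat_entry:
  assumes "i < d" "j < d"
  shows "(\<lambda>A. A $$ (i, j)) \<in> borel_measurable (mat_borel d)"
proof -
  let ?I = "{..<d} \<times> {..<d}"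
  have "(\<lambda>A. \<lambda>p\<in>?I. A $$ p) \<in> mat_borel d \<rightarrow>\<^sub>M (\<Pi>\<^sub>M p\<in>?I. borel)"
    unfolding mat_borel_def by (rule measurable_vimage_algebra1) (auto simp: space_PiM)
  moreover have "(\<lambda>x. x (i, j)) \<in> (\<Pi>\<^sub>M p\<in>?I. borel) \<rightarrow>\<^sub>M borel"
    by (rule measurable_component_singleton) (use assms in auto)
  ultimately have "(\<lambda>A. (\<lambda>p\<in>?I. A $$ p) (i, j)) \<in> borel_measurable (mat_borel d)"
    by (rule measurable_compose)
  then show ?thesis using assms by simp
qed

lemma measurable_toF: "toF d \<in> mat_borel d \<rightarrow>\<^sub>M FM"
proof (rule measurable_FM_I)
  fix i j
  show "(\<lambda>x. ent (toF d x) i j) \<in> borel_measurable (mat_borel d)"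
    using measurable_mat_entry[of i d j] by (cases "i < d \<and> j < d") (auto simp: ent_toF)
qed

lemma inner_toF: "inner L (toF d A) = (\<Sum>i<d. \<Sum>j<d. Re (ent L i j) * Re (A $$ (i, j)) + Im (ent L i j) * Im (A $$ (i, j)))"
  unfolding inner_fm_bd'[OF bd_toF] by (intro sum.cong refl) (simp add: ent_toF)

lemma inner_toF_expect:
  assumes i: "\<And>i j. i < d \<Longrightarrow> j < d \<Longrightarrow> integrable M (\<lambda>\<omega>. Y \<omega> $$ (i, j))"
  shows "integrable M (\<lambda>\<omega>. inner L (toF d (Y \<omega>)))"
    and "(LINT \<omega>|M. inner L (toF d (Y \<omega>))) = inner L (toF d (expect_mat M d Y))"
proof -
  have t: "integrable M (\<lambda>\<omega>. Re (ent L i j) * Re (Y \<omega> $$ (i, j)) + Im (ent L i j) * Im (Y \<omega> $$ (i, j)))"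
    if "i < d" "j < d" for i j using i[OF that] by simp
  show "integrable M (\<lambda>\<omega>. inner L (toF d (Y \<omega>)))"
    unfolding inner_toF by (intro Bochner_Integration.integrable_sum t) auto
  have "(LINT \<omega>|M. inner L (toF d (Y \<omega>)))
    = (\<Sum>i<d. \<Sum>j<d. LINT \<omega>|M. Re (ent L i j) * Re (Y \<omega> $$ (i, j)) + Im (ent L i j) * Im (Y \<omega> $$ (i, j)))"
    unfolding inner_toF by (subst Bochner_Integration.integral_sum, (intro Bochner_Integration.integrable_sum t; simp))
      (intro sum.cong refl Bochner_Integration.integral_sum t; simp)
  also have "\<dots> = inner L (toF d (expect_mat M d Y))"
    unfolding inner_toF by (intro sum.cong refl) (simp add: expect_mat_def i)
  finally show "(LINT \<omega>|M. inner L (toF d (Y \<omega>))) = inner L (toF d (expect_mat M d Y))" .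
qed

lemma self_adjoint_if_sad:
  assumes A: "A \<in> carrier_mat d d" and s: "toF d A \<in> sad d"
  shows "self_adjoint d A"
proof -
  have *: "cnj (A $$ (j, i)) = A $$ (i, j)" if "i < d" "j < d" for i j
  proof -
    have "ent (adj (toF d A)) i j = ent (toF d A) i j" using s by (simp add: sad_def)
    then show ?thesis using that by (simp add: ent_toF)
  qed
  have "mat_adjoint A = A"
  proof (rule eq_matI)
    show d: "dim_row (mat_adjoint A) = dim_row A" "dim_col (mat_adjoint A) = dim_col A"
      using A by (auto simp: mat_adjoint_def)
    fix i j assume ij: "i < dim_row A" "j < dim_col A"
    then have "mat_adjoint A $$ (i, j) = cnj (A $$ (j, i))"
      using A unfolding mat_adjoint_def by (simp add: mat_of_rows_index)
    then show "mat_adjoint A $$ (i, j) = A $$ (i, j)" using * ij A by auto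
  qed
  then show ?thesis using A by (simp add: self_adjoint_def)
qed

definition sq_integrable :: "'a measure \<Rightarrow> nat \<Rightarrow> ('a \<Rightarrow> fm) \<Rightarrow> bool" where
  "sq_integrable M d A \<longleftrightarrow> A \<in> M \<rightarrow>\<^sub>M FM \<and> (\<forall>\<omega>\<in>space M. A \<omega> \<in> sad d) \<and> (\<forall>L. integrable M (\<lambda>\<omega>. (inner L (A \<omega>))\<^sup>2))"

lemma sq_integrable_mult:
  "sq_integrable M d A \<Longrightarrow> sq_integrable M d B \<Longrightarrow> integrable M (\<lambda>\<omega>. inner L (A \<omega>) * inner L' (B \<omega>))"
  unfolding sq_integrable_def by (intro integrable_mult_of_squares) auto

text \<open>Parseval's identity in the basis \<open>bv\<close>. It reduces the matrix variance to
  real second moments, which are additive over independent centred summands.\<close>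

lemma sq_integrable_norm:
  assumes A: "sq_integrable M d A" and P: "bd P d"
  shows "integrable M (\<lambda>\<omega>. (norm (A \<omega> * P))\<^sup>2)"
    and "(LINT \<omega>|M. (norm (A \<omega> * P))\<^sup>2) = (\<Sum>p\<in>Ix d. LINT \<omega>|M. (inner (bv p * adj P) (A \<omega>))\<^sup>2)"
proof -
  have i: "integrable M (\<lambda>\<omega>. (inner L (A \<omega>))\<^sup>2)" for L using A by (simp add: sq_integrable_def)
  have e: "(norm (A \<omega> * P))\<^sup>2 = (\<Sum>p\<in>Ix d. (inner (bv p * adj P) (A \<omega>))\<^sup>2)" if "\<omega> \<in> space M" for \<omega>
  proof -
    have "bd (A \<omega> * P) d" using A P that by (auto simp: sq_integrable_def sad_def bd_times)
    from norm_fm_sq[OF this] have "(norm (A \<omega> * P))\<^sup>2 = (\<Sum>p\<in>Ix d. (inner (bv p) (A \<omega> * P))\<^sup>2)"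
      by (simp add: sum_Ix inner_bv cmod_power2)
    then show ?thesis by (simp add: inner_times_right)
  qed
  show "integrable M (\<lambda>\<omega>. (norm (A \<omega> * P))\<^sup>2)"
    by (subst Bochner_Integration.integrable_cong[OF refl e]) (auto intro!: Bochner_Integration.integrable_sum i)
  show "(LINT \<omega>|M. (norm (A \<omega> * P))\<^sup>2) = (\<Sum>p\<in>Ix d. LINT \<omega>|M. (inner (bv p * adj P) (A \<omega>))\<^sup>2)"
    by (subst Bochner_Integration.integral_cong[OF refl e]) (auto intro!: Bochner_Integration.integral_sum i)
qed

text \<open>Self-adjointness makes the complex covariances determine all real ones, since the conjugate
  of an entry is again an entry.\<close>

lemma real_cov_eqI:
  assumes A: "sq_integrable M d A" and B: "sq_integrable N d B"
    and c: "\<And>i j k l. i < d \<Longrightarrow> j < d \<Longrightarrow> k < d \<Longrightarrow> l < d \<Longrightarrow>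
      (LINT \<omega>|M. ent (A \<omega>) i j * cnj (ent (A \<omega>) k l)) = (LINT \<omega>|N. ent (B \<omega>) i j * cnj (ent (B \<omega>) k l))"
  shows "(LINT \<omega>|M. inner L (A \<omega>) * inner L' (A \<omega>)) = (LINT \<omega>|N. inner L (B \<omega>) * inner L' (B \<omega>))"
proof -
  \<comment> \<open>For complex a, b put x = a conj(b) and y = conj(a) conj(b). The four cases are
    the products of the real or imaginary part of a with the real or imaginary part of b; by
    self-adjointness conj(a) is the transposed entry.\<close>
  define F where "F r s x y = (if r then (if s then Re (x + y) / 2 else - Im (x + y) / 2)
      else (if s then Im (x - y) / 2 else Re (x - y) / 2))" for r s and x y :: complex
  have basic: "(LINT \<omega>|K. inner (bv (i, j, r)) (H \<omega>) * inner (bv (k, l, s)) (H \<omega>))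
      = F r s (LINT \<omega>|K. ent (H \<omega>) i j * cnj (ent (H \<omega>) k l)) (LINT \<omega>|K. ent (H \<omega>) j i * cnj (ent (H \<omega>) k l))"
    if H: "sq_integrable K d H" for K :: "'x measure" and H i j k l r s
  proof -
    have [measurable]: "H \<in> K \<rightarrow>\<^sub>M FM" using H by (simp add: sq_integrable_def)
    have re: "integrable K (\<lambda>\<omega>. Re (ent (H \<omega>) i j) * Re (ent (H \<omega>) k l))"
      "integrable K (\<lambda>\<omega>. Re (ent (H \<omega>) i j) * Im (ent (H \<omega>) k l))"
      "integrable K (\<lambda>\<omega>. Im (ent (H \<omega>) i j) * Re (ent (H \<omega>) k l))"
      "integrable K (\<lambda>\<omega>. Im (ent (H \<omega>) i j) * Im (ent (H \<omega>) k l))" for i j k l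
      using sq_integrable_mult[OF H H, of "bv (i, j, True)" "bv (k, l, True)"] sq_integrable_mult[OF H H, of "bv (i, j, True)" "bv (k, l, False)"]
        sq_integrable_mult[OF H H, of "bv (i, j, False)" "bv (k, l, True)"] sq_integrable_mult[OF H H, of "bv (i, j, False)" "bv (k, l, False)"]
      by (simp_all add: inner_bv)
    have cx: "integrable K (\<lambda>\<omega>. ent (H \<omega>) i j * cnj (ent (H \<omega>) k l))" for i j k l
    proof -
      have "integrable K (\<lambda>\<omega>. complex_of_real (Re (ent (H \<omega>) i j) * Re (ent (H \<omega>) k l) + Im (ent (H \<omega>) i j) * Im (ent (H \<omega>) k l))
         + \<i> * complex_of_real (Im (ent (H \<omega>) i j) * Re (ent (H \<omega>) k l) - Re (ent (H \<omega>) i j) * Im (ent (H \<omega>) k l)))"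
        by (intro Bochner_Integration.integrable_add integrable_mult_right integrable_of_real Bochner_Integration.integrable_diff re)
      also have "?this \<longleftrightarrow> ?thesis"
        by (intro Bochner_Integration.integrable_cong refl) (simp add: complex_eq_iff)
      finally show ?thesis .
    qed
    have ji: "ent (H \<omega>) j i = cnj (ent (H \<omega>) i j)" if "\<omega> \<in> space K" for \<omega>
    proof -
      have "adj (H \<omega>) = H \<omega>" using H that by (simp add: sq_integrable_def sad_def)
      then show ?thesis by (metis ent_adj)
    qed
    have "(LINT \<omega>|K. inner (bv (i, j, r)) (H \<omega>) * inner (bv (k, l, s)) (H \<omega>))
        = (LINT \<omega>|K. F r s (ent (H \<omega>) i j * cnj (ent (H \<omega>) k l)) (ent (H \<omega>) j i * cnj (ent (H \<omega>) k l)))"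
      by (intro Bochner_Integration.integral_cong refl) (simp add: inner_bv F_def ji)
    also have "\<dots> = F r s (LINT \<omega>|K. ent (H \<omega>) i j * cnj (ent (H \<omega>) k l)) (LINT \<omega>|K. ent (H \<omega>) j i * cnj (ent (H \<omega>) k l))"
      unfolding F_def using cx
      by (cases r; cases s; simp only: if_True if_False integral_divide_zero integral_minus divide_minus_left
        integral_Re integral_Im Bochner_Integration.integral_add Bochner_Integration.integral_diff
        Bochner_Integration.integrable_add Bochner_Integration.integrable_diff Bochner_Integration.integral_minus)
    finally show ?thesis .
  qed
  have expand: "(LINT \<omega>|K. inner L (H \<omega>) * inner L' (H \<omega>))
     = (\<Sum>p\<in>Ix d. \<Sum>q\<in>Ix d. inner L (bv p) * inner L' (bv q) * (LINT \<omega>|K. inner (bv p) (H \<omega>) * inner (bv q) (H \<omega>)))"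
    if H: "sq_integrable K d H" for K :: "'x measure" and H
  proof -
    have ex: "inner L (H \<omega>) = (\<Sum>p\<in>Ix d. inner (bv p) (H \<omega>) * inner L (bv p))" if "\<omega> \<in> space K" for \<omega> L
    proof -
      have "bd (H \<omega>) d" using H that by (simp add: sq_integrable_def sad_def)
      from arg_cong[OF fm_expand[OF this], of "inner L"] show ?thesis by (simp add: inner_sum_right)
    qed
    have i: "integrable K (\<lambda>\<omega>. inner L (bv p) * inner L' (bv q) * (inner (bv p) (H \<omega>) * inner (bv q) (H \<omega>)))" for p q
      by (intro integrable_mult_right sq_integrable_mult[OF H H])
    have "(LINT \<omega>|K. inner L (H \<omega>) * inner L' (H \<omega>))
      = (LINT \<omega>|K. (\<Sum>p\<in>Ix d. \<Sum>q\<in>Ix d. inner L (bv p) * inner L' (bv q) * (inner (bv p) (H \<omega>) * inner (bv q) (H \<omega>))))"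
    proof (intro Bochner_Integration.integral_cong refl)
      fix \<omega> assume w: "\<omega> \<in> space K"
      have "inner L (H \<omega>) * inner L' (H \<omega>)
        = (\<Sum>p\<in>Ix d. inner (bv p) (H \<omega>) * inner L (bv p)) * (\<Sum>q\<in>Ix d. inner (bv q) (H \<omega>) * inner L' (bv q))"
        by (rule arg_cong2[where f = "(*)", OF ex[OF w] ex[OF w]])
      then show "inner L (H \<omega>) * inner L' (H \<omega>)
        = (\<Sum>p\<in>Ix d. \<Sum>q\<in>Ix d. inner L (bv p) * inner L' (bv q) * (inner (bv p) (H \<omega>) * inner (bv q) (H \<omega>)))"
        by (simp only: sum_product mult_ac)
    qed
    also have "\<dots> = (\<Sum>p\<in>Ix d. LINT \<omega>|K. (\<Sum>q\<in>Ix d. inner L (bv p) * inner L' (bv q) * (inner (bv p) (H \<omega>) * inner (bv q) (H \<omega>))))"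
      by (intro Bochner_Integration.integral_sum Bochner_Integration.integrable_sum i)
    also have "\<dots> = (\<Sum>p\<in>Ix d. \<Sum>q\<in>Ix d. LINT \<omega>|K. inner L (bv p) * inner L' (bv q) * (inner (bv p) (H \<omega>) * inner (bv q) (H \<omega>)))"
      by (intro sum.cong refl Bochner_Integration.integral_sum i)
    finally show ?thesis by simp
  qed
  have "(LINT \<omega>|M. inner (bv p) (A \<omega>) * inner (bv q) (A \<omega>)) = (LINT \<omega>|N. inner (bv p) (B \<omega>) * inner (bv q) (B \<omega>))"
    if pq: "p \<in> Ix d" "q \<in> Ix d" for p q
  proof -
    obtain i j r k l s where e: "p = (i, j, r)" "q = (k, l, s)" using prod_cases3 by metis
    have "i < d" "j < d" "k < d" "l < d" using pq by (auto simp: e Ix_def)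
    then show ?thesis unfolding e basic[OF A] basic[OF B] by (simp add: c)
  qed
  then show ?thesis unfolding expand[OF A] expand[OF B] by (intro sum.cong refl) simp
qed

text \<open>The mixed terms factor by independence and vanish because the summands are
  centred.\<close>

lemma (in prob_space) indep_sum_cov:
  assumes ind: "indep_vars (\<lambda>_. FM) Y I" and fin: "finite I"
    and sq: "\<And>k. k \<in> I \<Longrightarrow> sq_integrable M d (Y k)"
    and mean: "\<And>k L. k \<in> I \<Longrightarrow> (LINT \<omega>|M. inner L (Y k \<omega>)) = 0"
  shows "(LINT \<omega>|M. inner L (\<Sum>k\<in>I. Y k \<omega>) * inner L' (\<Sum>k\<in>I. Y k \<omega>)) = (\<Sum>k\<in>I. LINT \<omega>|M. inner L (Y k \<omega>) * inner L' (Y k \<omega>))"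
proof -
  have [measurable]: "Y k \<in> M \<rightarrow>\<^sub>M FM" if "k \<in> I" for k using sq[OF that] by (simp add: sq_integrable_def)
  have i: "integrable M (\<lambda>\<omega>. inner L (Y k \<omega>) * inner L' (Y l \<omega>))" if "k \<in> I" "l \<in> I" for k l
    using sq_integrable_mult[OF sq[OF that(1)] sq[OF that(2)]] .
  have i1: "integrable M (\<lambda>\<omega>. inner L (Y k \<omega>))" if k: "k \<in> I" for k L
  proof (rule Bochner_Integration.integrable_bound)
    show "integrable M (\<lambda>\<omega>. 1 + (inner L (Y k \<omega>))\<^sup>2)" using sq[OF k] by (simp add: sq_integrable_def)
    have "\<bar>x\<bar> \<le> 1 + x\<^sup>2" for x :: real using sum_squares_bound[of "\<bar>x\<bar>" 1] by (simp add: power2_eq_square)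
    then show "AE \<omega> in M. norm (inner L (Y k \<omega>)) \<le> norm (1 + (inner L (Y k \<omega>))\<^sup>2)" by simp
  qed (use k in measurable)
  have z: "(LINT \<omega>|M. inner L (Y k \<omega>) * inner L' (Y l \<omega>)) = 0" if k: "k \<in> I" "l \<in> I" "k \<noteq> l" for k l
  proof -
    have "indep_var (PiM {k} (\<lambda>_. FM)) (\<lambda>\<omega>. restrict (\<lambda>j. Y j \<omega>) {k}) (PiM {l} (\<lambda>_. FM)) (\<lambda>\<omega>. restrict (\<lambda>j. Y j \<omega>) {l})"
      by (rule indep_var_restrict[OF ind]) (use k in auto)
    from indep_var_compose[OF this, of "\<lambda>x. inner L (x k)" borel "\<lambda>x. inner L' (x l)" borel]
    have "indep_var borel ((\<lambda>x. inner L (x k)) \<circ> (\<lambda>\<omega>. restrict (\<lambda>j. Y j \<omega>) {k})) borel ((\<lambda>x. inner L' (x l)) \<circ> (\<lambda>\<omega>. restrict (\<lambda>j. Y j \<omega>) {l}))"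
      by measurable
    then have "indep_var borel (\<lambda>\<omega>. inner L (Y k \<omega>)) borel (\<lambda>\<omega>. inner L' (Y l \<omega>))" by (simp add: comp_def)
    from indep_var_lebesgue_integral[OF this i1[OF k(1)] i1[OF k(2)]] show ?thesis by (simp add: mean[OF k(1)])
  qed
  have "(LINT \<omega>|M. inner L (\<Sum>k\<in>I. Y k \<omega>) * inner L' (\<Sum>k\<in>I. Y k \<omega>)) = (LINT \<omega>|M. (\<Sum>k\<in>I. \<Sum>l\<in>I. inner L (Y k \<omega>) * inner L' (Y l \<omega>)))"
    by (simp only: inner_sum_right sum_product)
  also have "\<dots> = (\<Sum>k\<in>I. LINT \<omega>|M. (\<Sum>l\<in>I. inner L (Y k \<omega>) * inner L' (Y l \<omega>)))"
    by (intro Bochner_Integration.integral_sum Bochner_Integration.integrable_sum i)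
  also have "\<dots> = (\<Sum>k\<in>I. \<Sum>l\<in>I. LINT \<omega>|M. inner L (Y k \<omega>) * inner L' (Y l \<omega>))"
    by (intro sum.cong refl Bochner_Integration.integral_sum i)
  also have "\<dots> = (\<Sum>k\<in>I. LINT \<omega>|M. inner L (Y k \<omega>) * inner L' (Y k \<omega>))"
  proof (intro sum.cong refl)
    fix k assume k: "k \<in> I"
    have "(\<Sum>l\<in>I. LINT \<omega>|M. inner L (Y k \<omega>) * inner L' (Y l \<omega>)) = (\<Sum>l\<in>{k}. LINT \<omega>|M. inner L (Y k \<omega>) * inner L' (Y l \<omega>))"
      by (rule sum.mono_neutral_right) (use k fin z in auto)
    then show "(\<Sum>l\<in>I. LINT \<omega>|M. inner L (Y k \<omega>) * inner L' (Y l \<omega>)) = (LINT \<omega>|M. inner L (Y k \<omega>) * inner L' (Y k \<omega>))" by simp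
  qed
  finally show ?thesis .
qed

lemma (in prob_space) moment_pair_cong_AE:
  assumes m: "moment_pair M U V d R \<sigma> \<tau>" and [measurable]: "U' \<in> borel_measurable M" "V' \<in> borel_measurable M"
    and ae: "AE \<omega> in M. U \<omega> = U' \<omega>" "AE \<omega> in M. V \<omega> = V' \<omega>"
  shows "moment_pair M U' V' d R \<sigma> \<tau>"
proof -
  interpret m: moment_pair M U V d R \<sigma> \<tau> by (rule m)
  have e: "(LINT \<omega>|M. exp (\<beta> * \<bar>W' \<omega>\<bar>)) = (LINT \<omega>|M. exp (\<beta> * \<bar>W \<omega>\<bar>))"
    and i: "integrable M (\<lambda>\<omega>. exp (\<beta> * \<bar>W \<omega>\<bar>)) \<Longrightarrow> integrable M (\<lambda>\<omega>. exp (\<beta> * \<bar>W' \<omega>\<bar>))"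
    if [measurable]: "W \<in> borel_measurable M" "W' \<in> borel_measurable M" and a: "AE \<omega> in M. W \<omega> = W' \<omega>"
    for W W' :: "'a \<Rightarrow> real" and \<beta>
  proof -
    have a': "AE \<omega> in M. exp (\<beta> * \<bar>W \<omega>\<bar>) = exp (\<beta> * \<bar>W' \<omega>\<bar>)" using a by (rule eventually_mono) simp
    show "(LINT \<omega>|M. exp (\<beta> * \<bar>W' \<omega>\<bar>)) = (LINT \<omega>|M. exp (\<beta> * \<bar>W \<omega>\<bar>))"
      by (rule integral_cong_AE[symmetric]) (use a' in measurable)
    show "integrable M (\<lambda>\<omega>. exp (\<beta> * \<bar>W \<omega>\<bar>)) \<Longrightarrow> integrable M (\<lambda>\<omega>. exp (\<beta> * \<bar>W' \<omega>\<bar>))"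
      by (rule integrable_cong_AE_imp) (use a' in \<open>auto elim: eventually_mono\<close>)
  qed
  note U = m.meas(1) assms(2) ae(1) and V = m.meas(2) assms(3) ae(2)
  show ?thesis
    by unfold_locales (use m.d2 m.nonneg m.moment in \<open>auto simp: e[OF U] e[OF V] intro!: i[OF U] i[OF V] m.int_UV\<close>)
qed

lemma integrable_complexI:
  assumes "integrable M (\<lambda>\<omega>. Re (f \<omega>))" "integrable M (\<lambda>\<omega>. Im (f \<omega>))"
  shows "integrable M (f :: 'a \<Rightarrow> complex)"
proof -
  have "integrable M (\<lambda>\<omega>. complex_of_real (Re (f \<omega>)) + \<i> * complex_of_real (Im (f \<omega>)))"
    using assms by (intro Bochner_Integration.integrable_add integrable_mult_right integrable_of_real)
  then show ?thesis by (simp only: complex_eq[symmetric])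
qed

lemma inner_cvF:
  assumes d: "1 \<le> d" and u: "u \<in> carrier_vec d" and v: "v \<in> carrier_vec d"
  shows "inner (cvF d v) (cvF d u) = Re (u \<bullet>c v)"
proof -
  have b: "bd (cvF d v) d" by (auto simp: bd_def ent_cvF)
  have "inner (cvF d v) (cvF d u) = (\<Sum>i<d. \<Sum>j<d. if j = 0 then Re (vec_index v i * cnj (vec_index u i)) else 0)"
    unfolding inner_fm_bd[OF b] by (intro sum.cong refl) (auto simp: ent_cvF)
  also have "\<dots> = (\<Sum>i<d. Re (vec_index v i * cnj (vec_index u i)))"
    using d by (intro sum.cong refl) (simp add: sum.delta)
  also have "\<dots> = Re (\<Sum>i<d. vec_index u i * cnj (vec_index v i))"
    unfolding Re_sum by (intro sum.cong refl) (simp add: mult.commute)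
  also have "(\<Sum>i<d. vec_index u i * cnj (vec_index v i)) = u \<bullet>c v"
    using v by (auto simp: scalar_prod_def atLeast0LessThan conjugate_complex_def intro!: sum.cong)
  finally show ?thesis .
qed

text \<open>The inner product of \<open>fm\<close> keeps only real parts; the imaginary part of a
  complex scalar product is obtained by testing with i v.\<close>

lemma cmod_sq_scalar_prod:
  assumes d: "1 \<le> d" and u: "u \<in> carrier_vec d" and v: "v \<in> carrier_vec d"
  shows "(cmod (u \<bullet>c v))\<^sup>2 = (inner (cvF d v) (cvF d u))\<^sup>2 + (inner (cvF d (\<i> \<cdot>\<^sub>v v)) (cvF d u))\<^sup>2"
proof -
  have iv: "\<i> \<cdot>\<^sub>v v \<in> carrier_vec d" using v by simp
  have "u \<bullet>c (\<i> \<cdot>\<^sub>v v) = - \<i> * (u \<bullet>c v)"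
    using v by (simp add: scalar_prod_def sum_distrib_left conjugate_complex_def mult_ac)
  then have "inner (cvF d (\<i> \<cdot>\<^sub>v v)) (cvF d u) = Im (u \<bullet>c v)" by (simp add: inner_cvF[OF d u iv])
  then show ?thesis by (simp add: inner_cvF[OF d u v] cmod_power2)
qed

lemma vnorm_ii: "vnorm (\<i> \<cdot>\<^sub>v v) = vnorm v"
  by (simp add: vnorm_def norm_mult)

lemma toF_minus: "A \<in> carrier_mat d d \<Longrightarrow> B \<in> carrier_mat d d \<Longrightarrow> toF d (A - B) = toF d A - toF d B"
  by (rule fm_eqI) (auto simp: ent_toF)

section \<open>From the matrices of the statement to the model\<close>

locale matrix_model = prob_space M for M :: "'a measure" +
  fixes d n :: nat and Z0 :: "complex mat" and Z :: "nat \<Rightarrow> 'a \<Rightarrow> complex mat" and G :: "'a \<Rightarrow> complex mat"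
  assumes im: "independent_sum_model M d n Z0 Z" and gm: "gaussian_model M d (rsum d n Z0 Z) G"
begin

definition "Y k \<omega> = toF d (Z k \<omega>)"
definition "SX \<omega> = (\<Sum>k=1..n. Y k \<omega>)"
definition "Z0' = toF d Z0"
definition "\<Gamma> \<omega> = toF d (G \<omega>) - Z0'"
abbreviation "X \<equiv> rsum d n Z0 Z"

lemma d2: "2 \<le> d" and d1: "1 \<le> d" and Z0_sa: "self_adjoint d Z0"
  and Z_sa: "k \<in> {1..n} \<Longrightarrow> \<omega> \<in> space M \<Longrightarrow> self_adjoint d (Z k \<omega>)"
  and Z_sq: "k \<in> {1..n} \<Longrightarrow> i < d \<Longrightarrow> j < d \<Longrightarrow> integrable M (\<lambda>\<omega>. (cmod (Z k \<omega> $$ (i, j)))\<^sup>2)"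
  and Z_mean: "k \<in> {1..n} \<Longrightarrow> expect_mat M d (Z k) = 0\<^sub>m d d"
  and Z_ind: "indep_vars (\<lambda>_. mat_borel d) Z {1..n}"
  using im by (auto simp: independent_sum_model_def)

lemma Z0_c: "Z0 \<in> carrier_mat d d" using Z0_sa by (simp add: self_adjoint_def)

lemma Z_meas: "k \<in> {1..n} \<Longrightarrow> Z k \<in> M \<rightarrow>\<^sub>M mat_borel d"
  using Z_ind by (auto simp: indep_vars_def)

lemma Y_meas: "k \<in> {1..n} \<Longrightarrow> Y k \<in> M \<rightarrow>\<^sub>M FM"
  unfolding Y_def[abs_def] by (rule measurable_compose[OF Z_meas measurable_toF])

lemma Y_sad: "k \<in> {1..n} \<Longrightarrow> \<omega> \<in> space M \<Longrightarrow> Y k \<omega> \<in> sad d"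
  unfolding Y_def by (intro toF_sad Z_sa)

lemma Y_ind: "indep_vars (\<lambda>_. FM) Y {1..n}"
  unfolding Y_def[abs_def] by (rule indep_vars_compose2[OF Z_ind]) (rule measurable_toF)

lemma Z_int: "k \<in> {1..n} \<Longrightarrow> i < d \<Longrightarrow> j < d \<Longrightarrow> integrable M (\<lambda>\<omega>. Z k \<omega> $$ (i, j))"
proof (rule Bochner_Integration.integrable_bound)
  assume a: "k \<in> {1..n}" "i < d" "j < d"
  show "integrable M (\<lambda>\<omega>. 1 + (cmod (Z k \<omega> $$ (i, j)))\<^sup>2)" using Z_sq[OF a] by simp
  show "(\<lambda>\<omega>. Z k \<omega> $$ (i, j)) \<in> borel_measurable M"
    by (rule measurable_compose[OF Z_meas[OF a(1)] measurable_mat_entry[OF a(2,3)]])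
  have "x \<le> 1 + x\<^sup>2" for x :: real
  proof -
    have "0 \<le> (x - 1)\<^sup>2" by simp
    then have "2 * x \<le> x\<^sup>2 + 1" by (simp add: power2_diff)
    then show ?thesis using zero_le_power2[of x] by linarith
  qed
  then show "AE \<omega> in M. norm (Z k \<omega> $$ (i, j)) \<le> norm (1 + (cmod (Z k \<omega> $$ (i, j)))\<^sup>2)" by simp
qed

lemma Y_sq: "k \<in> {1..n} \<Longrightarrow> sq_integrable M d (Y k)"
  unfolding sq_integrable_def
proof (intro conjI ballI allI)
  assume k: "k \<in> {1..n}"
  note [measurable] = Y_meas[OF k]
  show "Y k \<in> M \<rightarrow>\<^sub>M FM" by measurable
  show "Y k \<omega> \<in> sad d" if "\<omega> \<in> space M" for \<omega> by (rule Y_sad[OF k that])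
  show "integrable M (\<lambda>\<omega>. (inner L (Y k \<omega>))\<^sup>2)" for L
  proof (rule Bochner_Integration.integrable_bound)
    show "integrable M (\<lambda>\<omega>. (norm L)\<^sup>2 * (\<Sum>i<d. \<Sum>j<d. (cmod (Z k \<omega> $$ (i, j)))\<^sup>2))"
      using Z_sq[OF k] by (intro integrable_mult_right Bochner_Integration.integrable_sum) auto
    have "(inner L (Y k \<omega>))\<^sup>2 \<le> (norm L)\<^sup>2 * (\<Sum>i<d. \<Sum>j<d. (cmod (Z k \<omega> $$ (i, j)))\<^sup>2)" for \<omega>
    proof -
      have "(inner L (Y k \<omega>))\<^sup>2 \<le> (norm L)\<^sup>2 * (norm (Y k \<omega>))\<^sup>2"
        using power_mono[OF Cauchy_Schwarz_ineq2[of L "Y k \<omega>"], of 2] by (simp add: power_mult_distrib)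
      moreover have "(norm (Y k \<omega>))\<^sup>2 = (\<Sum>i<d. \<Sum>j<d. (cmod (Z k \<omega> $$ (i, j)))\<^sup>2)"
        unfolding Y_def norm_fm_sq[OF bd_toF] by (intro sum.cong refl) (simp add: ent_toF)
      ultimately show ?thesis by simp
    qed
    then show "AE \<omega> in M. norm ((inner L (Y k \<omega>))\<^sup>2) \<le> norm ((norm L)\<^sup>2 * (\<Sum>i<d. \<Sum>j<d. (cmod (Z k \<omega> $$ (i, j)))\<^sup>2))"
      by (intro AE_I2) (simp add: sum_nonneg)
  qed measurable
qed

lemma Y_mean: "k \<in> {1..n} \<Longrightarrow> (LINT \<omega>|M. inner L (Y k \<omega>)) = 0"
  unfolding Y_def by (subst inner_toF_expect(2)) (auto simp: Z_int Z_mean inner_toF)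

lemma SX_sq: "sq_integrable M d SX"
  unfolding sq_integrable_def
proof (intro conjI ballI allI)
  show "SX \<in> M \<rightarrow>\<^sub>M FM" unfolding SX_def[abs_def] by (intro measurable_FM_sum Y_meas)
  show "SX \<omega> \<in> sad d" if "\<omega> \<in> space M" for \<omega> unfolding SX_def by (intro sad_sum Y_sad that)
  have e: "(inner L (SX \<omega>))\<^sup>2 = (\<Sum>k=1..n. \<Sum>l=1..n. inner L (Y k \<omega>) * inner L (Y l \<omega>))" for L \<omega>
    by (simp only: SX_def inner_sum_right sum_product power2_eq_square)
  show "integrable M (\<lambda>\<omega>. (inner L (SX \<omega>))\<^sup>2)" for L
    unfolding e by (intro Bochner_Integration.integrable_sum sq_integrable_mult[OF Y_sq Y_sq])
qed

lemma SX_cov: "(LINT \<omega>|M. inner L (SX \<omega>) * inner L' (SX \<omega>)) = (\<Sum>k=1..n. LINT \<omega>|M. inner L (Y k \<omega>) * inner L' (Y k \<omega>))"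
  unfolding SX_def by (rule indep_sum_cov[OF Y_ind _ Y_sq Y_mean]) auto

lemma X_c: "X \<omega> \<in> carrier_mat d d" by (simp add: rsum_def)

lemma toF_X: "toF d (X \<omega>) = Z0' + SX \<omega>"
proof (rule fm_eqI)
  have es: "ent (sum f I) i j = (\<Sum>k\<in>I. ent (f k) i j)" for f :: "nat \<Rightarrow> fm" and I i j
    by (induction I rule: infinite_finite_induct) auto
  show "ent (toF d (X \<omega>)) i j = ent (Z0' + SX \<omega>) i j" for i j
    by (auto simp: ent_toF rsum_def Z0'_def SX_def Y_def es)
qed

lemma X_sa: "\<omega> \<in> space M \<Longrightarrow> self_adjoint d (X \<omega>)"
  using SX_sq by (intro self_adjoint_if_sad X_c) (auto simp: toF_X Z0'_def sq_integrable_def intro!: sad_add toF_sad Z0_sa)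

lemma EX: "expect_mat M d X = Z0"
proof (rule eq_matI)
  show "dim_row (expect_mat M d X) = dim_row Z0" "dim_col (expect_mat M d X) = dim_col Z0"
    using Z0_c by (auto simp: expect_mat_def)
  fix i j assume "i < dim_row Z0" "j < dim_col Z0"
  then have ij: "i < d" "j < d" using Z0_c by auto
  have z: "(LINT \<omega>|M. Z k \<omega> $$ (i, j)) = 0" if "k \<in> {1..n}" for k
    using arg_cong[OF Z_mean[OF that], of "\<lambda>A. A $$ (i, j)"] ij by (simp add: expect_mat_def)
  have "expect_mat M d X $$ (i, j) = (LINT \<omega>|M. Z0 $$ (i, j) + (\<Sum>k=1..n. Z k \<omega> $$ (i, j)))"
    using ij by (simp add: expect_mat_def rsum_def)
  also have "\<dots> = Z0 $$ (i, j) + (\<Sum>k=1..n. LINT \<omega>|M. Z k \<omega> $$ (i, j))"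
    by (subst Bochner_Integration.integral_add) (auto intro!: Bochner_Integration.integrable_sum Z_int ij Bochner_Integration.integral_sum simp: prob_space)
  also have "\<dots> = Z0 $$ (i, j)" using z by simp
  finally show "expect_mat M d X $$ (i, j) = Z0 $$ (i, j)" .
qed

lemma toF_centered_X: "toF d (centered M d X \<omega>) = SX \<omega>"
  by (simp add: centered_def EX toF_minus[OF X_c Z0_c] toF_X Z0'_def)

lemma G_meas: "G \<in> M \<rightarrow>\<^sub>M mat_borel d" and G_sa: "\<omega> \<in> space M \<Longrightarrow> self_adjoint d (G \<omega>)"
  and G_gauss: "gaussian_mat M d G" and EG: "expect_mat M d G = Z0" and G_cov: "cov_mat M d G = cov_mat M d X"
  using gm by (auto simp: gaussian_model_def EX)

lemma G_lin: "gaussian_var M (\<lambda>\<omega>. inner L (toF d (G \<omega>)))"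
  using G_gauss[unfolded gaussian_mat_def, rule_format, of "\<lambda>i j. Re (ent L i j)" "\<lambda>i j. Im (ent L i j)"]
  by (simp only: inner_toF)

lemma G_int: "i < d \<Longrightarrow> j < d \<Longrightarrow> integrable M (\<lambda>\<omega>. G \<omega> $$ (i, j))"
  using gaussian_var_centered(1)[OF G_lin, of "bv (i, j, True)"] gaussian_var_centered(1)[OF G_lin, of "bv (i, j, False)"]
  by (intro integrable_complexI) (simp_all add: inner_bv ent_toF)

lemma G_lin_mean: "(LINT \<omega>|M. inner L (toF d (G \<omega>))) = inner L Z0'"
  using inner_toF_expect(2)[of d M G L] G_int by (simp add: EG Z0'_def)

lemma gaussian: "gaussian_fm M \<Gamma> d"
proof
  have e: "inner L (\<Gamma> \<omega>) = inner L (toF d (G \<omega>)) - (LINT \<omega>|M. inner L (toF d (G \<omega>)))" for L \<omega>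
    by (simp add: G_lin_mean \<Gamma>_def inner_diff_right)
  note g = gaussian_var_centered[OF G_lin]
  show "\<Gamma> \<in> M \<rightarrow>\<^sub>M FM" unfolding \<Gamma>_def[abs_def]
    by (intro measurable_FM_diff measurable_compose[OF G_meas measurable_toF] measurable_const) simp
  show "\<Gamma> \<omega> \<in> sad d" if "\<omega> \<in> space M" for \<omega>
    unfolding \<Gamma>_def Z0'_def by (intro sad_diff toF_sad G_sa Z0_sa that)
  show "integrable M (\<lambda>\<omega>. (inner L (\<Gamma> \<omega>))\<^sup>2)" for L unfolding e by (rule g(2))
  show "(LINT \<omega>|M. inner L (\<Gamma> \<omega>)) = 0" for L unfolding e using g(1)[of L] by (simp add: prob_space)
  show "(CLINT \<omega>|M. iexp (inner L (\<Gamma> \<omega>))) = exp (- complex_of_real (LINT \<omega>|M. (inner L (\<Gamma> \<omega>))\<^sup>2) / 2)" for L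
    unfolding e by (rule g(5))
  show "integrable M (\<lambda>\<omega>. exp (inner L (\<Gamma> \<omega>)))" for L unfolding e by (rule g(3))
  show "(LINT \<omega>|M. exp (inner L (\<Gamma> \<omega>))) = exp ((LINT \<omega>|M. (inner L (\<Gamma> \<omega>))\<^sup>2) / 2)" for L
    unfolding e by (rule g(4))
qed

lemma \<Gamma>_cov: "(LINT \<omega>|M. inner L (\<Gamma> \<omega>) * inner L' (\<Gamma> \<omega>)) = (LINT \<omega>|M. inner L (SX \<omega>) * inner L' (SX \<omega>))"
proof (rule real_cov_eqI[OF _ SX_sq])
  interpret gaussian_fm M \<Gamma> d by (rule gaussian)
  show "sq_integrable M d \<Gamma>" using G_meas G_sad G_int2 by (simp add: sq_integrable_def)
  fix i j k l assume a: "i < d" "j < d" "k < d" "l < d"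
  have Gc: "G \<omega> \<in> carrier_mat d d" if "\<omega> \<in> space M" for \<omega> using G_sa[OF that] by (simp add: self_adjoint_def)
  have "ent (\<Gamma> \<omega>) i j = centered M d G \<omega> $$ (i, j)" if "\<omega> \<in> space M" "i < d" "j < d" for \<omega> i j
    using that Gc[OF that(1)] Z0_c by (simp add: \<Gamma>_def Z0'_def ent_toF centered_def EG)
  then have "(LINT \<omega>|M. ent (\<Gamma> \<omega>) i j * cnj (ent (\<Gamma> \<omega>) k l)) = cov_mat M d G (i, j) (k, l)"
    using a by (auto simp: cov_mat_def intro!: Bochner_Integration.integral_cong)
  moreover have "ent (SX \<omega>) i j = centered M d X \<omega> $$ (i, j)" if "i < d" "j < d" for \<omega> i j
    using that unfolding toF_centered_X[symmetric] by (simp add: ent_toF)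
  then have "(LINT \<omega>|M. ent (SX \<omega>) i j * cnj (ent (SX \<omega>) k l)) = cov_mat M d X (i, j) (k, l)"
    using a by (auto simp: cov_mat_def intro!: Bochner_Integration.integral_cong)
  ultimately show "(LINT \<omega>|M. ent (\<Gamma> \<omega>) i j * cnj (ent (\<Gamma> \<omega>) k l)) = (LINT \<omega>|M. ent (SX \<omega>) i j * cnj (ent (SX \<omega>) k l))"
    by (simp add: G_cov)
qed

text \<open>The covariances of the summands add up, so the left-hand side is the mean squared norm
  of S P for the centred sum S. This is the form of W = E S^2 at P, and the operator norm of W is
  \<sigma>^2.\<close>

lemma sigma_par_bound:
  assumes P: "bd P d"
  shows "(\<Sum>k=1..n. LINT \<omega>|M. (norm (Y k \<omega> * P))\<^sup>2) \<le> (sigma_par M d X)\<^sup>2 * (norm P)\<^sup>2"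
proof -
  define A where "A \<omega> = centered M d X \<omega> * centered M d X \<omega>" for \<omega>
  define W where "W = toF d (expect_mat M d A)"
  have Cc: "centered M d X \<omega> \<in> carrier_mat d d" for \<omega>
    unfolding centered_def by (simp add: EX) (use X_c[of \<omega>] Z0_c in auto)
  have tA: "toF d (A \<omega>) = SX \<omega> * SX \<omega>" for \<omega>
    unfolding A_def toF_times[OF Cc Cc] toF_centered_X ..
  have ij: "integrable M (\<lambda>\<omega>. A \<omega> $$ (i, j))" if "i < d" "j < d" for i j
  proof -
    have e: "inner (bv (i, j, r)) (SX \<omega> * SX \<omega>)
      = (\<Sum>p\<in>Ix d. inner (bv p) (SX \<omega>) * inner (bv (i, j, r) * adj (bv p)) (SX \<omega>))"
      if "\<omega> \<in> space M" for r \<omega>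
    proof -
      have s: "SX \<omega> \<in> sad d" using SX_sq that by (simp add: sq_integrable_def)
      have "SX \<omega> * SX \<omega> = SX \<omega> * (\<Sum>p\<in>Ix d. inner (bv p) (SX \<omega>) *\<^sub>R bv p)"
        using fm_expand[of "SX \<omega>" d] s by (simp add: sad_def)
      then show ?thesis by (simp add: sum_distrib_left inner_sum_right inner_times_right)
    qed
    have "integrable M (\<lambda>\<omega>. inner (bv (i, j, r)) (SX \<omega> * SX \<omega>))" for r
      by (subst Bochner_Integration.integrable_cong[OF refl e])
        (auto intro!: Bochner_Integration.integrable_sum sq_integrable_mult[OF SX_sq SX_sq])
    from this[of True] this[of False] show ?thesis
      using that by (intro integrable_complexI) (simp_all add: inner_bv tA[symmetric] ent_toF)
  qed
  have W: "inner L W = (LINT \<omega>|M. inner L (SX \<omega> * SX \<omega>))" for L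
    unfolding W_def tA[symmetric] by (rule inner_toF_expect(2)[symmetric]) (rule ij)
  have sad: "SX \<omega> \<in> sad d" if "\<omega> \<in> space M" for \<omega> using SX_sq that by (simp add: sq_integrable_def)
  have aSS: "adj (SX \<omega> * SX \<omega>) = SX \<omega> * SX \<omega>" if "\<omega> \<in> space M" for \<omega>
    using sad[OF that] by (simp add: sad_def adj_times)
  \<comment> \<open>W is known only through its pairings with all L; self-adjointness is therefore
    checked under the integral.\<close>
  have "inner L (adj W) = inner L W" for L
  proof -
    have "inner L (adj W) = inner (adj L) W" using inner_adj[of "adj L" W] by simp
    also have "\<dots> = (LINT \<omega>|M. inner (adj L) (SX \<omega> * SX \<omega>))" by (rule W)
    also have "\<dots> = (LINT \<omega>|M. inner L (SX \<omega> * SX \<omega>))"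
      by (intro Bochner_Integration.integral_cong refl) (metis aSS inner_adj adj_adj)
    finally show ?thesis by (simp add: W)
  qed
  then have "inner (adj W - W) (adj W - W) = 0" unfolding inner_diff_right by simp
  then have "adj W = W" by simp
  then have Ws: "W \<in> sad d" by (simp add: sad_def W_def)
  have Ec: "expect_mat M d A \<in> carrier_mat d d" by (simp add: expect_mat_def)
  have "opnorm (expect_mat M d A) = opS d W"
    unfolding W_def by (rule opnorm_toF[OF d1 self_adjoint_if_sad[OF Ec Ws[unfolded W_def]]])
  moreover have "0 \<le> opS d W" by (rule opS_nonneg[OF d1])
  ultimately have sp: "(sigma_par M d X)\<^sup>2 = opS d W"
    by (simp add: sigma_par_def A_def[abs_def] powr_half_sqrt)
  have "(\<Sum>k=1..n. LINT \<omega>|M. (norm (Y k \<omega> * P))\<^sup>2) = (\<Sum>k=1..n. \<Sum>p\<in>Ix d. LINT \<omega>|M. (inner (bv p * adj P) (Y k \<omega>))\<^sup>2)"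
    by (intro sum.cong refl sq_integrable_norm(2)[OF Y_sq P])
  also have "\<dots> = (\<Sum>p\<in>Ix d. \<Sum>k=1..n. LINT \<omega>|M. (inner (bv p * adj P) (Y k \<omega>))\<^sup>2)" by (rule sum.swap)
  also have "\<dots> = (\<Sum>p\<in>Ix d. LINT \<omega>|M. (inner (bv p * adj P) (SX \<omega>))\<^sup>2)"
    unfolding power2_eq_square SX_cov ..
  also have "\<dots> = (LINT \<omega>|M. (norm (SX \<omega> * P))\<^sup>2)" by (rule sq_integrable_norm(2)[OF SX_sq P, symmetric])
  also have "\<dots> = (LINT \<omega>|M. inner (P * adj P) (SX \<omega> * SX \<omega>))"
  proof (intro Bochner_Integration.integral_cong refl)
    fix \<omega> assume "\<omega> \<in> space M"
    then have a: "adj (SX \<omega>) = SX \<omega>" using sad by (simp add: sad_def)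
    have "(norm (SX \<omega> * P))\<^sup>2 = inner P (adj (SX \<omega>) * (SX \<omega> * P))"
      by (simp only: power2_norm_eq_inner inner_times_left)
    also have "\<dots> = inner (P * adj P) (SX \<omega> * SX \<omega>)"
      by (simp only: a inner_times_right[of P] adj_adj mult.assoc)
    finally show "(norm (SX \<omega> * P))\<^sup>2 = inner (P * adj P) (SX \<omega> * SX \<omega>)" .
  qed
  also have "\<dots> = inner P (W * P)" unfolding W[symmetric] by (simp add: inner_times_right)
  also have "\<dots> \<le> norm P * norm (W * P)" by (rule norm_cauchy_schwarz)
  also have "\<dots> \<le> norm P * (opS d W * norm P)" by (intro mult_left_mono opbD[OF opb_opS[OF d1 Ws]]) simp
  also have "\<dots> = (sigma_par M d X)\<^sup>2 * (norm P)\<^sup>2" unfolding sp by (simp add: power2_eq_square)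
  finally show ?thesis .
qed

text \<open>The bound by the mean squared norm shows that the supremum defining \<sigma>_* is over a
  bounded set, so that it is an upper bound. The last inequality passes from the complex modulus to
  the real part seen by \<open>inner\<close>.\<close>

lemma SX_form:
  assumes v: "v \<in> unit_vecs d" and w: "w \<in> unit_vecs d"
  defines "h \<equiv> \<lambda>\<omega>. (cmod ((centered M d X \<omega> *\<^sub>v w) \<bullet>c v))\<^sup>2"
  shows "integrable M h" and "(LINT \<omega>|M. h \<omega>) \<le> 2 * (LINT \<omega>|M. (norm (SX \<omega>))\<^sup>2)"
    and "(inner (cvF d v * adj (cvF d w)) (SX \<omega>))\<^sup>2 \<le> h \<omega>"
proof -
  have Cc: "centered M d X \<omega> \<in> carrier_mat d d" for \<omega>
    unfolding centered_def by (simp add: EX) (use X_c[of \<omega>] Z0_c in auto)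
  have c: "v \<in> carrier_vec d" "w \<in> carrier_vec d" and n: "vnorm v = 1" "vnorm w = 1"
    using v w by (auto simp: unit_vecs_def)
  have uc: "centered M d X \<omega> *\<^sub>v w \<in> carrier_vec d" for \<omega> using Cc[of \<omega>] c by simp
  let ?L = "cvF d v * adj (cvF d w)" and ?L' = "cvF d (\<i> \<cdot>\<^sub>v v) * adj (cvF d w)"
  have h: "h \<omega> = (inner ?L (SX \<omega>))\<^sup>2 + (inner ?L' (SX \<omega>))\<^sup>2" for \<omega>
    unfolding h_def cmod_sq_scalar_prod[OF d1 uc c(1)] toF_cvF[OF Cc c(2), symmetric] toF_centered_X
    by (simp add: inner_times_right)
  have i: "integrable M (\<lambda>\<omega>. (inner L (SX \<omega>))\<^sup>2)" for L using SX_sq by (simp add: sq_integrable_def)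
  show ih: "integrable M h" unfolding h[abs_def] by (intro Bochner_Integration.integrable_add i)
  show "(inner ?L (SX \<omega>))\<^sup>2 \<le> h \<omega>" by (simp add: h)
  have nn: "norm ?L \<le> 1" "norm ?L' \<le> 1"
    using norm_mult_ineq[of "cvF d v" "adj (cvF d w)"] norm_mult_ineq[of "cvF d (\<i> \<cdot>\<^sub>v v)" "adj (cvF d w)"]
    by (simp_all add: norm_cvF c n vnorm_ii)
  have le: "(inner L (SX \<omega>))\<^sup>2 \<le> (norm (SX \<omega>))\<^sup>2" if "norm L \<le> 1" for L \<omega>
  proof -
    have "\<bar>inner L (SX \<omega>)\<bar> \<le> norm L * norm (SX \<omega>)" by (rule Cauchy_Schwarz_ineq2)
    also have "\<dots> \<le> norm (SX \<omega>)" using mult_right_mono[OF that norm_ge_zero[of "SX \<omega>"]] by simp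
    finally show ?thesis by (rule abs_le_square_iff[THEN iffD1, OF order_trans]) simp
  qed
  have "integrable M (\<lambda>\<omega>. (norm (SX \<omega> * idm d))\<^sup>2)" by (rule sq_integrable_norm(1)[OF SX_sq bd_idm])
  also have "?this \<longleftrightarrow> integrable M (\<lambda>\<omega>. (norm (SX \<omega>))\<^sup>2)"
    using SX_sq by (intro Bochner_Integration.integrable_cong refl) (simp add: sq_integrable_def sad_def)
  finally have iN: "integrable M (\<lambda>\<omega>. (norm (SX \<omega>))\<^sup>2)" .
  have "(LINT \<omega>|M. h \<omega>) \<le> (LINT \<omega>|M. 2 * (norm (SX \<omega>))\<^sup>2)"
  proof (intro integral_mono ih)
    show "integrable M (\<lambda>\<omega>. 2 * (norm (SX \<omega>))\<^sup>2)" using iN by simp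
    show "h \<omega> \<le> 2 * (norm (SX \<omega>))\<^sup>2" for \<omega> using le[OF nn(1), of \<omega>] le[OF nn(2), of \<omega>] by (simp add: h)
  qed
  then show "(LINT \<omega>|M. h \<omega>) \<le> 2 * (LINT \<omega>|M. (norm (SX \<omega>))\<^sup>2)" by simp
qed

lemma sigma_star_upper:
  assumes v: "v \<in> unit_vecs d" and w: "w \<in> unit_vecs d"
  shows "(LINT \<omega>|M. (cmod ((centered M d X \<omega> *\<^sub>v w) \<bullet>c v))\<^sup>2) powr (1/2) \<le> sigma_star M d X"
proof -
  define f where "f = (\<lambda>(v, w). (LINT \<omega>|M. (cmod ((centered M d X \<omega> *\<^sub>v w) \<bullet>c v))\<^sup>2) powr (1/2))"
  have "f p \<le> (2 * (LINT \<omega>|M. (norm (SX \<omega>))\<^sup>2)) powr (1/2)" if "p \<in> unit_vecs d \<times> unit_vecs d" for p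
    using that SX_form(2) by (auto simp: f_def intro!: powr_mono2)
  then have "bdd_above (f ` (unit_vecs d \<times> unit_vecs d))" by (intro bdd_aboveI2)
  then have "f (v, w) \<le> (SUP p\<in>unit_vecs d \<times> unit_vecs d. f p)" using v w by (intro cSUP_upper) auto
  then show ?thesis by (simp add: f_def sigma_star_def)
qed

lemma unitc_cvF: "P \<in> unitc d \<Longrightarrow> \<exists>v\<in>unit_vecs d. P = cvF d v"
proof -
  assume P: "P \<in> unitc d"
  define v where "v = Matrix.vec d (\<lambda>i. ent P i 0)"
  have Pv: "P = cvF d v" unfolding v_def by (rule colm_cvF) (use P in \<open>simp add: unitc_def\<close>)
  have vc: "v \<in> carrier_vec d" by (simp add: v_def)
  have "vnorm v = 1" using norm_cvF[OF vc] P unfolding Pv[symmetric] by (simp add: unitc_def)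
  then show ?thesis using Pv vc by (auto simp: unit_vecs_def)
qed

lemma sigma_star_nonneg: "0 \<le> sigma_star M d X"
proof -
  obtain P where "P \<in> unitc d" using unitc_nonempty[OF d1] by auto
  then obtain v where "v \<in> unit_vecs d" using unitc_cvF by blast
  from order_trans[OF powr_ge_zero sigma_star_upper[OF this this]] show ?thesis .
qed

lemma sigma_star_bound:
  assumes P: "P \<in> unitc d"
  shows "(LINT \<omega>|M. (inner (P * adj P) (\<Gamma> \<omega>))\<^sup>2) \<le> (sigma_star M d X)\<^sup>2"
proof -
  obtain v where v: "v \<in> unit_vecs d" and Pv: "P = cvF d v" using unitc_cvF[OF P] by auto
  let ?h = "\<lambda>\<omega>. (cmod ((centered M d X \<omega> *\<^sub>v v) \<bullet>c v))\<^sup>2"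
  have "(LINT \<omega>|M. (inner (P * adj P) (\<Gamma> \<omega>))\<^sup>2) = (LINT \<omega>|M. (inner (P * adj P) (SX \<omega>))\<^sup>2)"
    unfolding power2_eq_square by (rule \<Gamma>_cov)
  also have "\<dots> \<le> (LINT \<omega>|M. ?h \<omega>)"
    using SX_sq SX_form[OF v v] unfolding Pv by (intro integral_mono) (auto simp: sq_integrable_def)
  also have "\<dots> = ((LINT \<omega>|M. ?h \<omega>) powr (1/2))\<^sup>2"
    by (simp add: powr_half_sqrt)
  also have "\<dots> \<le> (sigma_star M d X)\<^sup>2"
    by (intro power_mono sigma_star_upper v) simp
  finally show ?thesis .
qed

definition "R = enn2real (R_par M n Z)"
text \<open>R bounds the summands only almost surely, whereas the pathwise estimates need the bound
  at every sample point. Clipping changes a summand only on a null set, and as a measurable function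
  of the single summand it preserves independence. The norm is expressed by \<open>lamM\<close> for
  the sake of measurability.\<close>

definition "clip A = (if max (lamM d A) (lamM d (- A)) \<le> R then A else 0)"

lemma clip_meas [measurable]: "clip \<in> FM \<rightarrow>\<^sub>M FM"
  unfolding clip_def[abs_def] by measurable

lemma opnorm_Z: "k \<in> {1..n} \<Longrightarrow> \<omega> \<in> space M \<Longrightarrow> opnorm (Z k \<omega>) = max (lamM d (Y k \<omega>)) (lamM d (- Y k \<omega>))"
  using opnorm_toF[OF d1 Z_sa] Y_sad[of k \<omega>] by (simp add: Y_def opS_def lamM_eq[OF d1] sad_uminus)

lemma clip_AE:
  assumes fin: "R_par M n Z < \<top>" and k: "k \<in> {1..n}"
  shows "AE \<omega> in M. clip (Y k \<omega>) = Y k \<omega>"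
proof -
  have "AE \<omega> in M. (SUP k\<in>{1..n}. ennreal (opnorm (Z k \<omega>))) \<le> R_par M n Z"
    unfolding R_par_def by (rule esssup_AE)
  then show ?thesis
  proof (rule AE_mp, intro AE_I2 impI)
    fix \<omega> assume \<omega>: "\<omega> \<in> space M" and le: "(SUP k\<in>{1..n}. ennreal (opnorm (Z k \<omega>))) \<le> R_par M n Z"
    have "ennreal (opnorm (Z k \<omega>)) \<le> (SUP k\<in>{1..n}. ennreal (opnorm (Z k \<omega>)))" by (rule SUP_upper[OF k])
    also note le
    also have "R_par M n Z = ennreal R" using fin by (simp add: R_def ennreal_enn2real)
    finally have "opnorm (Z k \<omega>) \<le> R" by (subst (asm) ennreal_le_iff) (simp_all add: R_def)
    then show "clip (Y k \<omega>) = Y k \<omega>" by (simp add: clip_def opnorm_Z[OF k \<omega>, symmetric])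
  qed
qed

lemma model:
  assumes fin: "R_par M n Z < \<top>"
  shows "model M \<Gamma> d M (\<lambda>k \<omega>. clip (Y k \<omega>)) n Z0' R ((sigma_par M d X)\<^sup>2) ((sigma_star M d X)\<^sup>2)"
proof -
  interpret gaussian_fm M \<Gamma> d by (rule gaussian)
  have int_eq: "(LINT \<omega>|M. f (clip (Y k \<omega>))) = (LINT \<omega>|M. f (Y k \<omega>))"
    if k: "k \<in> {1..n}" and [measurable]: "f \<in> borel_measurable FM" for f :: "fm \<Rightarrow> real" and k
  proof (rule integral_cong_AE)
    note [measurable] = Y_meas[OF k]
    show "(\<lambda>\<omega>. f (clip (Y k \<omega>))) \<in> borel_measurable M" "(\<lambda>\<omega>. f (Y k \<omega>)) \<in> borel_measurable M" by measurable
    show "AE \<omega> in M. f (clip (Y k \<omega>)) = f (Y k \<omega>)" using clip_AE[OF fin k] by (rule eventually_mono) simp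
  qed
  show ?thesis
  proof
    show "1 \<le> d" by (rule d1)
    show "0 \<le> R" by (simp add: R_def)
    show "Z0' \<in> sad d" unfolding Z0'_def by (rule toF_sad[OF Z0_sa])
    show "clip (Y k \<omega>) \<in> sad d" if "k \<in> {1..n}" "\<omega> \<in> space M" for k \<omega> using Y_sad[OF that] by (simp add: clip_def)
    show "opb (clip (Y k \<omega>)) R" if k: "k \<in> {1..n}" "\<omega> \<in> space M" for k \<omega>
    proof (cases "max (lamM d (Y k \<omega>)) (lamM d (- Y k \<omega>)) \<le> R")
      case True
      have "opb (Y k \<omega>) (opS d (Y k \<omega>))" by (rule opb_opS[OF d1 Y_sad[OF k]])
      moreover have "opS d (Y k \<omega>) \<le> R" using True Y_sad[OF k] by (simp add: opS_def lamM_eq[OF d1] sad_uminus)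
      ultimately have "opb (Y k \<omega>) R" unfolding opb_def
        by (meson mult_right_mono norm_ge_zero order_trans)
      then show ?thesis using True by (simp add: clip_def)
    next
      case False
      then have "clip (Y k \<omega>) = 0" by (auto simp: clip_def)
      then show ?thesis by (simp add: opb_def R_def)
    qed
    show "indep_vars (\<lambda>_. FM) (\<lambda>k \<omega>. clip (Y k \<omega>)) {1..n}"
      by (rule indep_vars_compose2[OF Y_ind, of "\<lambda>_. clip"]) (rule clip_meas)
    show "(LINT \<omega>|M. inner L (clip (Y k \<omega>))) = 0" if k: "k \<in> {1..n}" for k L
      using int_eq[OF k, of "inner L"] Y_mean[OF k, of L] by simp
    show "(LINT \<omega>|M. inner L (\<Gamma> \<omega>) * inner L' (\<Gamma> \<omega>)) = (\<Sum>k=1..n. LINT \<omega>|M. inner L (clip (Y k \<omega>)) * inner L' (clip (Y k \<omega>)))" for L L'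
      unfolding \<Gamma>_cov SX_cov by (intro sum.cong refl int_eq[symmetric, of _ "\<lambda>A. inner L A * inner L' A"]) measurable
    show "(\<Sum>k=1..n. LINT \<omega>|M. (norm (clip (Y k \<omega>) * P))\<^sup>2) \<le> (sigma_par M d X)\<^sup>2 * (norm P)\<^sup>2" if P: "bd P d" for P
    proof -
      have "(\<Sum>k=1..n. LINT \<omega>|M. (norm (clip (Y k \<omega>) * P))\<^sup>2) = (\<Sum>k=1..n. LINT \<omega>|M. (norm (Y k \<omega> * P))\<^sup>2)"
        by (intro sum.cong refl int_eq[of _ "\<lambda>A. (norm (A * P))\<^sup>2"]) measurable
      then show ?thesis using sigma_par_bound[OF P] by simp
    qed
    show "(LINT \<omega>|M. (inner (P * adj P) (\<Gamma> \<omega>))\<^sup>2) \<le> (sigma_star M d X)\<^sup>2" if "P \<in> unitc d" for P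
      by (rule sigma_star_bound[OF that])
  qed
qed

text \<open>For t > 0 the bound \<epsilon>(t) is infinite and nothing exceeds it; at t = 0 the
  right-hand side is d. The third bound is taken at log d > 0.\<close>

lemma three_bounds_top:
  assumes top: "R_par M n Z = \<top>"
  shows "three_bounds 1536 M d n Z0 Z G f"
proof -
  have e: "ennreal 1536 * epsilon M d n Z0 Z t = \<top>" if "0 < t" for t
    using that by (simp add: epsilon_def Let_def top ennreal_top_mult ennreal_mult_top)
  have tb: "prob {\<omega> \<in> space M. ennreal 1536 * epsilon M d n Z0 Z t < ennreal (u \<omega>)} \<le> real d * exp (- t)" if t: "0 \<le> t" for t u
  proof (cases "t = 0")
    case True
    then show ?thesis using d1 by (auto intro: order_trans[OF prob_le_1])
  next
    case False
    then show ?thesis using t e[of t] by simp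
  qed
  show ?thesis unfolding three_bounds_def Let_def
    using tb e[of "ln (real d)"] d2 by simp
qed

text \<open>The moment estimates hold for the clipped sum and for the maximum over signs. They are
  carried over to f of the given matrices by almost sure equality, and the extended real
  \<epsilon>(t) is identified with the real number \<open>m.eps t\<close>.\<close>

lemma three_bounds_fin:
  assumes fin: "R_par M n Z < \<top>" and S: "S = {1} \<or> S = {1, - 1}"
    and f: "\<And>A. self_adjoint d A \<Longrightarrow> f A = Max ((\<lambda>s. lamS d (s *\<^sub>R toF d A)) ` S)"
  shows "three_bounds 1536 M d n Z0 Z G f"
proof -
  interpret mo: model M \<Gamma> d M "\<lambda>k \<omega>. clip (Y k \<omega>)" n Z0' R "(sigma_par M d X)\<^sup>2" "(sigma_star M d X)\<^sup>2"
    by (rule model[OF fin])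
  define \<mu> where "\<mu> = Max ((\<lambda>s. LINT \<omega>|M. mo.fs s (Z0' + \<Gamma> \<omega>)) ` S)"
  have Sf: "finite S" "S \<noteq> {}" using S by auto
  have nn: "0 \<le> sigma_par M d X" "0 \<le> sigma_star M d X" using sigma_star_nonneg by (auto simp: sigma_par_def)
  have f': "f A = mo.fmax S (toF d A)" if "self_adjoint d A" for A
    unfolding f[OF that] mo.fmax_def using toF_sad[OF that] by (simp add: mo.fs_eq)
  note mp0 = model_moment_pair[OF model[OF fin] S d2 nn, folded \<mu>_def]
  note fm = mo.fmax_meas[OF Sf]
  have "(\<lambda>\<omega>. mo.fmax S (toF d (X \<omega>))) \<in> borel_measurable M"
    unfolding toF_X using SX_sq by (intro measurable_compose[OF _ fm] measurable_FM_add measurable_const) (auto simp: sq_integrable_def)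
  then have mX: "(\<lambda>\<omega>. f (X \<omega>)) \<in> borel_measurable M" by (subst measurable_cong[OF f'[OF X_sa]])
  have "(\<lambda>\<omega>. mo.fmax S (toF d (G \<omega>))) \<in> borel_measurable M"
    by (rule measurable_compose[OF measurable_compose[OF G_meas measurable_toF] fm])
  then have mG: "(\<lambda>\<omega>. f (G \<omega>)) \<in> borel_measurable M" by (subst measurable_cong[OF f'[OF G_sa]])
  have "AE \<omega> in M. \<forall>k\<in>{1..n}. clip (Y k \<omega>) = Y k \<omega>"
    by (rule AE_finite_allI) (auto intro: clip_AE[OF fin])
  then have aeX: "AE \<omega> in M. mo.fmax S (Z0' + (\<Sum>k=1..n. clip (Y k \<omega>))) - \<mu> = f (X \<omega>) - \<mu>"
  proof (rule AE_mp, intro AE_I2 impI)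
    fix \<omega> assume \<omega>: "\<omega> \<in> space M" and c: "\<forall>k\<in>{1..n}. clip (Y k \<omega>) = Y k \<omega>"
    have "(\<Sum>k=1..n. clip (Y k \<omega>)) = SX \<omega>" unfolding SX_def using c by (intro sum.cong refl) blast
    then show "mo.fmax S (Z0' + (\<Sum>k=1..n. clip (Y k \<omega>))) - \<mu> = f (X \<omega>) - \<mu>"
      by (simp only: f'[OF X_sa[OF \<omega>]] toF_X)
  qed
  have aeG: "AE \<omega> in M. mo.fmax S (Z0' + \<Gamma> \<omega>) - \<mu> = f (G \<omega>) - \<mu>"
    by (auto intro!: AE_I2 simp: f'[OF G_sa] \<Gamma>_def)
  interpret m: moment_pair M "\<lambda>\<omega>. f (X \<omega>) - \<mu>" "\<lambda>\<omega>. f (G \<omega>) - \<mu>" d R "sigma_par M d X" "sigma_star M d X"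
    by (rule moment_pair_cong_AE[OF mp0 _ _ aeX aeG]) (use mX mG in auto)
  have Rt: "R_par M n Z = ennreal R" using fin by (simp add: R_def ennreal_enn2real)
  have R0: "0 \<le> R" by (simp add: R_def)
  have eps: "epsilon M d n Z0 Z t = ennreal (m.eps t)" if "0 \<le> t" for t
    unfolding epsilon_def Let_def Rt m.eps_def ennpowr_def using R0 nn that
    by (simp add: ennreal_plus[symmetric] ennreal_mult[symmetric] del: ennreal_plus)
  have e0: "0 \<le> 1536 * m.eps t" if "0 \<le> t" for t using m.eps_nonneg[OF that] by simp
  have ce: "ennreal 1536 * epsilon M d n Z0 Z t = ennreal (1536 * m.eps t)" if "0 \<le> t" for t
    unfolding eps[OF that] by (rule ennreal_mult[symmetric]) (use m.eps_nonneg[OF that] in auto)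
  have lt: "ennreal 1536 * epsilon M d n Z0 Z t < ennreal u \<longleftrightarrow> 1536 * m.eps t < u" if "0 \<le> t" for t u
    unfolding ce[OF that] by (rule ennreal_less_iff[OF e0[OF that]])
  have "integrable M (\<lambda>\<omega>. (f (G \<omega>) - \<mu>) + \<mu>)" "integrable M (\<lambda>\<omega>. (f (X \<omega>) - \<mu>) + \<mu>)"
    by (intro Bochner_Integration.integrable_add m.int_U m.int_V integrable_const)+
  then have iX: "integrable M (\<lambda>\<omega>. f (X \<omega>))" and iG: "integrable M (\<lambda>\<omega>. f (G \<omega>))" by simp_all
  have EV: "(LINT \<omega>|M. f (G \<omega>) - \<mu>) = (LINT \<omega>|M. f (G \<omega>)) - \<mu>" using iG by (simp add: prob_space)
  have EU: "(LINT \<omega>|M. f (X \<omega>) - \<mu>) = (LINT \<omega>|M. f (X \<omega>)) - \<mu>" using iX by (simp add: prob_space)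
  have l0: "0 \<le> ln (real d)" using d1 by simp
  have cancel: "x - \<mu> - (y - \<mu>) = x - y" for x y :: real by simp
  show ?thesis
    unfolding three_bounds_def Let_def
  proof (intro conjI allI impI)
    fix t :: real assume t: "0 \<le> t"
    show "\<P>(\<omega> in M. ennreal 1536 * epsilon M d n Z0 Z t < ennreal \<bar>f (X \<omega>) - f (G \<omega>)\<bar>) \<le> real d * exp (- t)"
      using m.tails(1)[OF t] by (simp only: lt[OF t] cancel)
    show "\<P>(\<omega> in M. ennreal 1536 * epsilon M d n Z0 Z t < ennreal \<bar>f (X \<omega>) - (LINT \<omega>'|M. f (G \<omega>'))\<bar>) \<le> real d * exp (- t)"
      using m.tails(2)[OF t] by (simp only: lt[OF t] EV cancel)
  next
    show "ennreal \<bar>(LINT \<omega>|M. f (X \<omega>)) - (LINT \<omega>|M. f (G \<omega>))\<bar> \<le> ennreal 1536 * epsilon M d n Z0 Z (ln (real d))"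
      unfolding ce[OF l0] using m.means[of "ln (real d)"] by (intro ennreal_leI) (simp only: EU EV cancel order_refl)
  qed
qed

end

lemma admissible_1536: "admissible_constant 1536 M"
  unfolding admissible_constant_def
proof (intro allI impI)
  fix d n Z0 Z G
  assume im: "independent_sum_model M d n Z0 Z" and gm: "gaussian_model M d (rsum d n Z0 Z) G"
  interpret prob_space M using im by (simp add: independent_sum_model_def)
  interpret matrix_model M d n Z0 Z G by unfold_locales (rule im gm)+
  show "three_bounds 1536 M d n Z0 Z G lambda_max \<and> three_bounds 1536 M d n Z0 Z G opnorm"
  proof (cases "R_par M n Z = \<top>")
    case True
    then show ?thesis by (intro conjI three_bounds_top)
  next
    case False
    then have fin: "R_par M n Z < \<top>" by (simp add: less_top)
    have "three_bounds 1536 M d n Z0 Z G lambda_max"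
      by (rule three_bounds_fin[OF fin, of "{1}"]) (simp_all add: lambda_max_toF[OF d1])
    moreover have "three_bounds 1536 M d n Z0 Z G opnorm"
      by (rule three_bounds_fin[OF fin, of "{1, -1}"]) (simp_all add: opnorm_toF[OF d1] opS_def)
    ultimately show ?thesis by simp
  qed
qed

section \<open>Change of the sample space\<close>

text \<open>The image of \<open>M\<close> under \<open>T\<close> carries the largest \<open>\<sigma>\<close>-algebra that makes \<open>T\<close> measurable, so that
  measurability on it is equivalent to measurability after composition with \<open>T\<close>. Hence nothing has
  to be assumed about the functions and events that are transferred.\<close>

definition final_sigma :: "'a measure \<Rightarrow> ('a \<Rightarrow> 'b) \<Rightarrow> 'b measure" where
  "final_sigma M T = sigma (T ` space M) {A. A \<subseteq> T ` space M \<and> T -` A \<inter> space M \<in> sets M}"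

definition push :: "'a measure \<Rightarrow> ('a \<Rightarrow> 'b) \<Rightarrow> 'b measure" where
  "push M T = distr M (final_sigma M T) T"

lemma sets_final_sigma: "sets (final_sigma M T) = {A. A \<subseteq> T ` space M \<and> T -` A \<inter> space M \<in> sets M}"
proof -
  let ?F = "{A. A \<subseteq> T ` space M \<and> T -` A \<inter> space M \<in> sets M}"
  have "sigma_algebra (T ` space M) ?F"
    unfolding sigma_algebra_iff2
  proof (intro conjI ballI allI impI)
    show "T ` space M - s \<in> ?F" if "s \<in> ?F" for s
    proof -
      have "T -` (T ` space M - s) \<inter> space M = space M - (T -` s \<inter> space M)" by auto
      then show ?thesis using that by auto
    qed
    show "(\<Union>i. A i) \<in> ?F" if "range A \<subseteq> ?F" for A :: "nat \<Rightarrow> _"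
    proof -
      have "T -` (\<Union>i. A i) \<inter> space M = (\<Union>i. T -` A i \<inter> space M)" by auto
      moreover have "(\<Union>i. T -` A i \<inter> space M) \<in> sets M" using that by (intro sets.countable_UN) auto
      ultimately show ?thesis using that by auto
    qed
  qed auto
  then show ?thesis unfolding final_sigma_def by (rule sigma_algebra.sets_measure_of_eq)
qed

lemma space_push [simp]: "space (push M T) = T ` space M"
  by (simp add: push_def final_sigma_def space_measure_of_conv)

lemma space_final_sigma: "space (final_sigma M T) = T ` space M"
  by (simp add: final_sigma_def space_measure_of_conv)

lemma measurable_final_sigma: "T \<in> M \<rightarrow>\<^sub>M final_sigma M T"
  by (rule measurableI) (auto simp: space_final_sigma sets_final_sigma)

lemma measurable_push_iff: "g \<in> push M T \<rightarrow>\<^sub>M L \<longleftrightarrow> (\<lambda>\<omega>. g (T \<omega>)) \<in> M \<rightarrow>\<^sub>M L"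
proof
  assume "g \<in> push M T \<rightarrow>\<^sub>M L"
  then have "g \<in> final_sigma M T \<rightarrow>\<^sub>M L" by (simp add: push_def)
  then show "(\<lambda>\<omega>. g (T \<omega>)) \<in> M \<rightarrow>\<^sub>M L" by (rule measurable_compose[OF measurable_final_sigma])
next
  assume g: "(\<lambda>\<omega>. g (T \<omega>)) \<in> M \<rightarrow>\<^sub>M L"
  have "g \<in> final_sigma M T \<rightarrow>\<^sub>M L"
  proof (rule measurableI)
    show "g x \<in> space L" if "x \<in> space (final_sigma M T)" for x
      using that measurable_space[OF g] by (auto simp: space_final_sigma)
    fix A assume "A \<in> sets L"
    from measurable_sets[OF g this] have "(\<lambda>\<omega>. g (T \<omega>)) -` A \<inter> space M \<in> sets M" .
    also have "(\<lambda>\<omega>. g (T \<omega>)) -` A \<inter> space M = T -` (g -` A \<inter> T ` space M) \<inter> space M" by auto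
    finally show "g -` A \<inter> space (final_sigma M T) \<in> sets (final_sigma M T)"
      by (simp add: sets_final_sigma space_final_sigma)
  qed
  then show "g \<in> push M T \<rightarrow>\<^sub>M L" by (simp add: push_def)
qed

lemma integrable_push_iff:
  fixes g :: "'b \<Rightarrow> 'c :: {banach, second_countable_topology}"
  shows "integrable (push M T) g \<longleftrightarrow> integrable M (\<lambda>\<omega>. g (T \<omega>))"
proof (cases "g \<in> borel_measurable (push M T)")
  case True
  then show ?thesis unfolding push_def by (intro integrable_distr_eq measurable_final_sigma) simp
next
  case False
  then have "(\<lambda>\<omega>. g (T \<omega>)) \<notin> borel_measurable M" by (simp add: measurable_push_iff)
  then show ?thesis using False by (auto dest: borel_measurable_integrable)
qed

text \<open>No integrability is assumed: it fails on both sides at once, and then both integrals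
  have the default value 0.\<close>

lemma integral_push:
  fixes g :: "'b \<Rightarrow> 'c :: {banach, second_countable_topology}"
  shows "(LINT x|push M T. g x) = (LINT \<omega>|M. g (T \<omega>))"
proof (cases "g \<in> borel_measurable (push M T)")
  case True
  then show ?thesis unfolding push_def by (intro integral_distr measurable_final_sigma) simp
next
  case False
  then have "\<not> integrable (push M T) g" by (auto dest: borel_measurable_integrable)
  then show ?thesis using integrable_push_iff[of M T g] by (simp add: not_integrable_integral_eq)
qed

lemma sets_push_iff: "{x \<in> T ` space M. P x} \<in> sets (push M T) \<longleftrightarrow> {\<omega> \<in> space M. P (T \<omega>)} \<in> sets M"
proof -
  have "T -` {x \<in> T ` space M. P x} \<inter> space M = {\<omega> \<in> space M. P (T \<omega>)}" by auto
  then show ?thesis by (auto simp: push_def sets_final_sigma)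
qed

text \<open>An event is measurable on one side exactly if it is on the other; otherwise both
  measures are 0 by default.\<close>

lemma measure_push: "measure (push M T) {x \<in> space (push M T). P x} = measure M {\<omega> \<in> space M. P (T \<omega>)}"
proof (cases "{\<omega> \<in> space M. P (T \<omega>)} \<in> sets M")
  case True
  have "measure (push M T) {x \<in> T ` space M. P x} = measure M (T -` {x \<in> T ` space M. P x} \<inter> space M)"
    unfolding push_def using True sets_push_iff[of T M P]
    by (intro measure_distr measurable_final_sigma) (simp add: push_def)
  moreover have "T -` {x \<in> T ` space M. P x} \<inter> space M = {\<omega> \<in> space M. P (T \<omega>)}" by auto
  ultimately show ?thesis by simp
next
  case False
  then show ?thesis using sets_push_iff[of T M P] by (simp add: measure_notin_sets)
qed

lemma AE_push: "{\<omega> \<in> space M. P (T \<omega>)} \<in> sets M \<Longrightarrow> (AE x in push M T. P x) \<longleftrightarrow> (AE \<omega> in M. P (T \<omega>))"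
  unfolding push_def
  by (rule AE_distr_iff[OF measurable_final_sigma])
    (use sets_push_iff[of T M P] in \<open>simp add: push_def space_final_sigma\<close>)

lemma esssup_push:
  fixes f :: "'b \<Rightarrow> ennreal"
  shows "esssup (push M T) f = esssup M (\<lambda>\<omega>. f (T \<omega>))"
proof (cases "f \<in> borel_measurable (push M T)")
  case True
  then have [measurable]: "(\<lambda>\<omega>. f (T \<omega>)) \<in> borel_measurable M" by (simp add: measurable_push_iff)
  have "(AE x in push M T. f x \<le> z) \<longleftrightarrow> (AE \<omega> in M. f (T \<omega>) \<le> z)" for z by (rule AE_push) simp
  then show ?thesis using True by (simp add: esssup_eq_AE)
next
  case False
  then show ?thesis by (simp add: esssup_non_measurable measurable_push_iff)
qed

lemma gaussian_var_push: "gaussian_var (push M T) Y \<longleftrightarrow> gaussian_var M (\<lambda>\<omega>. Y (T \<omega>))"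
proof (cases "Y \<in> borel_measurable (push M T)")
  case True
  then have m [measurable]: "(\<lambda>\<omega>. Y (T \<omega>)) \<in> borel_measurable M" by (simp add: measurable_push_iff)
  have "(AE x in push M T. Y x = \<mu>) \<longleftrightarrow> (AE \<omega> in M. Y (T \<omega>) = \<mu>)" for \<mu> by (rule AE_push) simp
  moreover have "distr (push M T) lborel Y = distr M lborel (\<lambda>\<omega>. Y (T \<omega>))"
    using True unfolding push_def by (subst distr_distr) (auto simp: comp_def intro: measurable_final_sigma)
  ultimately show ?thesis using True m by (simp add: gaussian_var_def distributed_def)
next
  case False
  then show ?thesis by (simp add: gaussian_var_def measurable_push_iff)
qed

lemma prob_space_push: "prob_space M \<Longrightarrow> prob_space (push M T)"
  unfolding push_def by (rule prob_space.prob_space_distr[OF _ measurable_final_sigma])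

text \<open>Independence is a property of the joint law, which the image measure shares. The empty
  family is separate because the characterisation by product measures is for nonempty index
  sets.\<close>

lemma indep_vars_push:
  assumes M: "prob_space M" and ind: "prob_space.indep_vars M M' (\<lambda>k \<omega>. Z k (T \<omega>)) I"
  shows "prob_space.indep_vars (push M T) M' Z I"
proof -
  interpret M: prob_space M by (rule M)
  interpret P: prob_space "push M T" by (rule prob_space_push[OF M])
  show ?thesis
  proof (cases "I = {}")
    case True
    then show ?thesis by (simp add: P.indep_vars_def P.indep_sets_def)
  next
    case False
    have rM: "(\<lambda>\<omega>. Z k (T \<omega>)) \<in> M \<rightarrow>\<^sub>M M' k" if "k \<in> I" for k using ind that by (simp add: M.indep_vars_def)
    then have rP: "Z k \<in> push M T \<rightarrow>\<^sub>M M' k" if "k \<in> I" for k using that by (simp add: measurable_push_iff)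
    have d: "distr (push M T) L Y = distr M L (\<lambda>\<omega>. Y (T \<omega>))" if "Y \<in> push M T \<rightarrow>\<^sub>M L" for Y L
      using that unfolding push_def by (subst distr_distr) (auto simp: comp_def intro: measurable_final_sigma)
    have "distr (push M T) (PiM I M') (\<lambda>x. \<lambda>i\<in>I. Z i x) = distr M (PiM I M') (\<lambda>\<omega>. \<lambda>i\<in>I. Z i (T \<omega>))"
      by (rule d) (intro measurable_restrict rP)
    also have "\<dots> = PiM I (\<lambda>i. distr M (M' i) (\<lambda>\<omega>. Z i (T \<omega>)))"
      using ind M.indep_vars_iff_distr_eq_PiM'[OF False rM] by simp
    also have "\<dots> = PiM I (\<lambda>i. distr (push M T) (M' i) (Z i))"
      by (intro PiM_cong refl) (simp add: d[OF rP])
    finally show ?thesis using P.indep_vars_iff_distr_eq_PiM'[OF False rP] by simp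
  qed
qed

lemma expect_mat_push: "expect_mat (push M T) d Y = expect_mat M d (\<lambda>\<omega>. Y (T \<omega>))"
  by (simp add: expect_mat_def integral_push)

lemma centered_push: "centered (push M T) d Y (T \<omega>) = centered M d (\<lambda>\<omega>. Y (T \<omega>)) \<omega>"
  by (simp add: centered_def expect_mat_push)

lemma cov_mat_push: "cov_mat (push M T) d Y = cov_mat M d (\<lambda>\<omega>. Y (T \<omega>))"
  by (simp add: cov_mat_def integral_push centered_push)

lemma sigma_par_push: "sigma_par (push M T) d Y = sigma_par M d (\<lambda>\<omega>. Y (T \<omega>))"
  by (simp add: sigma_par_def expect_mat_push centered_push)

lemma sigma_star_push: "sigma_star (push M T) d Y = sigma_star M d (\<lambda>\<omega>. Y (T \<omega>))"
  by (simp add: sigma_star_def integral_push centered_push)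

lemma R_par_push: "R_par (push M T) n Z = R_par M n (\<lambda>k \<omega>. Z k (T \<omega>))"
  by (simp add: R_par_def esssup_push)

lemma rsum_push: "(\<lambda>\<omega>. rsum d n Z0 Z (T \<omega>)) = rsum d n Z0 (\<lambda>k \<omega>. Z k (T \<omega>))"
  by (simp add: rsum_def fun_eq_iff)

lemma epsilon_push: "epsilon (push M T) d n Z0 Z t = epsilon M d n Z0 (\<lambda>k \<omega>. Z k (T \<omega>)) t"
  by (simp add: epsilon_def Let_def sigma_star_push sigma_par_push R_par_push rsum_push[of d n Z0 Z T])

lemma three_bounds_push:
  "three_bounds C (push M T) d n Z0 Z G f \<longleftrightarrow> three_bounds C M d n Z0 (\<lambda>k \<omega>. Z k (T \<omega>)) (\<lambda>\<omega>. G (T \<omega>)) f"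
proof -
  have r: "rsum d n Z0 Z (T \<omega>) = rsum d n Z0 (\<lambda>k \<omega>. Z k (T \<omega>)) \<omega>" for \<omega>
    by (simp add: rsum_def)
  show ?thesis
    unfolding three_bounds_def Let_def measure_push integral_push epsilon_push r ..
qed

lemma independent_sum_model_push:
  assumes "independent_sum_model M d n Z0 (\<lambda>k \<omega>. Z k (T \<omega>))"
  shows "independent_sum_model (push M T) d n Z0 Z"
  using assms unfolding independent_sum_model_def
  by (auto simp: integrable_push_iff expect_mat_push intro: prob_space_push indep_vars_push)

lemma gaussian_model_push:
  assumes "gaussian_model M d (rsum d n Z0 (\<lambda>k \<omega>. Z k (T \<omega>))) (\<lambda>\<omega>. G (T \<omega>))"
  shows "gaussian_model (push M T) d (rsum d n Z0 Z) G"
  using assms unfolding gaussian_model_def gaussian_mat_def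
  by (auto simp: measurable_push_iff gaussian_var_push expect_mat_push cov_mat_push rsum_push[of d n Z0 Z T])

text \<open>Every quantity of the model depends on the sample point only through the values of G and
  of the summands. Recording these values in a sequence maps the model to one on the fixed type,
  with the same parameters, probabilities and means.\<close>

lemma admissible_constant_push:
  fixes M :: "'a measure"
  assumes "\<And>N :: (nat \<Rightarrow> complex mat) measure. admissible_constant C N"
  shows "admissible_constant C M"
  unfolding admissible_constant_def
proof (intro allI impI)
  fix d n Z0 and Z :: "nat \<Rightarrow> 'a \<Rightarrow> complex mat" and G
  assume im: "independent_sum_model M d n Z0 Z" and gm: "gaussian_model M d (rsum d n Z0 Z) G"
  \<comment> \<open>Position 0 carries G, and position k + 1 carries \<open>Z k\<close>.\<close>
  define T where "T \<omega> k = (case k of 0 \<Rightarrow> G \<omega> | Suc k \<Rightarrow> Z k \<omega>)" for \<omega> and k :: nat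
  let ?Z = "\<lambda>k (x :: nat \<Rightarrow> complex mat). x (Suc k)" and ?G = "\<lambda>x :: nat \<Rightarrow> complex mat. x 0"
  have ZT: "(\<lambda>k \<omega>. ?Z k (T \<omega>)) = Z" and GT: "(\<lambda>\<omega>. ?G (T \<omega>)) = G" by (simp_all add: T_def fun_eq_iff)
  have i: "independent_sum_model (push M T) d n Z0 ?Z"
    by (rule independent_sum_model_push) (simp only: ZT im)
  have g: "gaussian_model (push M T) d (rsum d n Z0 ?Z) ?G"
    by (rule gaussian_model_push) (simp only: ZT GT gm)
  from assms[of "push M T", unfolded admissible_constant_def, rule_format, OF i g] show "three_bounds C M d n Z0 Z G lambda_max \<and> three_bounds C M d n Z0 Z G opnorm"
    by (simp only: three_bounds_push ZT GT)
qed

theorem corollary2p7: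
  shows "(\<exists>C>0. \<forall>M :: (nat \<Rightarrow> complex mat) measure. admissible_constant C M) \<and>
    (\<forall>C>0. (\<forall>M :: (nat \<Rightarrow> complex mat) measure. admissible_constant C M) \<longrightarrow>
       (\<forall>M :: 'a measure. admissible_constant C M))"
proof (intro conjI allI impI)
  show "\<exists>C>0. \<forall>M :: (nat \<Rightarrow> complex mat) measure. admissible_constant C M"
    using admissible_1536 zero_less_numeral by blast
  fix C :: real and M :: "'a measure"
  assume a: "\<forall>M :: (nat \<Rightarrow> complex mat) measure. admissible_constant C M"
  show "admissible_constant C M" by (rule admissible_constant_push[OF a[rule_format]])
qed

end
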